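(* Let $b,\sigma:\mathbb{R}\times\mathcal{P}_2(\mathbb{R})\to\mathbb{R}$ satisfy, for some constant $L>0$, $|b(x,\mu)-b(y,\nu)|+|\sigma(x,\mu)-\sigma(y,\nu)|\le L(|x-y|+\mathcal{W}_2(\mu,\nu))$ for all $x,y\in\mathbb{R}$, $\mu,\nu\in\mathcal{P}_2(\mathbb{R})$; let $h:\mathbb{R}\to\mathbb{R}$ be increasing with $m|x-y|\le|h(x)-h(y)|\le M|x-y|$ for all $x,y$, for some $0<m\le M$, and twice continuously differentiable with bounded derivatives; and let $\xi$ be an $\mathcal{F}_0$-measurable random variable with $\mathbb{E}[\xi^2]<\infty$ and $\mathbb{E}[h(\xi)]\ge0$. Let $(X,K)$ be the unique deterministic flat solution of the mean reflected McKean-Vlasov SDE with data $(\xi,b,\sigma,h)$. Then the process $K$ is Lipschitz continuous, and the Stieltjes measure $dK$ has the following density with respect to Lebesgue measure: $$k:\mathbb{R}^+\ni t\mapsto\frac{\big(\mathbb{E}[\mathcal{A}_{\mathcal{L}_{X_t}}h(X_t)]\big)^-}{\mathbb{E}[h'(X_t)]}\,\mathbf{1}_{\{\mathbb{E}[h(X_t)]=0\}},$$ where $\mathcal{A}_\mu f(x)=b(x,\mu)f'(x)+\frac12\sigma(x,\mu)^2f''(x)$ and $(a)^-:=\max(-a,0)$.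
   Context: $(\Omega,\mathcal{F},\{\mathcal{F}_t\},\mathbb{P})$ is a complete filtered probability space with a standard one-dimensional $\{\mathcal{F}_t\}$-Brownian motion $B$; $\mathcal{L}_Z$ is the law of $Z$; $\mathcal{P}_2(\mathbb{R})$ is the set of probability measures on $\mathbb{R}$ with finite second moment, $\mathcal{W}_2$ the 2-Wasserstein distance. The mean reflected McKean-Vlasov SDE with data $(\xi,b,\sigma,h)$ is $$X_t=\xi+\int_0^tb(X_s,\mathcal{L}_{X_s})ds+\int_0^t\sigma(X_s,\mathcal{L}_{X_s})dB_s+K_t,\quad \mathbb{E}[h(X_t)]\ge0,\quad\int_0^t\mathbb{E}[h(X_s)]dK_s=0,\quad t\ge0.$$ A deterministic flat solution is a pair $(X,K)$ satisfying it, with $X$ continuous adapted and $K$ a non-decreasing continuous deterministic function, $K_0=0$. Under the stated assumptions it exists and is unique.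
   Formalization: "K is Lipschitz continuous" is proved on every bounded interval [0,T], with a constant depending on T; one constant for all t≥0 is false in general, e.g. b(x,μ)=-(∫y²dμ)^{1/2}, σ(x,μ)=x, h(x)=x, ξ=±1 with probability 1/2, where k(t)=e^{t/2}. *)

theory Defs
  imports "HOL-Probability.Probability"
begin

section \<open>Filtered probability spaces and Brownian motion\<close>

text \<open>Time is the half-line \<open>t \<ge> 0\<close>; processes and filtrations are functions on \<^typ>\<open>real\<close>
  whose values at negative arguments are irrelevant. The measures \<open>F t\<close> only serve as carriers of
  \<open>\<sigma>\<close>-algebras. Completeness means that \<open>P\<close> is complete and that \<open>F 0\<close> contains
  all \<open>P\<close>-null sets; right-continuity of the filtration is not required.
  Path continuity is understood almost surely.\<close>

locale complete_filtered_prob_space = prob_space P + complete_measure P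
  for P :: "'a measure" +
  fixes F :: "real \<Rightarrow> 'a measure"
  assumes subalgebra_filtration: "\<And>t. 0 \<le> t \<Longrightarrow> subalgebra P (F t)"
    and filtration_mono: "\<And>s t. 0 \<le> s \<Longrightarrow> s \<le> t \<Longrightarrow> sets (F s) \<subseteq> sets (F t)"
    and null_sets_filtration: "null_sets P \<subseteq> sets (F 0)"

definition adapted :: "(real \<Rightarrow> 'a measure) \<Rightarrow> (real \<Rightarrow> 'a \<Rightarrow> real) \<Rightarrow> bool" where
  "adapted F X \<longleftrightarrow> (\<forall>t\<ge>0. X t \<in> borel_measurable (F t))"

definition continuous_paths :: "'a measure \<Rightarrow> (real \<Rightarrow> 'a \<Rightarrow> real) \<Rightarrow> bool" where
  "continuous_paths P X \<longleftrightarrow> (AE \<omega> in P. continuous_on {0..} (\<lambda>t. X t \<omega>))"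

definition brownian_motion ::
    "'a measure \<Rightarrow> (real \<Rightarrow> 'a measure) \<Rightarrow> (real \<Rightarrow> 'a \<Rightarrow> real) \<Rightarrow> bool" where
  "brownian_motion P F B \<longleftrightarrow>
     adapted F B \<and> continuous_paths P B \<and> (AE \<omega> in P. B 0 \<omega> = 0) \<and>
     (\<forall>s t. 0 \<le> s \<and> s < t \<longrightarrow>
        distributed P lborel (\<lambda>\<omega>. B t \<omega> - B s \<omega>) (normal_density 0 (sqrt (t - s))) \<and>
        prob_space.indep_set P (sets (F s))
          (sets (vimage_algebra (space P) (\<lambda>\<omega>. B t \<omega> - B s \<omega>) borel)))"


section \<open>The Ito integral\<close>

text \<open>A simple process is \<open>\<Sum>i<n. \<phi> i * indicator {\<tau> i<..\<tau> (Suc i)}\<close> with bounded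
  coefficients \<open>\<phi> i\<close> known at time \<open>\<tau> i\<close>.\<close>

definition simple_process ::
    "'a measure \<Rightarrow> (real \<Rightarrow> 'a measure) \<Rightarrow> nat \<Rightarrow> (nat \<Rightarrow> real) \<Rightarrow> (nat \<Rightarrow> 'a \<Rightarrow> real) \<Rightarrow> bool" where
  "simple_process P F n \<tau> \<phi> \<longleftrightarrow>
     0 \<le> \<tau> 0 \<and>
     (\<forall>i<n. \<tau> i < \<tau> (Suc i) \<and> \<phi> i \<in> borel_measurable (F (\<tau> i)) \<and>
            (\<exists>C. \<forall>\<omega>\<in>space P. \<bar>\<phi> i \<omega>\<bar> \<le> C))"

definition simple_value ::
    "nat \<Rightarrow> (nat \<Rightarrow> real) \<Rightarrow> (nat \<Rightarrow> 'a \<Rightarrow> real) \<Rightarrow> real \<Rightarrow> 'a \<Rightarrow> real" where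
  "simple_value n \<tau> \<phi> s \<omega> = (\<Sum>i<n. \<phi> i \<omega> * indicator {\<tau> i<..\<tau> (Suc i)} s)"

definition simple_integral ::
    "(real \<Rightarrow> 'a \<Rightarrow> real) \<Rightarrow> nat \<Rightarrow> (nat \<Rightarrow> real) \<Rightarrow> (nat \<Rightarrow> 'a \<Rightarrow> real) \<Rightarrow> real \<Rightarrow> 'a \<Rightarrow> real" where
  "simple_integral B n \<tau> \<phi> t \<omega> =
     (\<Sum>i<n. \<phi> i \<omega> * (B (min (\<tau> (Suc i)) t) \<omega> - B (min (\<tau> i) t) \<omega>))"

definition tendsto_in_prob ::
    "'a measure \<Rightarrow> (nat \<Rightarrow> 'a \<Rightarrow> real) \<Rightarrow> ('a \<Rightarrow> real) \<Rightarrow> bool" where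
  "tendsto_in_prob P Y Z \<longleftrightarrow>
     (\<forall>\<epsilon>>0. (\<lambda>k. measure P {\<omega> \<in> space P. \<epsilon> < \<bar>Y k \<omega> - Z \<omega>\<bar>}) \<longlonglongrightarrow> 0)"

definition progressively_measurable ::
    "(real \<Rightarrow> 'a measure) \<Rightarrow> (real \<Rightarrow> 'a \<Rightarrow> real) \<Rightarrow> bool" where
  "progressively_measurable F H \<longleftrightarrow>
     (\<forall>T\<ge>0. (\<lambda>(s, \<omega>). H s \<omega>) \<in> borel_measurable (restrict_space borel {0..T} \<Otimes>\<^sub>M F T))"

definition ito_integrable ::
    "'a measure \<Rightarrow> (real \<Rightarrow> 'a measure) \<Rightarrow> (real \<Rightarrow> 'a \<Rightarrow> real) \<Rightarrow> bool" where
  "ito_integrable P F H \<longleftrightarrow>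
     progressively_measurable F H \<and>
     (\<forall>T\<ge>0. AE \<omega> in P. set_integrable lborel {0..T} (\<lambda>s. (H s \<omega>)\<^sup>2))"

text \<open>\<open>ito_integral P F B H J\<close> says that \<open>J\<close> is (a version of) the process
  \<open>t \<mapsto> \<integral>\<^sub>0\<^sup>t H dB\<close>: the continuous adapted process whose values are the limits in
  probability of the integrals of simple processes approximating \<open>H\<close> in \<open>L\<^sup>2[0,t]\<close>, in
  probability, for every \<open>t\<close>. It is unique up to indistinguishability.\<close>

definition ito_integral ::
    "'a measure \<Rightarrow> (real \<Rightarrow> 'a measure) \<Rightarrow> (real \<Rightarrow> 'a \<Rightarrow> real) \<Rightarrow>
     (real \<Rightarrow> 'a \<Rightarrow> real) \<Rightarrow> (real \<Rightarrow> 'a \<Rightarrow> real) \<Rightarrow> bool" where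
  "ito_integral P F B H J \<longleftrightarrow>
     ito_integrable P F H \<and> adapted F J \<and> continuous_paths P J \<and>
     (\<exists>n \<tau> \<phi>.
        (\<forall>k. simple_process P F (n k) (\<tau> k) (\<phi> k)) \<and>
        (\<forall>t\<ge>0.
           tendsto_in_prob P
             (\<lambda>k \<omega>. LINT s:{0..t}|lborel. (simple_value (n k) (\<tau> k) (\<phi> k) s \<omega> - H s \<omega>)\<^sup>2)
             (\<lambda>_. 0) \<and>
           tendsto_in_prob P (\<lambda>k. simple_integral B (n k) (\<tau> k) (\<phi> k) t) (J t)))"


section \<open>Laws and the 2-Wasserstein distance\<close>

abbreviation law :: "'a measure \<Rightarrow> ('a \<Rightarrow> real) \<Rightarrow> real measure" where
  "law P Z \<equiv> distr P borel Z"

definition P2 :: "real measure set" where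
  "P2 = {\<mu>. prob_space \<mu> \<and> sets \<mu> = sets borel \<and> integrable \<mu> (\<lambda>x. x\<^sup>2)}"

definition couplings :: "real measure \<Rightarrow> real measure \<Rightarrow> (real \<times> real) measure set" where
  "couplings \<mu> \<nu> =
     {\<pi>. prob_space \<pi> \<and> sets \<pi> = sets (borel \<Otimes>\<^sub>M borel) \<and>
         distr \<pi> borel fst = \<mu> \<and> distr \<pi> borel snd = \<nu>}"

definition W2 :: "real measure \<Rightarrow> real measure \<Rightarrow> real" where
  "W2 \<mu> \<nu> = sqrt (enn2real (\<Sqinter>\<pi>\<in>couplings \<mu> \<nu>. \<integral>\<^sup>+(x, y). ennreal ((x - y)\<^sup>2) \<partial>\<pi>))"


section \<open>Mean reflected McKean-Vlasov equations\<close>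

text \<open>The measure \<open>dK\<close> on the half-line, as a measure on \<^typ>\<open>real\<close> that does not charge the
  negative numbers: \<open>K\<close> is extended by \<open>K 0\<close> to the left.\<close>

definition stieltjes_measure :: "(real \<Rightarrow> real) \<Rightarrow> real measure" where
  "stieltjes_measure K = interval_measure (\<lambda>t. K (max 0 t))"

text \<open>The coefficients \<open>b\<close> and \<open>\<sigma>\<close> are only meaningful on \<open>P2\<close>, so the laws of a solution
  must lie there; likewise the existence of the two integrals is part of being a solution.\<close>

definition deterministic_flat_solution ::
    "'a measure \<Rightarrow> (real \<Rightarrow> 'a measure) \<Rightarrow> (real \<Rightarrow> 'a \<Rightarrow> real) \<Rightarrow>
     ('a \<Rightarrow> real) \<Rightarrow> (real \<Rightarrow> real measure \<Rightarrow> real) \<Rightarrow> (real \<Rightarrow> real measure \<Rightarrow> real) \<Rightarrow> (real \<Rightarrow> real) \<Rightarrow>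
     (real \<Rightarrow> 'a \<Rightarrow> real) \<Rightarrow> (real \<Rightarrow> real) \<Rightarrow> bool" where
  "deterministic_flat_solution P F B \<xi> b \<sigma> h X K \<longleftrightarrow>
     adapted F X \<and> continuous_paths P X \<and> (\<forall>t\<ge>0. law P (X t) \<in> P2) \<and>
     continuous_on {0..} K \<and> mono_on {0..} K \<and> K 0 = 0 \<and>
     (AE \<omega> in P. \<forall>t\<ge>0. set_integrable lborel {0..t} (\<lambda>s. b (X s \<omega>) (law P (X s)))) \<and>
     (\<exists>J. ito_integral P F B (\<lambda>s \<omega>. \<sigma> (X s \<omega>) (law P (X s))) J \<and>
        (AE \<omega> in P. \<forall>t\<ge>0.
           X t \<omega> = \<xi> \<omega> + (LINT s:{0..t}|lborel. b (X s \<omega>) (law P (X s))) + J t \<omega> + K t)) \<and>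
     (\<forall>t\<ge>0. 0 \<le> (LINT \<omega>|P. h (X t \<omega>))) \<and>
     (\<forall>t\<ge>0. (LINT s:{0..t}|stieltjes_measure K. (LINT \<omega>|P. h (X s \<omega>))) = 0)"

definition generator ::
    "(real \<Rightarrow> real measure \<Rightarrow> real) \<Rightarrow> (real \<Rightarrow> real measure \<Rightarrow> real) \<Rightarrow>
     real measure \<Rightarrow> (real \<Rightarrow> real) \<Rightarrow> real \<Rightarrow> real" where
  "generator b \<sigma> \<mu> f x = b x \<mu> * deriv f x + 1 / 2 * (\<sigma> x \<mu>)\<^sup>2 * deriv (deriv f) x"

definition neg_part :: "real \<Rightarrow> real" where
  "neg_part a = max (- a) 0"

definition reflection_density ::
    "'a measure \<Rightarrow> (real \<Rightarrow> real measure \<Rightarrow> real) \<Rightarrow> (real \<Rightarrow> real measure \<Rightarrow> real) \<Rightarrow> (real \<Rightarrow> real) \<Rightarrow>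
     (real \<Rightarrow> 'a \<Rightarrow> real) \<Rightarrow> real \<Rightarrow> real" where
  "reflection_density P b \<sigma> h X t =
     neg_part (LINT \<omega>|P. generator b \<sigma> (law P (X t)) h (X t \<omega>)) / (LINT \<omega>|P. deriv h (X t \<omega>))
       * indicator {t. (LINT \<omega>|P. h (X t \<omega>)) = 0} t"

end

theory Submission
  imports Defs
begin

text \<open>Write \<open>\<phi> t = E h(X t)\<close>, \<open>a t = E (A h)(X t)\<close> and \<open>c t = E h'(X t)\<close>. A second order Taylor formula
  for \<open>h\<close> over a short interval \<open>{u..v}\<close>, in which the stochastic integral is replaced by
  \<open>\<sigma>(X u) * (B v - B u)\<close>, gives \<open>\<phi> v - \<phi> u = a u * (v - u) + c u * (K v - K u)\<close> up to an error that
  is small relative to \<open>(v - u) + (K v - K u)\<close>. This needs only the isometry and the martingale property of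
  the stochastic integral, no Ito formula. Applied to \<open>\<phi> / (1 + n * \<phi>)\<close> with \<open>n\<close> tending to infinity, and
  because \<open>dK\<close> is carried by \<open>Z = {\<phi> = 0}\<close>, the expansion yields \<open>c dK = - a 1\<^sub>Z dt\<close>. As the left-hand
  side is nonnegative, \<open>a\<close> is nonpositive almost everywhere on \<open>Z\<close>, and this identity is the claim.

  Square integrability of \<open>\<sigma>(X)\<close> in mean is not assumed. It is obtained from a Gronwall inequality for the
  energy \<open>\<integral>\<^sub>0\<^sup>t \<sigma>(X s)\<^sup>2 ds\<close> truncated at a level \<open>R\<close>, whose bound does not depend on \<open>R\<close>.\<close>

section \<open>Square-integrable functions\<close>

text \<open>Until the density is found, \<open>K\<close> is only known to be continuous and
  nondecreasing, so it could be singular. Errors are therefore measured against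
  \<open>(v - u) + (K v - K u)\<close>. This weight is additive over adjacent intervals, so a defect
  that is additive as well and locally below e times the weight, for every e > 0, must vanish. Such
  a bisection on expectations is all that is needed to integrate the short-interval expansion.

  The damped function is at most 1/n but has slope 1 on \<open>Z\<close>: this encodes that the
  differential of a continuous function of bounded variation does not charge one of its level sets.

  The other obstacle is integrability. Laws in \<open>P2\<close> give a second moment at each single
  time, without a bound that is locally uniform in time, and the energy has no a priori mean. The
  Gronwall loop runs energy, then \<open>J\<close>, then \<open>X\<close>, then energy again; every
  link carries the indicator of energy below R, and this indicator passes under time integrals
  because the energy increases in time. Lipschitz continuity of \<open>K\<close> is read off from
  the density at the very end, on each bounded time interval.\<close>

definition square_integrable :: "'a measure \<Rightarrow> ('a \<Rightarrow> real) \<Rightarrow> bool" where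
  "square_integrable M f \<longleftrightarrow> f \<in> borel_measurable M \<and> integrable M (\<lambda>x. (f x)\<^sup>2)"

lemma square_integrableI:
  "f \<in> borel_measurable M \<Longrightarrow> integrable M (\<lambda>x. (f x)\<^sup>2) \<Longrightarrow> square_integrable M f"
  by (simp add: square_integrable_def)

lemma square_integrableD:
  assumes "square_integrable M f"
  shows "f \<in> borel_measurable M" "integrable M (\<lambda>x. (f x)\<^sup>2)"
  using assms by (auto simp: square_integrable_def)

lemma square_integrable_bound:
  assumes "integrable M g" "f \<in> borel_measurable M" "\<And>x. x \<in> space M \<Longrightarrow> (f x)\<^sup>2 \<le> g x"
  shows "square_integrable M f"
proof (rule square_integrableI)
  show "integrable M (\<lambda>x. (f x)\<^sup>2)"
    using assms by (intro Bochner_Integration.integrable_bound[OF assms(1)]) (auto intro: order_trans[OF _ abs_ge_self])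
qed (use assms in auto)

lemma square_integrable_mult:
  assumes "square_integrable M f" "square_integrable M g"
  shows "integrable M (\<lambda>x. f x * g x)"
proof -
  have [measurable]: "f \<in> borel_measurable M" "g \<in> borel_measurable M"
    using assms by (auto simp: square_integrable_def)
  have "integrable M (\<lambda>x. (f x)\<^sup>2 + (g x)\<^sup>2)"
    using assms by (auto simp: square_integrable_def)
  moreover have "\<bar>a * b\<bar> \<le> a\<^sup>2 + b\<^sup>2" for a b :: real
  proof -
    have "2 * (\<bar>a\<bar> * \<bar>b\<bar>) \<le> a\<^sup>2 + b\<^sup>2"
      using sum_squares_bound[of "\<bar>a\<bar>" "\<bar>b\<bar>"] by simp
    moreover have "0 \<le> \<bar>a\<bar> * \<bar>b\<bar>" by simp
    ultimately show ?thesis unfolding abs_mult by linarith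
  qed
  ultimately show ?thesis
    by (elim Bochner_Integration.integrable_bound) (auto intro: order_trans[OF _ abs_ge_self])
qed

lemma square_integrable_add:
  assumes "square_integrable M f" "square_integrable M g"
  shows "square_integrable M (\<lambda>x. f x + g x)"
proof (rule square_integrableI)
  show "integrable M (\<lambda>x. (f x + g x)\<^sup>2)"
    using assms square_integrable_mult[OF assms]
    by (auto simp: power2_sum mult.assoc square_integrable_def)
qed (use assms in \<open>auto simp: square_integrable_def\<close>)

lemma square_integrable_cmult:
  "square_integrable M f \<Longrightarrow> square_integrable M (\<lambda>x. c * f x)"
  by (auto simp: square_integrable_def power_mult_distrib)

lemma square_integrable_diff:
  assumes "square_integrable M f" "square_integrable M g"
  shows "square_integrable M (\<lambda>x. f x - g x)"
  using square_integrable_add[OF assms(1) square_integrable_cmult[OF assms(2), of "-1"]] by simp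

lemma square_integrable_zero: "square_integrable M (\<lambda>_. 0)"
  by (simp add: square_integrable_def)

lemma square_integrable_sum:
  "(\<And>i. i \<in> I \<Longrightarrow> square_integrable M (f i)) \<Longrightarrow> square_integrable M (\<lambda>x. \<Sum>i\<in>I. f i x)"
  by (induction I rule: infinite_finite_induct) (auto intro: square_integrable_add square_integrable_zero)

lemma square_integrable_abs: "square_integrable M f \<Longrightarrow> square_integrable M (\<lambda>x. \<bar>f x\<bar>)"
  by (auto simp: square_integrable_def)

lemma square_integrable_bounded_mult:
  assumes "square_integrable M f" "g \<in> borel_measurable M" "\<And>x. \<bar>g x\<bar> \<le> C"
  shows "square_integrable M (\<lambda>x. g x * f x)"
proof (rule square_integrable_bound[where g = "\<lambda>x. C\<^sup>2 * (f x)\<^sup>2"])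
  show "(g x * f x)\<^sup>2 \<le> C\<^sup>2 * (f x)\<^sup>2" for x
    unfolding power_mult_distrib by (intro mult_right_mono) (use assms(3)[of x] in \<open>auto simp: abs_le_square_iff[symmetric]\<close>)
qed (use assms in \<open>auto simp: square_integrable_def\<close>)

lemma Cauchy_Schwarz_integral:
  assumes f: "square_integrable M f" and g: "square_integrable M g"
  shows "(\<integral>x. \<bar>f x * g x\<bar> \<partial>M) \<le> sqrt (\<integral>x. (f x)\<^sup>2 \<partial>M) * sqrt (\<integral>x. (g x)\<^sup>2 \<partial>M)"
proof -
  note sf = square_integrableD[OF f] and sg = square_integrableD[OF g]
  note [measurable] = sf(1) sg(1)
  have "ennreal (\<integral>x. \<bar>f x * g x\<bar> \<partial>M) = (\<integral>\<^sup>+x. ennreal \<bar>f x\<bar> * ennreal \<bar>g x\<bar> \<partial>M)"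
    using nn_integral_eq_integral[OF integrable_abs[OF square_integrable_mult[OF f g]]]
    by (simp add: abs_mult ennreal_mult')
  then have "ennreal ((\<integral>x. \<bar>f x * g x\<bar> \<partial>M)\<^sup>2) = (\<integral>\<^sup>+x. ennreal \<bar>f x\<bar> * ennreal \<bar>g x\<bar> \<partial>M)\<^sup>2"
    by (simp add: ennreal_power[symmetric])
  also have "\<dots> \<le> (\<integral>\<^sup>+x. (ennreal \<bar>f x\<bar>)\<^sup>2 \<partial>M) * (\<integral>\<^sup>+x. (ennreal \<bar>g x\<bar>)\<^sup>2 \<partial>M)"
    by (rule Cauchy_Schwarz_nn_integral) auto
  also have "\<dots> = ennreal ((\<integral>x. (f x)\<^sup>2 \<partial>M) * (\<integral>x. (g x)\<^sup>2 \<partial>M))"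
    by (simp add: ennreal_power nn_integral_eq_integral[OF sf(2)] nn_integral_eq_integral[OF sg(2)] ennreal_mult'')
  finally have "(\<integral>x. \<bar>f x * g x\<bar> \<partial>M)\<^sup>2 \<le> (\<integral>x. (f x)\<^sup>2 \<partial>M) * (\<integral>x. (g x)\<^sup>2 \<partial>M)"
    by (subst (asm) ennreal_le_iff) auto
  then show ?thesis
    by (metis real_le_rsqrt real_sqrt_mult)
qed

lemma Cauchy_Schwarz_integral_le:
  assumes "square_integrable M f" "square_integrable M g"
    and "(\<integral>x. (f x)\<^sup>2 \<partial>M) \<le> A\<^sup>2" "(\<integral>x. (g x)\<^sup>2 \<partial>M) \<le> B\<^sup>2" "0 \<le> A" "0 \<le> B"
  shows "(\<integral>x. \<bar>f x * g x\<bar> \<partial>M) \<le> A * B"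
proof -
  have "sqrt (\<integral>x. (f x)\<^sup>2 \<partial>M) \<le> A" "sqrt (\<integral>x. (g x)\<^sup>2 \<partial>M) \<le> B"
    using assms by (auto intro: real_le_lsqrt)
  then show ?thesis
    by (intro order_trans[OF Cauchy_Schwarz_integral[OF assms(1,2)]] mult_mono) (use assms in auto)
qed

context prob_space begin

lemma square_integrable_const: "square_integrable M (\<lambda>_. c :: real)"
  by (simp add: square_integrable_def)

lemma square_integrable_bounded:
  assumes "f \<in> borel_measurable M" "\<And>x. x \<in> space M \<Longrightarrow> \<bar>f x\<bar> \<le> C"
  shows "square_integrable M f"
proof (rule square_integrable_bound[where g = "\<lambda>x. C\<^sup>2"])
  show "(f x)\<^sup>2 \<le> C\<^sup>2" if "x \<in> space M" for x
    using assms(2)[OF that] by (metis abs_ge_self abs_le_square_iff order_trans)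
qed (use assms in auto)

lemma square_integrable_imp_integrable: "square_integrable M f \<Longrightarrow> integrable M f"
  using square_integrable_mult[OF _ square_integrable_const[of 1]] by simp

lemma integral_abs_le_root:
  assumes "square_integrable M f" "(\<integral>x. (f x)\<^sup>2 \<partial>M) \<le> A\<^sup>2" "0 \<le> A"
  shows "(\<integral>x. \<bar>f x\<bar> \<partial>M) \<le> A"
  using Cauchy_Schwarz_integral_le[OF assms(1) square_integrable_const[of 1] assms(2), of 1]
    assms by (simp add: prob_space)

end

section \<open>Brownian increments\<close>

locale brownian_space = complete_filtered_prob_space P F
  for P :: "'a measure" and F :: "real \<Rightarrow> 'a measure" +
  fixes B :: "real \<Rightarrow> 'a \<Rightarrow> real"
  assumes brownian: "brownian_motion P F B"
begin

lemma space_F: "0 \<le> t \<Longrightarrow> space (F t) = space P"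
  using subalgebra_filtration by (auto simp: subalgebra_def)

lemma measurable_F_P: "0 \<le> t \<Longrightarrow> f \<in> borel_measurable (F t) \<Longrightarrow> f \<in> borel_measurable P"
  using subalgebra_filtration measurable_from_subalg by blast

lemma measurable_F_mono:
  assumes "0 \<le> s" "s \<le> t" "f \<in> borel_measurable (F s)"
  shows "f \<in> borel_measurable (F t)"
proof -
  have "subalgebra (F t) (F s)"
    using assms filtration_mono[of s t] space_F[of s] space_F[of t] by (auto simp: subalgebra_def)
  then show ?thesis using measurable_from_subalg assms(3) by blast
qed

lemma B_measurable_F: "0 \<le> t \<Longrightarrow> B t \<in> borel_measurable (F t)"
  using brownian by (auto simp: brownian_motion_def adapted_def)

lemma B_measurable_F': "0 \<le> s \<Longrightarrow> s \<le> t \<Longrightarrow> B s \<in> borel_measurable (F t)"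
  using B_measurable_F measurable_F_mono by blast

lemma B_measurable: "0 \<le> t \<Longrightarrow> B t \<in> borel_measurable P"
  using B_measurable_F measurable_F_P by blast

lemma B_indep_increment:
  assumes "0 \<le> s" "s < t" and Z: "Z \<in> borel_measurable (F s)"
  shows "indep_var borel Z borel (\<lambda>\<omega>. B t \<omega> - B s \<omega>)"
proof -
  let ?D = "\<lambda>\<omega>. B t \<omega> - B s \<omega>"
  have ind: "indep_set (sets (F s)) (sets (vimage_algebra (space P) ?D borel))"
    using brownian assms by (auto simp: brownian_motion_def)
  have 1: "sigma_sets (space P) {Z -` A \<inter> space P | A. A \<in> sets borel} \<subseteq> sets (F s)"
  proof -
    have "{Z -` A \<inter> space P | A. A \<in> sets borel} \<subseteq> sets (F s)"
      using Z assms by (auto simp: space_F[symmetric] dest: measurable_sets)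
    then have "sigma_sets (space (F s)) {Z -` A \<inter> space P | A. A \<in> sets borel} \<subseteq> sets (F s)"
      by (rule sets.sigma_sets_subset)
    then show ?thesis
      by (simp add: space_F[OF assms(1)])
  qed
  have 2: "sigma_sets (space P) {?D -` A \<inter> space P | A. A \<in> sets borel} = sets (vimage_algebra (space P) ?D borel)"
    by (simp add: sets_vimage_algebra)
  have "indep_set (sigma_sets (space P) {Z -` A \<inter> space P | A. A \<in> sets borel})
     (sigma_sets (space P) {?D -` A \<inter> space P | A. A \<in> sets borel})"
    using ind 1 unfolding 2 indep_sets2_eq by (meson subset_iff)
  then show ?thesis
    unfolding indep_var_eq
    by (intro conjI measurable_F_P[OF assms(1) Z] borel_measurable_diff B_measurable) (use assms in auto)
qed

lemma B_increment_moment: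
  assumes "0 \<le> s" "s \<le> t"
  shows "integrable P (\<lambda>\<omega>. (B t \<omega> - B s \<omega>) ^ k)"
    and "(\<integral>\<omega>. (B t \<omega> - B s \<omega>) ^ (2 * k) \<partial>P) = fact (2 * k) / (2 ^ k * fact k) * (t - s) ^ k"
    and "(\<integral>\<omega>. (B t \<omega> - B s \<omega>) ^ (2 * k + 1) \<partial>P) = 0"
proof -
  have "integrable P (\<lambda>\<omega>. (B t \<omega> - B s \<omega>) ^ k) \<and>
    (\<integral>\<omega>. (B t \<omega> - B s \<omega>) ^ (2 * k) \<partial>P) = fact (2 * k) / (2 ^ k * fact k) * (t - s) ^ k \<and>
    (\<integral>\<omega>. (B t \<omega> - B s \<omega>) ^ (2 * k + 1) \<partial>P) = 0"
  proof (cases "s = t")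
    case True
    then show ?thesis by (cases "k = 0") (auto simp: prob_space power_0_left)
  next
    case False
    then have st: "s < t" using assms by auto
    then have D: "distributed P lborel (\<lambda>\<omega>. B t \<omega> - B s \<omega>) (normal_density 0 (sqrt (t - s)))"
      using brownian assms by (auto simp: brownian_motion_def)
    have pos: "0 < sqrt (t - s)" using st by simp
    have 1: "integrable P (\<lambda>\<omega>. (B t \<omega> - B s \<omega>) ^ k)"
      by (rule distributed_integrable[OF D, where g="\<lambda>x. x^k", THEN iffD1])
         (use integrable_normal_moment[OF pos, of 0 k] in \<open>auto\<close>)
    have 2: "(\<integral>\<omega>. (B t \<omega> - B s \<omega>) ^ j \<partial>P) = (\<integral>x. normal_density 0 (sqrt (t - s)) x * x ^ j \<partial>lborel)" for j
      by (rule distributed_integral[OF D, where g="\<lambda>x. x^j", symmetric]) auto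
    show ?thesis
      unfolding 2 using 1 integral_normal_moment_even[OF pos, of 0 k] integral_normal_moment_odd[OF pos, of 0 k] st
      by (simp add: field_simps power_divide)
  qed
  then show "integrable P (\<lambda>\<omega>. (B t \<omega> - B s \<omega>) ^ k)"
    and "(\<integral>\<omega>. (B t \<omega> - B s \<omega>) ^ (2 * k) \<partial>P) = fact (2 * k) / (2 ^ k * fact k) * (t - s) ^ k"
    and "(\<integral>\<omega>. (B t \<omega> - B s \<omega>) ^ (2 * k + 1) \<partial>P) = 0" by auto
qed

text \<open>Independence of \<open>Z\<close> from the increment factors the expectation.
  Measurability of \<open>Z\<close> is demanded only for \<open>s < t\<close>: clipping an interval
  of a simple process can collapse it to a point lying before the time at which its coefficient
  becomes known.\<close>

lemma B_increment_mult:
  assumes "0 \<le> s" "s \<le> t" and Z: "s < t \<Longrightarrow> Z \<in> borel_measurable (F s)" and iZ: "integrable P Z"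
  shows "integrable P (\<lambda>\<omega>. Z \<omega> * (B t \<omega> - B s \<omega>) ^ Suc k)"
    and "(\<integral>\<omega>. Z \<omega> * (B t \<omega> - B s \<omega>) ^ Suc k \<partial>P) = (\<integral>\<omega>. Z \<omega> \<partial>P) * (\<integral>\<omega>. (B t \<omega> - B s \<omega>) ^ Suc k \<partial>P)"
proof -
  have "integrable P (\<lambda>\<omega>. Z \<omega> * (B t \<omega> - B s \<omega>) ^ Suc k) \<and> 
    (\<integral>\<omega>. Z \<omega> * (B t \<omega> - B s \<omega>) ^ Suc k \<partial>P) = (\<integral>\<omega>. Z \<omega> \<partial>P) * (\<integral>\<omega>. (B t \<omega> - B s \<omega>) ^ Suc k \<partial>P)"
  proof (cases "s = t")
    case False
    then have "indep_var borel Z borel (\<lambda>\<omega>. B t \<omega> - B s \<omega>)" using B_indep_increment assms by auto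
    then have "indep_var borel (id \<circ> Z) borel ((\<lambda>x. x ^ Suc k) \<circ> (\<lambda>\<omega>. B t \<omega> - B s \<omega>))"
      by (rule indep_var_compose) auto
    then have "indep_var borel Z borel (\<lambda>\<omega>. (B t \<omega> - B s \<omega>) ^ Suc k)"
      by (simp add: o_def)
    then show ?thesis
      using indep_var_integrable[OF _ iZ] indep_var_lebesgue_integral[OF _ iZ]
        B_increment_moment(1)[OF assms(1,2), of "Suc k"] by blast
  qed simp
  then show "integrable P (\<lambda>\<omega>. Z \<omega> * (B t \<omega> - B s \<omega>) ^ Suc k)"
    and "(\<integral>\<omega>. Z \<omega> * (B t \<omega> - B s \<omega>) ^ Suc k \<partial>P) = (\<integral>\<omega>. Z \<omega> \<partial>P) * (\<integral>\<omega>. (B t \<omega> - B s \<omega>) ^ Suc k \<partial>P)"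
    by auto
qed

lemma B_increment_mult1:
  assumes "0 \<le> s" "s \<le> t" and "s < t \<Longrightarrow> Z \<in> borel_measurable (F s)" and "integrable P Z"
  shows "integrable P (\<lambda>\<omega>. Z \<omega> * (B t \<omega> - B s \<omega>))" "(\<integral>\<omega>. Z \<omega> * (B t \<omega> - B s \<omega>) \<partial>P) = 0"
  using B_increment_mult[OF assms, of 0] B_increment_moment(3)[OF assms(1,2), of 0] by simp_all

lemma B_increment_mult2:
  assumes "0 \<le> s" "s \<le> t" and "s < t \<Longrightarrow> Z \<in> borel_measurable (F s)" and "integrable P Z"
  shows "integrable P (\<lambda>\<omega>. Z \<omega> * (B t \<omega> - B s \<omega>)\<^sup>2)" "(\<integral>\<omega>. Z \<omega> * (B t \<omega> - B s \<omega>)\<^sup>2 \<partial>P) = (\<integral>\<omega>. Z \<omega> \<partial>P) * (t - s)"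
  using B_increment_mult[OF assms, of 1] B_increment_moment(2)[OF assms(1,2), of 1]
  by (simp_all add: numeral_2_eq_2)

lemma B_increment_mult4:
  assumes "0 \<le> s" "s \<le> t" and "s < t \<Longrightarrow> Z \<in> borel_measurable (F s)" and "integrable P Z"
  shows "integrable P (\<lambda>\<omega>. Z \<omega> * (B t \<omega> - B s \<omega>) ^ 4)" "(\<integral>\<omega>. Z \<omega> * (B t \<omega> - B s \<omega>) ^ 4 \<partial>P) = 3 * (\<integral>\<omega>. Z \<omega> \<partial>P) * (t - s)\<^sup>2"
proof -
  have 4: "4 = Suc 3" "2 * 2 = Suc 3" by simp_all
  show "integrable P (\<lambda>\<omega>. Z \<omega> * (B t \<omega> - B s \<omega>) ^ 4)" 
    unfolding 4 using B_increment_mult[OF assms, of 3] by simp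
  show "(\<integral>\<omega>. Z \<omega> * (B t \<omega> - B s \<omega>) ^ 4 \<partial>P) = 3 * (\<integral>\<omega>. Z \<omega> \<partial>P) * (t - s)\<^sup>2"
    using B_increment_mult(2)[OF assms, of 3] B_increment_moment(2)[OF assms(1,2), of 2]
    by (simp add: eval_nat_numeral fact_reduce)
qed

end

section \<open>Finite sums of pieces: isometry and mean zero\<close>

lemma integral_indicator_Ioc_mult:
  fixes a b c d :: real
  shows "integrable lborel (\<lambda>s. indicator {a<..b} s * indicator {c<..d} s :: real)"
    and "(\<integral>s. indicator {a<..b} s * indicator {c<..d} s \<partial>lborel) = max 0 (min b d - max a c)"
proof -
  have eq: "(\<lambda>s. indicator {a<..b} s * indicator {c<..d} s :: real) = indicator {max a c<..min b d}"
    by (auto simp: fun_eq_iff indicator_def)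
  show "integrable lborel (\<lambda>s. indicator {a<..b} s * indicator {c<..d} s :: real)"
    unfolding eq by (cases "max a c \<le> min b d") (auto intro!: integrable_real_indicator)
  show "(\<integral>s. indicator {a<..b} s * indicator {c<..d} s \<partial>lborel) = max 0 (min b d - max a c)"
    unfolding eq by (cases "max a c \<le> min b d") auto
qed

lemma pieces_square_integral:
  fixes \<phi> :: "'i \<Rightarrow> 'a \<Rightarrow> real" and a b :: "'i \<Rightarrow> real"
  assumes "finite I"
  shows "integrable lborel (\<lambda>s. (\<Sum>i\<in>I. \<phi> i \<omega> * indicator {a i<..b i} s)\<^sup>2)"
    and "(\<integral>s. (\<Sum>i\<in>I. \<phi> i \<omega> * indicator {a i<..b i} s)\<^sup>2 \<partial>lborel) =
      (\<Sum>i\<in>I. \<Sum>j\<in>I. (\<phi> i \<omega> * \<phi> j \<omega>) * max 0 (min (b i) (b j) - max (a i) (a j)))"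
proof -
  have eq: "(\<Sum>i\<in>I. \<phi> i \<omega> * indicator {a i<..b i} s)\<^sup>2 =
    (\<Sum>i\<in>I. \<Sum>j\<in>I. (\<phi> i \<omega> * \<phi> j \<omega>) * (indicator {a i<..b i} s * indicator {a j<..b j} s))" for s
    by (simp add: power2_eq_square sum_product mult_ac)
  show "integrable lborel (\<lambda>s. (\<Sum>i\<in>I. \<phi> i \<omega> * indicator {a i<..b i} s)\<^sup>2)"
    unfolding eq
    by (intro Bochner_Integration.integrable_sum integrable_mult_right integral_indicator_Ioc_mult)
  show "(\<integral>s. (\<Sum>i\<in>I. \<phi> i \<omega> * indicator {a i<..b i} s)\<^sup>2 \<partial>lborel) =
      (\<Sum>i\<in>I. \<Sum>j\<in>I. (\<phi> i \<omega> * \<phi> j \<omega>) * max 0 (min (b i) (b j) - max (a i) (a j)))"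
    unfolding eq
    by (simp add: Bochner_Integration.integral_sum Bochner_Integration.integrable_sum integral_indicator_Ioc_mult)
qed

context brownian_space begin

text \<open>A piece stands for the integrand \<open>\<phi> * indicator {a<..b}\<close>. Its products with other pieces only
  depend on the overlap of the two intervals, so sums of pieces need no common partition.\<close>

definition piece :: "('a \<Rightarrow> real) \<Rightarrow> real \<Rightarrow> real \<Rightarrow> bool" where
  "piece \<phi> a b \<longleftrightarrow> 0 \<le> a \<and> a \<le> b \<and> square_integrable P \<phi> \<and> (a < b \<longrightarrow> \<phi> \<in> borel_measurable (F a))"

lemma piece_subinterval:
  assumes "piece \<phi> a b" "a \<le> a'" "a' \<le> b'" "b' \<le> b"
  shows "piece \<phi> a' b'"
  unfolding piece_def
proof (intro conjI impI)
  show "0 \<le> a'" "a' \<le> b'" "square_integrable P \<phi>" using assms by (simp_all add: piece_def)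
  assume "a' < b'"
  then show "\<phi> \<in> borel_measurable (F a')"
    using assms by (intro measurable_F_mono[of a a' \<phi>]) (auto simp: piece_def)
qed

lemma piece_increment:
  assumes "piece \<phi> a b"
  shows "square_integrable P (\<lambda>\<omega>. \<phi> \<omega> * (B b \<omega> - B a \<omega>))"
proof (rule square_integrableI)
  have \<phi>: "\<phi> \<in> borel_measurable P" and ab: "0 \<le> a" "a \<le> b"
    using assms by (auto simp: piece_def square_integrable_def)
  then show "(\<lambda>\<omega>. \<phi> \<omega> * (B b \<omega> - B a \<omega>)) \<in> borel_measurable P"
    using B_measurable by (intro borel_measurable_times borel_measurable_diff) auto
  have "integrable P (\<lambda>\<omega>. (\<phi> \<omega>)\<^sup>2 * (B b \<omega> - B a \<omega>)\<^sup>2)"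
    using assms by (intro B_increment_mult2) (auto simp: piece_def square_integrable_def)
  then show "integrable P (\<lambda>\<omega>. (\<phi> \<omega> * (B b \<omega> - B a \<omega>))\<^sup>2)"
    by (simp add: power_mult_distrib)
qed

text \<open>All factors except the later increment are known at time \<open>c\<close>, and their
  product is integrable because \<open>\<phi> * (B b - B a)\<close> and \<open>\<psi>\<close> are
  both square-integrable. The later increment then averages it to 0.\<close>

lemma piece_product_disjoint:
  assumes p: "piece \<phi> a b" and q: "piece \<psi> c d" and "b \<le> c"
  shows "(\<integral>\<omega>. (\<phi> \<omega> * (B b \<omega> - B a \<omega>)) * (\<psi> \<omega> * (B d \<omega> - B c \<omega>)) \<partial>P) = 0"
proof (cases "a < b")
  case True
  have i: "integrable P (\<lambda>\<omega>. (\<phi> \<omega> * (B b \<omega> - B a \<omega>)) * \<psi> \<omega>)"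
    using p q by (intro square_integrable_mult piece_increment) (auto simp: piece_def)
  have "(\<integral>\<omega>. ((\<phi> \<omega> * (B b \<omega> - B a \<omega>)) * \<psi> \<omega>) * (B d \<omega> - B c \<omega>) \<partial>P) = 0"
  proof (rule B_increment_mult1(2)[OF _ _ _ i])
    assume "c < d"
    show "(\<lambda>\<omega>. \<phi> \<omega> * (B b \<omega> - B a \<omega>) * \<psi> \<omega>) \<in> borel_measurable (F c)"
      using p q True \<open>c < d\<close> \<open>b \<le> c\<close>
      by (intro borel_measurable_times borel_measurable_diff B_measurable_F' measurable_F_mono[of a c \<phi>])
        (auto simp: piece_def)
  qed (use q in \<open>auto simp: piece_def\<close>)
  then show ?thesis by (simp add: mult.assoc)
next
  case False
  then have "a = b" using p by (auto simp: piece_def)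
  then show ?thesis by simp
qed

lemma piece_product_same:
  assumes p: "piece \<phi> a b" and q: "piece \<psi> a b"
  shows "(\<integral>\<omega>. (\<phi> \<omega> * (B b \<omega> - B a \<omega>)) * (\<psi> \<omega> * (B b \<omega> - B a \<omega>)) \<partial>P) = (\<integral>\<omega>. \<phi> \<omega> * \<psi> \<omega> \<partial>P) * (b - a)"
proof -
  have "(\<integral>\<omega>. (\<phi> \<omega> * \<psi> \<omega>) * (B b \<omega> - B a \<omega>)\<^sup>2 \<partial>P) = (\<integral>\<omega>. \<phi> \<omega> * \<psi> \<omega> \<partial>P) * (b - a)"
    using p q by (intro B_increment_mult2 square_integrable_mult borel_measurable_times) (auto simp: piece_def)
  then show ?thesis by (simp add: power2_eq_square mult.assoc mult.left_commute)
qed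

text \<open>Splitting the longer interval at \<open>b\<close> leaves a common interval, which yields
  the variance, and a later one, which is orthogonal to it.\<close>

lemma piece_product_left:
  assumes p: "piece \<phi> a b" and q: "piece \<psi> a d" and "b \<le> d"
  shows "(\<integral>\<omega>. (\<phi> \<omega> * (B b \<omega> - B a \<omega>)) * (\<psi> \<omega> * (B d \<omega> - B a \<omega>)) \<partial>P) = (\<integral>\<omega>. \<phi> \<omega> * \<psi> \<omega> \<partial>P) * (b - a)"
proof -
  have q1: "piece \<psi> a b" and q2: "piece \<psi> b d"
    using piece_subinterval[OF q] p \<open>b \<le> d\<close> by (auto simp: piece_def)
  have "(\<integral>\<omega>. (\<phi> \<omega> * (B b \<omega> - B a \<omega>)) * (\<psi> \<omega> * (B d \<omega> - B a \<omega>)) \<partial>P) =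
    (\<integral>\<omega>. (\<phi> \<omega> * (B b \<omega> - B a \<omega>)) * (\<psi> \<omega> * (B b \<omega> - B a \<omega>)) +
          (\<phi> \<omega> * (B b \<omega> - B a \<omega>)) * (\<psi> \<omega> * (B d \<omega> - B b \<omega>)) \<partial>P)"
    by (simp add: algebra_simps)
  also have "\<dots> = (\<integral>\<omega>. (\<phi> \<omega> * (B b \<omega> - B a \<omega>)) * (\<psi> \<omega> * (B b \<omega> - B a \<omega>)) \<partial>P) +
     (\<integral>\<omega>. (\<phi> \<omega> * (B b \<omega> - B a \<omega>)) * (\<psi> \<omega> * (B d \<omega> - B b \<omega>)) \<partial>P)"
    by (intro Bochner_Integration.integral_add square_integrable_mult piece_increment p q1 q2)
  finally show ?thesis
    using piece_product_same[OF p q1] piece_product_disjoint[OF p q2] by simp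
qed

text \<open>Cutting the first piece at \<open>c\<close> removes the part before the second piece
  starts. What remains are two pieces with the same left end, and the shorter one is the
  overlap.\<close>

lemma piece_product_aux:
  assumes p: "piece \<phi> a b" and q: "piece \<psi> c d" and "a \<le> c"
  shows "(\<integral>\<omega>. (\<phi> \<omega> * (B b \<omega> - B a \<omega>)) * (\<psi> \<omega> * (B d \<omega> - B c \<omega>)) \<partial>P) =
    (\<integral>\<omega>. \<phi> \<omega> * \<psi> \<omega> \<partial>P) * max 0 (min b d - max a c)"
proof (cases "b \<le> c")
  case True
  then show ?thesis using piece_product_disjoint[OF p q] assms by simp
next
  case False
  have p1: "piece \<phi> a c" and p2: "piece \<phi> c b"
    by (rule piece_subinterval[OF p]; use \<open>a \<le> c\<close> False in linarith)+
  have "(\<integral>\<omega>. (\<phi> \<omega> * (B b \<omega> - B a \<omega>)) * (\<psi> \<omega> * (B d \<omega> - B c \<omega>)) \<partial>P) =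
    (\<integral>\<omega>. (\<phi> \<omega> * (B c \<omega> - B a \<omega>)) * (\<psi> \<omega> * (B d \<omega> - B c \<omega>)) +
          (\<phi> \<omega> * (B b \<omega> - B c \<omega>)) * (\<psi> \<omega> * (B d \<omega> - B c \<omega>)) \<partial>P)"
    by (simp add: algebra_simps)
  also have "\<dots> = (\<integral>\<omega>. (\<phi> \<omega> * (B c \<omega> - B a \<omega>)) * (\<psi> \<omega> * (B d \<omega> - B c \<omega>)) \<partial>P) +
     (\<integral>\<omega>. (\<phi> \<omega> * (B b \<omega> - B c \<omega>)) * (\<psi> \<omega> * (B d \<omega> - B c \<omega>)) \<partial>P)"
    by (intro Bochner_Integration.integral_add square_integrable_mult piece_increment p1 p2 q)
  also have "(\<integral>\<omega>. (\<phi> \<omega> * (B c \<omega> - B a \<omega>)) * (\<psi> \<omega> * (B d \<omega> - B c \<omega>)) \<partial>P) = 0"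
    by (rule piece_product_disjoint[OF p1 q]) simp
  also have "(\<integral>\<omega>. (\<phi> \<omega> * (B b \<omega> - B c \<omega>)) * (\<psi> \<omega> * (B d \<omega> - B c \<omega>)) \<partial>P) = (\<integral>\<omega>. \<phi> \<omega> * \<psi> \<omega> \<partial>P) * (min b d - c)"
  proof (cases "b \<le> d")
    case True
    then show ?thesis using piece_product_left[OF p2 q] by simp
  next
    case False
    then show ?thesis using piece_product_left[OF q p2] by (simp add: mult.commute)
  qed
  finally show ?thesis
    using assms False by (simp add: piece_def max_def)
qed

lemma piece_product:
  assumes p: "piece \<phi> a b" and q: "piece \<psi> c d"
  shows "(\<integral>\<omega>. (\<phi> \<omega> * (B b \<omega> - B a \<omega>)) * (\<psi> \<omega> * (B d \<omega> - B c \<omega>)) \<partial>P) =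
    (\<integral>\<omega>. \<phi> \<omega> * \<psi> \<omega> \<partial>P) * max 0 (min b d - max a c)"
proof (cases "a \<le> c")
  case True
  then show ?thesis using piece_product_aux[OF p q] by simp
next
  case False
  then show ?thesis using piece_product_aux[OF q p] by (simp add: mult.commute min.commute max.commute)
qed

text \<open>Both squares expand into double sums, and \<open>piece_product\<close> matches them term
  by term. The intervals may overlap arbitrarily, which later allows one family to be subtracted
  from an unrelated one without a common refinement.\<close>

lemma pieces_isometry:
  fixes \<phi> :: "'i \<Rightarrow> 'a \<Rightarrow> real"
  assumes I: "finite I" and p: "\<And>i. i \<in> I \<Longrightarrow> piece (\<phi> i) (a i) (b i)"
  shows "integrable P (\<lambda>\<omega>. \<integral>s. (\<Sum>i\<in>I. \<phi> i \<omega> * indicator {a i<..b i} s)\<^sup>2 \<partial>lborel)"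
    and "(\<integral>\<omega>. (\<Sum>i\<in>I. \<phi> i \<omega> * (B (b i) \<omega> - B (a i) \<omega>))\<^sup>2 \<partial>P) =
      (\<integral>\<omega>. (\<integral>s. (\<Sum>i\<in>I. \<phi> i \<omega> * indicator {a i<..b i} s)\<^sup>2 \<partial>lborel) \<partial>P)"
proof -
  have i1: "integrable P (\<lambda>\<omega>. \<phi> i \<omega> * \<phi> j \<omega>)" if "i \<in> I" "j \<in> I" for i j
    using p that by (intro square_integrable_mult) (auto simp: piece_def)
  show "integrable P (\<lambda>\<omega>. \<integral>s. (\<Sum>i\<in>I. \<phi> i \<omega> * indicator {a i<..b i} s)\<^sup>2 \<partial>lborel)"
    unfolding pieces_square_integral(2)[OF I] using i1
    by (intro Bochner_Integration.integrable_sum integrable_mult_left) auto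
  have i2: "integrable P (\<lambda>\<omega>. (\<phi> i \<omega> * (B (b i) \<omega> - B (a i) \<omega>)) * (\<phi> j \<omega> * (B (b j) \<omega> - B (a j) \<omega>)))"
    if "i \<in> I" "j \<in> I" for i j
    using p that by (intro square_integrable_mult piece_increment) auto
  have "(\<integral>\<omega>. (\<Sum>i\<in>I. \<phi> i \<omega> * (B (b i) \<omega> - B (a i) \<omega>))\<^sup>2 \<partial>P) =
    (\<Sum>i\<in>I. \<Sum>j\<in>I. \<integral>\<omega>. (\<phi> i \<omega> * (B (b i) \<omega> - B (a i) \<omega>)) * (\<phi> j \<omega> * (B (b j) \<omega> - B (a j) \<omega>)) \<partial>P)"
    unfolding power2_eq_square sum_product using i2
    by (subst Bochner_Integration.integral_sum; (intro Bochner_Integration.integrable_sum sum.cong refl Bochner_Integration.integral_sum)?) auto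
  also have "\<dots> = (\<Sum>i\<in>I. \<Sum>j\<in>I. (\<integral>\<omega>. \<phi> i \<omega> * \<phi> j \<omega> \<partial>P) * max 0 (min (b i) (b j) - max (a i) (a j)))"
    by (intro sum.cong refl piece_product p)
  also have "\<dots> = (\<integral>\<omega>. (\<Sum>i\<in>I. \<Sum>j\<in>I. (\<phi> i \<omega> * \<phi> j \<omega>) * max 0 (min (b i) (b j) - max (a i) (a j))) \<partial>P)"
    using i1
    by (subst Bochner_Integration.integral_sum; (intro Bochner_Integration.integrable_sum integrable_mult_left sum.cong refl)?)
       (auto simp: Bochner_Integration.integral_sum)
  finally show "(\<integral>\<omega>. (\<Sum>i\<in>I. \<phi> i \<omega> * (B (b i) \<omega> - B (a i) \<omega>))\<^sup>2 \<partial>P) =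
      (\<integral>\<omega>. (\<integral>s. (\<Sum>i\<in>I. \<phi> i \<omega> * indicator {a i<..b i} s)\<^sup>2 \<partial>lborel) \<partial>P)"
    unfolding pieces_square_integral(2)[OF I] .
qed

text \<open>The martingale property: each \<open>Z * \<phi> i\<close> is known when its interval
  starts, since \<open>u \<le> a i\<close>.\<close>

lemma pieces_mean_zero:
  fixes \<phi> :: "'i \<Rightarrow> 'a \<Rightarrow> real"
  assumes I: "finite I" and p: "\<And>i. i \<in> I \<Longrightarrow> piece (\<phi> i) (a i) (b i) \<and> u \<le> a i"
    and Z: "Z \<in> borel_measurable (F u)" "\<And>\<omega>. \<bar>Z \<omega>\<bar> \<le> C" and u: "0 \<le> u"
  shows "(\<integral>\<omega>. Z \<omega> * (\<Sum>i\<in>I. \<phi> i \<omega> * (B (b i) \<omega> - B (a i) \<omega>)) \<partial>P) = 0"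
proof -
  have *: "integrable P (\<lambda>\<omega>. Z \<omega> * (\<phi> i \<omega> * (B (b i) \<omega> - B (a i) \<omega>))) \<and>
    (\<integral>\<omega>. Z \<omega> * (\<phi> i \<omega> * (B (b i) \<omega> - B (a i) \<omega>)) \<partial>P) = 0" if "i \<in> I" for i
  proof -
    have pi: "piece (\<phi> i) (a i) (b i)" "u \<le> a i" using p that by auto
    have "integrable P (\<lambda>\<omega>. Z \<omega> * \<phi> i \<omega>)"
      using pi measurable_F_P[OF u Z(1)] Z(2)
      by (intro square_integrable_imp_integrable square_integrable_bounded_mult) (auto simp: piece_def)
    from B_increment_mult1[OF _ _ _ this, of "a i" "b i"]
    show ?thesis
      using pi measurable_F_mono[OF u pi(2) Z(1)] by (auto simp: piece_def mult.assoc)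
  qed
  then show ?thesis
    by (simp add: sum_distrib_left Bochner_Integration.integral_sum)
qed

end

section \<open>Simple processes\<close>

text \<open>The energy \<open>\<integral>\<^sub>0\<^sup>T \<phi>\<^sup>2\<close> of the first \<open>Suc i\<close> steps is known at time \<open>\<tau> i\<close>. Dropping the steps after
  this energy has exceeded \<open>R\<close> thus leaves a simple process, and no stopping time is needed.\<close>

definition step_energy :: "real \<Rightarrow> (nat \<Rightarrow> real) \<Rightarrow> (nat \<Rightarrow> 'a \<Rightarrow> real) \<Rightarrow> nat \<Rightarrow> 'a \<Rightarrow> real" where
  "step_energy T \<tau> \<phi> n \<omega> = (\<Sum>j<n. (\<phi> j \<omega>)\<^sup>2 * (min (\<tau> (Suc j)) T - min (\<tau> j) T))"

definition energy_cutoff :: "real \<Rightarrow> real \<Rightarrow> (nat \<Rightarrow> real) \<Rightarrow> (nat \<Rightarrow> 'a \<Rightarrow> real) \<Rightarrow> nat \<Rightarrow> 'a \<Rightarrow> real" where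
  "energy_cutoff T R \<tau> \<phi> i \<omega> = (if step_energy T \<tau> \<phi> (Suc i) \<omega> \<le> R then \<phi> i \<omega> else 0)"

lemma simple_process_mono:
  assumes "simple_process P F n \<tau> \<phi>" "i \<le> j" "j \<le> n"
  shows "\<tau> i \<le> \<tau> j"
  using assms(2,3)
proof (induction j)
  case (Suc j)
  have "\<tau> j < \<tau> (Suc j)" using assms(1) Suc.prems by (auto simp: simple_process_def)
  then show ?case using Suc by (cases "i = Suc j") auto
qed simp

lemma simple_process_nonneg:
  assumes "simple_process P F n \<tau> \<phi>" "j \<le> n"
  shows "0 \<le> \<tau> j"
proof -
  have "0 \<le> \<tau> 0" using assms(1) by (simp add: simple_process_def)
  then show ?thesis using simple_process_mono[OF assms(1) _ assms(2), of 0] by simp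
qed

lemma step_energy_mono:
  assumes "simple_process P F n \<tau> \<phi>" "i \<le> j" "j \<le> n"
  shows "step_energy T \<tau> \<phi> i \<omega> \<le> step_energy T \<tau> \<phi> j \<omega>"
  unfolding step_energy_def
proof (rule sum_mono2)
  fix k assume "k \<in> {..<j} - {..<i}"
  then have "\<tau> k \<le> \<tau> (Suc k)" using simple_process_mono[OF assms(1), of k "Suc k"] assms by auto
  then show "0 \<le> (\<phi> k \<omega>)\<^sup>2 * (min (\<tau> (Suc k)) T - min (\<tau> k) T)" by auto
qed (use assms in auto)

text \<open>Step energies increase with the index, so a total of at most \<open>R\<close> means that
  no step was dropped.\<close>

lemma energy_cutoff_inactive:
  assumes "simple_process P F n \<tau> \<phi>" "step_energy T \<tau> \<phi> n \<omega> \<le> R" "i < n"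
  shows "energy_cutoff T R \<tau> \<phi> i \<omega> = \<phi> i \<omega>"
proof -
  have "step_energy T \<tau> \<phi> (Suc i) \<omega> \<le> R"
    using step_energy_mono[OF assms(1), of "Suc i" n T \<omega>] assms(2,3) by linarith
  then show ?thesis by (simp add: energy_cutoff_def)
qed

text \<open>The surviving steps form an initial segment. In the induction either nothing up to step
  \<open>k\<close> has been dropped, or step \<open>k\<close> itself is 0 and adds nothing to the
  energy.\<close>

lemma step_energy_cutoff_le:
  assumes "simple_process P F n \<tau> \<phi>" "0 \<le> R" "k \<le> n"
  shows "step_energy T \<tau> (energy_cutoff T R \<tau> \<phi>) k \<omega> \<le> R"
  using assms(3)
proof (induction k)
  case 0
  then show ?case using assms by (simp add: step_energy_def)
next
  case (Suc k)
  show ?case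
  proof (cases "step_energy T \<tau> \<phi> (Suc k) \<omega> \<le> R")
    case True
    have "step_energy T \<tau> (energy_cutoff T R \<tau> \<phi>) (Suc k) \<omega> = step_energy T \<tau> \<phi> (Suc k) \<omega>"
      unfolding step_energy_def
    proof (intro sum.cong refl)
      fix j assume "j \<in> {..<Suc k}"
      then have "step_energy T \<tau> \<phi> (Suc j) \<omega> \<le> R"
        using step_energy_mono[OF assms(1), of "Suc j" "Suc k" T \<omega>] True Suc by auto
      then show "(energy_cutoff T R \<tau> \<phi> j \<omega>)\<^sup>2 * (min (\<tau> (Suc j)) T - min (\<tau> j) T) =
         (\<phi> j \<omega>)\<^sup>2 * (min (\<tau> (Suc j)) T - min (\<tau> j) T)"
        by (simp add: energy_cutoff_def)
    qed
    then show ?thesis using True by simp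
  next
    case False
    then have "energy_cutoff T R \<tau> \<phi> k \<omega> = 0" by (simp add: energy_cutoff_def)
    then have "step_energy T \<tau> (energy_cutoff T R \<tau> \<phi>) (Suc k) \<omega> = step_energy T \<tau> (energy_cutoff T R \<tau> \<phi>) k \<omega>"
      by (simp add: step_energy_def)
    then show ?thesis using Suc by simp
  qed
qed

text \<open>The steps live on disjoint intervals, so at most one indicator is non-zero and the cross
  terms vanish.\<close>

lemma simple_value_square:
  assumes "simple_process P F n \<tau> \<phi>"
  shows "(simple_value n \<tau> \<phi> s \<omega>)\<^sup>2 = (\<Sum>i<n. (\<phi> i \<omega>)\<^sup>2 * indicator {\<tau> i<..\<tau> (Suc i)} s)"
proof (cases "\<exists>i<n. s \<in> {\<tau> i<..\<tau> (Suc i)}")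
  case True
  then obtain i where i: "i < n" "s \<in> {\<tau> i<..\<tau> (Suc i)}" by auto
  have other: "indicator {\<tau> j<..\<tau> (Suc j)} s = (if j = i then 1 else 0 :: real)" if "j < n" for j
    using i that simple_process_mono[OF assms, of "Suc i" j] simple_process_mono[OF assms, of "Suc j" i]
    by (cases j i rule: linorder_cases) (auto simp: indicator_def)
  have "simple_value n \<tau> \<phi> s \<omega> = (\<Sum>j<n. \<phi> j \<omega> * (if j = i then 1 else 0))"
    "(\<Sum>j<n. (\<phi> j \<omega>)\<^sup>2 * indicator {\<tau> j<..\<tau> (Suc j)} s) = (\<Sum>j<n. (\<phi> j \<omega>)\<^sup>2 * (if j = i then 1 else 0))"
    unfolding simple_value_def by (intro sum.cong refl; simp add: other)+
  moreover have "(\<Sum>j<n. \<phi> j \<omega> * (if j = i then 1 else 0)) = \<phi> i \<omega>"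
    "(\<Sum>j<n. (\<phi> j \<omega>)\<^sup>2 * (if j = i then 1 else 0)) = (\<phi> i \<omega>)\<^sup>2"
    using i(1) by (simp_all add: if_distrib[of "(*) _"] cong: if_cong)
  ultimately show ?thesis by (simp only:)
next
  case False
  then show ?thesis by (auto simp: simple_value_def)
qed

lemma simple_value_energy:
  assumes "simple_process P F n \<tau> \<phi>" "0 \<le> T"
  shows "integrable lborel (\<lambda>s. indicator {0<..T} s * (simple_value n \<tau> \<phi> s \<omega>)\<^sup>2)"
    and "(\<integral>s. indicator {0<..T} s * (simple_value n \<tau> \<phi> s \<omega>)\<^sup>2 \<partial>lborel) = step_energy T \<tau> \<phi> n \<omega>"
proof -
  have eq: "indicator {0<..T} s * (simple_value n \<tau> \<phi> s \<omega>)\<^sup>2 =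
    (\<Sum>i<n. (\<phi> i \<omega>)\<^sup>2 * (indicator {\<tau> i<..\<tau> (Suc i)} s * indicator {0<..T} s))" for s
    unfolding simple_value_square[OF assms(1)] by (simp only: sum_distrib_left mult_ac)
  show "integrable lborel (\<lambda>s. indicator {0<..T} s * (simple_value n \<tau> \<phi> s \<omega>)\<^sup>2)"
    unfolding eq
    by (intro Bochner_Integration.integrable_sum integrable_mult_right integral_indicator_Ioc_mult)
  have "(\<integral>s. indicator {0<..T} s * (simple_value n \<tau> \<phi> s \<omega>)\<^sup>2 \<partial>lborel) =
     (\<Sum>i<n. (\<phi> i \<omega>)\<^sup>2 * max 0 (min (\<tau> (Suc i)) T - max (\<tau> i) 0))"
    unfolding eq by (simp add: Bochner_Integration.integral_sum integral_indicator_Ioc_mult)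
  also have "\<dots> = step_energy T \<tau> \<phi> n \<omega>"
    unfolding step_energy_def
  proof (intro sum.cong refl arg_cong2[where f="(*)"])
    fix i assume "i \<in> {..<n}"
    then have "0 \<le> \<tau> i" "\<tau> i \<le> \<tau> (Suc i)"
      using simple_process_nonneg[OF assms(1), of i] simple_process_mono[OF assms(1), of i "Suc i"] by auto
    then show "max 0 (min (\<tau> (Suc i)) T - max (\<tau> i) 0) = min (\<tau> (Suc i)) T - min (\<tau> i) T"
      using assms(2) by (auto simp: min_def max_def)
  qed
  finally show "(\<integral>s. indicator {0<..T} s * (simple_value n \<tau> \<phi> s \<omega>)\<^sup>2 \<partial>lborel) = step_energy T \<tau> \<phi> n \<omega>" .
qed

context brownian_space begin

lemma simple_process_energy_cutoff:
  assumes s: "simple_process P F n \<tau> \<phi>"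
  shows "simple_process P F n \<tau> (energy_cutoff T R \<tau> \<phi>)"
  unfolding simple_process_def
proof (intro conjI allI impI)
  show "0 \<le> \<tau> 0" using s by (simp add: simple_process_def)
  fix i assume i: "i < n"
  show "\<tau> i < \<tau> (Suc i)" using s i by (simp add: simple_process_def)
  have m: "\<phi> j \<in> borel_measurable (F (\<tau> i))" if "j \<le> i" for j
    using s i that simple_process_mono[OF s that] simple_process_nonneg[OF s, of j]
    by (intro measurable_F_mono[of "\<tau> j" "\<tau> i"]) (auto simp: simple_process_def)
  show "energy_cutoff T R \<tau> \<phi> i \<in> borel_measurable (F (\<tau> i))"
  proof -
    have [measurable]: "step_energy T \<tau> \<phi> (Suc i) \<in> borel_measurable (F (\<tau> i))"
      unfolding step_energy_def[abs_def] using m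
      by (intro borel_measurable_sum borel_measurable_times borel_measurable_power) auto
    have [measurable]: "\<phi> i \<in> borel_measurable (F (\<tau> i))" using m by simp
    show ?thesis unfolding energy_cutoff_def[abs_def] by measurable
  qed
  obtain C where C: "\<And>\<omega>. \<omega> \<in> space P \<Longrightarrow> \<bar>\<phi> i \<omega>\<bar> \<le> C"
    using s i unfolding simple_process_def by blast
  have "\<bar>energy_cutoff T R \<tau> \<phi> i \<omega>\<bar> \<le> C" if "\<omega> \<in> space P" for \<omega>
    using C[OF that] by (auto simp: energy_cutoff_def intro: order_trans[OF abs_ge_zero])
  then show "\<exists>C. \<forall>\<omega>\<in>space P. \<bar>energy_cutoff T R \<tau> \<phi> i \<omega>\<bar> \<le> C" by blast
qed

text \<open>If \<open>\<tau> i\<close> lies beyond \<open>v\<close>, the clipped interval is the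
  point \<open>v\<close>, where \<open>\<phi> i\<close> may still be unknown. This case is the
  reason for the guard \<open>a < b\<close> in \<open>piece\<close>.\<close>

lemma simple_process_piece:
  assumes s: "simple_process P F n \<tau> \<phi>" and i: "i < n" and uv: "0 \<le> u" "u \<le> v"
  shows "piece (\<phi> i) (max u (min (\<tau> i) v)) (max u (min (\<tau> (Suc i)) v))"
proof -
  let ?a = "max u (min (\<tau> i) v)" and ?b = "max u (min (\<tau> (Suc i)) v)"
  have m: "\<phi> i \<in> borel_measurable (F (\<tau> i))" and \<tau>: "0 \<le> \<tau> i" "\<tau> i < \<tau> (Suc i)"
    using s i simple_process_nonneg[OF s, of i] by (auto simp: simple_process_def)
  obtain C where C: "\<And>\<omega>. \<omega> \<in> space P \<Longrightarrow> \<bar>\<phi> i \<omega>\<bar> \<le> C"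
    using s i unfolding simple_process_def by blast
  have "square_integrable P (\<phi> i)"
    using C measurable_F_P[OF \<tau>(1) m] by (rule square_integrable_bounded[rotated])
  moreover have "?a \<le> ?b" "0 \<le> ?a" using uv \<tau> by auto
  moreover have "\<phi> i \<in> borel_measurable (F ?a)" if "?a < ?b"
    using that \<tau> by (intro measurable_F_mono[OF \<tau>(1) _ m]) (auto simp: max_def min_def split: if_splits)
  ultimately show ?thesis by (simp add: piece_def)
qed

lemma simple_integral_increment:
  assumes s: "simple_process P F n \<tau> \<phi>" and uv: "0 \<le> u" "u \<le> v"
  shows "simple_integral B n \<tau> \<phi> v \<omega> - simple_integral B n \<tau> \<phi> u \<omega> =
    (\<Sum>i<n. \<phi> i \<omega> * (B (max u (min (\<tau> (Suc i)) v)) \<omega> - B (max u (min (\<tau> i) v)) \<omega>))"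
  unfolding simple_integral_def sum_subtractf[symmetric]
proof (intro sum.cong refl)
  fix i assume "i \<in> {..<n}"
  then have "\<tau> i < \<tau> (Suc i)" using s by (auto simp: simple_process_def)
  moreover have "B (min x v) \<omega> - B (min x u) \<omega> = B (max u (min x v)) \<omega> - B u \<omega>" for x
    using uv by (auto simp: min_def max_def)
  from this[of "\<tau> i"] this[of "\<tau> (Suc i)"]
  show "\<phi> i \<omega> * (B (min (\<tau> (Suc i)) v) \<omega> - B (min (\<tau> i) v) \<omega>) - \<phi> i \<omega> * (B (min (\<tau> (Suc i)) u) \<omega> - B (min (\<tau> i) u) \<omega>) =
       \<phi> i \<omega> * (B (max u (min (\<tau> (Suc i)) v)) \<omega> - B (max u (min (\<tau> i) v)) \<omega>)"
    unfolding right_diff_distrib[symmetric] by (intro arg_cong2[where f="(*)"] refl) linarith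
qed

end

lemma simple_value_clip:
  assumes "0 \<le> u" "u \<le> v"
  shows "indicator {u<..v} s * simple_value n \<tau> \<phi> s \<omega> =
    (\<Sum>i<n. \<phi> i \<omega> * indicator {max u (min (\<tau> i) v)<..max u (min (\<tau> (Suc i)) v)} s)"
proof -
  have "indicator {u<..v} s * indicator {a<..b} s = (indicator {max u (min a v)<..max u (min b v)} s :: real)" for a b
  proof -
    have "u < s \<and> s \<le> v \<and> a < s \<and> s \<le> b \<longleftrightarrow> max u (min a v) < s \<and> s \<le> max u (min b v)"
      using assms by linarith
    then show ?thesis by (auto simp: indicator_def)
  qed
  then show ?thesis
    unfolding simple_value_def sum_distrib_left
    by (intro sum.cong refl) (simp only: mult.left_commute)
qed

section \<open>Limit theorems: squares in mean, Fatou, convergence in probability\<close>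

lemma integral_square_tendsto:
  assumes f: "square_integrable M f" and g: "\<And>k. square_integrable M (g k)"
    and lim: "(\<lambda>k. \<integral>x. (g k x - f x)\<^sup>2 \<partial>M) \<longlonglongrightarrow> 0"
  shows "(\<lambda>k. \<integral>x. (g k x)\<^sup>2 \<partial>M) \<longlonglongrightarrow> (\<integral>x. (f x)\<^sup>2 \<partial>M)"
proof -
  define e where "e k = (\<integral>x. (g k x - f x)\<^sup>2 \<partial>M)" for k
  define A where "A = (\<integral>x. (f x)\<^sup>2 \<partial>M)"
  have sd: "square_integrable M (\<lambda>x. g k x - f x)" for k by (intro square_integrable_diff g f)
  have bound: "\<bar>(\<integral>x. (g k x)\<^sup>2 \<partial>M) - A\<bar> \<le> e k + 2 * (sqrt A * sqrt (e k))" for k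
  proof -
    have "(\<integral>x. (g k x)\<^sup>2 \<partial>M) = (\<integral>x. (f x)\<^sup>2 + ((g k x - f x)\<^sup>2 + 2 * (f x * (g k x - f x))) \<partial>M)"
      by (intro Bochner_Integration.integral_cong refl) (simp add: power2_eq_square algebra_simps)
    also have "\<dots> = A + (e k + 2 * (\<integral>x. f x * (g k x - f x) \<partial>M))"
      unfolding A_def e_def
      using square_integrableD(2)[OF f] square_integrableD(2)[OF sd[of k]] square_integrable_mult[OF f sd[of k]]
      by simp
    finally have "(\<integral>x. (g k x)\<^sup>2 \<partial>M) = A + (e k + 2 * (\<integral>x. f x * (g k x - f x) \<partial>M))" .
    moreover have "0 \<le> e k" by (simp add: e_def)
    ultimately have "\<bar>(\<integral>x. (g k x)\<^sup>2 \<partial>M) - A\<bar> \<le> e k + 2 * \<bar>\<integral>x. f x * (g k x - f x) \<partial>M\<bar>"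
      by linarith
    moreover have "\<bar>\<integral>x. f x * (g k x - f x) \<partial>M\<bar> \<le> sqrt A * sqrt (e k)"
      using Cauchy_Schwarz_integral[OF f sd[of k]] integral_abs_bound[of M "\<lambda>x. f x * (g k x - f x)"]
      unfolding A_def e_def by linarith
    ultimately show ?thesis by linarith
  qed
  have "e \<longlonglongrightarrow> 0" using lim by (simp add: e_def[abs_def])
  then have "(\<lambda>k. e k + 2 * (sqrt A * sqrt (e k))) \<longlonglongrightarrow> 0 + 2 * (sqrt A * sqrt 0)"
    by (intro tendsto_intros)
  then have "(\<lambda>k. e k + 2 * (sqrt A * sqrt (e k))) \<longlonglongrightarrow> 0" by simp
  then have "(\<lambda>k. (\<integral>x. (g k x)\<^sup>2 \<partial>M) - A) \<longlonglongrightarrow> 0"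
    by (rule Lim_null_comparison[rotated]) (use bound in auto)
  then show ?thesis unfolding A_def by (rule LIM_zero_cancel)
qed

text \<open>Convergence is only asked where \<open>f\<close> does not vanish. This suits limits of
  the form "square times indicator of low energy": on the event of high energy the approximations
  need not converge at all.\<close>

lemma Fatou_real:
  fixes f :: "'a \<Rightarrow> real" and g :: "nat \<Rightarrow> 'a \<Rightarrow> real"
  assumes f: "f \<in> borel_measurable M" "\<And>x. 0 \<le> f x"
    and g: "\<And>k. integrable M (g k)" "\<And>k x. 0 \<le> g k x"
    and lim: "AE x in M. f x = 0 \<or> (\<lambda>k. g k x) \<longlonglongrightarrow> f x"
    and c: "\<And>k. (\<integral>x. g k x \<partial>M) \<le> c k" "c \<longlonglongrightarrow> C"
  shows "integrable M f" "(\<integral>x. f x \<partial>M) \<le> C"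
proof -
  have C: "0 \<le> C"
    by (rule LIMSEQ_le_const[OF c(2)]) (use order_trans[OF Bochner_Integration.integral_nonneg c(1)] g(2) in blast)
  have "(\<integral>\<^sup>+x. ennreal (f x) \<partial>M) \<le> (\<integral>\<^sup>+x. liminf (\<lambda>k. ennreal (g k x)) \<partial>M)"
  proof (rule nn_integral_mono_AE, use lim in eventually_elim)
    fix x assume "f x = 0 \<or> (\<lambda>k. g k x) \<longlonglongrightarrow> f x"
    then show "ennreal (f x) \<le> liminf (\<lambda>k. ennreal (g k x))"
    proof
      assume "(\<lambda>k. g k x) \<longlonglongrightarrow> f x"
      then have "(\<lambda>k. ennreal (g k x)) \<longlonglongrightarrow> ennreal (f x)" by (rule tendsto_ennrealI)
      then show ?thesis by (simp add: lim_imp_Liminf)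
    qed simp
  qed
  also have "\<dots> \<le> liminf (\<lambda>k. \<integral>\<^sup>+x. ennreal (g k x) \<partial>M)"
    by (rule nn_integral_liminf) (use g in auto)
  also have "\<dots> \<le> liminf (\<lambda>k. ennreal (c k))"
    by (intro Liminf_mono always_eventually allI)
       (use g c(1) in \<open>auto simp: nn_integral_eq_integral intro: ennreal_leI\<close>)
  also have "\<dots> = ennreal C"
    by (intro lim_imp_Liminf tendsto_ennrealI c(2)) simp
  finally have *: "(\<integral>\<^sup>+x. ennreal (f x) \<partial>M) \<le> ennreal C" .
  show i: "integrable M f"
    using f * by (intro integrableI_nonneg) (auto simp: less_top[symmetric] top_unique)
  show "(\<integral>x. f x \<partial>M) \<le> C"
    using * C by (simp add: nn_integral_eq_integral[OF i] f ennreal_le_iff)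
qed

lemma eventually_less_real: "\<forall>\<^sub>F k in sequentially. x < real k"
  using filterlim_real_sequentially by (auto simp: filterlim_at_top_dense)

lemma tendsto_of_tendsto_min_1:
  fixes x :: "nat \<Rightarrow> real"
  assumes "(\<lambda>k. min 1 \<bar>x k\<bar>) \<longlonglongrightarrow> 0"
  shows "x \<longlonglongrightarrow> 0"
proof -
  have "\<forall>\<^sub>F k in sequentially. min 1 \<bar>x k\<bar> < 1" using order_tendstoD(2)[OF assms, of 1] by simp
  then have "\<forall>\<^sub>F k in sequentially. min 1 \<bar>x k\<bar> = \<bar>x k\<bar>" by eventually_elim (auto simp: min_def split: if_splits)
  from tendsto_cong[THEN iffD1, OF this assms] show ?thesis by (rule tendsto_rabs_zero_cancel)
qed

context prob_space begin

text \<open>The distance truncated at 1 metrises convergence in probability and is always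
  integrable, so several such convergences can be added and treated as one convergence in
  mean.\<close>

lemma tendsto_in_prob_expectation:
  assumes "tendsto_in_prob M Y Z" and m: "\<And>k. Y k \<in> borel_measurable M" "Z \<in> borel_measurable M"
  shows "(\<lambda>k. expectation (\<lambda>x. min 1 \<bar>Y k x - Z x\<bar>)) \<longlonglongrightarrow> 0"
proof (rule LIMSEQ_I)
  fix r :: real assume "0 < r"
  define e where "e = r / 2"
  have "0 < e" using \<open>0 < r\<close> by (simp add: e_def)
  note [measurable] = m
  have "(\<lambda>k. prob {x \<in> space M. e < \<bar>Y k x - Z x\<bar>}) \<longlonglongrightarrow> 0"
    using assms(1) \<open>0 < e\<close> by (auto simp: tendsto_in_prob_def)
  from LIMSEQ_D[OF this \<open>0 < e\<close>] obtain N
    where N: "\<And>k. N \<le> k \<Longrightarrow> prob {x \<in> space M. e < \<bar>Y k x - Z x\<bar>} < e" by auto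
  show "\<exists>no. \<forall>k\<ge>no. norm (expectation (\<lambda>x. min 1 \<bar>Y k x - Z x\<bar>) - 0) < r"
  proof (intro exI allI impI)
    fix k assume "N \<le> k"
    let ?S = "{x \<in> space M. e < \<bar>Y k x - Z x\<bar>}"
    have i: "integrable M (\<lambda>x. e + indicator ?S x :: real)"
      by (intro Bochner_Integration.integrable_add integrable_real_indicator) (auto simp: emeasure_eq_measure)
    have "expectation (\<lambda>x. min 1 \<bar>Y k x - Z x\<bar>) \<le> expectation (\<lambda>x. e + indicator ?S x)"
    proof (rule integral_mono[OF _ i])
      show "integrable M (\<lambda>x. min 1 \<bar>Y k x - Z x\<bar>)"
        by (rule integrable_const_bound[where B=1]) auto
      show "min 1 \<bar>Y k x - Z x\<bar> \<le> e + indicator ?S x" if "x \<in> space M" for x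
        using that \<open>0 < e\<close> by (auto simp: indicator_def)
    qed
    also have "\<dots> = e + prob ?S"
      by (subst Bochner_Integration.integral_add) (auto simp: prob_space emeasure_eq_measure)
    also have "\<dots> < r" using N[OF \<open>N \<le> k\<close>] by (simp add: e_def)
    finally show "norm (expectation (\<lambda>x. min 1 \<bar>Y k x - Z x\<bar>) - 0) < r"
      by (simp add: abs_of_nonneg Bochner_Integration.integral_nonneg)
  qed
qed

text \<open>The sum of the three truncated distances tends to 0 in mean, so one subsequence serves
  all of them. In the application these are the approximation error on \<open>{0..T}\<close> and the
  integrals at two times.\<close>

lemma tendsto_in_prob_AE_subseq3:
  assumes 1: "tendsto_in_prob M Y1 Z1" "\<And>k. Y1 k \<in> borel_measurable M" "Z1 \<in> borel_measurable M"
    and 2: "tendsto_in_prob M Y2 Z2" "\<And>k. Y2 k \<in> borel_measurable M" "Z2 \<in> borel_measurable M"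
    and 3: "tendsto_in_prob M Y3 Z3" "\<And>k. Y3 k \<in> borel_measurable M" "Z3 \<in> borel_measurable M"
  shows "\<exists>r::nat\<Rightarrow>nat. AE x in M. (\<lambda>k. Y1 (r k) x) \<longlonglongrightarrow> Z1 x \<and> (\<lambda>k. Y2 (r k) x) \<longlonglongrightarrow> Z2 x \<and> (\<lambda>k. Y3 (r k) x) \<longlonglongrightarrow> Z3 x"
proof -
  note [measurable] = 1(2,3) 2(2,3) 3(2,3)
  define W1 where "W1 k x = min 1 \<bar>Y1 k x - Z1 x\<bar>" for k x
  define W2 where "W2 k x = min 1 \<bar>Y2 k x - Z2 x\<bar>" for k x
  define W3 where "W3 k x = min 1 \<bar>Y3 k x - Z3 x\<bar>" for k x
  have i: "integrable M (W1 k)" "integrable M (W2 k)" "integrable M (W3 k)" for k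
    unfolding W1_def W2_def W3_def by (rule integrable_const_bound[where B=1]; auto)+
  have nn: "0 \<le> W1 k x" "0 \<le> W2 k x" "0 \<le> W3 k x" for k x
    by (auto simp: W1_def W2_def W3_def)
  have "(\<lambda>k. expectation (W1 k) + expectation (W2 k) + expectation (W3 k)) \<longlonglongrightarrow> 0 + 0 + 0"
    unfolding W1_def W2_def W3_def by (intro tendsto_add tendsto_in_prob_expectation 1 2 3)
  moreover have "expectation (\<lambda>x. norm (W1 k x + W2 k x + W3 k x)) = expectation (W1 k) + expectation (W2 k) + expectation (W3 k)" for k
    using i nn by (simp add: abs_of_nonneg)
  ultimately have lim: "(\<lambda>k. expectation (\<lambda>x. norm (W1 k x + W2 k x + W3 k x))) \<longlonglongrightarrow> 0" by simp
  have "\<exists>r::nat\<Rightarrow>nat. strict_mono r \<and> (AE x in M. (\<lambda>k. W1 (r k) x + W2 (r k) x + W3 (r k) x) \<longlonglongrightarrow> 0)"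
    by (rule tendsto_L1_AE_subseq[of _ "\<lambda>k x. W1 k x + W2 k x + W3 k x"]) (use i lim in auto)
  then obtain r :: "nat \<Rightarrow> nat" where r: "AE x in M. (\<lambda>k. W1 (r k) x + W2 (r k) x + W3 (r k) x) \<longlonglongrightarrow> 0"
    by auto
  have "AE x in M. (\<lambda>k. Y1 (r k) x) \<longlonglongrightarrow> Z1 x \<and> (\<lambda>k. Y2 (r k) x) \<longlonglongrightarrow> Z2 x \<and> (\<lambda>k. Y3 (r k) x) \<longlonglongrightarrow> Z3 x"
    using r
  proof eventually_elim
    fix x assume x: "(\<lambda>k. W1 (r k) x + W2 (r k) x + W3 (r k) x) \<longlonglongrightarrow> 0"
    have "(\<lambda>k. W1 (r k) x) \<longlonglongrightarrow> 0" "(\<lambda>k. W2 (r k) x) \<longlonglongrightarrow> 0" "(\<lambda>k. W3 (r k) x) \<longlonglongrightarrow> 0"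
      by (rule tendsto_sandwich[OF _ _ tendsto_const x]; use nn in \<open>auto intro!: always_eventually add_nonneg_nonneg\<close>)+
    from this[unfolded W1_def W2_def W3_def, THEN tendsto_of_tendsto_min_1]
    show "(\<lambda>k. Y1 (r k) x) \<longlonglongrightarrow> Z1 x \<and> (\<lambda>k. Y2 (r k) x) \<longlonglongrightarrow> Z2 x \<and> (\<lambda>k. Y3 (r k) x) \<longlonglongrightarrow> Z3 x"
      by (auto intro: LIM_zero_cancel)
  qed
  then show ?thesis by blast
qed

end

section \<open>The Ito isometry\<close>

locale ito_process = brownian_space P F B
  for P :: "'a measure" and F B +
  fixes H J :: "real \<Rightarrow> 'a \<Rightarrow> real"
  assumes ito: "ito_integral P F B H J"
begin

definition energy :: "real \<Rightarrow> 'a \<Rightarrow> real" where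
  "energy t \<omega> = (\<integral>r. (indicator {0..t} r * H r \<omega>)\<^sup>2 \<partial>lborel)"

lemma J_measurable_F: "0 \<le> t \<Longrightarrow> J t \<in> borel_measurable (F t)"
  using ito by (auto simp: ito_integral_def adapted_def)

lemma J_measurable: "0 \<le> t \<Longrightarrow> J t \<in> borel_measurable P"
  using J_measurable_F measurable_F_P by blast

text \<open>Progressive measurability speaks about \<open>{0..T}\<close> and \<open>F T\<close>
  only. Extending by 0 outside \<open>{0..T}\<close> and enlarging \<open>F T\<close> to
  \<open>P\<close> gives joint measurability on the whole product, as needed for Fubini.\<close>

lemma H_joint_measurable:
  assumes T: "0 \<le> T"
  shows "(\<lambda>(\<omega>, r). indicator {0..T} r * H r \<omega>) \<in> borel_measurable (P \<Otimes>\<^sub>M lborel)"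
proof -
  have H: "(\<lambda>(s, \<omega>). H s \<omega>) \<in> borel_measurable (restrict_space borel {0..T} \<Otimes>\<^sub>M F T)"
    using ito T by (auto simp: ito_integral_def ito_integrable_def progressively_measurable_def)
  have id: "(\<lambda>\<omega>. \<omega>) \<in> measurable P (F T)"
    using subalgebra_filtration[OF T] by (auto simp: measurable_def subalgebra_def)
  let ?\<Omega> = "space P \<times> {0..T}"
  have \<Omega>: "?\<Omega> \<inter> space (P \<Otimes>\<^sub>M borel) \<in> sets (P \<Otimes>\<^sub>M borel)"
    by (auto simp: space_pair_measure intro!: sets.Int)
  have "(\<lambda>x. (snd x, fst x)) \<in> measurable (restrict_space (P \<Otimes>\<^sub>M borel) ?\<Omega>) (restrict_space borel {0..T} \<Otimes>\<^sub>M F T)"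
  proof (rule measurable_Pair)
    show "snd \<in> measurable (restrict_space (P \<Otimes>\<^sub>M borel) ?\<Omega>) (restrict_space borel {0..T})"
      by (rule measurable_restrict_space3) auto
    have "(\<lambda>x. (\<lambda>\<omega>. \<omega>) (fst x)) \<in> measurable (P \<Otimes>\<^sub>M borel) (F T)"
      by (rule measurable_compose[OF measurable_fst id])
    then show "fst \<in> measurable (restrict_space (P \<Otimes>\<^sub>M borel) ?\<Omega>) (F T)"
      by (intro measurable_restrict_space1) simp
  qed
  from measurable_compose[OF this H]
  have "(\<lambda>x. H (snd x) (fst x)) \<in> borel_measurable (restrict_space (P \<Otimes>\<^sub>M borel) ?\<Omega>)"
    by simp
  then have "(\<lambda>x. indicator ?\<Omega> x *\<^sub>R H (snd x) (fst x)) \<in> borel_measurable (P \<Otimes>\<^sub>M borel)"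
    by (subst (asm) borel_measurable_restrict_space_iff[OF \<Omega>])
  then have "(\<lambda>x. indicator {0..T} (snd x) * H (snd x) (fst x)) \<in> borel_measurable (P \<Otimes>\<^sub>M borel)"
    by (rule measurable_cong[THEN iffD1, rotated]) (auto simp: space_pair_measure indicator_def)
  moreover have "sets (P \<Otimes>\<^sub>M borel) = sets (P \<Otimes>\<^sub>M lborel)"
    by (rule sets_pair_measure_cong) auto
  ultimately show ?thesis
    using measurable_cong_sets[of "P \<Otimes>\<^sub>M borel" "P \<Otimes>\<^sub>M lborel"] by (auto simp: case_prod_beta)
qed

lemma energy_measurable [measurable]:
  assumes "0 \<le> T" shows "energy T \<in> borel_measurable P"
proof -
  note [measurable] = H_joint_measurable[OF assms]
  show ?thesis unfolding energy_def[abs_def]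
    by (intro lborel.borel_measurable_lebesgue_integral) measurable
qed

lemma energy_nonneg: "0 \<le> energy T \<omega>"
  by (simp add: energy_def)

lemma H_path:
  assumes T: "0 \<le> T"
  shows "AE \<omega> in P. square_integrable lborel (\<lambda>r. indicator {0..T} r * H r \<omega>)"
proof -
  have "AE \<omega> in P. set_integrable lborel {0..T} (\<lambda>s. (H s \<omega>)\<^sup>2)"
    using ito T by (auto simp: ito_integral_def ito_integrable_def)
  then show ?thesis
  proof (rule AE_mp, intro AE_I2 impI)
    fix \<omega> assume \<omega>: "\<omega> \<in> space P" and i: "set_integrable lborel {0..T} (\<lambda>s. (H s \<omega>)\<^sup>2)"
    have "(\<lambda>r. indicator {0..T} r * H r \<omega>) \<in> borel_measurable lborel"
      using measurable_compose[OF measurable_Pair1'[OF \<omega>] H_joint_measurable[OF T]] by simp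
    moreover have "(\<lambda>r. (indicator {0..T} r * H r \<omega>)\<^sup>2) = (\<lambda>r. indicator {0..T} r *\<^sub>R (H r \<omega>)\<^sup>2)"
      by (auto simp: fun_eq_iff indicator_def)
    ultimately show "square_integrable lborel (\<lambda>r. indicator {0..T} r * H r \<omega>)"
      using i by (simp add: square_integrable_def set_integrable_def)
  qed
qed

lemma simple_integral_measurable:
  assumes s: "simple_process P F n \<tau> \<phi>" and t: "0 \<le> t"
  shows "simple_integral B n \<tau> \<phi> t \<in> borel_measurable P"
  unfolding simple_integral_def[abs_def]
proof (intro borel_measurable_sum borel_measurable_times borel_measurable_diff B_measurable)
  fix i assume i: "i \<in> {..<n}"
  then have "0 \<le> \<tau> i" "0 \<le> \<tau> (Suc i)" using simple_process_nonneg[OF s] by auto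
  then show "0 \<le> min (\<tau> i) t" "0 \<le> min (\<tau> (Suc i)) t" using t by auto
  show "\<phi> i \<in> borel_measurable P"
    by (rule measurable_F_P[OF \<open>0 \<le> \<tau> i\<close>]) (use s i in \<open>simp add: simple_process_def\<close>)
qed

lemma simple_value_measurable:
  assumes s: "simple_process P F n \<tau> \<phi>"
  shows "(\<lambda>(\<omega>, r). simple_value n \<tau> \<phi> r \<omega>) \<in> borel_measurable (P \<Otimes>\<^sub>M lborel)"
proof -
  have "\<phi> i \<in> borel_measurable P" if "i < n" for i
    by (rule measurable_F_P[of "\<tau> i"]) (use s that simple_process_nonneg[OF s, of i] in \<open>auto simp: simple_process_def\<close>)
  then have [measurable]: "(\<lambda>x. \<phi> i (fst x)) \<in> borel_measurable (P \<Otimes>\<^sub>M lborel)" if "i < n" for i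
    using that by (intro measurable_compose[OF measurable_fst]) auto
  show ?thesis unfolding simple_value_def case_prod_beta by measurable
qed

text \<open>The convergences in probability contained in \<open>ito_integral\<close> become almost
  sure along a subsequence, which depends on \<open>u\<close>, \<open>v\<close> and
  \<open>T\<close>.\<close>

lemma approximating_sequence:
  assumes "0 \<le> u" "u \<le> v" "v \<le> T"
  shows "\<exists>n \<tau> \<phi>. (\<forall>k::nat. simple_process P F (n k) (\<tau> k) (\<phi> k)) \<and>
    (AE \<omega> in P. square_integrable lborel (\<lambda>r. indicator {0..T} r * H r \<omega>) \<and>
       (\<lambda>k. \<integral>r. (indicator {0..T} r * simple_value (n k) (\<tau> k) (\<phi> k) r \<omega> - indicator {0..T} r * H r \<omega>)\<^sup>2 \<partial>lborel) \<longlonglongrightarrow> 0 \<and>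
       (\<lambda>k. simple_integral B (n k) (\<tau> k) (\<phi> k) u \<omega>) \<longlonglongrightarrow> J u \<omega> \<and>
       (\<lambda>k. simple_integral B (n k) (\<tau> k) (\<phi> k) v \<omega>) \<longlonglongrightarrow> J v \<omega>)"
proof -
  have T: "0 \<le> T" "0 \<le> v" using assms by auto
  obtain n \<tau> \<phi> where s: "\<And>k. simple_process P F (n k) (\<tau> k) (\<phi> k)"
    and A: "\<And>t. t \<ge> 0 \<Longrightarrow> tendsto_in_prob P
             (\<lambda>k \<omega>. LINT s:{0..t}|lborel. (simple_value (n k) (\<tau> k) (\<phi> k) s \<omega> - H s \<omega>)\<^sup>2) (\<lambda>_. 0)"
    and C: "\<And>t. t \<ge> 0 \<Longrightarrow> tendsto_in_prob P (\<lambda>k. simple_integral B (n k) (\<tau> k) (\<phi> k) t) (J t)"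
    using ito unfolding ito_integral_def by blast
  define Y where "Y k \<omega> = (\<integral>r. (indicator {0..T} r * simple_value (n k) (\<tau> k) (\<phi> k) r \<omega> - indicator {0..T} r * H r \<omega>)\<^sup>2 \<partial>lborel)" for k \<omega>
  have Y_eq: "Y k \<omega> = (LINT s:{0..T}|lborel. (simple_value (n k) (\<tau> k) (\<phi> k) s \<omega> - H s \<omega>)\<^sup>2)" for k \<omega>
    unfolding Y_def set_lebesgue_integral_def
    by (intro Bochner_Integration.integral_cong refl) (auto simp: indicator_def)
  have m: "Y k \<in> borel_measurable P" for k
  proof -
    note [measurable] = H_joint_measurable[OF T(1)] simple_value_measurable[OF s]
    show ?thesis unfolding Y_def[abs_def]
      by (intro lborel.borel_measurable_lebesgue_integral) measurable
  qed
  have "tendsto_in_prob P Y (\<lambda>_. 0)"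
    using A[OF T(1)] unfolding Y_eq[abs_def] .
  from tendsto_in_prob_AE_subseq3[OF this m borel_measurable_const C[OF assms(1)]
      simple_integral_measurable[OF s assms(1)] J_measurable[OF assms(1)]
      C[OF T(2)] simple_integral_measurable[OF s T(2)] J_measurable[OF T(2)]]
  obtain r where r: "AE x in P. (\<lambda>k. Y (r k) x) \<longlonglongrightarrow> 0 \<and>
       (\<lambda>k. simple_integral B (n (r k)) (\<tau> (r k)) (\<phi> (r k)) u x) \<longlonglongrightarrow> J u x \<and>
       (\<lambda>k. simple_integral B (n (r k)) (\<tau> (r k)) (\<phi> (r k)) v x) \<longlonglongrightarrow> J v x" by blast
  have "AE \<omega> in P. square_integrable lborel (\<lambda>r. indicator {0..T} r * H r \<omega>) \<and>
       (\<lambda>k. \<integral>s. (indicator {0..T} s * simple_value (n (r k)) (\<tau> (r k)) (\<phi> (r k)) s \<omega> - indicator {0..T} s * H s \<omega>)\<^sup>2 \<partial>lborel) \<longlonglongrightarrow> 0 \<and>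
       (\<lambda>k. simple_integral B (n (r k)) (\<tau> (r k)) (\<phi> (r k)) u \<omega>) \<longlonglongrightarrow> J u \<omega> \<and>
       (\<lambda>k. simple_integral B (n (r k)) (\<tau> (r k)) (\<phi> (r k)) v \<omega>) \<longlonglongrightarrow> J v \<omega>"
    using r H_path[OF T(1)] by eventually_elim (simp add: Y_def)
  with s show ?thesis
    by (intro exI[of _ "\<lambda>k. n (r k)"] exI[of _ "\<lambda>k. \<tau> (r k)"] exI[of _ "\<lambda>k. \<phi> (r k)"]) simp
qed

end

lemma square_integrable_simple_value:
  assumes s: "simple_process P F n \<tau> \<phi>" and T: "0 \<le> T"
  shows "square_integrable lborel (\<lambda>r. indicator {0..T} r * simple_value n \<tau> \<phi> r \<omega>)"
    and "(\<integral>r. (indicator {0..T} r * simple_value n \<tau> \<phi> r \<omega>)\<^sup>2 \<partial>lborel) = step_energy T \<tau> \<phi> n \<omega>"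
proof -
  \<comment> \<open>Left-open intervals with non-negative end points miss time 0. This reconciles
    the closed interval \<open>{0..T}\<close> used here with \<open>{0<..T}\<close> in
    \<open>simple_value_energy\<close>.\<close>
  have "simple_value n \<tau> \<phi> 0 \<omega> = 0"
    unfolding simple_value_def
  proof (intro sum.neutral ballI)
    fix i assume "i \<in> {..<n}"
    then have "0 \<le> \<tau> i" using simple_process_nonneg[OF s, of i] by auto
    then show "\<phi> i \<omega> * indicator {\<tau> i<..\<tau> (Suc i)} 0 = 0" by simp
  qed
  then have eq: "(indicator {0..T} r * simple_value n \<tau> \<phi> r \<omega>)\<^sup>2 = indicator {0<..T} r * (simple_value n \<tau> \<phi> r \<omega>)\<^sup>2" for r
    by (cases "r = 0") (auto simp: indicator_def)
  show "square_integrable lborel (\<lambda>r. indicator {0..T} r * simple_value n \<tau> \<phi> r \<omega>)"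
  proof (rule square_integrableI)
    show "(\<lambda>r. indicator {0..T} r * simple_value n \<tau> \<phi> r \<omega>) \<in> borel_measurable lborel"
      unfolding simple_value_def by measurable
  qed (use simple_value_energy(1)[OF s T] in \<open>simp only: eq\<close>)
  show "(\<integral>r. (indicator {0..T} r * simple_value n \<tau> \<phi> r \<omega>)\<^sup>2 \<partial>lborel) = step_energy T \<tau> \<phi> n \<omega>"
    using simple_value_energy(2)[OF s T] by (simp only: eq)
qed

lemma square_diff_le: "(x - y)\<^sup>2 \<le> 2 * x\<^sup>2 + 2 * (y::real)\<^sup>2"
proof -
  have "0 \<le> (x + y)\<^sup>2" by simp
  then show ?thesis by (simp add: power2_eq_square algebra_simps)
qed

lemma integral_square_diff_le:
  assumes "square_integrable M f" "square_integrable M g"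
  shows "(\<integral>x. (f x - g x)\<^sup>2 \<partial>M) \<le> 2 * (\<integral>x. (f x)\<^sup>2 \<partial>M) + 2 * (\<integral>x. (g x)\<^sup>2 \<partial>M)"
proof -
  have "(\<integral>x. (f x - g x)\<^sup>2 \<partial>M) \<le> (\<integral>x. 2 * (f x)\<^sup>2 + 2 * (g x)\<^sup>2 \<partial>M)"
    using assms
    by (intro integral_mono square_diff_le square_integrableD(2)[OF square_integrable_diff])
       (auto simp: square_integrable_def)
  then show ?thesis using assms by (simp add: square_integrable_def)
qed

definition pieces_value :: "'i set \<Rightarrow> ('i \<Rightarrow> 'a \<Rightarrow> real) \<Rightarrow> ('i \<Rightarrow> real) \<Rightarrow> ('i \<Rightarrow> real) \<Rightarrow> real \<Rightarrow> 'a \<Rightarrow> real" where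
  "pieces_value I \<psi> c d r \<omega> = (\<Sum>i\<in>I. \<psi> i \<omega> * indicator {c i<..d i} r)"

definition pieces_integral ::
    "(real \<Rightarrow> 'a \<Rightarrow> real) \<Rightarrow> 'i set \<Rightarrow> ('i \<Rightarrow> 'a \<Rightarrow> real) \<Rightarrow> ('i \<Rightarrow> real) \<Rightarrow> ('i \<Rightarrow> real) \<Rightarrow> 'a \<Rightarrow> real" where
  "pieces_integral B I \<psi> c d \<omega> = (\<Sum>i\<in>I. \<psi> i \<omega> * (B (d i) \<omega> - B (c i) \<omega>))"

lemma square_integrable_pieces_value:
  assumes "finite I"
  shows "square_integrable lborel (\<lambda>r. pieces_value I \<psi> c d r \<omega>)"
proof (rule square_integrableI)
  show "(\<lambda>r. pieces_value I \<psi> c d r \<omega>) \<in> borel_measurable lborel"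
    unfolding pieces_value_def by measurable
  show "integrable lborel (\<lambda>r. (pieces_value I \<psi> c d r \<omega>)\<^sup>2)"
    unfolding pieces_value_def by (rule pieces_square_integral(1)[OF assms])
qed

lemma square_integrable_indicator:
  assumes "square_integrable lborel f"
  shows "square_integrable lborel (\<lambda>r. indicator {u<..v::real} r * f r)"
  by (rule square_integrable_bounded_mult[OF assms, where C=1]) (auto simp: indicator_def)

lemma integral_indicator_square_le:
  assumes "square_integrable lborel f"
  shows "(\<integral>r. (indicator {u<..v::real} r * f r)\<^sup>2 \<partial>lborel) \<le> (\<integral>r. (f r)\<^sup>2 \<partial>lborel)"
  by (intro integral_mono square_integrableD(2)[OF square_integrable_indicator[OF assms]] square_integrableD(2)[OF assms])
     (auto simp: indicator_def)

context brownian_space begin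

lemma square_integrable_pieces_integral:
  assumes "\<And>i. i \<in> I \<Longrightarrow> piece (\<psi> i) (c i) (d i)"
  shows "square_integrable P (pieces_integral B I \<psi> c d)"
  unfolding pieces_integral_def[abs_def] by (intro square_integrable_sum piece_increment assms)

lemma pieces_value_measurable:
  assumes "\<And>i. i \<in> I \<Longrightarrow> piece (\<psi> i) (c i) (d i)"
  shows "(\<lambda>(\<omega>, r). pieces_value I \<psi> c d r \<omega>) \<in> borel_measurable (P \<Otimes>\<^sub>M lborel)"
proof -
  have [measurable]: "(\<lambda>x. \<psi> i (fst x)) \<in> borel_measurable (P \<Otimes>\<^sub>M lborel)" if "i \<in> I" for i
    using assms[OF that] by (intro measurable_compose[OF measurable_fst]) (auto simp: piece_def square_integrable_def)
  show ?thesis unfolding pieces_value_def case_prod_beta by measurable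
qed

text \<open>The clipped steps and the pieces with reversed sign are put into one family, indexed by
  the disjoint union \<open>{..<n} <+> I\<close>; the difference is then itself a sum of pieces and
  \<open>pieces_isometry\<close> applies.\<close>

lemma simple_minus_pieces_isometry:
  fixes I :: "'i set"
  assumes s: "simple_process P F n \<tau> \<phi>" and uv: "0 \<le> u" "u \<le> v" and I: "finite I"
    and p: "\<And>i. i \<in> I \<Longrightarrow> piece (\<psi> i) (c i) (d i)"
  defines "DD \<equiv> \<lambda>\<omega>. \<integral>r. (indicator {u<..v} r * simple_value n \<tau> \<phi> r \<omega> - pieces_value I \<psi> c d r \<omega>)\<^sup>2 \<partial>lborel"
    and "N \<equiv> \<lambda>\<omega>. simple_integral B n \<tau> \<phi> v \<omega> - simple_integral B n \<tau> \<phi> u \<omega> - pieces_integral B I \<psi> c d \<omega>"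
  shows "integrable P DD" "square_integrable P N" "(\<integral>\<omega>. (N \<omega>)\<^sup>2 \<partial>P) = (\<integral>\<omega>. DD \<omega> \<partial>P)"
proof -
  define K where "K = {..<n} <+> I"
  define \<theta> where "\<theta> = case_sum \<phi> (\<lambda>i \<omega>. - \<psi> i \<omega>)"
  define a where "a = case_sum (\<lambda>i. max u (min (\<tau> i) v)) c"
  define b where "b = case_sum (\<lambda>i. max u (min (\<tau> (Suc i)) v)) d"
  have K: "finite K" using I by (simp add: K_def)
  have q: "piece (\<theta> k) (a k) (b k)" if k: "k \<in> K" for k
  proof (cases k)
    case (Inl i)
    then show ?thesis using k simple_process_piece[OF s _ uv] by (auto simp: K_def \<theta>_def a_def b_def)
  next
    case (Inr i)
    then have "i \<in> I" using k by (auto simp: K_def)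
    then show ?thesis using p[of i] square_integrable_cmult[of P "\<psi> i" "-1"] Inr
      by (simp add: piece_def \<theta>_def a_def b_def)
  qed
  have N_eq: "N \<omega> = (\<Sum>k\<in>K. \<theta> k \<omega> * (B (b k) \<omega> - B (a k) \<omega>))" for \<omega>
    unfolding N_def K_def simple_integral_increment[OF s uv] pieces_integral_def
    by (simp add: sum.Plus I \<theta>_def a_def b_def sum_negf)
  have "indicator {u<..v} r * simple_value n \<tau> \<phi> r \<omega> - pieces_value I \<psi> c d r \<omega> =
      (\<Sum>k\<in>K. \<theta> k \<omega> * indicator {a k<..b k} r)" for r \<omega>
    unfolding K_def simple_value_clip[OF uv] pieces_value_def
    by (simp add: sum.Plus I \<theta>_def a_def b_def sum_negf del: sum_mult_indicator)
  then have D_eq: "DD = (\<lambda>\<omega>. \<integral>r. (\<Sum>k\<in>K. \<theta> k \<omega> * indicator {a k<..b k} r)\<^sup>2 \<partial>lborel)"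
    by (simp add: DD_def)
  show "integrable P DD" unfolding D_eq by (rule pieces_isometry(1)[OF K q])
  show "square_integrable P N" unfolding N_eq[abs_def] by (intro square_integrable_sum piece_increment q)
  show "(\<integral>\<omega>. (N \<omega>)\<^sup>2 \<partial>P) = (\<integral>\<omega>. DD \<omega> \<partial>P)" unfolding D_eq N_eq by (rule pieces_isometry(2)[OF K q])
qed

end

context ito_process begin

text \<open>The pathwise side of the isometry for \<open>J v - J u\<close> minus a sum of pieces.
  Without pieces it is the energy on \<open>{u<..v}\<close>; with the single coefficient
  \<open>H u\<close> it measures the error of freezing the integrand at time
  \<open>u\<close>.\<close>

definition residual :: "real \<Rightarrow> real \<Rightarrow> 'i set \<Rightarrow> ('i \<Rightarrow> 'a \<Rightarrow> real) \<Rightarrow> ('i \<Rightarrow> real) \<Rightarrow> ('i \<Rightarrow> real) \<Rightarrow> 'a \<Rightarrow> real" where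
  "residual u v I \<psi> c d \<omega> = (\<integral>r. (indicator {u<..v} r * H r \<omega> - pieces_value I \<psi> c d r \<omega>)\<^sup>2 \<partial>lborel)"

lemma residual_eq:
  assumes "0 \<le> u" "u \<le> v" "v \<le> T"
  shows "residual u v I \<psi> c d \<omega> =
    (\<integral>r. (indicator {u<..v} r * (indicator {0..T} r * H r \<omega>) - pieces_value I \<psi> c d r \<omega>)\<^sup>2 \<partial>lborel)"
  unfolding residual_def using assms
  by (intro Bochner_Integration.integral_cong refl) (auto simp: indicator_def)

lemma residual_measurable:
  assumes uv: "0 \<le> u" "u \<le> v" and p: "\<And>i. i \<in> I \<Longrightarrow> piece (\<psi> i) (c i) (d i)"
  shows "residual u v I \<psi> c d \<in> borel_measurable P"
proof -
  have "0 \<le> v" using uv by simp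
  note [measurable] = H_joint_measurable[OF this] pieces_value_measurable[OF p]
  show ?thesis unfolding residual_eq[OF uv order_refl, abs_def]
    by (intro lborel.borel_measurable_lebesgue_integral) measurable
qed

text \<open>Convergence in mean square along the path carries the step energies to
  \<open>energy T \<omega>\<close>. Because this limit lies strictly below \<open>R\<close>, the
  step energies are eventually below \<open>R\<close> too, and the cutoff changes nothing.\<close>

lemma cutoff_eventually_inactive:
  assumes s: "\<And>k::nat. simple_process P F (n k) (\<tau> k) (\<phi> k)" and T: "0 \<le> T"
    and H: "square_integrable lborel (\<lambda>r. indicator {0..T} r * H r \<omega>)"
    and L2: "(\<lambda>k. \<integral>r. (indicator {0..T} r * simple_value (n k) (\<tau> k) (\<phi> k) r \<omega> - indicator {0..T} r * H r \<omega>)\<^sup>2 \<partial>lborel) \<longlonglongrightarrow> 0"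
    and R: "energy T \<omega> < R"
  shows "\<forall>\<^sub>F k in sequentially.
    (\<forall>r. simple_value (n k) (\<tau> k) (energy_cutoff T R (\<tau> k) (\<phi> k)) r \<omega> = simple_value (n k) (\<tau> k) (\<phi> k) r \<omega>) \<and>
    (\<forall>t. simple_integral B (n k) (\<tau> k) (energy_cutoff T R (\<tau> k) (\<phi> k)) t \<omega> = simple_integral B (n k) (\<tau> k) (\<phi> k) t \<omega>)"
proof -
  note sq = square_integrable_simple_value[OF s T, of _ \<omega>]
  have "(\<lambda>k. step_energy T (\<tau> k) (\<phi> k) (n k) \<omega>) \<longlonglongrightarrow> energy T \<omega>"
    using integral_square_tendsto[OF H sq(1) L2] unfolding sq(2) energy_def .
  then have "\<forall>\<^sub>F k in sequentially. step_energy T (\<tau> k) (\<phi> k) (n k) \<omega> < R"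
    using R by (rule order_tendstoD)
  then show ?thesis
  proof eventually_elim
    case (elim k)
    then have "energy_cutoff T R (\<tau> k) (\<phi> k) i \<omega> = \<phi> k i \<omega>" if "i < n k" for i
      using energy_cutoff_inactive[OF s _ that] by simp
    then show ?case
      unfolding simple_value_def simple_integral_def by (intro conjI allI sum.cong refl) simp_all
  qed
qed

text \<open>The isometry is exact for the cut-off simple processes. Where the energy is below
  \<open>R\<close> both sides converge to the untruncated expressions; elsewhere only the bound
  \<open>2 * R + 2 * \<Sigma>\<close> is available, whence the two cases of \<open>G\<close>. Fatou
  is applied on the left, so an inequality is what survives, and it suffices.\<close>

lemma truncated_Ito_inequality:
  fixes I :: "'i set"
  assumes uv: "0 \<le> u" "u \<le> v" "v \<le> T" and I: "finite I"
    and p: "\<And>i. i \<in> I \<Longrightarrow> piece (\<psi> i) (c i) (d i)" and R: "0 \<le> R"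
  defines "N \<equiv> \<lambda>\<omega>. (J v \<omega> - J u \<omega> - pieces_integral B I \<psi> c d \<omega>)\<^sup>2 * indicator {..<R} (energy T \<omega>)"
    and "G \<equiv> \<lambda>\<omega>. if energy T \<omega> < R then residual u v I \<psi> c d \<omega>
      else 2 * R + 2 * (\<integral>r. (pieces_value I \<psi> c d r \<omega>)\<^sup>2 \<partial>lborel)"
  shows "integrable P N" "(\<integral>\<omega>. N \<omega> \<partial>P) \<le> (\<integral>\<omega>. G \<omega> \<partial>P)"
proof -
  have T: "0 \<le> T" "0 \<le> v" using uv by auto
  define \<Sigma> where "\<Sigma> \<omega> = (\<integral>r. (pieces_value I \<psi> c d r \<omega>)\<^sup>2 \<partial>lborel)" for \<omega>
  have \<Sigma>: "integrable P \<Sigma>"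
    unfolding \<Sigma>_def[abs_def] pieces_value_def by (rule pieces_isometry(1)[OF I p])
  obtain n \<tau> \<phi> where s: "\<And>k::nat. simple_process P F (n k) (\<tau> k) (\<phi> k)"
    and good: "AE \<omega> in P. square_integrable lborel (\<lambda>r. indicator {0..T} r * H r \<omega>) \<and>
       (\<lambda>k. \<integral>r. (indicator {0..T} r * simple_value (n k) (\<tau> k) (\<phi> k) r \<omega> - indicator {0..T} r * H r \<omega>)\<^sup>2 \<partial>lborel) \<longlonglongrightarrow> 0 \<and>
       (\<lambda>k. simple_integral B (n k) (\<tau> k) (\<phi> k) u \<omega>) \<longlonglongrightarrow> J u \<omega> \<and>
       (\<lambda>k. simple_integral B (n k) (\<tau> k) (\<phi> k) v \<omega>) \<longlonglongrightarrow> J v \<omega>"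
    using approximating_sequence[OF uv] by blast
  define \<theta> where "\<theta> k = energy_cutoff T R (\<tau> k) (\<phi> k)" for k
  have s': "simple_process P F (n k) (\<tau> k) (\<theta> k)" for k
    unfolding \<theta>_def by (rule simple_process_energy_cutoff[OF s])
  define DD where "DD k \<omega> = (\<integral>r. (indicator {u<..v} r * simple_value (n k) (\<tau> k) (\<theta> k) r \<omega> - pieces_value I \<psi> c d r \<omega>)\<^sup>2 \<partial>lborel)" for k \<omega>
  define NN where "NN k \<omega> = (simple_integral B (n k) (\<tau> k) (\<theta> k) v \<omega> - simple_integral B (n k) (\<tau> k) (\<theta> k) u \<omega> - pieces_integral B I \<psi> c d \<omega>)\<^sup>2" for k \<omega>
  have iso: "integrable P (DD k)"
    "square_integrable P (\<lambda>\<omega>. simple_integral B (n k) (\<tau> k) (\<theta> k) v \<omega> - simple_integral B (n k) (\<tau> k) (\<theta> k) u \<omega> - pieces_integral B I \<psi> c d \<omega>)"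
    "(\<integral>\<omega>. NN k \<omega> \<partial>P) = (\<integral>\<omega>. DD k \<omega> \<partial>P)" for k
    unfolding DD_def NN_def by (rule simple_minus_pieces_isometry[OF s' uv(1,2) I p]; assumption)+
  have ind: "indicator {u<..v} r * (indicator {0..T} r * x) = indicator {u<..v} r * x" for r x :: real
    using uv by (auto simp: indicator_def)
  have DD_le: "DD k \<omega> \<le> 2 * R + 2 * \<Sigma> \<omega>" for k \<omega>
  proof -
    note sq = square_integrable_simple_value[OF s' T(1), of k \<omega>]
    have "DD k \<omega> \<le> 2 * (\<integral>r. (indicator {u<..v} r * (indicator {0..T} r * simple_value (n k) (\<tau> k) (\<theta> k) r \<omega>))\<^sup>2 \<partial>lborel) + 2 * \<Sigma> \<omega>"
      unfolding DD_def \<Sigma>_def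
      using integral_square_diff_le[OF square_integrable_indicator[OF sq(1), of u v] square_integrable_pieces_value[OF I, of \<psi> c d \<omega>]]
      by (simp only: ind)
    also have "(\<integral>r. (indicator {u<..v} r * (indicator {0..T} r * simple_value (n k) (\<tau> k) (\<theta> k) r \<omega>))\<^sup>2 \<partial>lborel) \<le> step_energy T (\<tau> k) (\<theta> k) (n k) \<omega>"
      using integral_indicator_square_le[OF sq(1)] sq(2) by simp
    also have "\<dots> \<le> R" unfolding \<theta>_def by (rule step_energy_cutoff_le[OF s R order_refl])
    finally show ?thesis by simp
  qed
  \<comment> \<open>On the event of high energy, where \<open>DD k\<close> need not converge, it is
    replaced by its bound. The result dominates \<open>DD k\<close> and converges everywhere that
    matters, with an integrable majorant.\<close>
  define GG where "GG k \<omega> = (if energy T \<omega> < R then DD k \<omega> else 2 * R + 2 * \<Sigma> \<omega>)" for k \<omega>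
  note [measurable] = energy_measurable[OF T(1)] residual_measurable[OF uv(1,2) p] borel_measurable_integrable[OF \<Sigma>]
    borel_measurable_integrable[OF iso(1)]
  have conv: "(energy T \<omega> < R \<longrightarrow> (\<lambda>k. DD k \<omega>) \<longlonglongrightarrow> residual u v I \<psi> c d \<omega> \<and>
       (\<lambda>k. NN k \<omega>) \<longlonglongrightarrow> (J v \<omega> - J u \<omega> - pieces_integral B I \<psi> c d \<omega>)\<^sup>2)"
    if H: "square_integrable lborel (\<lambda>r. indicator {0..T} r * H r \<omega>)"
      and L2: "(\<lambda>k. \<integral>r. (indicator {0..T} r * simple_value (n k) (\<tau> k) (\<phi> k) r \<omega> - indicator {0..T} r * H r \<omega>)\<^sup>2 \<partial>lborel) \<longlonglongrightarrow> 0"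
      and Ju: "(\<lambda>k. simple_integral B (n k) (\<tau> k) (\<phi> k) u \<omega>) \<longlonglongrightarrow> J u \<omega>"
      and Jv: "(\<lambda>k. simple_integral B (n k) (\<tau> k) (\<phi> k) v \<omega>) \<longlonglongrightarrow> J v \<omega>"
    for \<omega>
  proof
    assume R: "energy T \<omega> < R"
    note sq = square_integrable_simple_value[OF s T(1), of _ \<omega>]
    note ev = cutoff_eventually_inactive[OF s T(1) H L2 R, folded \<theta>_def]
    define g where "g k r = indicator {u<..v} r * (indicator {0..T} r * simple_value (n k) (\<tau> k) (\<phi> k) r \<omega>) - pieces_value I \<psi> c d r \<omega>" for k r
    define f where "f r = indicator {u<..v} r * (indicator {0..T} r * H r \<omega>) - pieces_value I \<psi> c d r \<omega>" for r
    have gi: "square_integrable lborel (g k)" for k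
      unfolding g_def[abs_def] by (intro square_integrable_diff square_integrable_indicator sq square_integrable_pieces_value I)
    have fi: "square_integrable lborel f"
      unfolding f_def[abs_def] by (intro square_integrable_diff square_integrable_indicator H square_integrable_pieces_value I)
    have gf: "g k r - f r = indicator {u<..v} r * (indicator {0..T} r * simple_value (n k) (\<tau> k) (\<phi> k) r \<omega> - indicator {0..T} r * H r \<omega>)" for k r
      by (simp add: g_def f_def algebra_simps)
    have "(\<lambda>k. \<integral>r. (g k r - f r)\<^sup>2 \<partial>lborel) \<longlonglongrightarrow> 0"
      unfolding gf
      by (rule tendsto_sandwich[OF _ _ tendsto_const L2]; intro always_eventually allI integral_indicator_square_le
          square_integrable_diff sq H Bochner_Integration.integral_nonneg) simp
    from integral_square_tendsto[OF fi gi this]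
    have "(\<lambda>k. \<integral>r. (g k r)\<^sup>2 \<partial>lborel) \<longlonglongrightarrow> residual u v I \<psi> c d \<omega>"
      unfolding residual_eq[OF uv] f_def .
    moreover have "\<forall>\<^sub>F k in sequentially. (\<integral>r. (g k r)\<^sup>2 \<partial>lborel) = DD k \<omega>"
      using ev by eventually_elim (simp add: DD_def g_def ind)
    ultimately have 1: "(\<lambda>k. DD k \<omega>) \<longlonglongrightarrow> residual u v I \<psi> c d \<omega>"
      by (rule Lim_transform_eventually)
    have "(\<lambda>k. (simple_integral B (n k) (\<tau> k) (\<phi> k) v \<omega> - simple_integral B (n k) (\<tau> k) (\<phi> k) u \<omega> - pieces_integral B I \<psi> c d \<omega>)\<^sup>2)
      \<longlonglongrightarrow> (J v \<omega> - J u \<omega> - pieces_integral B I \<psi> c d \<omega>)\<^sup>2"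
      by (intro tendsto_intros Ju Jv)
    moreover have "\<forall>\<^sub>F k in sequentially. (simple_integral B (n k) (\<tau> k) (\<phi> k) v \<omega> - simple_integral B (n k) (\<tau> k) (\<phi> k) u \<omega> - pieces_integral B I \<psi> c d \<omega>)\<^sup>2 = NN k \<omega>"
      using ev by eventually_elim (simp add: NN_def)
    ultimately have 2: "(\<lambda>k. NN k \<omega>) \<longlonglongrightarrow> (J v \<omega> - J u \<omega> - pieces_integral B I \<psi> c d \<omega>)\<^sup>2"
      by (rule Lim_transform_eventually)
    show "(\<lambda>k. DD k \<omega>) \<longlonglongrightarrow> residual u v I \<psi> c d \<omega> \<and>
       (\<lambda>k. NN k \<omega>) \<longlonglongrightarrow> (J v \<omega> - J u \<omega> - pieces_integral B I \<psi> c d \<omega>)\<^sup>2"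
      using 1 2 by blast
  qed
  have DD_nonneg: "0 \<le> DD k \<omega>" for k \<omega> by (simp add: DD_def)
  have \<Sigma>_nonneg: "0 \<le> \<Sigma> \<omega>" for \<omega> by (simp add: \<Sigma>_def)
  have G_eq: "G = (\<lambda>\<omega>. if energy T \<omega> < R then residual u v I \<psi> c d \<omega> else 2 * R + 2 * \<Sigma> \<omega>)"
    unfolding G_def \<Sigma>_def ..
  have GG_lim: "(\<lambda>k. \<integral>\<omega>. GG k \<omega> \<partial>P) \<longlonglongrightarrow> (\<integral>\<omega>. G \<omega> \<partial>P)"
  proof (rule integral_dominated_convergence[where w = "\<lambda>\<omega>. 2 * R + 2 * \<Sigma> \<omega>"])
    show "G \<in> borel_measurable P" unfolding G_eq by measurable
    show "GG k \<in> borel_measurable P" for k unfolding GG_def[abs_def] by measurable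
    show "integrable P (\<lambda>\<omega>. 2 * R + 2 * \<Sigma> \<omega>)" using \<Sigma> by simp
    show "AE \<omega> in P. (\<lambda>k. GG k \<omega>) \<longlonglongrightarrow> G \<omega>"
      using good by eventually_elim (use conv in \<open>auto simp: GG_def G_eq\<close>)
    show "AE \<omega> in P. norm (GG k \<omega>) \<le> 2 * R + 2 * \<Sigma> \<omega>" for k
      using DD_le[of k] DD_nonneg[of k] \<Sigma>_nonneg R by (auto simp: GG_def)
  qed
  have N0: "N \<in> borel_measurable P"
  proof -
    note [measurable] = J_measurable[OF uv(1)] J_measurable[OF T(2)] square_integrableD(1)[OF square_integrable_pieces_integral[OF p]]
    show ?thesis unfolding N_def by measurable
  qed
  have GG_int: "integrable P (GG k)" for k
  proof (rule Bochner_Integration.integrable_bound[where f = "\<lambda>\<omega>. 2 * R + 2 * \<Sigma> \<omega>"])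
    show "integrable P (\<lambda>\<omega>. 2 * R + 2 * \<Sigma> \<omega>)" using \<Sigma> by simp
    show "GG k \<in> borel_measurable P" unfolding GG_def[abs_def] by measurable
    show "AE \<omega> in P. norm (GG k \<omega>) \<le> norm (2 * R + 2 * \<Sigma> \<omega>)"
      using DD_le[of k] DD_nonneg[of k] \<Sigma>_nonneg R by (auto simp: GG_def)
  qed
  have NN_int: "integrable P (NN k)" for k
    unfolding NN_def[abs_def] by (rule square_integrableD(2)[OF iso(2)])
  have NN_le: "(\<integral>\<omega>. NN k \<omega> \<partial>P) \<le> (\<integral>\<omega>. GG k \<omega> \<partial>P)" for k
  proof -
    have "(\<integral>\<omega>. NN k \<omega> \<partial>P) = (\<integral>\<omega>. DD k \<omega> \<partial>P)"
      by (rule iso(3))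
    also have "\<dots> \<le> (\<integral>\<omega>. GG k \<omega> \<partial>P)"
      by (rule integral_mono[OF iso(1) GG_int]) (use DD_le in \<open>auto simp: GG_def\<close>)
    finally show ?thesis .
  qed
  have lim: "AE \<omega> in P. N \<omega> = 0 \<or> (\<lambda>k. NN k \<omega>) \<longlonglongrightarrow> N \<omega>"
    using good
  proof eventually_elim
    case (elim \<omega>)
    then show ?case using conv[of \<omega>] by (cases "energy T \<omega> < R") (auto simp: N_def)
  qed
  have Npos: "0 \<le> N \<omega>" "0 \<le> NN k \<omega>" for k \<omega> by (auto simp: N_def NN_def)
  show "integrable P N" "(\<integral>\<omega>. N \<omega> \<partial>P) \<le> (\<integral>\<omega>. G \<omega> \<partial>P)"
    using Fatou_real[OF N0 Npos(1) NN_int Npos(2) lim NN_le GG_lim] by auto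
qed

end

section \<open>Removing the truncation: second moments and mean zero of the stochastic
  integral\<close>

context ito_process begin

text \<open>\<open>ito_integral\<close> does not prescribe the initial value; it follows because
  every approximating simple integral is 0 at time 0.\<close>

lemma J_0: "AE \<omega> in P. J 0 \<omega> = 0"
proof -
  obtain n \<tau> \<phi> where s: "\<And>k::nat. simple_process P F (n k) (\<tau> k) (\<phi> k)"
    and lim: "AE \<omega> in P. (\<lambda>k. simple_integral B (n k) (\<tau> k) (\<phi> k) 0 \<omega>) \<longlonglongrightarrow> J 0 \<omega>"
    using approximating_sequence[of 0 0 0] by (auto elim: eventually_mono)
  have "simple_integral B (n k) (\<tau> k) (\<phi> k) 0 \<omega> = 0" for k \<omega>
    unfolding simple_integral_def
  proof (intro sum.neutral ballI)
    fix i assume "i \<in> {..<n k}"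
    then have "0 \<le> \<tau> k i" "0 \<le> \<tau> k (Suc i)" using simple_process_nonneg[OF s] by auto
    then show "\<phi> k i \<omega> * (B (min (\<tau> k (Suc i)) 0) \<omega> - B (min (\<tau> k i) 0) \<omega>) = 0" by (simp add: min_def)
  qed
  with lim show ?thesis
    by (elim eventually_mono) (simp add: LIMSEQ_const_iff)
qed

lemma residual_empty_le:
  assumes "0 \<le> t" "square_integrable lborel (\<lambda>r. indicator {0..t} r * H r \<omega>)"
  shows "residual 0 t {} \<psi> c d \<omega> \<le> energy t \<omega>"
  unfolding residual_eq[OF order_refl assms(1) order_refl] energy_def pieces_value_def
  using integral_indicator_square_le[OF assms(2)] by simp

text \<open>The truncated inequality with no pieces. The factor 2 stems from the crude value
  \<open>2 * R\<close> on the event where the energy reaches \<open>R\<close>; a bound by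
  \<open>min (energy t \<omega>) R\<close> is what the Gronwall loop can absorb.\<close>

lemma J_square_truncated:
  assumes t: "0 \<le> t" and R: "0 \<le> R"
  shows "integrable P (\<lambda>\<omega>. (J t \<omega>)\<^sup>2 * indicator {..<R} (energy t \<omega>))"
    and "(\<integral>\<omega>. (J t \<omega>)\<^sup>2 * indicator {..<R} (energy t \<omega>) \<partial>P) \<le> 2 * (\<integral>\<omega>. min (energy t \<omega>) R \<partial>P)"
proof -
  define G where "G \<omega> = (if energy t \<omega> < R then energy t \<omega> else 2 * R)" for \<omega>
  note [measurable] = energy_measurable[OF t] J_measurable[OF t] J_measurable[OF order_refl]
  note * = truncated_Ito_inequality[OF order_refl t order_refl finite.emptyI _ R, of "undefined::nat \<Rightarrow> 'a \<Rightarrow> real" undefined undefined,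
      unfolded pieces_integral_def pieces_value_def, simplified]
  have G: "integrable P G" unfolding G_def[abs_def]
    by (rule integrable_const_bound[where B = "2 * R"]) (use R energy_nonneg[of t] in \<open>auto\<close>)
  have eq: "AE \<omega> in P. (J t \<omega> - J 0 \<omega>)\<^sup>2 * indicator {..<R} (energy t \<omega>) = (J t \<omega>)\<^sup>2 * indicator {..<R} (energy t \<omega>)"
    using J_0 by eventually_elim simp
  show "integrable P (\<lambda>\<omega>. (J t \<omega>)\<^sup>2 * indicator {..<R} (energy t \<omega>))"
    by (rule integrable_cong_AE[THEN iffD1, OF _ _ eq *(1)]) measurable
  have "(\<integral>\<omega>. (J t \<omega>)\<^sup>2 * indicator {..<R} (energy t \<omega>) \<partial>P) = (\<integral>\<omega>. (J t \<omega> - J 0 \<omega>)\<^sup>2 * indicator {..<R} (energy t \<omega>) \<partial>P)"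
    by (rule integral_cong_AE[symmetric, OF _ _ eq]) measurable
  also have "\<dots> \<le> (\<integral>\<omega>. (if energy t \<omega> < R then residual 0 t {} (undefined::nat \<Rightarrow> 'a \<Rightarrow> real) undefined undefined \<omega> else 2 * R) \<partial>P)"
    using *(2) by (simp cong: if_cong)
  also have "\<dots> \<le> (\<integral>\<omega>. G \<omega> \<partial>P)"
  proof (rule integral_mono_AE'[OF G])
    show "AE \<omega> in P. (if energy t \<omega> < R then residual 0 t {} (undefined::nat \<Rightarrow> 'a \<Rightarrow> real) undefined undefined \<omega> else 2 * R) \<le> G \<omega>"
      using H_path[OF t] by eventually_elim (auto simp: G_def intro: residual_empty_le[OF t])
  qed (use R energy_nonneg[of t] in \<open>auto simp: G_def\<close>)
  also have "\<dots> \<le> (\<integral>\<omega>. 2 * min (energy t \<omega>) R \<partial>P)"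
  proof (rule integral_mono)
    show "integrable P G" by (rule G)
    show "integrable P (\<lambda>\<omega>. 2 * min (energy t \<omega>) R)"
      by (rule integrable_const_bound[where B = "2 * R"]) (use R energy_nonneg[of t] in \<open>auto simp: abs_of_nonneg\<close>)
    show "G \<omega> \<le> 2 * min (energy t \<omega>) R" for \<omega> using energy_nonneg[of t \<omega>] R by (auto simp: G_def)
  qed
  finally show "(\<integral>\<omega>. (J t \<omega>)\<^sup>2 * indicator {..<R} (energy t \<omega>) \<partial>P) \<le> 2 * (\<integral>\<omega>. min (energy t \<omega>) R \<partial>P)"
    by simp
qed

lemma residual_le:
  assumes uv: "0 \<le> u" "u \<le> v" "v \<le> T" and I: "finite I"
    and H: "square_integrable lborel (\<lambda>r. indicator {0..T} r * H r \<omega>)"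
  shows "residual u v I \<psi> c d \<omega> \<le> 2 * energy T \<omega> + 2 * (\<integral>r. (pieces_value I \<psi> c d r \<omega>)\<^sup>2 \<partial>lborel)"
  unfolding residual_eq[OF uv]
  using integral_square_diff_le[OF square_integrable_indicator[OF H, of u v] square_integrable_pieces_value[OF I, of \<psi> c d \<omega>]]
    integral_indicator_square_le[OF H, of u v] unfolding energy_def by linarith

lemma residual_nonneg: "0 \<le> residual u v I \<psi> c d \<omega>"
  by (simp add: residual_def)

lemma residual_integrable:
  assumes uv: "0 \<le> u" "u \<le> v" "v \<le> T" and E: "integrable P (energy T)" and I: "finite I"
    and p: "\<And>i. i \<in> I \<Longrightarrow> piece (\<psi> i) (c i) (d i)"
  shows "integrable P (residual u v I \<psi> c d)"
proof (rule Bochner_Integration.integrable_bound)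
  have "integrable P (\<lambda>\<omega>. \<integral>r. (pieces_value I \<psi> c d r \<omega>)\<^sup>2 \<partial>lborel)"
    unfolding pieces_value_def by (rule pieces_isometry(1)[OF I p])
  then show "integrable P (\<lambda>\<omega>. 2 * energy T \<omega> + 2 * (\<integral>r. (pieces_value I \<psi> c d r \<omega>)\<^sup>2 \<partial>lborel))"
    using E by simp
  show "residual u v I \<psi> c d \<in> borel_measurable P" by (rule residual_measurable[OF uv(1,2) p])
  have "0 \<le> T" using uv by simp
  from H_path[OF this]
  show "AE \<omega> in P. norm (residual u v I \<psi> c d \<omega>) \<le> norm (2 * energy T \<omega> + 2 * (\<integral>r. (pieces_value I \<psi> c d r \<omega>)\<^sup>2 \<partial>lborel))"
  proof eventually_elim
    case (elim \<omega>)
    then show ?case using residual_le[OF uv I elim, of \<psi> c d] residual_nonneg[of u v I \<psi> c d \<omega>] by simp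
  qed
qed

text \<open>The level \<open>R = k\<close> tends to infinity. Where the energy is at least
  \<open>k\<close>, the value \<open>2 * k\<close> is at most twice the energy, so integrability of
  the energy supplies the dominating function.\<close>

lemma Ito_inequality:
  fixes I :: "'i set"
  assumes uv: "0 \<le> u" "u \<le> v" "v \<le> T" and E: "integrable P (energy T)" and I: "finite I"
    and p: "\<And>i. i \<in> I \<Longrightarrow> piece (\<psi> i) (c i) (d i)"
  shows "square_integrable P (\<lambda>\<omega>. J v \<omega> - J u \<omega> - pieces_integral B I \<psi> c d \<omega>)"
    and "(\<integral>\<omega>. (J v \<omega> - J u \<omega> - pieces_integral B I \<psi> c d \<omega>)\<^sup>2 \<partial>P) \<le> (\<integral>\<omega>. residual u v I \<psi> c d \<omega> \<partial>P)"
proof -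
  have T: "0 \<le> T" "0 \<le> v" using uv by auto
  define \<Sigma> where "\<Sigma> \<omega> = (\<integral>r. (pieces_value I \<psi> c d r \<omega>)\<^sup>2 \<partial>lborel)" for \<omega>
  have \<Sigma>: "integrable P \<Sigma>"
    unfolding \<Sigma>_def[abs_def] pieces_value_def by (rule pieces_isometry(1)[OF I p])
  have res_i: "integrable P (residual u v I \<psi> c d)" by (rule residual_integrable[OF uv E I p])
  note [measurable] = J_measurable[OF uv(1)] J_measurable[OF T(2)] energy_measurable[OF T(1)]
    borel_measurable_integrable[OF \<Sigma>] borel_measurable_integrable[OF res_i]
  have [measurable]: "pieces_integral B I \<psi> c d \<in> borel_measurable P"
    by (rule square_integrableD(1)[OF square_integrable_pieces_integral[OF p]])
  define D where "D \<omega> = (J v \<omega> - J u \<omega> - pieces_integral B I \<psi> c d \<omega>)\<^sup>2" for \<omega>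
  define N where "N k \<omega> = D \<omega> * indicator {..<real k} (energy T \<omega>)" for k \<omega>
  define G where "G k \<omega> = (if energy T \<omega> < real k then residual u v I \<psi> c d \<omega> else 2 * real k + 2 * \<Sigma> \<omega>)" for k \<omega>
  have trunc: "integrable P (N k)" "(\<integral>\<omega>. N k \<omega> \<partial>P) \<le> (\<integral>\<omega>. G k \<omega> \<partial>P)" for k
    using truncated_Ito_inequality[OF uv I p, where R = "real k"] unfolding N_def D_def G_def \<Sigma>_def by auto
  note ev = eventually_less_real
  have lim: "(\<lambda>k. \<integral>\<omega>. G k \<omega> \<partial>P) \<longlonglongrightarrow> (\<integral>\<omega>. residual u v I \<psi> c d \<omega> \<partial>P)"
  proof (rule integral_dominated_convergence[where w = "\<lambda>\<omega>. 2 * energy T \<omega> + 2 * \<Sigma> \<omega>"])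
    show "G k \<in> borel_measurable P" for k unfolding G_def[abs_def] by measurable
    show "integrable P (\<lambda>\<omega>. 2 * energy T \<omega> + 2 * \<Sigma> \<omega>)" using E \<Sigma> by simp
    show "AE \<omega> in P. (\<lambda>k. G k \<omega>) \<longlonglongrightarrow> residual u v I \<psi> c d \<omega>"
      unfolding G_def by (rule AE_I2, rule tendsto_eventually, rule eventually_mono[OF ev if_P])
    show "AE \<omega> in P. norm (G k \<omega>) \<le> 2 * energy T \<omega> + 2 * \<Sigma> \<omega>" for k
      using H_path[OF T(1)]
    proof eventually_elim
      case (elim \<omega>)
      moreover have "0 \<le> \<Sigma> \<omega>" by (simp add: \<Sigma>_def)
      ultimately show ?case
        using residual_le[OF uv I elim, of \<psi> c d] residual_nonneg[of u v I \<psi> c d \<omega>] energy_nonneg[of T \<omega>]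
        by (auto simp: G_def \<Sigma>_def[symmetric])
    qed
  qed (use borel_measurable_integrable[OF res_i] in simp)
  have "AE \<omega> in P. D \<omega> = 0 \<or> (\<lambda>k. N k \<omega>) \<longlonglongrightarrow> D \<omega>"
    proof (intro AE_I2 disjI2 tendsto_eventually)
    show "\<forall>\<^sub>F k in sequentially. N k \<omega> = D \<omega>" for \<omega>
      using ev[of "energy T \<omega>"] by eventually_elim (simp add: N_def)
  qed
  note F = Fatou_real[OF _ _ trunc(1) _ this trunc(2) lim]
  have "integrable P D" "(\<integral>\<omega>. D \<omega> \<partial>P) \<le> (\<integral>\<omega>. residual u v I \<psi> c d \<omega> \<partial>P)"
    by (rule F; simp add: D_def[abs_def] N_def)+
  then show "square_integrable P (\<lambda>\<omega>. J v \<omega> - J u \<omega> - pieces_integral B I \<psi> c d \<omega>)"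
    and "(\<integral>\<omega>. (J v \<omega> - J u \<omega> - pieces_integral B I \<psi> c d \<omega>)\<^sup>2 \<partial>P) \<le> (\<integral>\<omega>. residual u v I \<psi> c d \<omega> \<partial>P)"
    by (auto simp: D_def[abs_def] intro!: square_integrableI)
qed

text \<open>The level is chosen first, so that the contribution of high energy is below
  \<open>e\<close>; for this fixed level the cut-off approximations then converge on low energy with
  a bounded-plus-energy majorant.\<close>

lemma simple_approximation:
  assumes uv: "0 \<le> u" "u \<le> v" "v \<le> T" and E: "integrable P (energy T)" and e: "0 < e"
  shows "\<exists>n \<tau> \<phi>. simple_process P F n \<tau> \<phi> \<and>
    (\<integral>\<omega>. residual u v {..<n} \<phi> (\<lambda>i. max u (min (\<tau> i) v)) (\<lambda>i. max u (min (\<tau> (Suc i)) v)) \<omega> \<partial>P) < e"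
proof -
  have T: "0 \<le> T" "0 \<le> v" using uv by auto
  obtain n \<tau> \<phi> where s: "\<And>k::nat. simple_process P F (n k) (\<tau> k) (\<phi> k)"
    and good: "AE \<omega> in P. square_integrable lborel (\<lambda>r. indicator {0..T} r * H r \<omega>) \<and>
       (\<lambda>k. \<integral>r. (indicator {0..T} r * simple_value (n k) (\<tau> k) (\<phi> k) r \<omega> - indicator {0..T} r * H r \<omega>)\<^sup>2 \<partial>lborel) \<longlonglongrightarrow> 0 \<and>
       (\<lambda>k. simple_integral B (n k) (\<tau> k) (\<phi> k) u \<omega>) \<longlonglongrightarrow> J u \<omega> \<and>
       (\<lambda>k. simple_integral B (n k) (\<tau> k) (\<phi> k) v \<omega>) \<longlonglongrightarrow> J v \<omega>"
    using approximating_sequence[OF uv] by blast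
  note [measurable] = energy_measurable[OF T(1)]
  \<comment> \<open>The factor 4 anticipates the bound \<open>2 * R + 2 * energy T \<omega>\<close>
    for the approximation error, which is at most four times the energy once the energy is at least
    \<open>R\<close>.\<close>
  have "(\<lambda>j. \<integral>\<omega>. (if energy T \<omega> < real j then 0 else 4 * energy T \<omega>) \<partial>P) \<longlonglongrightarrow> (\<integral>\<omega>. 0 \<partial>P)"
  proof (rule integral_dominated_convergence[where w = "\<lambda>\<omega>. 4 * energy T \<omega>"])
    note ev = eventually_less_real
    show "AE \<omega> in P. (\<lambda>j. if energy T \<omega> < real j then 0 else 4 * energy T \<omega>) \<longlonglongrightarrow> 0"
      by (rule AE_I2, rule tendsto_eventually, rule eventually_mono[OF ev if_P])
  qed (use E energy_nonneg[of T] in auto)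
  then have "(\<lambda>j. \<integral>\<omega>. (if energy T \<omega> < real j then 0 else 4 * energy T \<omega>) \<partial>P) \<longlonglongrightarrow> 0" by simp
  from order_tendstoD(2)[OF this e] obtain j :: nat
    where j: "(\<integral>\<omega>. (if energy T \<omega> < real j then 0 else 4 * energy T \<omega>) \<partial>P) < e"
    by (auto simp: eventually_sequentially)
  define R where "R = real j"
  have R: "0 \<le> R" by (simp add: R_def)
  define \<theta> where "\<theta> k = energy_cutoff T R (\<tau> k) (\<phi> k)" for k
  have s': "simple_process P F (n k) (\<tau> k) (\<theta> k)" for k
    unfolding \<theta>_def by (rule simple_process_energy_cutoff[OF s])
  define A where "A k = residual u v {..<n k} (\<theta> k) (\<lambda>i. max u (min (\<tau> k i) v)) (\<lambda>i. max u (min (\<tau> k (Suc i)) v))" for k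
  have p: "piece (\<theta> k i) (max u (min (\<tau> k i) v)) (max u (min (\<tau> k (Suc i)) v))" if "i \<in> {..<n k}" for k i
    using simple_process_piece[OF s' _ uv(1,2)] that by auto
  have A_int: "integrable P (A k)" for k
    unfolding A_def by (rule residual_integrable[OF uv E _ p]) auto
  note [measurable] = borel_measurable_integrable[OF A_int]
  have A_eq: "A k \<omega> = (\<integral>r. (indicator {u<..v} r * (indicator {0..T} r * simple_value (n k) (\<tau> k) (\<theta> k) r \<omega> - indicator {0..T} r * H r \<omega>))\<^sup>2 \<partial>lborel)" for k \<omega>
    unfolding A_def residual_eq[OF uv] pieces_value_def simple_value_clip[OF uv(1,2), symmetric]
    by (intro Bochner_Integration.integral_cong refl) (use uv in \<open>auto simp: indicator_def power2_commute\<close>)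
  have A_bound: "A k \<omega> \<le> 2 * R + 2 * energy T \<omega>" if H: "square_integrable lborel (\<lambda>r. indicator {0..T} r * H r \<omega>)" for k \<omega>
  proof -
    note sq = square_integrable_simple_value[OF s' T(1), of k \<omega>]
    have "A k \<omega> \<le> (\<integral>r. (indicator {0..T} r * simple_value (n k) (\<tau> k) (\<theta> k) r \<omega> - indicator {0..T} r * H r \<omega>)\<^sup>2 \<partial>lborel)"
      unfolding A_eq by (intro integral_indicator_square_le square_integrable_diff sq H)
    also have "\<dots> \<le> 2 * step_energy T (\<tau> k) (\<theta> k) (n k) \<omega> + 2 * energy T \<omega>"
      using integral_square_diff_le[OF sq(1) H] unfolding sq(2) energy_def .
    also have "\<dots> \<le> 2 * R + 2 * energy T \<omega>"
      using step_energy_cutoff_le[OF s R order_refl, of T k \<omega>] unfolding \<theta>_def by simp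
    finally show ?thesis .
  qed
  define G where "G k \<omega> = (if energy T \<omega> < R then A k \<omega> else 2 * R + 2 * energy T \<omega>)" for k \<omega>
  define w where "w \<omega> = 2 * R + 2 * energy T \<omega>" for \<omega>
  have w: "integrable P w" using E by (simp add: w_def[abs_def])
  have A_nonneg: "0 \<le> A k \<omega>" for k \<omega> by (simp add: A_eq)
  have G_norm: "AE \<omega> in P. norm (G k \<omega>) \<le> w \<omega>" for k
    using good by eventually_elim
      (use A_bound[of _ k] A_nonneg[of k] energy_nonneg[of T] R in \<open>auto simp: G_def w_def\<close>)
  have [measurable]: "G k \<in> borel_measurable P" for k unfolding G_def[abs_def] by measurable
  have "(\<lambda>k. \<integral>\<omega>. G k \<omega> \<partial>P) \<longlonglongrightarrow> (\<integral>\<omega>. (if energy T \<omega> < R then 0 else 2 * R + 2 * energy T \<omega>) \<partial>P)"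
  proof (rule integral_dominated_convergence[OF _ _ w _ G_norm])
    show "AE \<omega> in P. (\<lambda>k. G k \<omega>) \<longlonglongrightarrow> (if energy T \<omega> < R then 0 else 2 * R + 2 * energy T \<omega>)"
      using good
    proof eventually_elim
      case (elim \<omega>)
      then have H: "square_integrable lborel (\<lambda>r. indicator {0..T} r * H r \<omega>)"
        and L2: "(\<lambda>k. \<integral>r. (indicator {0..T} r * simple_value (n k) (\<tau> k) (\<phi> k) r \<omega> - indicator {0..T} r * H r \<omega>)\<^sup>2 \<partial>lborel) \<longlonglongrightarrow> 0"
        by auto
      show ?case
      proof (cases "energy T \<omega> < R")
        case True
        note ev = cutoff_eventually_inactive[OF s T(1) H L2 True, folded \<theta>_def]
        have "(\<lambda>k. \<integral>r. (indicator {u<..v} r * (indicator {0..T} r * simple_value (n k) (\<tau> k) (\<phi> k) r \<omega> - indicator {0..T} r * H r \<omega>))\<^sup>2 \<partial>lborel) \<longlonglongrightarrow> 0"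
          by (rule tendsto_sandwich[OF _ _ tendsto_const L2]; intro always_eventually allI integral_indicator_square_le
            square_integrable_diff square_integrable_simple_value(1)[OF s T(1)] H Bochner_Integration.integral_nonneg) simp
        moreover have "\<forall>\<^sub>F k in sequentially. (\<integral>r. (indicator {u<..v} r * (indicator {0..T} r * simple_value (n k) (\<tau> k) (\<phi> k) r \<omega> - indicator {0..T} r * H r \<omega>))\<^sup>2 \<partial>lborel) = A k \<omega>"
          using ev by eventually_elim (simp add: A_eq)
        ultimately have "(\<lambda>k. A k \<omega>) \<longlonglongrightarrow> 0" by (rule Lim_transform_eventually)
        then show ?thesis using True by (simp add: G_def)
      qed (simp add: G_def)
    qed
  qed measurable
  moreover have "(\<integral>\<omega>. (if energy T \<omega> < R then 0 else 2 * R + 2 * energy T \<omega>) \<partial>P) < e"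
  proof -
    have "(\<integral>\<omega>. (if energy T \<omega> < R then 0 else 2 * R + 2 * energy T \<omega>) \<partial>P) \<le> (\<integral>\<omega>. (if energy T \<omega> < R then 0 else 4 * energy T \<omega>) \<partial>P)"
    proof (rule integral_mono)
      have "integrable P (\<lambda>\<omega>. 4 * energy T \<omega>)" using E by simp
      then show "integrable P (\<lambda>\<omega>. if energy T \<omega> < R then 0 else 4 * energy T \<omega>)"
        by (rule Bochner_Integration.integrable_bound) (use energy_nonneg[of T] in auto)
      show "integrable P (\<lambda>\<omega>. if energy T \<omega> < R then 0 else 2 * R + 2 * energy T \<omega>)"
        by (rule Bochner_Integration.integrable_bound[OF w]) (use energy_nonneg[of T] R in \<open>auto simp: w_def\<close>)
    qed auto
    then show ?thesis using j by (simp add: R_def)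
  qed
  ultimately have "\<forall>\<^sub>F k in sequentially. (\<integral>\<omega>. G k \<omega> \<partial>P) < e" by (rule order_tendstoD)
  then obtain k where k: "(\<integral>\<omega>. G k \<omega> \<partial>P) < e" by (auto simp: eventually_sequentially)
  have "(\<integral>\<omega>. A k \<omega> \<partial>P) \<le> (\<integral>\<omega>. G k \<omega> \<partial>P)"
  proof (rule integral_mono_AE[OF A_int])
    show "integrable P (G k)" 
      by (rule Bochner_Integration.integrable_bound[OF w]) (use G_norm[of k] in \<open>auto elim!: eventually_mono\<close>)
    show "AE \<omega> in P. A k \<omega> \<le> G k \<omega>"
      using good by eventually_elim (use A_bound[of _ k] in \<open>auto simp: G_def\<close>)
  qed
  then show ?thesis
    using k s'[of k] unfolding A_def by (meson le_less_trans)
qed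

text \<open>The claim is exact for simple integrals. By Cauchy-Schwarz the error of replacing
  \<open>J v - J u\<close> by one of them is at most \<open>C * e\<close> for arbitrary
  \<open>e\<close>.\<close>

lemma Ito_mean_zero:
  assumes uv: "0 \<le> u" "u \<le> v" and E: "integrable P (energy v)"
    and Z: "Z \<in> borel_measurable (F u)" "\<And>\<omega>. \<bar>Z \<omega>\<bar> \<le> C"
  shows "(\<integral>\<omega>. Z \<omega> * (J v \<omega> - J u \<omega>) \<partial>P) = 0"
proof -
  have C: "0 \<le> C" using Z(2)[of undefined] by linarith
  have ZP: "Z \<in> borel_measurable P" by (rule measurable_F_P[OF uv(1) Z(1)])
  have Z2: "square_integrable P Z" using Z(2) by (intro square_integrable_bounded[OF ZP])
  have ZC: "(\<integral>\<omega>. (Z \<omega>)\<^sup>2 \<partial>P) \<le> C\<^sup>2"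
  proof -
    have "(\<integral>\<omega>. (Z \<omega>)\<^sup>2 \<partial>P) \<le> (\<integral>\<omega>. C\<^sup>2 \<partial>P)"
      by (rule integral_mono[OF square_integrableD(2)[OF Z2]]) 
         (use Z(2) C in \<open>auto simp: abs_le_square_iff[symmetric]\<close>)
    then show ?thesis by (simp add: prob_space)
  qed
  have JJ: "square_integrable P (\<lambda>\<omega>. J v \<omega> - J u \<omega>)"
    using Ito_inequality(1)[OF uv order_refl E finite.emptyI, of "undefined::nat \<Rightarrow> 'a \<Rightarrow> real" undefined undefined]
    by (simp add: pieces_integral_def)
  have bound: "\<bar>\<integral>\<omega>. Z \<omega> * (J v \<omega> - J u \<omega>) \<partial>P\<bar> \<le> C * e" if e: "0 < e" for e
  proof -
    have "0 < e\<^sup>2" using e by simp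
    from simple_approximation[OF uv order_refl E this] obtain n \<tau> \<phi>
      where s: "simple_process P F n \<tau> \<phi>"
        and r: "(\<integral>\<omega>. residual u v {..<n} \<phi> (\<lambda>i. max u (min (\<tau> i) v)) (\<lambda>i. max u (min (\<tau> (Suc i)) v)) \<omega> \<partial>P) < e\<^sup>2"
      by blast
    let ?a = "\<lambda>i. max u (min (\<tau> i) v)" and ?b = "\<lambda>i. max u (min (\<tau> (Suc i)) v)"
    define S where "S = pieces_integral B {..<n} \<phi> ?a ?b"
    have p: "piece (\<phi> i) (?a i) (?b i) \<and> u \<le> ?a i" if "i \<in> {..<n}" for i
      using simple_process_piece[OF s _ uv] that by auto
    have p': "piece (\<phi> i) (?a i) (?b i)" if "i \<in> {..<n}" for i using p[OF that] by blast
    have I: "square_integrable P (\<lambda>\<omega>. J v \<omega> - J u \<omega> - S \<omega>)" "(\<integral>\<omega>. (J v \<omega> - J u \<omega> - S \<omega>)\<^sup>2 \<partial>P) \<le> e\<^sup>2"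
      using Ito_inequality[OF uv order_refl E, of "{..<n}" \<phi> ?a ?b] p' r unfolding S_def by fastforce+
    have S2: "square_integrable P S" unfolding S_def by (rule square_integrable_pieces_integral[OF p'])
    have "(\<integral>\<omega>. Z \<omega> * S \<omega> \<partial>P) = 0"
      unfolding S_def pieces_integral_def by (rule pieces_mean_zero[OF _ p Z uv(1)]) auto
    moreover have "(\<integral>\<omega>. Z \<omega> * (J v \<omega> - J u \<omega> - S \<omega>) \<partial>P) = (\<integral>\<omega>. Z \<omega> * (J v \<omega> - J u \<omega>) \<partial>P) - (\<integral>\<omega>. Z \<omega> * S \<omega> \<partial>P)"
      unfolding right_diff_distrib[of _ "J v _ - J u _"]
      by (intro Bochner_Integration.integral_diff square_integrable_mult Z2 JJ S2)
    ultimately have "\<bar>\<integral>\<omega>. Z \<omega> * (J v \<omega> - J u \<omega>) \<partial>P\<bar> \<le> (\<integral>\<omega>. \<bar>Z \<omega> * (J v \<omega> - J u \<omega> - S \<omega>)\<bar> \<partial>P)"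
      using integral_abs_bound[of P "\<lambda>\<omega>. Z \<omega> * (J v \<omega> - J u \<omega> - S \<omega>)"] by simp
    also have "\<dots> \<le> C * e"
      by (rule Cauchy_Schwarz_integral_le[OF Z2 I(1) ZC I(2) C]) (use e in simp)
    finally show ?thesis .
  qed
  have "\<bar>\<integral>\<omega>. Z \<omega> * (J v \<omega> - J u \<omega>) \<partial>P\<bar> \<le> 0 + e" if "0 < e" for e
  proof -
    have "\<bar>\<integral>\<omega>. Z \<omega> * (J v \<omega> - J u \<omega>) \<partial>P\<bar> \<le> C * (e / (C + 1))"
      using that C by (intro bound divide_pos_pos) auto
    also have "\<dots> \<le> e" using that C by (simp add: field_simps)
    finally show ?thesis by simp
  qed
  from field_le_epsilon[OF this] show ?thesis by simp
qed

end

section \<open>Integral inequalities and measurable versions\<close>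

lemma set_integral_continuous_eq:
  fixes f :: "real \<Rightarrow> real"
  assumes "continuous_on {a..b} f"
  shows "(LINT r:{a..b}|lborel. f r) = integral {a..b} f"
  using set_borel_integral_eq_integral(2)[OF borel_integrable_atLeastAtMost'[OF assms]] .

text \<open>The derivative of \<open>exp (- (L * s)) * U s\<close> is at most \<open>a s\<close>,
  where \<open>U\<close> is the integral of \<open>x\<close>. The bound is on this integral instead
  of on \<open>x\<close>, so that a rough additive term \<open>a\<close> enters only through its own
  integral.\<close>

lemma Gronwall_integral:
  fixes x a :: "real \<Rightarrow> real"
  assumes t: "0 \<le> t" and L: "0 \<le> L" and x: "continuous_on {0..t} x" and a: "continuous_on {0..t} a"
    and nonneg: "\<And>s. s \<in> {0..t} \<Longrightarrow> 0 \<le> a s"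
    and le: "\<And>s. s \<in> {0..t} \<Longrightarrow> x s \<le> a s + L * (LINT r:{0..s}|lborel. x r)"
  shows "(LINT r:{0..t}|lborel. x r) \<le> exp (L * t) * (LINT r:{0..t}|lborel. a r)"
proof -
  define U where "U s = integral {0..s} x" for s
  define w where "w s = exp (- (L * s)) * (x s - L * U s)" for s
  have U_eq: "U s = (LINT r:{0..s}|lborel. x r)" if "s \<in> {0..t}" for s
    unfolding U_def using that by (intro set_integral_continuous_eq[symmetric] continuous_on_subset[OF x]) auto
  have dU: "(U has_real_derivative x s) (at s within {0..t})" if "s \<in> {0..t}" for s
    using integral_has_vector_derivative[OF x that] unfolding U_def
    by (simp add: has_real_derivative_iff_has_vector_derivative)
  have dW: "((\<lambda>s. exp (- (L * s)) * U s) has_real_derivative w s) (at s within {0..t})" if "s \<in> {0..t}" for s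
    unfolding w_def by (rule derivative_eq_intros dU that refl | simp add: algebra_simps)+
  have "(w has_integral exp (- (L * t)) * U t - exp (- (L * 0)) * U 0) {0..t}"
    using dW t by (intro fundamental_theorem_of_calculus)
      (auto simp: has_real_derivative_iff_has_vector_derivative[symmetric])
  then have w: "w integrable_on {0..t}" "integral {0..t} w = exp (- (L * t)) * U t"
    by (auto simp: U_def integral_unique)
  have "integral {0..t} w \<le> integral {0..t} a"
  proof (rule integral_le[OF w(1) integrable_continuous_real[OF a]])
    fix s assume s: "s \<in> {0..t}"
    have "w s \<le> exp (- (L * s)) * a s"
      unfolding w_def by (intro mult_left_mono) (use le[OF s] U_eq[OF s] in auto)
    also have "\<dots> \<le> 1 * a s" by (intro mult_right_mono nonneg s) (use s L in auto)
    finally show "w s \<le> a s" by simp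
  qed
  then have "exp (L * t) * (exp (- (L * t)) * U t) \<le> exp (L * t) * integral {0..t} a"
    using w(2) by simp
  then show ?thesis
    using t by (simp add: mult.assoc[symmetric] exp_add[symmetric] U_eq set_integral_continuous_eq[OF a])
qed

lemma mono_on_set_integrable:
  fixes v :: "real \<Rightarrow> real"
  assumes "mono_on {a..b} v" "a \<le> b"
  shows "set_integrable lborel {a..b} v"
proof -
  define w where "w t = v (max a (min t b))" for t
  have "mono w"
    unfolding w_def using assms by (intro monoI mono_onD[OF assms(1)]) auto
  then have [measurable]: "w \<in> borel_measurable borel" by (rule borel_measurable_mono)
  have eq: "indicator {a..b} t *\<^sub>R v t = indicator {a..b} t *\<^sub>R w t" for t
    by (auto simp: indicator_def w_def min_def max_def)
  show ?thesis
    unfolding set_integrable_def eq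
  proof (rule Bochner_Integration.integrable_bound)
    show "integrable lborel (\<lambda>t. indicator {a..b} t * (\<bar>v a\<bar> + \<bar>v b\<bar>))"
      by (intro integrable_mult_left integrable_real_indicator) (auto simp: emeasure_lborel_Icc_eq)
    have "\<bar>w t\<bar> \<le> \<bar>v a\<bar> + \<bar>v b\<bar>" for t
      using mono_onD[OF assms(1), of a "max a (min t b)"] mono_onD[OF assms(1), of "max a (min t b)" b] assms(2)
      unfolding w_def by simp linarith
    then show "AE t in lborel. norm (indicator {a..b} t *\<^sub>R w t) \<le> norm (indicator {a..b} t * (\<bar>v a\<bar> + \<bar>v b\<bar>))"
      by (auto simp: indicator_def)
  qed measurable
qed

text \<open>A monotone \<open>v\<close> may jump, so the continuous version is applied to the
  majorant \<open>U\<close>, the right-hand side of the assumed inequality.\<close>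

lemma Gronwall_mono:
  fixes v :: "real \<Rightarrow> real"
  assumes T: "0 \<le> T" and C: "0 \<le> C1" "0 \<le> C2" and v: "mono_on {0..T} v"
    and le: "\<And>t. t \<in> {0..T} \<Longrightarrow> v t \<le> C1 + C2 * (LINT s:{0..t}|lborel. v s)"
  shows "v T \<le> C1 + C2 * (exp (C2 * T) * (C1 * T))"
proof -
  define U where "U t = C1 + C2 * (LINT s:{0..t}|lborel. v s)" for t
  have vi: "set_integrable lborel {0..t} v" if "t \<in> {0..T}" for t
    using that by (intro mono_on_set_integrable mono_on_subset[OF v]) auto
  have U_eq: "U t = C1 + C2 * integral {0..t} v" if "t \<in> {0..T}" for t
    unfolding U_def using set_borel_integral_eq_integral(2)[OF vi[OF that]] by simp
  have "continuous_on {0..T} (\<lambda>t. C1 + C2 * integral {0..t} v)"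
    using set_borel_integral_eq_integral(1)[OF vi[of T]] T
    by (intro continuous_intros indefinite_integral_continuous_1) auto
  then have U: "continuous_on {0..T} U" by (rule continuous_on_eq) (simp add: U_eq)
  have "U s \<le> C1 + C2 * (LINT r:{0..s}|lborel. U r)" if s: "s \<in> {0..T}" for s
  proof -
    have "(LINT r:{0..s}|lborel. v r) \<le> (LINT r:{0..s}|lborel. U r)"
      using s le
      by (intro set_integral_mono vi[OF s] borel_integrable_atLeastAtMost' continuous_on_subset[OF U]) (auto simp: U_def)
    then show ?thesis unfolding U_def using C(2) by (simp add: mult_left_mono)
  qed
  from Gronwall_integral[OF T C(2) U continuous_on_const C(1) this]
  have "(LINT r:{0..T}|lborel. U r) \<le> exp (C2 * T) * (C1 * T)"
    using T by (simp add: set_integral_continuous_eq mult.commute)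
  moreover have "v T \<le> U T" using le[of T] T by (simp add: U_def)
  moreover have "U T \<le> C1 + C2 * (LINT r:{0..T}|lborel. U r)"
    using \<open>\<And>s. s \<in> {0..T} \<Longrightarrow> U s \<le> C1 + C2 * (LINT r:{0..s}|lborel. U r)\<close>[of T] T by simp
  ultimately show ?thesis
    using C(2) by (meson add_left_mono mult_left_mono order_trans)
qed

section \<open>Everywhere continuous versions and the energy below a level\<close>

lemma continuous_joint_measurable:
  fixes Y :: "real \<Rightarrow> 'a \<Rightarrow> real"
  assumes Y: "\<And>t. Y t \<in> borel_measurable M" and cont: "\<And>\<omega>. continuous_on UNIV (\<lambda>t. Y t \<omega>)"
  shows "(\<lambda>(\<omega>, t). Y t \<omega>) \<in> borel_measurable (M \<Otimes>\<^sub>M lborel)"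
proof -
  define q :: "nat \<Rightarrow> real \<Rightarrow> real" where "q n t = of_int \<lfloor>t * real (Suc n)\<rfloor> / real (Suc n)" for n t
  have q: "(\<lambda>n. q n t) \<longlonglongrightarrow> t" for t
  proof (rule LIM_zero_cancel, rule Lim_null_comparison[OF always_eventually LIMSEQ_inverse_real_of_nat], rule allI)
    fix n
    have *: "\<bar>of_int \<lfloor>t * real (Suc n)\<rfloor> - t * real (Suc n)\<bar> \<le> 1"
      using of_int_floor_le[of "t * real (Suc n)"] real_of_int_floor_add_one_gt[of "t * real (Suc n)"] by linarith
    have "q n t - t = (of_int \<lfloor>t * real (Suc n)\<rfloor> - t * real (Suc n)) / real (Suc n)"
      by (simp add: q_def field_simps del: of_nat_Suc)
    then have "\<bar>q n t - t\<bar> = \<bar>of_int \<lfloor>t * real (Suc n)\<rfloor> - t * real (Suc n)\<bar> / real (Suc n)"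
      by (simp add: abs_divide del: of_nat_Suc)
    also have "\<dots> \<le> 1 / real (Suc n)" using * by (intro divide_right_mono) auto
    finally show "norm (q n t - t) \<le> inverse (real (Suc n))" by (simp add: inverse_eq_divide)
  qed
  show ?thesis
  proof (rule borel_measurable_LIMSEQ_real)
    fix n :: nat
    have "(\<lambda>x. Y (of_int \<lfloor>snd x * real (Suc n)\<rfloor> / real (Suc n)) (fst x)) \<in> borel_measurable (M \<Otimes>\<^sub>M lborel)"
    proof (rule measurable_compose_countable[where f = "\<lambda>(i::int) x. Y (of_int i / real (Suc n)) (fst x)"])
      show "(\<lambda>x. Y (of_int i / real (Suc n)) (fst x)) \<in> borel_measurable (M \<Otimes>\<^sub>M lborel)" for i :: int
        by (rule measurable_compose[OF measurable_fst Y])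
      show "(\<lambda>x. \<lfloor>snd x * real (Suc n)\<rfloor>) \<in> measurable (M \<Otimes>\<^sub>M lborel) (count_space UNIV)"
        by measurable
    qed
    then show "(\<lambda>(\<omega>, t). Y (q n t) \<omega>) \<in> borel_measurable (M \<Otimes>\<^sub>M lborel)"
      by (simp add: q_def case_prod_beta)
  next
    fix x :: "'a \<times> real"
    obtain \<omega> t where x: "x = (\<omega>, t)" by (cases x)
    have "isCont (\<lambda>t. Y t \<omega>) t" using cont by (simp add: continuous_on_eq_continuous_at)
    from isCont_tendsto_compose[OF this q]
    show "(\<lambda>n. case x of (\<omega>, t) \<Rightarrow> Y (q n t) \<omega>) \<longlonglongrightarrow> (case x of (\<omega>, t) \<Rightarrow> Y t \<omega>)"
      by (simp add: x)
  qed
qed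

text \<open>The process is set to 0 on a null set containing all bad paths and held constant on
  negative times. Joint measurability then holds without exceptional sets, which Fubini arguments
  require.\<close>

lemma (in prob_space) continuous_version:
  assumes cont: "continuous_paths M Y" and Y: "\<And>t. 0 \<le> t \<Longrightarrow> Y t \<in> borel_measurable M"
  obtains Y' where "(\<lambda>(\<omega>, t). Y' t \<omega>) \<in> borel_measurable (M \<Otimes>\<^sub>M lborel)"
    and "\<And>\<omega>. continuous_on UNIV (\<lambda>t. Y' t \<omega>)"
    and "AE \<omega> in M. \<forall>t\<ge>0. Y' t \<omega> = Y t \<omega>"
    and "\<And>t. Y' t \<in> borel_measurable M"
proof -
  obtain N where N: "{\<omega> \<in> space M. \<not> continuous_on {0..} (\<lambda>t. Y t \<omega>)} \<subseteq> N" "N \<in> sets M" "emeasure M N = 0"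
    using cont unfolding continuous_paths_def by (auto elim: AE_E)
  define Y' where "Y' t \<omega> = indicator (space M - N) \<omega> * Y (max 0 t) \<omega>" for t \<omega>
  have m: "Y' t \<in> borel_measurable M" for t
    unfolding Y'_def[abs_def] using Y[of "max 0 t"] N(2) by measurable
  have c: "continuous_on UNIV (\<lambda>t. Y' t \<omega>)" for \<omega>
  proof (cases "\<omega> \<in> space M - N")
    case True
    then have "continuous_on {0..} (\<lambda>t. Y t \<omega>)" using N by auto
    then have "continuous_on UNIV (\<lambda>t. Y (max 0 t) \<omega>)"
      by (rule continuous_on_compose2[of "{0..}" "\<lambda>t. Y t \<omega>" UNIV "max 0"]) (auto intro!: continuous_intros)
    then show ?thesis using True by (simp add: Y'_def)
  qed (simp add: Y'_def)
  have "AE \<omega> in M. \<omega> \<notin> N" using N by (intro AE_not_in) (auto simp: null_sets_def)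
  then have "AE \<omega> in M. \<forall>t\<ge>0. Y' t \<omega> = Y t \<omega>"
    by (rule AE_mp) (auto simp: Y'_def intro!: AE_I2)
  with continuous_joint_measurable[OF m c] c m show ?thesis by (intro that)
qed

text \<open>This takes the place of stopping when the energy reaches \<open>R\<close>: up to that
  moment the indicator is 1, so the right-hand side has accumulated everything up to level
  \<open>R\<close>.\<close>

lemma (in ito_process) min_energy_le:
  assumes t: "0 \<le> t" and H: "square_integrable lborel (\<lambda>r. indicator {0..t} r * H r \<omega>)"
  shows "ennreal (min (energy t \<omega>) R) \<le> (\<integral>\<^sup>+r. ennreal ((indicator {0..t} r * H r \<omega>)\<^sup>2) * indicator {..<R} (energy r \<omega>) \<partial>lborel)"
proof -
  define f where "f r = (H r \<omega>)\<^sup>2" for r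
  have sq: "(indicator {0..s} r * H r \<omega>)\<^sup>2 = indicator {0..s} r *\<^sub>R f r" for s r
    by (auto simp: indicator_def f_def)
  have fi: "set_integrable lborel {0..t} f"
    using square_integrableD(2)[OF H] unfolding set_integrable_def sq .
  have fi': "set_integrable lborel {0..s} f" if "s \<le> t" for s
    using set_integrable_subset[OF fi, of "{0..s}"] that by auto
  have en: "energy s \<omega> = (LINT r:{0..s}|lborel. f r)" for s
    by (simp only: energy_def sq set_lebesgue_integral_def)
  have en_nn: "ennreal (energy s \<omega>) = (\<integral>\<^sup>+r. ennreal ((indicator {0..s} r * H r \<omega>)\<^sup>2) \<partial>lborel)" if "s \<le> t" for s
    unfolding energy_def using fi'[OF that] by (subst nn_integral_eq_integral) (auto simp: sq set_integrable_def f_def)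
  have mono: "energy r \<omega> \<le> energy s \<omega>" if "r \<le> s" "s \<le> t" for r s
    unfolding en set_lebesgue_integral_def
    by (rule integral_mono) (use that fi'[of r] fi'[of s] in \<open>auto simp: f_def set_integrable_def indicator_def\<close>)
  have cont: "continuous_on {0..t} (\<lambda>s. energy s \<omega>)"
  proof -
    have "continuous_on {0..t} (\<lambda>s. integral {0..s} f)"
      by (rule indefinite_integral_continuous_1[OF set_borel_integral_eq_integral(1)[OF fi]])
    then show ?thesis
      by (rule continuous_on_eq) (auto simp: en set_borel_integral_eq_integral(2)[OF fi'])
  qed
  let ?I = "\<integral>\<^sup>+r. ennreal ((indicator {0..t} r * H r \<omega>)\<^sup>2) * indicator {..<R} (energy r \<omega>) \<partial>lborel"
  have key: "ennreal (energy s \<omega>) \<le> ?I" if s: "s \<in> {0..t}" and R: "energy s \<omega> < R" for s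
    unfolding en_nn[of s, OF atLeastAtMost_iff[THEN iffD1, OF s, THEN conjunct2]]
  proof (rule nn_integral_mono)
    fix r
    have "r \<in> {0..s} \<Longrightarrow> energy r \<omega> < R" using mono[of r s] R s by auto
    then show "ennreal ((indicator {0..s} r * H r \<omega>)\<^sup>2) \<le> ennreal ((indicator {0..t} r * H r \<omega>)\<^sup>2) * indicator {..<R} (energy r \<omega>)"
      using s by (auto simp: indicator_def)
  qed
  show ?thesis
  proof (cases "energy t \<omega> < R")
    case True
    then show ?thesis using key[of t] t by simp
  next
    case False
    \<comment> \<open>The energy is continuous in time and starts at 0, so it passes through every
      level \<open>x < R\<close>; until then it stays below \<open>R\<close>. The supremum over such
      \<open>x\<close> gives \<open>R\<close> itself.\<close>
    have "ennreal x \<le> ?I" if xR: "x < R" for x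
    proof (cases "0 \<le> x")
      case True
      have "energy 0 \<omega> \<le> x" 
      proof -
        have "energy 0 \<omega> = integral {0..0} f"
          unfolding en by (rule set_borel_integral_eq_integral(2)[OF fi'[OF t]])
        then show ?thesis using True by simp
      qed
      then obtain s where "0 \<le> s" "s \<le> t" "energy s \<omega> = x"
        using IVT'[of "\<lambda>s. energy s \<omega>" 0 x t, OF _ _ t cont] False xR by fastforce
      then show ?thesis using key[of s] xR by auto
    qed (simp add: ennreal_neg)
    then have "ennreal R \<le> ?I"
    proof (cases ?I)
      case (real y)
      show ?thesis
      proof (rule ccontr)
        assume "\<not> ennreal R \<le> ?I"
        then have "y < R" using real by (simp add: not_le ennreal_less_iff)
        then have "ennreal ((y + R) / 2) \<le> ennreal y" using \<open>\<And>x. x < R \<Longrightarrow> ennreal x \<le> ?I\<close>[of "(y + R) / 2"] real by simp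
        then show False using \<open>y < R\<close> real(1) by (subst (asm) ennreal_le_iff) auto
      qed
    qed simp
    then show ?thesis using False by (simp add: min_def)
  qed
qed

section \<open>The Wasserstein distance between laws\<close>

text \<open>The joint law of \<open>U\<close> and \<open>V\<close> is one admissible coupling, and
  the infimum lies below its cost.\<close>

lemma (in prob_space) W2_law_le:
  assumes U: "U \<in> borel_measurable M" and V: "V \<in> borel_measurable M"
    and i: "integrable M (\<lambda>\<omega>. (U \<omega> - V \<omega>)\<^sup>2)"
  shows "W2 (law M U) (law M V) \<le> sqrt (expectation (\<lambda>\<omega>. (U \<omega> - V \<omega>)\<^sup>2))"
proof -
  note [measurable] = U V
  define \<pi> where "\<pi> = distr M (borel \<Otimes>\<^sub>M borel) (\<lambda>\<omega>. (U \<omega>, V \<omega>))"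
  have "prob_space \<pi>" unfolding \<pi>_def by (rule prob_space_distr) measurable
  moreover have "distr \<pi> borel fst = law M U" "distr \<pi> borel snd = law M V"
    unfolding \<pi>_def by (subst distr_distr; simp add: o_def)+
  ultimately have "\<pi> \<in> couplings (law M U) (law M V)"
    by (simp add: couplings_def \<pi>_def)
  then have "(\<Sqinter>\<pi>\<in>couplings (law M U) (law M V). \<integral>\<^sup>+(x, y). ennreal ((x - y)\<^sup>2) \<partial>\<pi>) \<le> (\<integral>\<^sup>+(x, y). ennreal ((x - y)\<^sup>2) \<partial>\<pi>)"
    by (rule INF_lower)
  also have "\<dots> = (\<integral>\<^sup>+\<omega>. ennreal ((U \<omega> - V \<omega>)\<^sup>2) \<partial>M)"
    unfolding \<pi>_def by (subst nn_integral_distr) (auto simp: case_prod_beta)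
  also have "\<dots> = ennreal (expectation (\<lambda>\<omega>. (U \<omega> - V \<omega>)\<^sup>2))"
    by (rule nn_integral_eq_integral[OF i]) simp
  finally have "enn2real (\<Sqinter>\<pi>\<in>couplings (law M U) (law M V). \<integral>\<^sup>+(x, y). ennreal ((x - y)\<^sup>2) \<partial>\<pi>)
    \<le> enn2real (ennreal (expectation (\<lambda>\<omega>. (U \<omega> - V \<omega>)\<^sup>2)))"
    by (rule enn2real_mono) simp
  then show ?thesis unfolding W2_def by simp
qed

lemma (in prob_space) W2_law_self:
  assumes "U \<in> borel_measurable M"
  shows "W2 (law M U) (law M U) = 0"
proof (rule antisym)
  show "W2 (law M U) (law M U) \<le> 0" using W2_law_le[OF assms assms] by simp
qed (simp add: W2_def)

definition is_continuous_version :: "'a measure \<Rightarrow> (real \<Rightarrow> 'a \<Rightarrow> real) \<Rightarrow> (real \<Rightarrow> 'a \<Rightarrow> real) \<Rightarrow> bool" where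
  "is_continuous_version P Y Y' \<longleftrightarrow> (\<lambda>(\<omega>, t). Y' t \<omega>) \<in> borel_measurable (P \<Otimes>\<^sub>M lborel) \<and>
    (\<forall>\<omega>. continuous_on UNIV (\<lambda>t. Y' t \<omega>)) \<and> (AE \<omega> in P. \<forall>t\<ge>0. Y' t \<omega> = Y t \<omega>) \<and>
    (\<forall>t. Y' t \<in> borel_measurable P)"

definition some_continuous_version :: "'a measure \<Rightarrow> (real \<Rightarrow> 'a \<Rightarrow> real) \<Rightarrow> real \<Rightarrow> 'a \<Rightarrow> real" where
  "some_continuous_version P Y = (SOME Y'. is_continuous_version P Y Y')"

lemma (in prob_space) some_continuous_version:
  assumes "continuous_paths M Y" "\<And>t. 0 \<le> t \<Longrightarrow> Y t \<in> borel_measurable M"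
  shows "is_continuous_version M Y (some_continuous_version M Y)"
proof -
  obtain Y' where "(\<lambda>(\<omega>, t). Y' t \<omega>) \<in> borel_measurable (M \<Otimes>\<^sub>M lborel)"
    "\<And>\<omega>. continuous_on UNIV (\<lambda>t. Y' t \<omega>)" "AE \<omega> in M. \<forall>t\<ge>0. Y' t \<omega> = Y t \<omega>"
    "\<And>t. Y' t \<in> borel_measurable M"
    using continuous_version[OF assms] by blast
  then have "is_continuous_version M Y Y'" unfolding is_continuous_version_def by (intro conjI allI)
  then show ?thesis unfolding some_continuous_version_def by (rule someI[of "is_continuous_version M Y"])
qed

lemma add3_square_le: "(x + y + z)\<^sup>2 \<le> 3 * (x\<^sup>2 + y\<^sup>2 + (z::real)\<^sup>2)"
proof -
  have "0 \<le> (x - y)\<^sup>2 + (y - z)\<^sup>2 + (z - x)\<^sup>2" by simp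
  then show ?thesis by (simp add: power2_eq_square algebra_simps)
qed

lemma add2_square_le: "(x + y)\<^sup>2 \<le> 2 * x\<^sup>2 + 2 * (y::real)\<^sup>2"
  using square_diff_le[of x "- y"] by simp

lemma square_integrable_continuous_Icc:
  fixes f :: "real \<Rightarrow> real"
  assumes "continuous_on {s..t} f"
  shows "square_integrable lborel (\<lambda>r. indicator {s..t} r * f r)"
proof (rule square_integrableI)
  have "set_integrable lborel {s..t} (\<lambda>r. (f r)\<^sup>2)" "set_integrable lborel {s..t} f"
    by (intro borel_integrable_atLeastAtMost' continuous_intros assms)+
  moreover have "(indicator {s..t} r * f r)\<^sup>2 = indicator {s..t} r *\<^sub>R (f r)\<^sup>2" for r
    by (simp add: indicator_def)
  ultimately show "integrable lborel (\<lambda>r. (indicator {s..t} r * f r)\<^sup>2)"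
    "(\<lambda>r. indicator {s..t} r * f r) \<in> borel_measurable lborel"
    by (auto simp: set_integrable_def dest: borel_measurable_integrable)
qed

lemma integral_square_le_Icc:
  fixes f :: "real \<Rightarrow> real"
  assumes "square_integrable lborel (\<lambda>r. indicator {s..t} r * f r)" "s \<le> t"
  shows "(LINT r:{s..t}|lborel. \<bar>f r\<bar>)\<^sup>2 \<le> (t - s) * (\<integral>r. (indicator {s..t} r * f r)\<^sup>2 \<partial>lborel)"
proof -
  have eq: "(indicator {s..t} r :: real)\<^sup>2 = indicator {s..t} r" for r
    by (simp add: indicator_def)
  have 1: "square_integrable lborel (indicator {s..t} :: real \<Rightarrow> real)"
    by (auto simp: square_integrable_def eq emeasure_lborel_Icc_eq intro!: integrable_real_indicator)
  have "(LINT r:{s..t}|lborel. \<bar>f r\<bar>) = (\<integral>r. \<bar>indicator {s..t} r * (indicator {s..t} r * f r)\<bar> \<partial>lborel)"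
    unfolding set_lebesgue_integral_def
    by (intro Bochner_Integration.integral_cong) (auto simp: indicator_def)
  also have "\<dots> \<le> sqrt (t - s) * sqrt (\<integral>r. (indicator {s..t} r * f r)\<^sup>2 \<partial>lborel)"
    using Cauchy_Schwarz_integral[OF 1 assms(1)] assms(2) by (simp add: eq)
  finally have "(LINT r:{s..t}|lborel. \<bar>f r\<bar>)\<^sup>2 \<le> (sqrt (t - s) * sqrt (\<integral>r. (indicator {s..t} r * f r)\<^sup>2 \<partial>lborel))\<^sup>2"
    by (intro power_mono) (auto simp: set_lebesgue_integral_def intro!: Bochner_Integration.integral_nonneg)
  then show ?thesis using assms(2) by (simp add: power_mult_distrib)
qed

section \<open>Second moments of the solution\<close>

text \<open>Carries the equation alone. The function \<open>h\<close> is added in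
  \<open>constrained_mean_reflected\<close>, the constraint and the flatness condition in
  \<open>flat_expansion\<close>.\<close>

locale mean_reflected = ito_process P F B "\<lambda>s \<omega>. \<sigma> (X s \<omega>) (law P (X s))" J
  for P :: "'a measure" and F B and \<sigma> :: "real \<Rightarrow> real measure \<Rightarrow> real" and X :: "real \<Rightarrow> 'a \<Rightarrow> real" and J +
  fixes b :: "real \<Rightarrow> real measure \<Rightarrow> real" and \<xi> :: "'a \<Rightarrow> real" and K :: "real \<Rightarrow> real" and L :: real
  assumes L_pos: "0 < L"
    and coeff_lipschitz: "\<And>x y \<mu> \<nu>. \<mu> \<in> P2 \<Longrightarrow> \<nu> \<in> P2 \<Longrightarrow>
          \<bar>b x \<mu> - b y \<nu>\<bar> + \<bar>\<sigma> x \<mu> - \<sigma> y \<nu>\<bar> \<le> L * (\<bar>x - y\<bar> + W2 \<mu> \<nu>)"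
    and \<xi>_square_integrable: "square_integrable P \<xi>"
    and X_adapted: "adapted F X" and X_paths: "continuous_paths P X"
    and X_law: "\<And>t. 0 \<le> t \<Longrightarrow> law P (X t) \<in> P2"
    and K_cont: "continuous_on {0..} K" and K_mono: "mono_on {0..} K" and K_0: "K 0 = 0"
    and b_integrable: "AE \<omega> in P. \<forall>t\<ge>0. set_integrable lborel {0..t} (\<lambda>s. b (X s \<omega>) (law P (X s)))"
    and equation: "AE \<omega> in P. \<forall>t\<ge>0.
           X t \<omega> = \<xi> \<omega> + (LINT s:{0..t}|lborel. b (X s \<omega>) (law P (X s))) + J t \<omega> + K t"
begin

abbreviation \<mu> :: "real \<Rightarrow> real measure" where "\<mu> s \<equiv> law P (X s)"

lemma X_measurable_F: "0 \<le> t \<Longrightarrow> X t \<in> borel_measurable (F t)"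
  using X_adapted by (simp add: adapted_def)

lemma X_measurable: "0 \<le> t \<Longrightarrow> X t \<in> borel_measurable P"
  by (rule measurable_F_P[OF _ X_measurable_F])

lemma X_square_integrable:
  assumes t: "0 \<le> t" shows "square_integrable P (X t)"
proof -
  note [measurable] = X_measurable[OF t]
  have "integrable (\<mu> t) (\<lambda>x. x\<^sup>2)" using X_law[OF t] by (simp add: P2_def)
  then have "integrable P (\<lambda>\<omega>. (X t \<omega>)\<^sup>2)" by (subst (asm) integrable_distr_eq) auto
  then show ?thesis by (simp add: square_integrable_def)
qed

lemma K_nonneg: "0 \<le> t \<Longrightarrow> 0 \<le> K t"
  using mono_onD[OF K_mono, of 0 t] K_0 by simp

lemma J_paths: "continuous_paths P J"
  using ito by (simp add: ito_integral_def)

definition JV :: "real \<Rightarrow> 'a \<Rightarrow> real" where "JV = some_continuous_version P J"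
definition XV :: "real \<Rightarrow> 'a \<Rightarrow> real" where "XV = some_continuous_version P X"

lemma JV: "is_continuous_version P J JV"
  unfolding JV_def by (rule some_continuous_version[OF J_paths J_measurable])

lemma XV: "is_continuous_version P X XV"
  unfolding XV_def by (rule some_continuous_version[OF X_paths X_measurable])

text \<open>Comparing with one well-behaved path makes the growth bounds integrable in time, without any prior
  bound on the second moments of the laws.\<close>

lemma deterministic_growth:
  assumes T: "0 \<le> T"
  obtains \<beta> \<gamma> where "integrable lborel \<beta>" "integrable lborel \<gamma>" "\<And>s. 0 \<le> \<beta> s" "\<And>s. 0 \<le> \<gamma> s"
    and "\<And>s x. s \<in> {0..T} \<Longrightarrow> \<bar>b x (\<mu> s)\<bar> \<le> \<beta> s + L * \<bar>x\<bar>"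
    and "\<And>s x. s \<in> {0..T} \<Longrightarrow> (\<sigma> x (\<mu> s))\<^sup>2 \<le> \<gamma> s + 4 * L\<^sup>2 * x\<^sup>2"
proof -
  have "AE \<omega> in P. continuous_on {0..} (\<lambda>t. X t \<omega>) \<and>
    set_integrable lborel {0..T} (\<lambda>s. b (X s \<omega>) (\<mu> s)) \<and>
    square_integrable lborel (\<lambda>r. indicator {0..T} r * \<sigma> (X r \<omega>) (\<mu> r))"
    using X_paths[unfolded continuous_paths_def] b_integrable H_path[OF T] by eventually_elim (use T in auto)
  then obtain w where w: "continuous_on {0..} (\<lambda>t. X t w)" "set_integrable lborel {0..T} (\<lambda>s. b (X s w) (\<mu> s))"
    "square_integrable lborel (\<lambda>r. indicator {0..T} r * \<sigma> (X r w) (\<mu> r))"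
    using eventually_happens'[OF ae_filter_bot] by blast
  define \<beta> where "\<beta> s = indicator {0..T} s * (\<bar>b (X s w) (\<mu> s)\<bar> + L * \<bar>X s w\<bar>)" for s
  define \<gamma> where "\<gamma> s = 2 * (indicator {0..T} s * \<sigma> (X s w) (\<mu> s))\<^sup>2 + indicator {0..T} s * (4 * L\<^sup>2 * (X s w)\<^sup>2)" for s
  have c: "continuous_on {0..T} (\<lambda>t. X t w)" by (rule continuous_on_subset[OF w(1)]) auto
  have "set_integrable lborel {0..T} (\<lambda>s. \<bar>b (X s w) (\<mu> s)\<bar> + L * \<bar>X s w\<bar>)"
    by (intro set_integral_add(1) set_integrable_abs w(2) borel_integrable_atLeastAtMost' continuous_intros c)
  then have 1: "integrable lborel \<beta>" by (simp add: \<beta>_def[abs_def] set_integrable_def)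
  have "set_integrable lborel {0..T} (\<lambda>s. 4 * L\<^sup>2 * (X s w)\<^sup>2)"
    by (intro borel_integrable_atLeastAtMost' continuous_intros c)
  then have 2: "integrable lborel \<gamma>"
    using square_integrableD(2)[OF w(3)] by (simp add: \<gamma>_def[abs_def] set_integrable_def)
  have self: "W2 (\<mu> s) (\<mu> s) = 0" if "s \<in> {0..T}" for s
    using that by (intro W2_law_self X_measurable) auto
  \<comment> \<open>Both values are taken at the same law, so the Wasserstein term drops out and no
    moment of \<open>\<mu> s\<close> enters the comparison with the path \<open>w\<close>.\<close>
  have lip: "\<bar>b x (\<mu> s) - b y (\<mu> s)\<bar> + \<bar>\<sigma> x (\<mu> s) - \<sigma> y (\<mu> s)\<bar> \<le> L * \<bar>x - y\<bar>" if "s \<in> {0..T}" for s x y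
    using coeff_lipschitz[of "\<mu> s" "\<mu> s" x y] X_law[of s] self[OF that] that by auto
  show ?thesis
  proof (rule that[OF 1 2])
    show "0 \<le> \<beta> s" "0 \<le> \<gamma> s" for s using L_pos by (auto simp: \<beta>_def \<gamma>_def)
    fix s x assume s: "s \<in> {0..T}"
    have "L * \<bar>x - X s w\<bar> \<le> L * \<bar>x\<bar> + L * \<bar>X s w\<bar>"
      unfolding distrib_left[symmetric] using L_pos by (intro mult_left_mono abs_triangle_ineq4) auto
    then show "\<bar>b x (\<mu> s)\<bar> \<le> \<beta> s + L * \<bar>x\<bar>"
      using lip[OF s, of x "X s w"] s by (simp add: \<beta>_def) linarith
    have "\<bar>\<sigma> x (\<mu> s) - \<sigma> (X s w) (\<mu> s)\<bar> \<le> L * \<bar>x - X s w\<bar>"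
      using lip[OF s, of x "X s w"] by simp
    then have "(\<sigma> x (\<mu> s) - \<sigma> (X s w) (\<mu> s))\<^sup>2 \<le> (L * (x - X s w))\<^sup>2"
      using L_pos by (intro abs_le_square_iff[THEN iffD1]) (simp add: abs_mult)
    also have "\<dots> \<le> L\<^sup>2 * (2 * x\<^sup>2 + 2 * (X s w)\<^sup>2)"
      unfolding power_mult_distrib by (intro mult_left_mono square_diff_le) auto
    finally have "(\<sigma> x (\<mu> s) - \<sigma> (X s w) (\<mu> s))\<^sup>2 \<le> L\<^sup>2 * (2 * x\<^sup>2 + 2 * (X s w)\<^sup>2)" .
    moreover have "(\<sigma> x (\<mu> s))\<^sup>2 \<le> 2 * (\<sigma> x (\<mu> s) - \<sigma> (X s w) (\<mu> s))\<^sup>2 + 2 * (\<sigma> (X s w) (\<mu> s))\<^sup>2"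
      using add2_square_le[of "\<sigma> x (\<mu> s) - \<sigma> (X s w) (\<mu> s)" "\<sigma> (X s w) (\<mu> s)"] by simp
    ultimately show "(\<sigma> x (\<mu> s))\<^sup>2 \<le> \<gamma> s + 4 * L\<^sup>2 * x\<^sup>2"
      using s by (simp add: \<gamma>_def algebra_simps)
  qed
qed

definition JJ :: "real \<Rightarrow> 'a \<Rightarrow> real" where
  "JJ t \<omega> = (LINT r:{0..t}|lborel. (JV r \<omega>)\<^sup>2)"

text \<open>A pathwise Gronwall argument. Only the value of \<open>J\<close> at \<open>t\<close> and
  its time integral appear, no running maximum; hence fixed-time second moments of \<open>J\<close>
  are enough and no maximal inequality is called for.\<close>

lemma path_bound:
  assumes T: "0 \<le> T"
  obtains c where "0 \<le> c" "AE \<omega> in P. \<forall>t\<in>{0..T}. (X t \<omega>)\<^sup>2 \<le> c * (1 + (\<xi> \<omega>)\<^sup>2 + (J t \<omega>)\<^sup>2 + JJ t \<omega>)"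
proof -
  obtain \<beta> \<gamma> where \<beta>: "integrable lborel \<beta>" "\<And>s. 0 \<le> \<beta> s"
    "\<And>s x. s \<in> {0..T} \<Longrightarrow> \<bar>b x (\<mu> s)\<bar> \<le> \<beta> s + L * \<bar>x\<bar>"
    using deterministic_growth[OF T] by metis
  define A where "A = (\<integral>s. \<beta> s \<partial>lborel) + K T"
  define E where "E = exp (L * T)"
  define D where "D = L\<^sup>2 * E\<^sup>2 * T"
  \<comment> \<open>The 6 is 2 times 3: squares of a sum of two terms and then of three.
    \<open>D\<close> comes from squaring the Gronwall factor and applying Cauchy-Schwarz in time;
    the factors \<open>1 + A\<^sup>2\<close> and \<open>1 + T\<close> make one constant fit all
    summands.\<close>
  define c where "c = 6 * (1 + A\<^sup>2) * (1 + D * (1 + T))"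
  have A: "0 \<le> A" unfolding A_def using \<beta>(2) K_nonneg[OF T] by (intro add_nonneg_nonneg Bochner_Integration.integral_nonneg) auto
  have D: "0 \<le> D" unfolding D_def using T by simp
  have "0 \<le> c" unfolding c_def using D T by (intro mult_nonneg_nonneg add_nonneg_nonneg) auto
  have *: "\<forall>t\<in>{0..T}. (X t \<omega>)\<^sup>2 \<le> c * (1 + (\<xi> \<omega>)\<^sup>2 + (J t \<omega>)\<^sup>2 + JJ t \<omega>)"
    if Xc: "continuous_on {0..} (\<lambda>t. X t \<omega>)"
      and b: "\<forall>t\<ge>0. set_integrable lborel {0..t} (\<lambda>s. b (X s \<omega>) (\<mu> s))"
      and eq: "\<forall>t\<ge>0. X t \<omega> = \<xi> \<omega> + (LINT s:{0..t}|lborel. b (X s \<omega>) (\<mu> s)) + J t \<omega> + K t"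
      and JV: "\<forall>t\<ge>0. JV t \<omega> = J t \<omega>" and Jc: "continuous_on UNIV (\<lambda>t. JV t \<omega>)" for \<omega>
  proof
    fix t assume t: "t \<in> {0..T}"
    define a where "a s = A + \<bar>\<xi> \<omega>\<bar> + \<bar>JV s \<omega>\<bar>" for s
    have Jc': "continuous_on S (\<lambda>t. JV t \<omega>)" for S using Jc by (rule continuous_on_subset) auto
    have Xc': "continuous_on {0..s} (\<lambda>t. X t \<omega>)" for s using Xc by (rule continuous_on_subset) auto
    have ac: "continuous_on S a" for S unfolding a_def by (intro continuous_intros Jc')
    have a0: "0 \<le> a s" for s using A by (simp add: a_def)
    have le: "\<bar>X s \<omega>\<bar> \<le> a s + L * (LINT r:{0..s}|lborel. \<bar>X r \<omega>\<bar>)" if s: "s \<in> {0..T}" for s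
    proof -
      have Xi: "set_integrable lborel {0..s} (\<lambda>r. \<bar>X r \<omega>\<bar>)"
        by (intro borel_integrable_atLeastAtMost' continuous_intros Xc')
      have \<beta>i: "set_integrable lborel {0..s} \<beta>"
        unfolding set_integrable_def using \<beta>(1) by (rule integrable_mult_indicator[rotated]) auto
      have bi: "set_integrable lborel {0..s} (\<lambda>r. b (X r \<omega>) (\<mu> r))" using b s by auto
      have "\<bar>LINT r:{0..s}|lborel. b (X r \<omega>) (\<mu> r)\<bar> \<le> (LINT r:{0..s}|lborel. \<bar>b (X r \<omega>) (\<mu> r)\<bar>)"
        using set_integral_norm_bound[OF bi] by simp
      also have "\<dots> \<le> (LINT r:{0..s}|lborel. \<beta> r + L * \<bar>X r \<omega>\<bar>)"
        using s by (intro set_integral_mono set_integrable_abs bi set_integral_add(1) \<beta>i set_integrable_mult_right Xi \<beta>(3)) auto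
      also have "\<dots> = (LINT r:{0..s}|lborel. \<beta> r) + L * (LINT r:{0..s}|lborel. \<bar>X r \<omega>\<bar>)"
        by (simp add: set_integral_add(2)[OF \<beta>i set_integrable_mult_right[OF Xi]])
      also have "(LINT r:{0..s}|lborel. \<beta> r) \<le> (\<integral>r. \<beta> r \<partial>lborel)"
        unfolding set_lebesgue_integral_def
        by (intro integral_mono \<beta>(1) \<beta>i[unfolded set_integrable_def]) (use \<beta>(2) in \<open>auto simp: indicator_def\<close>)
      finally have "\<bar>LINT r:{0..s}|lborel. b (X r \<omega>) (\<mu> r)\<bar> \<le> (\<integral>r. \<beta> r \<partial>lborel) + L * (LINT r:{0..s}|lborel. \<bar>X r \<omega>\<bar>)" by simp
      moreover have "K s \<le> K T" "0 \<le> K s" using K_nonneg mono_onD[OF K_mono, of s T] s by auto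
      moreover have "X s \<omega> = \<xi> \<omega> + (LINT r:{0..s}|lborel. b (X r \<omega>) (\<mu> r)) + JV s \<omega> + K s" using eq JV s by auto
      ultimately show ?thesis unfolding a_def A_def by linarith
    qed
    have "(LINT r:{0..t}|lborel. \<bar>X r \<omega>\<bar>) \<le> exp (L * t) * (LINT r:{0..t}|lborel. a r)"
      using t L_pos le a0 by (intro Gronwall_integral ac continuous_intros Xc') auto
    also have "\<dots> \<le> E * (LINT r:{0..t}|lborel. a r)"
      unfolding E_def using t L_pos a0
      by (intro mult_right_mono) (auto simp: set_lebesgue_integral_def intro!: Bochner_Integration.integral_nonneg)
    finally have "L * (LINT r:{0..t}|lborel. \<bar>X r \<omega>\<bar>) \<le> L * (E * (LINT r:{0..t}|lborel. a r))"
      using L_pos by (intro mult_left_mono) auto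
    with le[OF t] have x: "\<bar>X t \<omega>\<bar> \<le> a t + L * E * (LINT r:{0..t}|lborel. a r)" by (simp add: mult.assoc)
    have Ji: "integrable lborel (\<lambda>r. indicator {0..t} r *\<^sub>R (JV r \<omega>)\<^sup>2)"
      using borel_integrable_atLeastAtMost'[of 0 t "\<lambda>r. (JV r \<omega>)\<^sup>2"] continuous_on_power[OF Jc', of "{0..t}" 2]
      by (simp add: set_integrable_def)
    have ai: "square_integrable lborel (\<lambda>r. indicator {0..t} r * a r)"
      by (rule square_integrable_continuous_Icc[OF ac])
    have asq: "(a r)\<^sup>2 \<le> 3 * (A\<^sup>2 + (\<xi> \<omega>)\<^sup>2 + (JV r \<omega>)\<^sup>2)" for r
      unfolding a_def using add3_square_le[of A "\<bar>\<xi> \<omega>\<bar>" "\<bar>JV r \<omega>\<bar>"] by simp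
    have "(\<integral>r. (indicator {0..t} r * a r)\<^sup>2 \<partial>lborel) \<le>
      (\<integral>r. 3 * (A\<^sup>2 + (\<xi> \<omega>)\<^sup>2) * indicator {0..t} r + 3 * (indicator {0..t} r *\<^sub>R (JV r \<omega>)\<^sup>2) \<partial>lborel)"
    proof (intro integral_mono square_integrableD(2)[OF ai] Bochner_Integration.integrable_add integrable_mult_right Ji)
      show "integrable lborel (indicator {0..t} :: real \<Rightarrow> real)"
        by (intro integrable_real_indicator) (auto simp: emeasure_lborel_Icc_eq)
      show "(indicator {0..t} r * a r)\<^sup>2 \<le> 3 * (A\<^sup>2 + (\<xi> \<omega>)\<^sup>2) * indicator {0..t} r + 3 * (indicator {0..t} r *\<^sub>R (JV r \<omega>)\<^sup>2)" for r
        using asq[of r] by (auto simp: indicator_def)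
    qed
    also have "\<dots> = 3 * (A\<^sup>2 + (\<xi> \<omega>)\<^sup>2) * t + 3 * JJ t \<omega>"
      using t Ji integrable_real_indicator[of "{0..t}" lborel]
      by (subst Bochner_Integration.integral_add) (auto simp: JJ_def set_lebesgue_integral_def)
    also have "\<dots> \<le> 3 * (A\<^sup>2 + (\<xi> \<omega>)\<^sup>2) * T + 3 * JJ t \<omega>"
      using t by (intro add_right_mono mult_left_mono) auto
    finally have ia: "(\<integral>r. (indicator {0..t} r * a r)\<^sup>2 \<partial>lborel) \<le> 3 * (A\<^sup>2 + (\<xi> \<omega>)\<^sup>2) * T + 3 * JJ t \<omega>" .
    have JJ0: "0 \<le> JJ t \<omega>" unfolding JJ_def set_lebesgue_integral_def by (intro Bochner_Integration.integral_nonneg) auto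
    have "(LINT r:{0..t}|lborel. a r)\<^sup>2 \<le> t * (\<integral>r. (indicator {0..t} r * a r)\<^sup>2 \<partial>lborel)"
      using integral_square_le_Icc[OF ai] t a0 by (simp add: abs_of_nonneg)
    also have "\<dots> \<le> T * (3 * (A\<^sup>2 + (\<xi> \<omega>)\<^sup>2) * T + 3 * JJ t \<omega>)"
      by (intro mult_mono ia) (use t in auto)
    finally have i2: "(LINT r:{0..t}|lborel. a r)\<^sup>2 \<le> T * (3 * (A\<^sup>2 + (\<xi> \<omega>)\<^sup>2) * T + 3 * JJ t \<omega>)" .
    have "(X t \<omega>)\<^sup>2 \<le> (a t + L * E * (LINT r:{0..t}|lborel. a r))\<^sup>2"
      using x by (intro abs_le_square_iff[THEN iffD1]) linarith
    also have "\<dots> \<le> 2 * (a t)\<^sup>2 + 2 * (L * E * (LINT r:{0..t}|lborel. a r))\<^sup>2" by (rule add2_square_le)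
    also have "\<dots> \<le> 2 * (3 * (A\<^sup>2 + (\<xi> \<omega>)\<^sup>2 + (J t \<omega>)\<^sup>2)) + 2 * ((L * E)\<^sup>2 * (T * (3 * (A\<^sup>2 + (\<xi> \<omega>)\<^sup>2) * T + 3 * JJ t \<omega>)))"
      unfolding power_mult_distrib[of "L * E"]
      by (intro add_mono mult_left_mono i2 asq[of t, THEN order_trans]) (use JV t in auto)
    also have "\<dots> = 6 * (A\<^sup>2 + (\<xi> \<omega>)\<^sup>2 + (J t \<omega>)\<^sup>2) + 6 * D * ((A\<^sup>2 + (\<xi> \<omega>)\<^sup>2) * T + JJ t \<omega>)"
      by (simp add: D_def power_mult_distrib algebra_simps)
    also have "\<dots> \<le> c * (1 + (\<xi> \<omega>)\<^sup>2 + (J t \<omega>)\<^sup>2 + JJ t \<omega>)"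
    proof -
      have c6: "6 * (1 + D * (1 + T)) \<le> c"
        unfolding c_def using D T by (intro mult_right_mono) auto
      have "6 * (1 + D * T) \<le> 6 * (1 + D * (1 + T))" using D by (intro mult_left_mono add_left_mono) auto
      with c6 have 2: "6 * (1 + D * T) * (\<xi> \<omega>)\<^sup>2 \<le> c * (\<xi> \<omega>)\<^sup>2" by (intro mult_right_mono) auto
      have "6 * 1 \<le> 6 * (1 + D * (1 + T))" using D T by (intro mult_left_mono) auto
      with c6 have 3: "6 * (J t \<omega>)\<^sup>2 \<le> c * (J t \<omega>)\<^sup>2" by (intro mult_right_mono) auto
      have "6 * D \<le> 6 * (1 + D * (1 + T))" using D T mult_nonneg_nonneg[OF D T] by (simp add: distrib_left)
      with c6 have 4: "6 * D * JJ t \<omega> \<le> c * JJ t \<omega>" by (intro mult_right_mono JJ0) auto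
      have 1: "6 * A\<^sup>2 * (1 + D * T) \<le> c"
        unfolding c_def using D T by (intro mult_mono) (auto intro: mult_left_mono)
      from 1 2 3 4 show ?thesis by (simp add: algebra_simps)
    qed
    finally show "(X t \<omega>)\<^sup>2 \<le> c * (1 + (\<xi> \<omega>)\<^sup>2 + (J t \<omega>)\<^sup>2 + JJ t \<omega>)" .
  qed
  have "AE \<omega> in P. \<forall>t\<in>{0..T}. (X t \<omega>)\<^sup>2 \<le> c * (1 + (\<xi> \<omega>)\<^sup>2 + (J t \<omega>)\<^sup>2 + JJ t \<omega>)"
    using X_paths[unfolded continuous_paths_def] b_integrable equation JV[unfolded is_continuous_version_def, THEN conjunct2, THEN conjunct2, THEN conjunct1]
    by eventually_elim (rule *; use JV in \<open>auto simp: is_continuous_version_def\<close>)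
  with \<open>0 \<le> c\<close> show ?thesis by (rule that)
qed

end

lemma (in ito_process) energy_mono:
  assumes H: "square_integrable lborel (\<lambda>r. indicator {0..t} r * H r \<omega>)" and "r \<le> t"
  shows "energy r \<omega> \<le> energy t \<omega>"
  unfolding energy_def
  by (rule integral_mono_AE'[OF square_integrableD(2)[OF H]]) (use assms(2) in \<open>auto simp: indicator_def\<close>)

lemma (in ito_process) H_path_le:
  assumes H: "square_integrable lborel (\<lambda>r. indicator {0..T} r * H r \<omega>)" and "t \<le> T"
  shows "square_integrable lborel (\<lambda>r. indicator {0..t} r * H r \<omega>)"
proof -
  have "square_integrable lborel (\<lambda>r. indicator {0..t} r * (indicator {0..T} r * H r \<omega>))"
    by (rule square_integrable_bounded_mult[OF H, where C = 1]) (auto simp: indicator_def)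
  moreover have "indicator {0..t} r * (indicator {0..T} r * H r \<omega>) = indicator {0..t} r * H r \<omega>" for r
    using assms(2) by (auto simp: indicator_def)
  ultimately show ?thesis by simp
qed

text \<open>The minimum with \<open>T\<close> keeps the inner integral within \<open>{0..T}\<close>,
  the range on which joint measurability of \<open>H\<close> is available.\<close>

lemma (in ito_process) energy_joint_measurable:
  assumes T: "0 \<le> T"
  shows "(\<lambda>(\<omega>, r). energy (min r T) \<omega>) \<in> borel_measurable (P \<Otimes>\<^sub>M lborel)"
proof -
  note H_joint_measurable[OF T, measurable]
  have [measurable]: "(\<lambda>x. indicator {0..T} (snd x) * H (snd x) (fst (fst x))) \<in> borel_measurable ((P \<Otimes>\<^sub>M lborel) \<Otimes>\<^sub>M lborel)"
  proof -
    have "(\<lambda>x. (fst (fst x), snd x)) \<in> measurable ((P \<Otimes>\<^sub>M lborel) \<Otimes>\<^sub>M (lborel :: real measure)) (P \<Otimes>\<^sub>M lborel)"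
      by measurable
    from measurable_compose[OF this H_joint_measurable[OF T]] show ?thesis by simp
  qed
  have "(\<lambda>x. \<integral>s. (indicator {0..} s * of_bool (s \<le> min (snd x) T) * (indicator {0..T} s * H s (fst x)))\<^sup>2 \<partial>lborel)
     \<in> borel_measurable (P \<Otimes>\<^sub>M lborel)"
    by (intro lborel.borel_measurable_lebesgue_integral) measurable
  moreover have "(\<integral>s. (indicator {0..} s * of_bool (s \<le> min r T) * (indicator {0..T} s * H s \<omega>))\<^sup>2 \<partial>lborel) = energy (min r T) \<omega>" for r \<omega>
    unfolding energy_def by (intro Bochner_Integration.integral_cong refl) (auto simp: indicator_def)
  ultimately show ?thesis unfolding case_prod_beta by (simp only:)
qed

context mean_reflected begin

abbreviation H :: "real \<Rightarrow> 'a \<Rightarrow> real" where "H s \<omega> \<equiv> \<sigma> (X s \<omega>) (\<mu> s)"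

text \<open>Finite for every \<open>R \<ge> 0\<close> and nondecreasing in \<open>t\<close>, so
  Gronwall can be applied to it before the energy is known to be integrable.\<close>

definition mean_energy :: "real \<Rightarrow> real \<Rightarrow> real" where
  "mean_energy R t = (\<integral>\<omega>. min (energy t \<omega>) R \<partial>P)"

lemma min_energy_integrable: "0 \<le> t \<Longrightarrow> 0 \<le> R \<Longrightarrow> integrable P (\<lambda>\<omega>. min (energy t \<omega>) R)"
  by (rule integrable_const_bound[where B = R]) (use energy_nonneg[of t] energy_measurable[of t] in auto)

lemma mean_energy_nonneg: "0 \<le> R \<Longrightarrow> 0 \<le> mean_energy R t"
  unfolding mean_energy_def by (intro Bochner_Integration.integral_nonneg) (simp add: energy_nonneg)

lemma mean_energy_mono: "0 \<le> R \<Longrightarrow> mono_on {0..T} (mean_energy R)"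
proof (rule mono_onI)
  fix r s assume *: "0 \<le> R" "r \<in> {0..T}" "s \<in> {0..T}" "r \<le> s"
  then have "0 \<le> s" by auto
  show "mean_energy R r \<le> mean_energy R s"
    unfolding mean_energy_def
  proof (rule integral_mono_AE)
    show "AE \<omega> in P. min (energy r \<omega>) R \<le> min (energy s \<omega>) R"
      using H_path[OF \<open>0 \<le> s\<close>]
    proof eventually_elim
      case (elim \<omega>)
      show ?case using energy_mono[OF elim \<open>r \<le> s\<close>] by auto
    qed
  qed (use * in \<open>auto intro!: min_energy_integrable\<close>)
qed

lemma JJ_eq_nn_integral: "ennreal (JJ t \<omega>) = (\<integral>\<^sup>+r. ennreal (indicator {0..t} r * (JV r \<omega>)\<^sup>2) \<partial>lborel)"
proof -
  have "continuous_on UNIV (\<lambda>t. JV t \<omega>)" using JV by (simp add: is_continuous_version_def)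
  then have "continuous_on {0..t} (\<lambda>r. (JV r \<omega>)\<^sup>2)"
    by (intro continuous_on_power) (rule continuous_on_subset[of UNIV], auto)
  from borel_integrable_atLeastAtMost'[OF this]
  show ?thesis unfolding JJ_def set_lebesgue_integral_def set_integrable_def
    by (subst nn_integral_eq_integral) auto
qed

lemma Fubini_P_lborel:
  fixes f :: "'a \<Rightarrow> real \<Rightarrow> ennreal"
  assumes "(\<lambda>(\<omega>, r). f \<omega> r) \<in> borel_measurable (P \<Otimes>\<^sub>M lborel)"
  shows "(\<integral>\<^sup>+\<omega>. (\<integral>\<^sup>+r. f \<omega> r \<partial>lborel) \<partial>P) = (\<integral>\<^sup>+r. (\<integral>\<^sup>+\<omega>. f \<omega> r \<partial>P) \<partial>lborel)"
proof -
  interpret pair_sigma_finite P "lborel :: real measure" by unfold_locales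
  show ?thesis using Fubini'[OF assms] by simp
qed

text \<open>The path bound is multiplied by the indicator of low energy at time \<open>t\<close>.
  Each \<open>J r\<close> with \<open>r \<le> t\<close> then carries its own indicator and costs at
  most twice the mean energy, which explains \<open>2 + 2 * T\<close>: one term from
  \<open>J t\<close>, one from the time integral.\<close>

lemma truncated_moment:
  assumes T: "0 \<le> T" and R: "0 \<le> R" and c: "0 \<le> c"
    and bound: "AE \<omega> in P. \<forall>t\<in>{0..T}. (X t \<omega>)\<^sup>2 \<le> c * (1 + (\<xi> \<omega>)\<^sup>2 + (J t \<omega>)\<^sup>2 + JJ t \<omega>)"
    and t: "t \<in> {0..T}"
  shows "(\<integral>\<^sup>+\<omega>. ennreal ((X t \<omega>)\<^sup>2) * indicator {..<R} (energy t \<omega>) \<partial>P) \<le>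
    ennreal (c * (1 + (\<integral>\<omega>. (\<xi> \<omega>)\<^sup>2 \<partial>P) + (2 + 2 * T) * mean_energy R t))"
proof -
  have t0: "0 \<le> t" using t by simp
  note [measurable] = energy_measurable[OF t0] X_measurable[OF t0] J_measurable[OF t0] square_integrableD(1)[OF \<xi>_square_integrable]
    energy_joint_measurable[OF T]
  have [measurable]: "(\<lambda>(\<omega>, r). JV r \<omega>) \<in> borel_measurable (P \<Otimes>\<^sub>M lborel)"
    using JV by (simp add: is_continuous_version_def)
  let ?v = "mean_energy R"
  define f where "f \<omega> r = ennreal (indicator {0..t} r * (JV r \<omega>)\<^sup>2) * indicator {..<R} (energy (min r T) \<omega>)" for \<omega> r
  have [measurable]: "(\<lambda>(\<omega>, r). f \<omega> r) \<in> borel_measurable (P \<Otimes>\<^sub>M lborel)"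
    unfolding f_def by measurable
  have Jr: "(\<integral>\<^sup>+\<omega>. ennreal ((J r \<omega>)\<^sup>2 * indicator {..<R} (energy r \<omega>)) \<partial>P) \<le> ennreal (2 * ?v t)" if r: "r \<in> {0..t}" for r
  proof -
    have r0: "0 \<le> r" using r by simp
    have "(\<integral>\<^sup>+\<omega>. ennreal ((J r \<omega>)\<^sup>2 * indicator {..<R} (energy r \<omega>)) \<partial>P) =
      ennreal (\<integral>\<omega>. (J r \<omega>)\<^sup>2 * indicator {..<R} (energy r \<omega>) \<partial>P)"
      by (rule nn_integral_eq_integral[OF J_square_truncated(1)[OF r0 R]]) simp
    also have "\<dots> \<le> ennreal (2 * ?v r)"
      using J_square_truncated(2)[OF r0 R] by (simp add: mean_energy_def ennreal_leI)
    also have "\<dots> \<le> ennreal (2 * ?v t)"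
      using mono_onD[OF mean_energy_mono[OF R], of r T t] r t by (intro ennreal_leI) auto
    finally show ?thesis .
  qed
  have "(\<integral>\<^sup>+\<omega>. ennreal ((X t \<omega>)\<^sup>2) * indicator {..<R} (energy t \<omega>) \<partial>P) \<le>
    (\<integral>\<^sup>+\<omega>. ennreal c * (ennreal (1 + (\<xi> \<omega>)\<^sup>2) + ennreal ((J t \<omega>)\<^sup>2 * indicator {..<R} (energy t \<omega>)) + (\<integral>\<^sup>+r. f \<omega> r \<partial>lborel)) \<partial>P)"
  proof (rule nn_integral_mono_AE, use bound H_path[OF T] in eventually_elim)
    case (elim \<omega>)
    show ?case
    proof (cases "energy t \<omega> < R")
      case True
      \<comment> \<open>Energy increases in time, so low energy at \<open>t\<close> implies low
        energy at all earlier times; this moves the indicator inside the integral over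
        \<open>r\<close>.\<close>
      have "energy (min r T) \<omega> < R" if "r \<in> {0..t}" for r
        using energy_mono[OF H_path_le[OF elim(2), of t], of r] True that t by (auto simp: min_def)
      then have "(\<integral>\<^sup>+r. f \<omega> r \<partial>lborel) = ennreal (JJ t \<omega>)"
        unfolding JJ_eq_nn_integral f_def by (intro nn_integral_cong) (auto simp: indicator_def)
      moreover have "0 \<le> JJ t \<omega>" unfolding JJ_def set_lebesgue_integral_def by (intro Bochner_Integration.integral_nonneg) auto
      ultimately show ?thesis
        using True elim(1) t c by (simp add: ennreal_plus[symmetric] ennreal_mult''[symmetric] del: ennreal_plus)
    qed simp
  qed
  also have "\<dots> = ennreal c * ((\<integral>\<^sup>+\<omega>. ennreal (1 + (\<xi> \<omega>)\<^sup>2) \<partial>P) + (\<integral>\<^sup>+\<omega>. ennreal ((J t \<omega>)\<^sup>2 * indicator {..<R} (energy t \<omega>)) \<partial>P) + (\<integral>\<^sup>+\<omega>. (\<integral>\<^sup>+r. f \<omega> r \<partial>lborel) \<partial>P))"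
    by (subst nn_integral_cmult, measurable) (simp add: nn_integral_add)
  also have "\<dots> \<le> ennreal c * (ennreal (1 + (\<integral>\<omega>. (\<xi> \<omega>)\<^sup>2 \<partial>P)) + ennreal (2 * ?v t) + ennreal (2 * T * ?v t))"
  proof (intro mult_left_mono add_mono Jr)
    have "(\<integral>\<^sup>+\<omega>. ennreal (1 + (\<xi> \<omega>)\<^sup>2) \<partial>P) = ennreal (\<integral>\<omega>. 1 + (\<xi> \<omega>)\<^sup>2 \<partial>P)"
      using square_integrableD(2)[OF \<xi>_square_integrable] by (intro nn_integral_eq_integral) auto
    then show "(\<integral>\<^sup>+\<omega>. ennreal (1 + (\<xi> \<omega>)\<^sup>2) \<partial>P) \<le> ennreal (1 + (\<integral>\<omega>. (\<xi> \<omega>)\<^sup>2 \<partial>P))"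
      using square_integrableD(2)[OF \<xi>_square_integrable] by (simp add: prob_space)
    have "(\<integral>\<^sup>+\<omega>. (\<integral>\<^sup>+r. f \<omega> r \<partial>lborel) \<partial>P) = (\<integral>\<^sup>+r. (\<integral>\<^sup>+\<omega>. f \<omega> r \<partial>P) \<partial>lborel)"
      by (rule Fubini_P_lborel) measurable
    also have "\<dots> \<le> (\<integral>\<^sup>+r. ennreal (2 * ?v t) * indicator {0..t} r \<partial>lborel)"
    proof (rule nn_integral_mono)
      fix r :: real
      show "(\<integral>\<^sup>+\<omega>. f \<omega> r \<partial>P) \<le> ennreal (2 * ?v t) * indicator {0..t} r"
      proof (cases "r \<in> {0..t}")
        case True
        have "(\<integral>\<^sup>+\<omega>. f \<omega> r \<partial>P) = (\<integral>\<^sup>+\<omega>. ennreal ((J r \<omega>)\<^sup>2 * indicator {..<R} (energy r \<omega>)) \<partial>P)"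
        proof (rule nn_integral_cong_AE)
          have "AE \<omega> in P. \<forall>t\<ge>0. JV t \<omega> = J t \<omega>" using JV by (simp add: is_continuous_version_def)
          then show "AE \<omega> in P. f \<omega> r = ennreal ((J r \<omega>)\<^sup>2 * indicator {..<R} (energy r \<omega>))"
            by eventually_elim (use True t in \<open>auto simp: f_def min_def indicator_def\<close>)
        qed
        then show ?thesis using Jr[OF True] True by simp
      qed (simp add: f_def)
    qed
    also have "\<dots> = ennreal (2 * ?v t) * ennreal t"
      using t0 by (simp add: nn_integral_cmult)
    also have "\<dots> \<le> ennreal (2 * ?v t) * ennreal T" using t by (intro mult_left_mono ennreal_leI) auto
    also have "\<dots> = ennreal (2 * T * ?v t)"
      using T mean_energy_nonneg[OF R, of t] by (subst ennreal_mult[symmetric]) (auto simp: mult_ac)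
    finally show "(\<integral>\<^sup>+\<omega>. (\<integral>\<^sup>+r. f \<omega> r \<partial>lborel) \<partial>P) \<le> ennreal (2 * T * ?v t)" .
  qed (use t0 in auto)
  also have "\<dots> = ennreal (c * (1 + (\<integral>\<omega>. (\<xi> \<omega>)\<^sup>2 \<partial>P) + (2 + 2 * T) * ?v t))"
    using c T mean_energy_nonneg[OF R, of t] 
    by (simp add: ennreal_plus[symmetric] ennreal_mult'[symmetric] Bochner_Integration.integral_nonneg algebra_simps del: ennreal_plus)
  finally show ?thesis .
qed

text \<open>Closes the loop: \<open>min_energy_le\<close> and Fubini reduce the mean energy to
  second moments of \<open>\<sigma>\<close> on low energy, linear growth reduces these to moments of
  \<open>X\<close>, and \<open>truncated_moment\<close> returns to the mean energy.
  \<open>C1\<close> and \<open>C2\<close> do not involve \<open>R\<close>.\<close>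

lemma mean_energy_bounded:
  assumes T: "0 \<le> T"
  obtains C where "\<And>R. 0 \<le> R \<Longrightarrow> mean_energy R T \<le> C"
proof -
  obtain \<beta> \<gamma> where \<gamma>: "integrable lborel \<gamma>" "\<And>s. 0 \<le> \<gamma> s"
    "\<And>s x. s \<in> {0..T} \<Longrightarrow> (\<sigma> x (\<mu> s))\<^sup>2 \<le> \<gamma> s + 4 * L\<^sup>2 * x\<^sup>2"
    using deterministic_growth[OF T] by metis
  obtain c where c: "0 \<le> c"
    and bound: "AE \<omega> in P. \<forall>t\<in>{0..T}. (X t \<omega>)\<^sup>2 \<le> c * (1 + (\<xi> \<omega>)\<^sup>2 + (J t \<omega>)\<^sup>2 + JJ t \<omega>)"
    using path_bound[OF T] .
  define D where "D = 1 + (\<integral>\<omega>. (\<xi> \<omega>)\<^sup>2 \<partial>P)"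
  have D: "0 \<le> D" by (simp add: D_def Bochner_Integration.integral_nonneg)
  define C1 where "C1 = (\<integral>s. \<gamma> s \<partial>lborel) + 4 * L\<^sup>2 * c * D * T"
  define C2 where "C2 = 4 * L\<^sup>2 * c * (2 + 2 * T)"
  have C: "0 \<le> C1" "0 \<le> C2"
    unfolding C1_def C2_def using \<gamma>(2) c D T
    by (auto intro!: add_nonneg_nonneg mult_nonneg_nonneg Bochner_Integration.integral_nonneg)
  have "mean_energy R T \<le> C1 + C2 * (exp (C2 * T) * (C1 * T))" if R: "0 \<le> R" for R
  proof (rule Gronwall_mono[OF T C mean_energy_mono[OF R]])
    fix t assume t: "t \<in> {0..T}"
    then have t0: "0 \<le> t" by simp
    have vi: "set_integrable lborel {0..t} (mean_energy R)"
      by (rule mono_on_set_integrable[OF mean_energy_mono[OF R] t0])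
    have Hm [measurable]: "(\<lambda>(\<omega>, r). indicator {0..t} r * H r \<omega>) \<in> borel_measurable (P \<Otimes>\<^sub>M lborel)"
      by (rule H_joint_measurable[OF t0])
    note [measurable] = energy_joint_measurable[OF T]
    define f where "f \<omega> r = ennreal ((indicator {0..t} r * H r \<omega>)\<^sup>2) * indicator {..<R} (energy (min r T) \<omega>)" for \<omega> r
    have [measurable]: "(\<lambda>(\<omega>, r). f \<omega> r) \<in> borel_measurable (P \<Otimes>\<^sub>M lborel)"
      unfolding f_def by measurable
    \<comment> \<open>The bound for the mean of \<open>\<sigma>\<close> squared at time
      \<open>r\<close> on low energy, obtained from the growth estimate with the truncated moment
      inserted.\<close>
    define q where "q r = \<gamma> r + 4 * L\<^sup>2 * (c * (D + (2 + 2 * T) * mean_energy R r))" for r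
    have q0: "0 \<le> q r" for r
      unfolding q_def using \<gamma>(2) c D T mean_energy_nonneg[OF R, of r]
      by (intro add_nonneg_nonneg mult_nonneg_nonneg) auto
    have qi: "set_integrable lborel {0..t} q"
    proof -
      have "set_integrable lborel {0..t} \<gamma>"
        unfolding set_integrable_def using \<gamma>(1) by (rule integrable_mult_indicator[rotated]) auto
      then show ?thesis unfolding q_def[abs_def]
        by (rule set_integral_add(1); intro set_integral_add(1) set_integrable_mult_right vi borel_integrable_atLeastAtMost'[OF continuous_on_const])
    qed
    have "ennreal (mean_energy R t) = (\<integral>\<^sup>+\<omega>. ennreal (min (energy t \<omega>) R) \<partial>P)"
      unfolding mean_energy_def by (rule nn_integral_eq_integral[symmetric, OF min_energy_integrable[OF t0 R]])
        (use R energy_nonneg[of t] in auto)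
    also have "\<dots> \<le> (\<integral>\<^sup>+\<omega>. (\<integral>\<^sup>+r. f \<omega> r \<partial>lborel) \<partial>P)"
    proof (rule nn_integral_mono_AE, use H_path[OF t0] in eventually_elim)
      case (elim \<omega>)
      have "ennreal (min (energy t \<omega>) R) \<le> (\<integral>\<^sup>+r. ennreal ((indicator {0..t} r * H r \<omega>)\<^sup>2) * indicator {..<R} (energy r \<omega>) \<partial>lborel)"
        by (rule min_energy_le[OF t0 elim])
      also have "\<dots> = (\<integral>\<^sup>+r. f \<omega> r \<partial>lborel)"
        using t by (intro nn_integral_cong) (auto simp: f_def indicator_def min_def)
      finally show ?case .
    qed
    also have "\<dots> = (\<integral>\<^sup>+r. (\<integral>\<^sup>+\<omega>. f \<omega> r \<partial>P) \<partial>lborel)"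
      by (rule Fubini_P_lborel) measurable
    also have "\<dots> \<le> (\<integral>\<^sup>+r. ennreal (indicator {0..t} r *\<^sub>R q r) \<partial>lborel)"
    proof (rule nn_integral_mono)
      fix r :: real
      show "(\<integral>\<^sup>+\<omega>. f \<omega> r \<partial>P) \<le> ennreal (indicator {0..t} r *\<^sub>R q r)"
      proof (cases "r \<in> {0..t}")
        case True
        then have r: "r \<in> {0..T}" "0 \<le> r" using t by auto
        note [measurable] = X_measurable[OF r(2)] energy_measurable[OF r(2)]
        have "(\<integral>\<^sup>+\<omega>. f \<omega> r \<partial>P) \<le> (\<integral>\<^sup>+\<omega>. ennreal (\<gamma> r) + ennreal (4 * L\<^sup>2) * (ennreal ((X r \<omega>)\<^sup>2) * indicator {..<R} (energy r \<omega>)) \<partial>P)"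
        proof (rule nn_integral_mono)
          fix \<omega>
          have "f \<omega> r = ennreal ((H r \<omega>)\<^sup>2) * indicator {..<R} (energy r \<omega>)" using True r by (simp add: f_def)
          also have "\<dots> \<le> (ennreal (\<gamma> r) + ennreal (4 * L\<^sup>2) * ennreal ((X r \<omega>)\<^sup>2)) * indicator {..<R} (energy r \<omega>)"
            using \<gamma>(3)[OF r(1), of "X r \<omega>"] \<gamma>(2)[of r]
            by (intro mult_right_mono) (auto simp: ennreal_plus[symmetric] ennreal_mult'[symmetric] intro!: ennreal_leI simp del: ennreal_plus)
          also have "\<dots> \<le> ennreal (\<gamma> r) + ennreal (4 * L\<^sup>2) * (ennreal ((X r \<omega>)\<^sup>2) * indicator {..<R} (energy r \<omega>))"
            by (auto simp: indicator_def)
          finally show "f \<omega> r \<le> ennreal (\<gamma> r) + ennreal (4 * L\<^sup>2) * (ennreal ((X r \<omega>)\<^sup>2) * indicator {..<R} (energy r \<omega>))" .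
        qed
        also have "\<dots> = ennreal (\<gamma> r) + ennreal (4 * L\<^sup>2) * (\<integral>\<^sup>+\<omega>. ennreal ((X r \<omega>)\<^sup>2) * indicator {..<R} (energy r \<omega>) \<partial>P)"
          by (simp add: nn_integral_add nn_integral_cmult emeasure_space_1)
        also have "\<dots> \<le> ennreal (\<gamma> r) + ennreal (4 * L\<^sup>2) * ennreal (c * (D + (2 + 2 * T) * mean_energy R r))"
          unfolding D_def by (intro add_left_mono mult_left_mono truncated_moment[OF T R c bound r(1)]) auto
        also have "\<dots> = ennreal (q r)"
          unfolding q_def using \<gamma>(2)[of r] c D T mean_energy_nonneg[OF R, of r]
          by (subst ennreal_plus; (intro mult_nonneg_nonneg add_nonneg_nonneg)?) (auto simp: ennreal_mult')
        finally show ?thesis using True by simp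
      qed (simp add: f_def)
    qed
    also have "\<dots> = ennreal (LINT r:{0..t}|lborel. q r)"
      unfolding set_lebesgue_integral_def using qi q0
      by (intro nn_integral_eq_integral) (auto simp: set_integrable_def)
    finally have "mean_energy R t \<le> (LINT r:{0..t}|lborel. q r)"
      using q0 by (subst (asm) ennreal_le_iff) (auto simp: set_lebesgue_integral_def intro!: Bochner_Integration.integral_nonneg)
    also have "\<dots> = (LINT r:{0..t}|lborel. \<gamma> r) + (4 * L\<^sup>2 * c * D * t + C2 * (LINT r:{0..t}|lborel. mean_energy R r))"
    proof -
      have 1: "set_integrable lborel {0..t} \<gamma>"
        unfolding set_integrable_def using \<gamma>(1) by (rule integrable_mult_indicator[rotated]) auto
      have 2: "set_integrable lborel {0..t} (\<lambda>r. 4 * L\<^sup>2 * c * D)"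
        by (intro borel_integrable_atLeastAtMost' continuous_on_const)
      have 3: "set_integrable lborel {0..t} (\<lambda>r. C2 * mean_energy R r)"
        using vi by (intro set_integrable_mult_right) auto
      have "q r = \<gamma> r + (4 * L\<^sup>2 * c * D + C2 * mean_energy R r)" for r
        by (simp add: q_def C2_def algebra_simps)
      then have "(LINT r:{0..t}|lborel. q r) = (LINT r:{0..t}|lborel. \<gamma> r + (4 * L\<^sup>2 * c * D + C2 * mean_energy R r))" by simp
      also have "\<dots> = (LINT r:{0..t}|lborel. \<gamma> r) + ((LINT r:{0..t}|lborel. 4 * L\<^sup>2 * c * D) + (LINT r:{0..t}|lborel. C2 * mean_energy R r))"
        by (simp only: set_integral_add(2)[OF 1 set_integral_add(1)[OF 2 3]] set_integral_add(2)[OF 2 3])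
      also have "(LINT r:{0..t}|lborel. 4 * L\<^sup>2 * c * D) = 4 * L\<^sup>2 * c * D * t"
        using t0 by (simp add: set_integral_continuous_eq)
      finally show ?thesis by simp
    qed
    also have "\<dots> \<le> C1 + C2 * (LINT r:{0..t}|lborel. mean_energy R r)"
    proof -
      have "(LINT r:{0..t}|lborel. \<gamma> r) \<le> (\<integral>r. \<gamma> r \<partial>lborel)"
        unfolding set_lebesgue_integral_def
        by (rule integral_mono_AE'[OF \<gamma>(1)]) (use \<gamma>(2) in \<open>auto simp: indicator_def\<close>)
      moreover have "4 * L\<^sup>2 * c * D * t \<le> 4 * L\<^sup>2 * c * D * T" using t c D by (intro mult_left_mono) auto
      ultimately show ?thesis by (simp add: C1_def)
    qed
    finally show "mean_energy R t \<le> C1 + C2 * (LINT r:{0..t}|lborel. mean_energy R r)" .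
  qed
  then show ?thesis by (rule that)
qed

lemma energy_integrable:
  assumes T: "0 \<le> T" shows "integrable P (energy T)"
proof -
  obtain C where C: "\<And>R. 0 \<le> R \<Longrightarrow> mean_energy R T \<le> C" using mean_energy_bounded[OF T] by blast
  show ?thesis
  proof (rule Fatou_real(1)[where g = "\<lambda>k \<omega>. min (energy T \<omega>) (real k)" and c = "\<lambda>_. C" and C = C])
    show "AE \<omega> in P. energy T \<omega> = 0 \<or> (\<lambda>k. min (energy T \<omega>) (real k)) \<longlonglongrightarrow> energy T \<omega>"
    proof (intro AE_I2 disjI2 tendsto_eventually)
      fix \<omega>
      show "\<forall>\<^sub>F k in sequentially. min (energy T \<omega>) (real k) = energy T \<omega>"
        using eventually_less_real[of "energy T \<omega>"] by eventually_elim simp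
    qed
  qed (use T C energy_nonneg[of T] energy_measurable[OF T] in \<open>auto intro!: min_energy_integrable simp: mean_energy_def\<close>)
qed

text \<open>\<open>truncated_moment\<close> now has a right-hand side that is bounded in the level;
  letting the level tend to infinity removes the indicator by Fatou.\<close>

lemma moment_bounded:
  assumes T: "0 \<le> T"
  obtains D where "0 \<le> D" "\<And>t. t \<in> {0..T} \<Longrightarrow> (\<integral>\<omega>. (X t \<omega>)\<^sup>2 \<partial>P) \<le> D"
proof -
  obtain C where C: "\<And>R. 0 \<le> R \<Longrightarrow> mean_energy R T \<le> C" using mean_energy_bounded[OF T] by blast
  obtain c where c: "0 \<le> c"
    and bound: "AE \<omega> in P. \<forall>t\<in>{0..T}. (X t \<omega>)\<^sup>2 \<le> c * (1 + (\<xi> \<omega>)\<^sup>2 + (J t \<omega>)\<^sup>2 + JJ t \<omega>)"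
    using path_bound[OF T] .
  define D where "D = c * (1 + (\<integral>\<omega>. (\<xi> \<omega>)\<^sup>2 \<partial>P) + (2 + 2 * T) * C)"
  have C0: "0 \<le> C" using C[of 0] mean_energy_nonneg[of 0 T] by linarith
  have "0 \<le> D" unfolding D_def using c T C0
    by (intro mult_nonneg_nonneg add_nonneg_nonneg) (auto intro!: Bochner_Integration.integral_nonneg)
  moreover have "(\<integral>\<omega>. (X t \<omega>)\<^sup>2 \<partial>P) \<le> D" if t: "t \<in> {0..T}" for t
  proof -
    have t0: "0 \<le> t" using t by simp
    note [measurable] = X_measurable[OF t0] energy_measurable[OF t0]
    define g where "g k \<omega> = (X t \<omega>)\<^sup>2 * indicator {..<real k} (energy t \<omega>)" for k \<omega>
    have gi: "integrable P (g k)" for k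
      unfolding g_def[abs_def]
      by (rule Bochner_Integration.integrable_bound[OF square_integrableD(2)[OF X_square_integrable[OF t0]]]) (auto simp: indicator_def)
    have "ennreal (\<integral>\<omega>. g k \<omega> \<partial>P) \<le> ennreal D" for k
    proof -
      have "ennreal (\<integral>\<omega>. g k \<omega> \<partial>P) = (\<integral>\<^sup>+\<omega>. ennreal ((X t \<omega>)\<^sup>2) * indicator {..<real k} (energy t \<omega>) \<partial>P)"
        unfolding g_def by (subst nn_integral_eq_integral[symmetric, OF gi[unfolded g_def]])
          (auto intro!: nn_integral_cong simp: indicator_def)
      also have "\<dots> \<le> ennreal (c * (1 + (\<integral>\<omega>. (\<xi> \<omega>)\<^sup>2 \<partial>P) + (2 + 2 * T) * mean_energy (real k) t))"
        by (rule truncated_moment[OF T _ c bound t]) simp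
      also have "\<dots> \<le> ennreal D"
        unfolding D_def using c T mono_onD[OF mean_energy_mono[of "real k" T], of t T] C[of "real k"] t
        by (intro ennreal_leI mult_left_mono add_left_mono) auto
      finally show ?thesis .
    qed
    then have le: "(\<integral>\<omega>. g k \<omega> \<partial>P) \<le> D" for k using \<open>0 \<le> D\<close> by (simp add: ennreal_le_iff)
    show ?thesis
    proof (rule Fatou_real(2)[where g = g and c = "\<lambda>_. D", OF _ _ gi _ _ le tendsto_const])
      show "AE \<omega> in P. (X t \<omega>)\<^sup>2 = 0 \<or> (\<lambda>k. g k \<omega>) \<longlonglongrightarrow> (X t \<omega>)\<^sup>2"
      proof (intro AE_I2 disjI2 tendsto_eventually)
        fix \<omega>
        show "\<forall>\<^sub>F k in sequentially. g k \<omega> = (X t \<omega>)\<^sup>2"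
          using eventually_less_real[of "energy t \<omega>"] by eventually_elim (simp add: g_def)
      qed
    qed (auto simp: g_def)
  qed
  ultimately show ?thesis by (rule that)
qed

end

section \<open>Mean square increments of the solution\<close>

context mean_reflected begin

text \<open>Fubini gives the factor \<open>t - s\<close>, and Cauchy-Schwarz in time gives the
  second one for the square of the integral. Continuity of every path supplies the square
  integrability in time.\<close>

lemma time_integral_square:
  assumes s: "s \<le> t" and m: "(\<lambda>(\<omega>, r). f r \<omega>) \<in> borel_measurable (P \<Otimes>\<^sub>M lborel)"
    and c: "\<And>\<omega>. continuous_on UNIV (\<lambda>r. f r \<omega>)"
    and Q: "\<And>r. r \<in> {s..t} \<Longrightarrow> square_integrable P (f r) \<and> (\<integral>\<omega>. (f r \<omega>)\<^sup>2 \<partial>P) \<le> Q"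
  shows "integrable P (\<lambda>\<omega>. \<integral>r. (indicator {s..t} r * f r \<omega>)\<^sup>2 \<partial>lborel)"
    and "(\<integral>\<omega>. (\<integral>r. (indicator {s..t} r * f r \<omega>)\<^sup>2 \<partial>lborel) \<partial>P) \<le> (t - s) * Q"
    and "square_integrable P (\<lambda>\<omega>. LINT r:{s..t}|lborel. \<bar>f r \<omega>\<bar>)"
    and "(\<integral>\<omega>. (LINT r:{s..t}|lborel. \<bar>f r \<omega>\<bar>)\<^sup>2 \<partial>P) \<le> (t - s)\<^sup>2 * Q"
proof -
  note m [measurable]
  have Q0: "0 \<le> Q"
  proof -
    have "0 \<le> (\<integral>\<omega>. (f s \<omega>)\<^sup>2 \<partial>P)" by simp
    also have "\<dots> \<le> Q" using Q[of s] s by auto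
    finally show ?thesis .
  qed
  have sq: "square_integrable lborel (\<lambda>r. indicator {s..t} r * f r \<omega>)" for \<omega>
    by (rule square_integrable_continuous_Icc[OF continuous_on_subset[OF c]]) simp
  define I where "I \<omega> = (\<integral>r. (indicator {s..t} r * f r \<omega>)\<^sup>2 \<partial>lborel)" for \<omega>
  have I_m [measurable]: "I \<in> borel_measurable P"
    unfolding I_def[abs_def] by (intro lborel.borel_measurable_lebesgue_integral) measurable
  have I0: "0 \<le> I \<omega>" for \<omega> by (simp add: I_def)
  have "(\<integral>\<^sup>+\<omega>. ennreal (I \<omega>) \<partial>P) = (\<integral>\<^sup>+\<omega>. (\<integral>\<^sup>+r. ennreal ((indicator {s..t} r * f r \<omega>)\<^sup>2) \<partial>lborel) \<partial>P)"
    unfolding I_def by (intro nn_integral_cong nn_integral_eq_integral[symmetric] square_integrableD(2)[OF sq]) auto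
  also have "\<dots> = (\<integral>\<^sup>+r. (\<integral>\<^sup>+\<omega>. ennreal ((indicator {s..t} r * f r \<omega>)\<^sup>2) \<partial>P) \<partial>lborel)"
    by (rule Fubini_P_lborel) measurable
  also have "\<dots> \<le> (\<integral>\<^sup>+r. ennreal Q * indicator {s..t} r \<partial>lborel)"
  proof (rule nn_integral_mono)
    fix r :: real
    show "(\<integral>\<^sup>+\<omega>. ennreal ((indicator {s..t} r * f r \<omega>)\<^sup>2) \<partial>P) \<le> ennreal Q * indicator {s..t} r"
    proof (cases "r \<in> {s..t}")
      case True
      have "(\<integral>\<^sup>+\<omega>. ennreal ((f r \<omega>)\<^sup>2) \<partial>P) = ennreal (\<integral>\<omega>. (f r \<omega>)\<^sup>2 \<partial>P)"
        using Q[OF True] by (intro nn_integral_eq_integral) (auto simp: square_integrable_def)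
      then show ?thesis using Q[OF True] True by (simp add: ennreal_leI)
    qed simp
  qed
  also have "\<dots> = ennreal Q * ennreal (t - s)" using s by (simp add: nn_integral_cmult)
  also have "\<dots> = ennreal ((t - s) * Q)" using s Q0 by (simp add: ennreal_mult mult.commute)
  finally have le: "(\<integral>\<^sup>+\<omega>. ennreal (I \<omega>) \<partial>P) \<le> ennreal ((t - s) * Q)" .
  then have Ii: "integrable P I"
    by (intro integrableI_nonneg) (auto simp: I0 less_top[symmetric] top_unique)
  then show "integrable P (\<lambda>\<omega>. \<integral>r. (indicator {s..t} r * f r \<omega>)\<^sup>2 \<partial>lborel)" by (simp add: I_def[abs_def])
  have I_le: "(\<integral>\<omega>. I \<omega> \<partial>P) \<le> (t - s) * Q"
    using le s Q0 by (simp add: nn_integral_eq_integral[OF Ii] I0 ennreal_le_iff)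
  then show "(\<integral>\<omega>. (\<integral>r. (indicator {s..t} r * f r \<omega>)\<^sup>2 \<partial>lborel) \<partial>P) \<le> (t - s) * Q" by (simp add: I_def)
  have A: "(LINT r:{s..t}|lborel. \<bar>f r \<omega>\<bar>)\<^sup>2 \<le> (t - s) * I \<omega>" for \<omega>
    unfolding I_def by (rule integral_square_le_Icc[OF sq s])
  have Am: "(\<lambda>\<omega>. LINT r:{s..t}|lborel. \<bar>f r \<omega>\<bar>) \<in> borel_measurable P"
    unfolding set_lebesgue_integral_def by (intro lborel.borel_measurable_lebesgue_integral) measurable
  show si: "square_integrable P (\<lambda>\<omega>. LINT r:{s..t}|lborel. \<bar>f r \<omega>\<bar>)"
    by (rule square_integrable_bound[OF _ Am A]) (use Ii in simp)
  have "(\<integral>\<omega>. (LINT r:{s..t}|lborel. \<bar>f r \<omega>\<bar>)\<^sup>2 \<partial>P) \<le> (\<integral>\<omega>. (t - s) * I \<omega> \<partial>P)"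
    by (rule integral_mono[OF square_integrableD(2)[OF si] _ A]) (use Ii in simp)
  also have "\<dots> = (t - s) * (\<integral>\<omega>. I \<omega> \<partial>P)" by simp
  also have "\<dots> \<le> (t - s) * ((t - s) * Q)" using s I_le by (intro mult_left_mono) auto
  finally show "(\<integral>\<omega>. (LINT r:{s..t}|lborel. \<bar>f r \<omega>\<bar>)\<^sup>2 \<partial>P) \<le> (t - s)\<^sup>2 * Q"
    by (simp add: power2_eq_square mult.assoc)
qed

lemma XV_props:
  shows "(\<lambda>(\<omega>, t). XV t \<omega>) \<in> borel_measurable (P \<Otimes>\<^sub>M lborel)"
    and "continuous_on UNIV (\<lambda>t. XV t \<omega>)"
    and "AE \<omega> in P. \<forall>t\<ge>0. XV t \<omega> = X t \<omega>"
    and "XV t \<in> borel_measurable P"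
  using XV by (simp_all add: is_continuous_version_def)

lemma XV_AE: "0 \<le> t \<Longrightarrow> AE \<omega> in P. XV t \<omega> = X t \<omega>"
  using XV_props(3) by (rule eventually_mono) simp

lemma XV_square_integrable:
  assumes t: "0 \<le> t" shows "square_integrable P (XV t)"
proof (rule square_integrableI[OF XV_props(4)])
  have "AE \<omega> in P. (X t \<omega>)\<^sup>2 = (XV t \<omega>)\<^sup>2" using XV_AE[OF t] by eventually_elim simp
  then show "integrable P (\<lambda>\<omega>. (XV t \<omega>)\<^sup>2)"
    by (rule integrable_cong_AE_imp[OF square_integrableD(2)[OF X_square_integrable[OF t]], rotated])
      (use XV_props(4)[of t] in simp)
qed

lemma XV_integral_cong:
  assumes "0 \<le> s" "0 \<le> t" and g: "(\<lambda>(x, y). g x y) \<in> borel_measurable (borel \<Otimes>\<^sub>M borel)"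
  shows "(\<integral>\<omega>. g (XV s \<omega>) (XV t \<omega>) \<partial>P) = (\<integral>\<omega>. g (X s \<omega>) (X t \<omega>) \<partial>P)"
proof (rule integral_cong_AE)
  note [measurable] = g X_measurable[OF assms(1)] X_measurable[OF assms(2)] XV_props(4)
  show "(\<lambda>\<omega>. g (XV s \<omega>) (XV t \<omega>)) \<in> borel_measurable P"
    using measurable_compose[OF measurable_Pair[OF XV_props(4)[of s] XV_props(4)[of t]] g] by simp
  show "(\<lambda>\<omega>. g (X s \<omega>) (X t \<omega>)) \<in> borel_measurable P"
    using measurable_compose[OF measurable_Pair[OF X_measurable[OF assms(1)] X_measurable[OF assms(2)]] g] by simp
  show "AE \<omega> in P. g (XV s \<omega>) (XV t \<omega>) = g (X s \<omega>) (X t \<omega>)"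
    using XV_AE[OF assms(1)] XV_AE[OF assms(2)] by eventually_elim simp
qed

definition increment_sq :: "real \<Rightarrow> real \<Rightarrow> real" where
  "increment_sq s t = (\<integral>\<omega>. (X t \<omega> - X s \<omega>)\<^sup>2 \<partial>P)"

lemma increment_sq_nonneg: "0 \<le> increment_sq s t"
  by (simp add: increment_sq_def)

lemma increment_sq_commute: "increment_sq s t = increment_sq t s"
  by (simp add: increment_sq_def power2_commute)

lemma X_diff_square_integrable: "0 \<le> s \<Longrightarrow> 0 \<le> t \<Longrightarrow> square_integrable P (\<lambda>\<omega>. X t \<omega> - X s \<omega>)"
  by (intro square_integrable_diff X_square_integrable)

lemma increment_sq_triangle:
  assumes "0 \<le> r" "0 \<le> s" "0 \<le> t"
  shows "increment_sq r t \<le> 2 * increment_sq s r + 2 * increment_sq s t"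
proof -
  have "X t \<omega> - X r \<omega> = (X t \<omega> - X s \<omega>) - (X r \<omega> - X s \<omega>)" for \<omega> by simp
  then show ?thesis
    unfolding increment_sq_def
    using integral_square_diff_le[OF X_diff_square_integrable[OF assms(2,3)] X_diff_square_integrable[OF assms(2,1)]] by simp
qed

lemma W2_le_increment: "0 \<le> s \<Longrightarrow> 0 \<le> t \<Longrightarrow> W2 (\<mu> t) (\<mu> s) \<le> sqrt (increment_sq s t)"
  unfolding increment_sq_def
  by (intro W2_law_le X_measurable square_integrableD(2)[OF X_diff_square_integrable])

text \<open>The pair of values at two times couples the two laws, so regularity of the flow of laws
  in time reduces to the mean square increment of \<open>X\<close>.\<close>

lemma coeff_increment_le:
  assumes "0 \<le> s" "0 \<le> t"
  shows "\<bar>b (X t \<omega>) (\<mu> t) - b (X s \<omega>) (\<mu> s)\<bar> \<le> L * (\<bar>X t \<omega> - X s \<omega>\<bar> + sqrt (increment_sq s t))"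
    and "\<bar>H t \<omega> - H s \<omega>\<bar> \<le> L * (\<bar>X t \<omega> - X s \<omega>\<bar> + sqrt (increment_sq s t))"
proof -
  have "\<bar>b (X t \<omega>) (\<mu> t) - b (X s \<omega>) (\<mu> s)\<bar> + \<bar>H t \<omega> - H s \<omega>\<bar> \<le> L * (\<bar>X t \<omega> - X s \<omega>\<bar> + W2 (\<mu> t) (\<mu> s))"
    using assms by (intro coeff_lipschitz X_law)
  also have "\<dots> \<le> L * (\<bar>X t \<omega> - X s \<omega>\<bar> + sqrt (increment_sq s t))"
    using W2_le_increment[OF assms] L_pos by (intro mult_left_mono add_left_mono) auto
  finally show "\<bar>b (X t \<omega>) (\<mu> t) - b (X s \<omega>) (\<mu> s)\<bar> \<le> L * (\<bar>X t \<omega> - X s \<omega>\<bar> + sqrt (increment_sq s t))"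
    and "\<bar>H t \<omega> - H s \<omega>\<bar> \<le> L * (\<bar>X t \<omega> - X s \<omega>\<bar> + sqrt (increment_sq s t))"
    by linarith+
qed

lemma coeff_continuous:
  assumes "0 \<le> t"
  shows "continuous_on UNIV (\<lambda>x. b x (\<mu> t))" "continuous_on UNIV (\<lambda>x. \<sigma> x (\<mu> t))"
proof -
  have le: "\<bar>b x (\<mu> t) - b y (\<mu> t)\<bar> + \<bar>\<sigma> x (\<mu> t) - \<sigma> y (\<mu> t)\<bar> \<le> L * \<bar>x - y\<bar>" for x y
    using coeff_lipschitz[OF X_law[OF assms] X_law[OF assms], of x y] W2_law_self[OF X_measurable[OF assms]] by simp
  have "L-lipschitz_on UNIV (\<lambda>x. b x (\<mu> t))" "L-lipschitz_on UNIV (\<lambda>x. \<sigma> x (\<mu> t))"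
  proof -
    have "\<bar>b x (\<mu> t) - b y (\<mu> t)\<bar> \<le> L * \<bar>x - y\<bar>" "\<bar>\<sigma> x (\<mu> t) - \<sigma> y (\<mu> t)\<bar> \<le> L * \<bar>x - y\<bar>" for x y
      using le[of x y] by linarith+
    then show "L-lipschitz_on UNIV (\<lambda>x. b x (\<mu> t))" "L-lipschitz_on UNIV (\<lambda>x. \<sigma> x (\<mu> t))"
      using L_pos by (auto intro!: lipschitz_onI simp: dist_real_def)
  qed
  then show "continuous_on UNIV (\<lambda>x. b x (\<mu> t))" "continuous_on UNIV (\<lambda>x. \<sigma> x (\<mu> t))"
    by (auto intro: lipschitz_on_continuous_on)
qed

lemma drift_measurable: "0 \<le> t \<Longrightarrow> (\<lambda>\<omega>. b (X t \<omega>) (\<mu> t)) \<in> borel_measurable P"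
  by (rule borel_measurable_continuous_on[OF coeff_continuous(1) X_measurable])

lemma H_measurable_F: "0 \<le> t \<Longrightarrow> H t \<in> borel_measurable (F t)"
  by (rule borel_measurable_continuous_on[OF coeff_continuous(2) X_measurable_F])

text \<open>The comparison point is the Dirac mass at 0, realised as the law of the constant 0. Its
  distance to \<open>\<mu> t\<close> is controlled by the now uniform second moment.\<close>

lemma linear_growth:
  assumes T: "0 \<le> T"
  obtains C G where "0 \<le> C" "0 \<le> G"
    and "\<And>t x. t \<in> {0..T} \<Longrightarrow> \<bar>b x (\<mu> t)\<bar> \<le> C + L * \<bar>x\<bar> \<and> \<bar>\<sigma> x (\<mu> t)\<bar> \<le> C + L * \<bar>x\<bar>"
    and "\<And>t. t \<in> {0..T} \<Longrightarrow> (\<integral>\<omega>. (C + L * \<bar>X t \<omega>\<bar>)\<^sup>2 \<partial>P) \<le> G\<^sup>2"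
proof -
  obtain D where D: "0 \<le> D" "\<And>t. t \<in> {0..T} \<Longrightarrow> (\<integral>\<omega>. (X t \<omega>)\<^sup>2 \<partial>P) \<le> D" using moment_bounded[OF T] by blast
  define \<nu> where "\<nu> = law P (\<lambda>_. 0)"
  have \<nu>: "\<nu> \<in> P2"
  proof -
    have "integrable \<nu> (\<lambda>x. x\<^sup>2)" unfolding \<nu>_def by (subst integrable_distr_eq) auto
    moreover have "prob_space \<nu>" unfolding \<nu>_def by (rule prob_space_distr) simp
    moreover have "sets \<nu> = sets borel" by (simp only: \<nu>_def sets_distr)
    ultimately show ?thesis by (simp add: P2_def)
  qed
  define C where "C = \<bar>b 0 \<nu>\<bar> + \<bar>\<sigma> 0 \<nu>\<bar> + L * sqrt D"
  have C0: "0 \<le> C" using L_pos D by (simp add: C_def)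
  define G where "G = sqrt (2 * C\<^sup>2 + 2 * (L\<^sup>2 * D))"
  have G: "0 \<le> G" "G\<^sup>2 = 2 * C\<^sup>2 + 2 * (L\<^sup>2 * D)" using D by (auto simp: G_def)
  show ?thesis
  proof (rule that[OF C0 G(1)])
    fix t x assume t: "t \<in> {0..T}"
    then have t0: "0 \<le> t" by simp
    have "W2 (\<mu> t) \<nu> \<le> sqrt (\<integral>\<omega>. (X t \<omega> - 0)\<^sup>2 \<partial>P)"
      unfolding \<nu>_def using square_integrableD(2)[OF X_square_integrable[OF t0]]
      by (intro W2_law_le X_measurable t0) auto
    also have "\<dots> \<le> sqrt D" using D(2)[OF t] by simp
    finally have "L * (\<bar>x - 0\<bar> + W2 (\<mu> t) \<nu>) \<le> L * (\<bar>x - 0\<bar> + sqrt D)" using L_pos by (intro mult_left_mono) auto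
    then have "L * (\<bar>x - 0\<bar> + W2 (\<mu> t) \<nu>) \<le> L * \<bar>x\<bar> + L * sqrt D" by (simp add: distrib_left)
    with coeff_lipschitz[OF X_law[OF t0] \<nu>, of x 0]
    show "\<bar>b x (\<mu> t)\<bar> \<le> C + L * \<bar>x\<bar> \<and> \<bar>\<sigma> x (\<mu> t)\<bar> \<le> C + L * \<bar>x\<bar>"
      unfolding C_def by linarith
  next
    fix t assume t: "t \<in> {0..T}"
    then have t0: "0 \<le> t" by simp
    note X2 = square_integrableD(2)[OF X_square_integrable[OF t0]]
    have "(\<integral>\<omega>. (C + L * \<bar>X t \<omega>\<bar>)\<^sup>2 \<partial>P) \<le> (\<integral>\<omega>. 2 * C\<^sup>2 + 2 * (L\<^sup>2 * (X t \<omega>)\<^sup>2) \<partial>P)"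
    proof (rule integral_mono)
      show "integrable P (\<lambda>\<omega>. (C + L * \<bar>X t \<omega>\<bar>)\<^sup>2)"
        by (intro square_integrableD(2) square_integrable_add square_integrable_const square_integrable_cmult
            square_integrable_abs X_square_integrable t0)
      show "(C + L * \<bar>X t \<omega>\<bar>)\<^sup>2 \<le> 2 * C\<^sup>2 + 2 * (L\<^sup>2 * (X t \<omega>)\<^sup>2)" for \<omega>
        using add2_square_le[of C "L * \<bar>X t \<omega>\<bar>"] by (simp add: power_mult_distrib)
    qed (use X2 in simp)
    also have "\<dots> = 2 * C\<^sup>2 + 2 * (L\<^sup>2 * (\<integral>\<omega>. (X t \<omega>)\<^sup>2 \<partial>P))" using X2 by (simp add: prob_space)
    also have "\<dots> \<le> G\<^sup>2" unfolding G(2) using D(2)[OF t] by (intro add_left_mono mult_left_mono) auto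
    finally show "(\<integral>\<omega>. (C + L * \<bar>X t \<omega>\<bar>)\<^sup>2 \<partial>P) \<le> G\<^sup>2" .
  qed
qed

lemma growth_square_integrable: "0 \<le> t \<Longrightarrow> square_integrable P (\<lambda>\<omega>. C + L * \<bar>X t \<omega>\<bar>)"
  by (intro square_integrable_add square_integrable_const square_integrable_cmult square_integrable_abs X_square_integrable)

lemma coeff_square_integrable:
  assumes t: "0 \<le> t"
  shows "square_integrable P (\<lambda>\<omega>. b (X t \<omega>) (\<mu> t))" "square_integrable P (H t)"
proof -
  obtain C G where CG: "0 \<le> C" "\<And>s x. s \<in> {0..t} \<Longrightarrow> \<bar>b x (\<mu> s)\<bar> \<le> C + L * \<bar>x\<bar> \<and> \<bar>\<sigma> x (\<mu> s)\<bar> \<le> C + L * \<bar>x\<bar>"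
    using linear_growth[OF t] by metis
  have sq: "x\<^sup>2 \<le> (C + L * \<bar>y\<bar>)\<^sup>2" if "\<bar>x\<bar> \<le> C + L * \<bar>y\<bar>" for x y
    using that by (intro abs_le_square_iff[THEN iffD1]) linarith
  show "square_integrable P (\<lambda>\<omega>. b (X t \<omega>) (\<mu> t))"
    by (rule square_integrable_bound[OF square_integrableD(2)[OF growth_square_integrable[OF t, of C]] drift_measurable[OF t] sq])
      (use CG(2)[of t] t in auto)
  show "square_integrable P (H t)"
    by (rule square_integrable_bound[OF square_integrableD(2)[OF growth_square_integrable[OF t, of C]] measurable_F_P[OF t H_measurable_F[OF t]] sq])
      (use CG(2)[of t] t in auto)
qed

lemma path_increment:
  assumes uv: "0 \<le> u" "u \<le> v"
  shows "AE \<omega> in P. set_integrable lborel {u..v} (\<lambda>r. b (X r \<omega>) (\<mu> r)) \<and>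
    X v \<omega> - X u \<omega> = (LINT r:{u..v}|lborel. b (X r \<omega>) (\<mu> r)) + (K v - K u) + (J v \<omega> - J u \<omega>)"
  using b_integrable equation
proof eventually_elim
  case (elim \<omega>)
  let ?b = "\<lambda>r. b (X r \<omega>) (\<mu> r)"
  have bi: "set_integrable lborel {0..v} ?b" using elim(1) uv by auto
  have b1: "set_integrable lborel {0..u} ?b" "set_integrable lborel {u..v} ?b" "set_integrable lborel {u<..v} ?b"
    by (rule set_integrable_subset[OF bi]; use uv in auto)+
  have "(LINT r:{0..u} \<union> {u<..v}|lborel. ?b r) = (LINT r:{0..u}|lborel. ?b r) + (LINT r:{u<..v}|lborel. ?b r)"
    by (rule set_integral_Un[OF _ b1(1) b1(3)]) auto
  moreover have "{0..u} \<union> {u<..v} = {0..v}" using uv by auto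
  moreover have "(LINT r:{u<..v}|lborel. ?b r) = (LINT r:{u..v}|lborel. ?b r)"
    by (rule set_integral_cong_set)
      (use b1 AE_lborel_singleton[of u] in \<open>auto simp: set_integrable_def set_borel_measurable_def elim!: eventually_mono dest: borel_measurable_integrable\<close>)
  ultimately have "(LINT r:{0..v}|lborel. ?b r) = (LINT r:{0..u}|lborel. ?b r) + (LINT r:{u..v}|lborel. ?b r)" by simp
  then show ?case using elim(2) b1 uv by auto
qed

text \<open>Joint measurability of the drift in path and time is not among the assumptions, so the
  drift integral is represented by a square-integrable majorant built from \<open>XV\<close>. The
  other two conclusions are \<open>Ito_inequality\<close> without pieces.\<close>

lemma drift_integral_square:
  assumes uv: "0 \<le> u" "u \<le> v" "v \<le> T"
    and C: "\<And>t x. t \<in> {0..T} \<Longrightarrow> \<bar>b x (\<mu> t)\<bar> \<le> C + L * \<bar>x\<bar> \<and> \<bar>\<sigma> x (\<mu> t)\<bar> \<le> C + L * \<bar>x\<bar>"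
    and G: "\<And>t. t \<in> {0..T} \<Longrightarrow> (\<integral>\<omega>. (C + L * \<bar>X t \<omega>\<bar>)\<^sup>2 \<partial>P) \<le> G\<^sup>2"
  shows "\<exists>A. square_integrable P A \<and> (\<integral>\<omega>. (A \<omega>)\<^sup>2 \<partial>P) \<le> (v - u)\<^sup>2 * G\<^sup>2 \<and>
    (AE \<omega> in P. \<bar>LINT r:{u..v}|lborel. b (X r \<omega>) (\<mu> r)\<bar> \<le> A \<omega>)"
    and "(\<integral>\<omega>. (J v \<omega> - J u \<omega>)\<^sup>2 \<partial>P) \<le> (v - u) * G\<^sup>2"
    and "square_integrable P (\<lambda>\<omega>. J v \<omega> - J u \<omega>)"
proof -
  define f where "f r \<omega> = C + L * \<bar>XV r \<omega>\<bar>" for r \<omega>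
  have m: "(\<lambda>(\<omega>, r). f r \<omega>) \<in> borel_measurable (P \<Otimes>\<^sub>M lborel)"
    using XV_props(1) unfolding f_def by (simp add: case_prod_beta)
  have c: "continuous_on UNIV (\<lambda>r. f r \<omega>)" for \<omega>
    unfolding f_def by (intro continuous_intros XV_props(2))
  have Q: "square_integrable P (f r) \<and> (\<integral>\<omega>. (f r \<omega>)\<^sup>2 \<partial>P) \<le> G\<^sup>2" if r: "r \<in> {u..v}" for r
  proof
    have r0: "0 \<le> r" "r \<in> {0..T}" using r uv by auto
    show "square_integrable P (f r)"
      unfolding f_def[abs_def]
      by (intro square_integrable_add square_integrable_const square_integrable_cmult square_integrable_abs XV_square_integrable r0)
    have "(\<integral>\<omega>. (f r \<omega>)\<^sup>2 \<partial>P) = (\<integral>\<omega>. (C + L * \<bar>X r \<omega>\<bar>)\<^sup>2 \<partial>P)"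
      unfolding f_def by (rule XV_integral_cong[OF r0(1) r0(1), of "\<lambda>x _. (C + L * \<bar>x\<bar>)\<^sup>2"]) measurable
    then show "(\<integral>\<omega>. (f r \<omega>)\<^sup>2 \<partial>P) \<le> G\<^sup>2" using G[OF r0(2)] by simp
  qed
  note A = time_integral_square[OF uv(2) m c Q]
  have f0: "0 \<le> f r \<omega>" if "r \<in> {u..v}" for r \<omega>
    using C[of r "XV r \<omega>"] uv that unfolding f_def by fastforce
  have fi: "set_integrable lborel {u..v} (\<lambda>r. f r \<omega>)" for \<omega>
    by (rule borel_integrable_atLeastAtMost'[OF continuous_on_subset[OF c]]) simp
  have "AE \<omega> in P. \<bar>LINT r:{u..v}|lborel. b (X r \<omega>) (\<mu> r)\<bar> \<le> (LINT r:{u..v}|lborel. \<bar>f r \<omega>\<bar>)"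
    using path_increment[OF uv(1,2)] XV_props(3)
  proof eventually_elim
    case (elim \<omega>)
    then have bi: "set_integrable lborel {u..v} (\<lambda>r. b (X r \<omega>) (\<mu> r))" by blast
    have "\<bar>LINT r:{u..v}|lborel. b (X r \<omega>) (\<mu> r)\<bar> \<le> (LINT r:{u..v}|lborel. \<bar>b (X r \<omega>) (\<mu> r)\<bar>)"
      using set_integral_norm_bound[OF bi] by simp
    also have "\<dots> \<le> (LINT r:{u..v}|lborel. \<bar>f r \<omega>\<bar>)"
    proof (intro set_integral_mono set_integrable_abs bi fi)
      fix r assume r: "r \<in> {u..v}"
      then show "\<bar>b (X r \<omega>) (\<mu> r)\<bar> \<le> \<bar>f r \<omega>\<bar>"
        using C[of r "X r \<omega>"] elim(2) uv f0[OF r, of \<omega>] by (auto simp: f_def)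
    qed
    finally show ?case .
  qed
  with A(3,4) show "\<exists>A. square_integrable P A \<and> (\<integral>\<omega>. (A \<omega>)\<^sup>2 \<partial>P) \<le> (v - u)\<^sup>2 * G\<^sup>2 \<and>
    (AE \<omega> in P. \<bar>LINT r:{u..v}|lborel. b (X r \<omega>) (\<mu> r)\<bar> \<le> A \<omega>)" by blast
  have v0: "0 \<le> v" using uv by simp
  note E = energy_integrable[OF v0]
  note I = Ito_inequality[OF uv(1,2) order_refl E finite.emptyI, of "undefined::nat \<Rightarrow> 'a \<Rightarrow> real" undefined undefined]
  show "square_integrable P (\<lambda>\<omega>. J v \<omega> - J u \<omega>)"
    using I(1) by (simp add: pieces_integral_def)
  have "(\<integral>\<omega>. (J v \<omega> - J u \<omega>)\<^sup>2 \<partial>P) \<le> (\<integral>\<omega>. residual u v {} (undefined::nat \<Rightarrow> 'a \<Rightarrow> real) undefined undefined \<omega> \<partial>P)"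
    using I(2) by (simp add: pieces_integral_def)
  also have "\<dots> \<le> (\<integral>\<omega>. (\<integral>r. (indicator {u..v} r * f r \<omega>)\<^sup>2 \<partial>lborel) \<partial>P)"
  proof (rule integral_mono_AE'[OF A(1)])
    show "AE \<omega> in P. residual u v {} (undefined::nat \<Rightarrow> 'a \<Rightarrow> real) undefined undefined \<omega> \<le> (\<integral>r. (indicator {u..v} r * f r \<omega>)\<^sup>2 \<partial>lborel)"
      using XV_props(3)
    proof eventually_elim
      case (elim \<omega>)
      have fsq: "integrable lborel (\<lambda>r. (indicator {u..v} r * f r \<omega>)\<^sup>2)"
        by (rule square_integrableD(2)[OF square_integrable_continuous_Icc[OF continuous_on_subset[OF c]]]) simp
      show ?case
        unfolding residual_def pieces_value_def
      proof (rule integral_mono_AE'[OF fsq], intro AE_I2)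
        fix r :: real
        show "(indicator {u<..v} r * H r \<omega> - (\<Sum>i\<in>{}. undefined i \<omega> * indicator {undefined i<..undefined i} r))\<^sup>2 \<le> (indicator {u..v} r * f r \<omega>)\<^sup>2"
        proof (cases "r \<in> {u<..v}")
          case True
          then have "\<bar>H r \<omega>\<bar> \<le> \<bar>f r \<omega>\<bar>" using C[of r "X r \<omega>"] elim uv f0[of r \<omega>] by (auto simp: f_def)
          then show ?thesis using True by (simp add: abs_le_square_iff)
        qed simp
      qed simp
    qed
  qed (auto intro!: Bochner_Integration.integral_nonneg)
  also have "\<dots> \<le> (v - u) * G\<^sup>2" by (rule A(2))
  finally show "(\<integral>\<omega>. (J v \<omega> - J u \<omega>)\<^sup>2 \<partial>P) \<le> (v - u) * G\<^sup>2" .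
qed

text \<open>The increment is a sum of drift, reflection and stochastic integral. The stochastic part
  is of order \<open>v - u\<close> in mean square; the reflection part keeps the square of its own
  increment since no modulus for \<open>K\<close> is known yet.\<close>

lemma increment_sq_le:
  assumes T: "0 \<le> T"
  obtains C where "0 \<le> C" "\<And>u v. 0 \<le> u \<Longrightarrow> u \<le> v \<Longrightarrow> v \<le> T \<Longrightarrow> increment_sq u v \<le> C * ((v - u) + (K v - K u)\<^sup>2)"
proof -
  obtain C G where CG: "0 \<le> C" "0 \<le> G"
    "\<And>t x. t \<in> {0..T} \<Longrightarrow> \<bar>b x (\<mu> t)\<bar> \<le> C + L * \<bar>x\<bar> \<and> \<bar>\<sigma> x (\<mu> t)\<bar> \<le> C + L * \<bar>x\<bar>"
    "\<And>t. t \<in> {0..T} \<Longrightarrow> (\<integral>\<omega>. (C + L * \<bar>X t \<omega>\<bar>)\<^sup>2 \<partial>P) \<le> G\<^sup>2"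
    using linear_growth[OF T] by metis
  \<comment> \<open>The 3 comes from squaring three summands, and the factor \<open>1 + T\<close>
    from \<open>(v - u)\<^sup>2 \<le> T * (v - u)\<close>.\<close>
  define D where "D = 3 * (1 + T) * (1 + G\<^sup>2)"
  have "increment_sq u v \<le> D * ((v - u) + (K v - K u)\<^sup>2)" if uv: "0 \<le> u" "u \<le> v" "v \<le> T" for u v
  proof -
    note d = drift_integral_square[OF uv CG(3,4)]
    obtain A where A: "square_integrable P A" "(\<integral>\<omega>. (A \<omega>)\<^sup>2 \<partial>P) \<le> (v - u)\<^sup>2 * G\<^sup>2"
      "AE \<omega> in P. \<bar>LINT r:{u..v}|lborel. b (X r \<omega>) (\<mu> r)\<bar> \<le> A \<omega>"
      using d(1) by blast
    note sA = square_integrableD(2)[OF A(1)] and sJ = square_integrableD(2)[OF d(3)]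
    have "increment_sq u v \<le> (\<integral>\<omega>. 3 * ((A \<omega>)\<^sup>2 + (K v - K u)\<^sup>2 + (J v \<omega> - J u \<omega>)\<^sup>2) \<partial>P)"
      unfolding increment_sq_def
    proof (rule integral_mono_AE)
      show "integrable P (\<lambda>\<omega>. (X v \<omega> - X u \<omega>)\<^sup>2)"
        using uv by (intro square_integrableD(2) X_diff_square_integrable) auto
      show "AE \<omega> in P. (X v \<omega> - X u \<omega>)\<^sup>2 \<le> 3 * ((A \<omega>)\<^sup>2 + (K v - K u)\<^sup>2 + (J v \<omega> - J u \<omega>)\<^sup>2)"
        using path_increment[OF uv(1,2)] A(3)
      proof eventually_elim
        case (elim \<omega>)
        let ?I = "LINT r:{u..v}|lborel. b (X r \<omega>) (\<mu> r)"
        have "(X v \<omega> - X u \<omega>)\<^sup>2 \<le> 3 * (?I\<^sup>2 + (K v - K u)\<^sup>2 + (J v \<omega> - J u \<omega>)\<^sup>2)"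
          using elim(1) add3_square_le[of ?I "K v - K u" "J v \<omega> - J u \<omega>"] by simp
        moreover have "?I\<^sup>2 \<le> (A \<omega>)\<^sup>2" using elim(2) by (intro abs_le_square_iff[THEN iffD1]) linarith
        ultimately show ?case by simp
      qed
    qed (use sA sJ in simp)
    also have "\<dots> = 3 * ((\<integral>\<omega>. (A \<omega>)\<^sup>2 \<partial>P) + (K v - K u)\<^sup>2 + (\<integral>\<omega>. (J v \<omega> - J u \<omega>)\<^sup>2 \<partial>P))"
      using sA sJ by (simp add: prob_space)
    also have "\<dots> \<le> 3 * ((v - u)\<^sup>2 * G\<^sup>2 + (K v - K u)\<^sup>2 + (v - u) * G\<^sup>2)"
      using A(2) d(2) by (intro mult_left_mono add_mono) auto
    also have "\<dots> \<le> D * ((v - u) + (K v - K u)\<^sup>2)"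
    proof -
      have "(v - u)\<^sup>2 \<le> T * (v - u)" unfolding power2_eq_square using uv by (intro mult_right_mono) auto
      then have "(v - u)\<^sup>2 * G\<^sup>2 \<le> (T * (v - u)) * G\<^sup>2" by (intro mult_right_mono) auto
      then have "3 * ((v - u)\<^sup>2 * G\<^sup>2 + (v - u) * G\<^sup>2) \<le> 3 * ((1 + T) * G\<^sup>2) * (v - u)"
        by (simp add: algebra_simps)
      also have "\<dots> \<le> D * (v - u)" unfolding D_def using T uv by (intro mult_right_mono) (auto simp: algebra_simps)
      finally have 1: "3 * ((v - u)\<^sup>2 * G\<^sup>2 + (v - u) * G\<^sup>2) \<le> D * (v - u)" .
      have "3 * 1 * 1 \<le> D" unfolding D_def using T by (intro mult_mono) auto
      then have "3 * (K v - K u)\<^sup>2 \<le> D * (K v - K u)\<^sup>2" by (intro mult_right_mono) auto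
      with 1 show ?thesis by (simp add: algebra_simps)
    qed
    finally show ?thesis .
  qed
  moreover have "0 \<le> D" unfolding D_def using T by (intro mult_nonneg_nonneg add_nonneg_nonneg) auto
  ultimately show ?thesis using that by blast
qed

lemma increment_sq_small:
  assumes x: "0 \<le> x" and e: "0 < e"
  obtains d where "0 < d" "\<And>s. 0 \<le> s \<Longrightarrow> \<bar>s - x\<bar> < d \<Longrightarrow> increment_sq x s < e"
proof -
  have x1: "0 \<le> x + 1" using x by simp
  obtain C where C: "0 \<le> C" "\<And>u v. 0 \<le> u \<Longrightarrow> u \<le> v \<Longrightarrow> v \<le> x + 1 \<Longrightarrow> increment_sq u v \<le> C * ((v - u) + (K v - K u)\<^sup>2)"
    using increment_sq_le[OF x1] by blast
  have "continuous (at x within {0..}) K" using K_cont x by (simp add: continuous_on_eq_continuous_within)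
  then have "((\<lambda>s. C * (\<bar>s - x\<bar> + (K s - K x)\<^sup>2)) \<longlongrightarrow> C * (\<bar>x - x\<bar> + (K x - K x)\<^sup>2)) (at x within {0..})"
    unfolding continuous_within by (intro tendsto_intros)
  then have "\<forall>\<^sub>F s in at x within {0..}. C * (\<bar>s - x\<bar> + (K s - K x)\<^sup>2) < e"
    using e by (intro order_tendstoD(2)) auto
  then obtain d where d: "0 < d" "\<And>s. 0 \<le> s \<Longrightarrow> s \<noteq> x \<Longrightarrow> dist s x < d \<Longrightarrow> C * (\<bar>s - x\<bar> + (K s - K x)\<^sup>2) < e"
    unfolding eventually_at by auto
  show ?thesis
  proof (rule that[of "min d 1"])
    fix s assume s: "0 \<le> s" "\<bar>s - x\<bar> < min d 1"
    show "increment_sq x s < e"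
    proof (cases s x rule: linorder_cases)
      case less
      then have "increment_sq s x \<le> C * ((x - s) + (K x - K s)\<^sup>2)" using s by (intro C(2)) auto
      also have "\<dots> < e" using d(2)[of s] s less by (simp add: dist_real_def power2_commute[of "K x"])
      finally show ?thesis by (simp add: increment_sq_commute)
    next
      case equal
      then show ?thesis using e by (simp add: increment_sq_def)
    next
      case greater
      then have "increment_sq x s \<le> C * ((s - x) + (K s - K x)\<^sup>2)" using s x by (intro C(2)) auto
      also have "\<dots> < e" using d(2)[of s] s greater by (simp add: dist_real_def)
      finally show ?thesis .
    qed
  qed (use d in auto)
qed

lemma increment_sq_tendsto:
  assumes "0 \<le> x" "\<And>n::nat. 0 \<le> s n" "s \<longlonglongrightarrow> x"
  shows "(\<lambda>n. increment_sq x (s n)) \<longlonglongrightarrow> 0"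
proof (rule tendstoI)
  fix e :: real assume "0 < e"
  obtain d where d: "0 < d" "\<And>s. 0 \<le> s \<Longrightarrow> \<bar>s - x\<bar> < d \<Longrightarrow> increment_sq x s < e"
    using increment_sq_small[OF assms(1) \<open>0 < e\<close>] by blast
  have "\<forall>\<^sub>F n in sequentially. dist (s n) x < d" using assms(3) d(1) by (rule tendstoD)
  then show "\<forall>\<^sub>F n in sequentially. dist (increment_sq x (s n)) 0 < e"
    by eventually_elim (use d(2) assms(2) increment_sq_nonneg in \<open>auto simp: dist_real_def\<close>)
qed

end

section \<open>Expansion of the constraint functional\<close>

locale constrained_mean_reflected = mean_reflected P F B \<sigma> X J b \<xi> K L
  for P :: "'a measure" and F B \<sigma> X J b \<xi> K L +
  fixes h :: "real \<Rightarrow> real" and m M :: real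
  assumes h_mono: "mono h" and m_pos: "0 < m"
    and h_bilipschitz:
          "\<And>x y. m * \<bar>x - y\<bar> \<le> \<bar>h x - h y\<bar> \<and> \<bar>h x - h y\<bar> \<le> M * \<bar>x - y\<bar>"
    and h_C2: "h differentiable_on UNIV" "deriv h differentiable_on UNIV"
          "continuous_on UNIV (deriv (deriv h))"
    and h_bounded: "bounded (range (deriv h))" "bounded (range (deriv (deriv h)))"
begin

lemma h_deriv: "(h has_field_derivative deriv h x) (at x)"
  using h_C2(1) by (simp add: differentiable_on_def DERIV_deriv_iff_real_differentiable)

lemma h_deriv2: "(deriv h has_field_derivative deriv (deriv h) x) (at x)"
  using h_C2(2) by (simp add: differentiable_on_def DERIV_deriv_iff_real_differentiable)

lemma deriv_h_continuous: "continuous_on UNIV (deriv h)"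
  using h_C2(2) by (rule differentiable_imp_continuous_on)

lemma h_continuous: "continuous_on UNIV h"
  using h_C2(1) by (rule differentiable_imp_continuous_on)

lemma h_measurable [measurable]:
  "h \<in> borel_measurable borel" "deriv h \<in> borel_measurable borel" "deriv (deriv h) \<in> borel_measurable borel"
  by (intro borel_measurable_continuous_onI h_continuous deriv_h_continuous h_C2)+

text \<open>For an increasing function the lower Lipschitz bound is a bound on all difference
  quotients. It keeps the denominator of the density away from 0.\<close>

lemma deriv_h_ge: "m \<le> deriv h x"
proof (rule tendsto_lowerbound)
  show "((\<lambda>y. (h y - h x) / (y - x)) \<longlongrightarrow> deriv h x) (at x)"
    using h_deriv has_field_derivative_iff by blast
  have "m \<le> (h y - h x) / (y - x)" if "y \<noteq> x" for y
  proof (cases "x < y")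
    case True
    then show ?thesis using h_bilipschitz[of y x] monoD[OF h_mono, of x y] by (simp add: pos_le_divide_eq)
  next
    case False
    then show ?thesis using h_bilipschitz[of y x] monoD[OF h_mono, of y x] that by (simp add: neg_le_divide_eq algebra_simps)
  qed
  then show "\<forall>\<^sub>F y in at x. m \<le> (h y - h x) / (y - x)" by (auto simp: eventually_at_filter)
qed simp

lemma derivative_bound:
  obtains D where "0 \<le> D" "\<And>x. \<bar>deriv h x\<bar> \<le> D" "\<And>x. \<bar>deriv (deriv h) x\<bar> \<le> D"
proof -
  obtain D1 D2 where "\<And>x. \<bar>deriv h x\<bar> \<le> D1" "\<And>x. \<bar>deriv (deriv h) x\<bar> \<le> D2"
    using h_bounded unfolding bounded_iff by auto
  then show ?thesis
    by (intro that[of "max (max D1 D2) 0"]) (simp_all add: le_max_iff_disj)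
qed

text \<open>The second order Taylor remainder divided by the squared increment. Division by 0 makes
  it 0 on the diagonal, so \<open>remainder_eq\<close> holds without exception.\<close>

definition remainder :: "real \<Rightarrow> real \<Rightarrow> real" where
  "remainder x y = (h y - h x - deriv h x * (y - x) - 1 / 2 * deriv (deriv h) x * (y - x)\<^sup>2) / (y - x)\<^sup>2"

lemma remainder_eq:
  "h y - h x = deriv h x * (y - x) + 1 / 2 * deriv (deriv h) x * (y - x)\<^sup>2 + remainder x y * (y - x)\<^sup>2"
  by (cases "x = y") (simp_all add: remainder_def)

text \<open>Lagrange's form of the remainder: the second derivative is evaluated at an intermediate
  point.\<close>

lemma remainder_Taylor:
  "\<exists>\<theta>. \<bar>\<theta> - x\<bar> \<le> \<bar>y - x\<bar> \<and> \<bar>remainder x y\<bar> \<le> 1 / 2 * \<bar>deriv (deriv h) \<theta> - deriv (deriv h) x\<bar>"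
proof (cases "x = y")
  case True
  then show ?thesis by (auto simp: remainder_def)
next
  case False
  define diff where "diff = (\<lambda>k::nat. if k = 0 then h else if k = 1 then deriv h else deriv (deriv h))"
  have "\<forall>k t. k < 2 \<and> min x y \<le> t \<and> t \<le> max x y \<longrightarrow> DERIV (diff k) t :> diff (Suc k) t"
    using h_deriv h_deriv2 by (auto simp: diff_def less_2_cases_iff)
  from Taylor[OF _ _ this, of h x y] False
  obtain t where t: "if y < x then y < t \<and> t < x else x < t \<and> t < y"
    "h y = (\<Sum>k<2. (diff k x / fact k) * (y - x) ^ k) + (diff 2 t / fact 2) * (y - x)\<^sup>2"
    by (auto simp: diff_def)
  have "h y = h x + deriv h x * (y - x) + 1 / 2 * deriv (deriv h) t * (y - x)\<^sup>2"
    using t(2) by (simp add: diff_def numeral_2_eq_2)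
  then have "remainder x y = 1 / 2 * (deriv (deriv h) t - deriv (deriv h) x)"
    using False by (simp add: remainder_def field_simps)
  moreover have "\<bar>t - x\<bar> \<le> \<bar>y - x\<bar>" using t(1) by (auto split: if_splits)
  ultimately show ?thesis by (intro exI[of _ t]) (simp add: abs_mult)
qed

lemma remainder_bound:
  assumes "\<And>x. \<bar>deriv (deriv h) x\<bar> \<le> D"
  shows "\<bar>remainder x y\<bar> \<le> D"
proof -
  obtain t where "\<bar>remainder x y\<bar> \<le> 1 / 2 * \<bar>deriv (deriv h) t - deriv (deriv h) x\<bar>"
    using remainder_Taylor[of x y] by blast
  moreover have "\<bar>deriv (deriv h) t - deriv (deriv h) x\<bar> \<le> D + D"
    by (rule order_trans[OF abs_triangle_ineq4 add_mono[OF assms assms]])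
  ultimately show ?thesis by simp
qed

text \<open>Continuity of the second derivative at \<open>z\<close> suffices because the
  intermediate points are squeezed towards \<open>z\<close> together with both arguments.\<close>

lemma remainder_tendsto:
  assumes "x \<longlonglongrightarrow> z" "y \<longlonglongrightarrow> z"
  shows "(\<lambda>n. remainder (x n) (y n)) \<longlonglongrightarrow> 0"
proof -
  have "\<forall>n. \<exists>t. \<bar>t - x n\<bar> \<le> \<bar>y n - x n\<bar> \<and>
      \<bar>remainder (x n) (y n)\<bar> \<le> 1 / 2 * \<bar>deriv (deriv h) t - deriv (deriv h) (x n)\<bar>"
    using remainder_Taylor by blast
  from choice[OF this] obtain t where t: "\<And>n. \<bar>t n - x n\<bar> \<le> \<bar>y n - x n\<bar>"
    "\<And>n. \<bar>remainder (x n) (y n)\<bar> \<le> 1 / 2 * \<bar>deriv (deriv h) (t n) - deriv (deriv h) (x n)\<bar>"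
    by blast
  have "(\<lambda>n. \<bar>y n - x n\<bar>) \<longlonglongrightarrow> \<bar>z - z\<bar>" by (intro tendsto_intros assms)
  then have yx: "(\<lambda>n. \<bar>y n - x n\<bar>) \<longlonglongrightarrow> 0" by simp
  have "(\<lambda>n. t n - x n) \<longlonglongrightarrow> 0"
    by (rule Lim_null_comparison[OF always_eventually yx], rule allI) (simp add: t(1))
  from tendsto_add[OF this assms(1)] have tz: "t \<longlonglongrightarrow> z" by simp
  have c: "isCont (deriv (deriv h)) z" using h_C2(3) by (simp add: continuous_on_eq_continuous_at)
  have "(\<lambda>n. 1 / 2 * \<bar>deriv (deriv h) (t n) - deriv (deriv h) (x n)\<bar>) \<longlonglongrightarrow> 1 / 2 * \<bar>deriv (deriv h) z - deriv (deriv h) z\<bar>"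
    by (intro tendsto_intros isCont_tendsto_compose[OF c] tz assms)
  then have rt: "(\<lambda>n. 1 / 2 * \<bar>deriv (deriv h) (t n) - deriv (deriv h) (x n)\<bar>) \<longlonglongrightarrow> 0" by simp
  show ?thesis
    by (rule Lim_null_comparison[OF always_eventually rt], rule allI) (simp only: real_norm_def t(2))
qed

lemma remainder_measurable: "(\<lambda>(x, y). remainder x y) \<in> borel_measurable (borel \<Otimes>\<^sub>M borel)"
  unfolding remainder_def by measurable

definition mean_h :: "real \<Rightarrow> real" where "mean_h t = (\<integral>\<omega>. h (X t \<omega>) \<partial>P)"
definition mean_deriv :: "real \<Rightarrow> real" where "mean_deriv t = (\<integral>\<omega>. deriv h (X t \<omega>) \<partial>P)"
definition mean_generator :: "real \<Rightarrow> real" where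
  "mean_generator t = (\<integral>\<omega>. generator b \<sigma> (\<mu> t) h (X t \<omega>) \<partial>P)"

lemma h_X_integrable:
  assumes t: "0 \<le> t" shows "integrable P (\<lambda>\<omega>. h (X t \<omega>))"
proof (rule Bochner_Integration.integrable_bound)
  show "integrable P (\<lambda>\<omega>. \<bar>h 0\<bar> + M * \<bar>X t \<omega>\<bar>)"
    using square_integrable_imp_integrable[OF X_square_integrable[OF t]] by simp
  show "(\<lambda>\<omega>. h (X t \<omega>)) \<in> borel_measurable P" using X_measurable[OF t] by measurable
  have "\<bar>h x\<bar> \<le> \<bar>\<bar>h 0\<bar> + M * \<bar>x\<bar>\<bar>" for x using h_bilipschitz[of x 0] by simp linarith
  then show "AE \<omega> in P. norm (h (X t \<omega>)) \<le> norm (\<bar>h 0\<bar> + M * \<bar>X t \<omega>\<bar>)" by simp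
qed

lemma bounded_mult_integrable:
  fixes g :: "real \<Rightarrow> real" and Y :: "'a \<Rightarrow> real"
  assumes t: "0 \<le> t" and g: "g \<in> borel_measurable borel" "\<And>x. \<bar>g x\<bar> \<le> D" and Y: "integrable P Y"
  shows "integrable P (\<lambda>\<omega>. g (X t \<omega>) * Y \<omega>)"
proof (rule Bochner_Integration.integrable_bound)
  show "integrable P (\<lambda>\<omega>. D * \<bar>Y \<omega>\<bar>)" using Y by simp
  note [measurable] = X_measurable[OF t] borel_measurable_integrable[OF Y] g(1)
  show "(\<lambda>\<omega>. g (X t \<omega>) * Y \<omega>) \<in> borel_measurable P" by measurable
  have "\<bar>g x\<bar> \<le> \<bar>D\<bar>" for x using g(2)[of x] by linarith
  then show "AE \<omega> in P. norm (g (X t \<omega>) * Y \<omega>) \<le> norm (D * \<bar>Y \<omega>\<bar>)"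
    by (intro AE_I2) (simp add: abs_mult mult_right_mono)
qed

lemma mean_generator_eq:
  assumes t: "0 \<le> t"
  shows "mean_generator t = (\<integral>\<omega>. deriv h (X t \<omega>) * b (X t \<omega>) (\<mu> t) \<partial>P) + 1 / 2 * (\<integral>\<omega>. deriv (deriv h) (X t \<omega>) * (H t \<omega>)\<^sup>2 \<partial>P)"
proof -
  obtain D where D: "\<And>x. \<bar>deriv h x\<bar> \<le> D" "\<And>x. \<bar>deriv (deriv h) x\<bar> \<le> D" using derivative_bound by metis
  have 1: "integrable P (\<lambda>\<omega>. deriv h (X t \<omega>) * b (X t \<omega>) (\<mu> t))"
    by (rule bounded_mult_integrable[OF t h_measurable(2) D(1) square_integrable_imp_integrable[OF coeff_square_integrable(1)[OF t]]])
  have 2: "integrable P (\<lambda>\<omega>. deriv (deriv h) (X t \<omega>) * (H t \<omega>)\<^sup>2)"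
    by (rule bounded_mult_integrable[OF t h_measurable(3) D(2) square_integrableD(2)[OF coeff_square_integrable(2)[OF t]]])
  have "mean_generator t = (\<integral>\<omega>. deriv h (X t \<omega>) * b (X t \<omega>) (\<mu> t) + 1 / 2 * (deriv (deriv h) (X t \<omega>) * (H t \<omega>)\<^sup>2) \<partial>P)"
    unfolding mean_generator_def generator_def by (intro Bochner_Integration.integral_cong) (auto simp: mult_ac)
  then show ?thesis using 1 2 by simp
qed

lemma mean_deriv_ge: "0 \<le> t \<Longrightarrow> m \<le> mean_deriv t"
proof -
  assume t: "0 \<le> t"
  obtain D where D: "\<And>x. \<bar>deriv h x\<bar> \<le> D" using derivative_bound by metis
  have "(\<integral>\<omega>. m \<partial>P) \<le> mean_deriv t"
    unfolding mean_deriv_def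
    by (rule integral_mono) (use bounded_mult_integrable[OF t h_measurable(2) D, of "\<lambda>_. 1"] deriv_h_ge in auto)
  then show ?thesis by (simp add: prob_space)
qed

text \<open>\<open>\<rho>\<close> is a common measure of smallness, chosen so that every error term
  is \<open>\<rho>\<close> times \<open>v - u\<close> or \<open>\<rho>\<close> times
  \<open>K v - K u\<close>. The increment of \<open>X\<close> is split into frozen drift
  \<open>bu * \<Delta>\<close>, drift error \<open>\<alpha>\<close>, reflection
  \<open>\<kappa>\<close>, frozen stochastic part \<open>W\<close> and its error \<open>e\<close>.
  In the quadratic term only the square of \<open>W\<close> is of first order in time. The constant
  on the right merely collects all terms; what matters is that it depends on neither
  \<open>u\<close> nor \<open>v\<close>.\<close>

lemma expansion_bound:
  assumes uv: "0 \<le> u" "u \<le> v" "v \<le> T" and CG: "0 \<le> C" "0 \<le> G"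
    and C: "\<And>t x. t \<in> {0..T} \<Longrightarrow> \<bar>b x (\<mu> t)\<bar> \<le> C + L * \<bar>x\<bar> \<and> \<bar>\<sigma> x (\<mu> t)\<bar> \<le> C + L * \<bar>x\<bar>"
    and G: "\<And>t. t \<in> {0..T} \<Longrightarrow> (\<integral>\<omega>. (C + L * \<bar>X t \<omega>\<bar>)\<^sup>2 \<partial>P) \<le> G\<^sup>2"
    and D: "0 \<le> D" "\<And>x. \<bar>deriv h x\<bar> \<le> D" "\<And>x. \<bar>deriv (deriv h) x\<bar> \<le> D"
    and \<rho>: "0 \<le> \<rho>" "\<rho> \<le> 1" "v - u \<le> \<rho>\<^sup>2" "K v - K u \<le> \<rho>"
    and inc: "\<And>r. r \<in> {u..v} \<Longrightarrow> increment_sq u r \<le> \<rho>\<^sup>2"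
    and rem: "(\<integral>\<omega>. (remainder (X u \<omega>) (X v \<omega>) * H u \<omega>)\<^sup>2 \<partial>P) \<le> \<rho>\<^sup>2"
  shows "\<bar>mean_h v - mean_h u - mean_generator u * (v - u) - mean_deriv u * (K v - K u)\<bar> \<le>
    \<rho> * (2 * D * L + 2 * D * (5 * G\<^sup>2 + 12 * L\<^sup>2 + 4 * L * G) + 2 * G + 2 * D * (3 + 2 * G)) * ((v - u) + (K v - K u))"
proof -
  define \<Delta> where "\<Delta> = v - u"
  define \<kappa> where "\<kappa> = K v - K u"
  have v0: "0 \<le> v" using uv by simp
  have \<Delta>: "0 \<le> \<Delta>" "\<Delta> \<le> \<rho>\<^sup>2" using uv \<rho> by (auto simp: \<Delta>_def)
  have \<kappa>: "0 \<le> \<kappa>" "\<kappa> \<le> \<rho>" using \<rho> mono_onD[OF K_mono, of u v] uv by (auto simp: \<kappa>_def)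
  define bu where "bu \<omega> = b (X u \<omega>) (\<mu> u)" for \<omega>
  define Hu where "Hu = H u"
  define W where "W \<omega> = Hu \<omega> * (B v \<omega> - B u \<omega>)" for \<omega>
  define DX where "DX \<omega> = X v \<omega> - X u \<omega>" for \<omega>
  define DJ where "DJ \<omega> = J v \<omega> - J u \<omega>" for \<omega>
  \<comment> \<open>Almost surely the drift integral over \<open>{u..v}\<close>; defining it as a
    difference makes measurability and square integrability immediate.\<close>
  define I where "I \<omega> = DX \<omega> - \<kappa> - DJ \<omega>" for \<omega>
  define \<alpha> where "\<alpha> \<omega> = I \<omega> - bu \<omega> * \<Delta>" for \<omega>
  define e where "e \<omega> = DJ \<omega> - W \<omega>" for \<omega>
  define Z where "Z \<omega> = deriv h (X u \<omega>)" for \<omega>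
  define Z2 where "Z2 \<omega> = deriv (deriv h) (X u \<omega>)" for \<omega>
  define r where "r \<omega> = remainder (X u \<omega>) (X v \<omega>)" for \<omega>
  note Xu [measurable] = X_measurable[OF uv(1)] and Xv [measurable] = X_measurable[OF v0]
  note drift = drift_integral_square[OF uv C G]
  have sDX: "square_integrable P DX" unfolding DX_def[abs_def] by (rule X_diff_square_integrable[OF uv(1) v0])
  have sDJ: "square_integrable P DJ" unfolding DJ_def[abs_def] by (rule drift(3))
  have sI: "square_integrable P I"
    unfolding I_def[abs_def] by (intro square_integrable_diff sDX sDJ square_integrable_const)
  have sbu: "square_integrable P bu" unfolding bu_def[abs_def] by (rule coeff_square_integrable(1)[OF uv(1)])
  have sHu: "square_integrable P Hu" unfolding Hu_def by (rule coeff_square_integrable(2)[OF uv(1)])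
  have s\<alpha>: "square_integrable P \<alpha>"
    unfolding \<alpha>_def[abs_def] using square_integrable_cmult[OF sbu, of \<Delta>]
    by (intro square_integrable_diff sI) (simp add: mult.commute)
  have piece: "piece Hu u v"
    unfolding piece_def using uv sHu H_measurable_F[OF uv(1)] by (auto simp: Hu_def)
  have sW: "square_integrable P W" unfolding W_def[abs_def] by (rule piece_increment[OF piece])
  have se: "square_integrable P e" unfolding e_def[abs_def] by (intro square_integrable_diff sDJ sW)
  have Hu2: "(\<integral>\<omega>. (Hu \<omega>)\<^sup>2 \<partial>P) \<le> G\<^sup>2"
  proof -
    have "(\<integral>\<omega>. (Hu \<omega>)\<^sup>2 \<partial>P) \<le> (\<integral>\<omega>. (C + L * \<bar>X u \<omega>\<bar>)\<^sup>2 \<partial>P)"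
    proof (intro integral_mono square_integrableD(2) sHu growth_square_integrable uv)
      show "(Hu \<omega>)\<^sup>2 \<le> (C + L * \<bar>X u \<omega>\<bar>)\<^sup>2" for \<omega>
        unfolding Hu_def using C[of u "X u \<omega>"] uv by (intro abs_le_square_iff[THEN iffD1]) fastforce
    qed
    then show ?thesis using G[of u] uv by simp
  qed
  have I2: "(\<integral>\<omega>. (I \<omega>)\<^sup>2 \<partial>P) \<le> (\<Delta> * G)\<^sup>2"
  proof -
    obtain A where A: "square_integrable P A" "(\<integral>\<omega>. (A \<omega>)\<^sup>2 \<partial>P) \<le> (v - u)\<^sup>2 * G\<^sup>2"
      "AE \<omega> in P. \<bar>LINT r:{u..v}|lborel. b (X r \<omega>) (\<mu> r)\<bar> \<le> A \<omega>"
      using drift(1) by blast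
    have "(\<integral>\<omega>. (I \<omega>)\<^sup>2 \<partial>P) \<le> (\<integral>\<omega>. (A \<omega>)\<^sup>2 \<partial>P)"
    proof (rule integral_mono_AE[OF square_integrableD(2)[OF sI] square_integrableD(2)[OF A(1)]])
      show "AE \<omega> in P. (I \<omega>)\<^sup>2 \<le> (A \<omega>)\<^sup>2"
        using A(3) path_increment[OF uv(1,2)]
      proof eventually_elim
        case (elim \<omega>)
        then have "\<bar>I \<omega>\<bar> \<le> A \<omega>" by (simp add: I_def DX_def DJ_def \<kappa>_def)
        then show ?case by (intro abs_le_square_iff[THEN iffD1]) linarith
      qed
    qed
    with A(2) show ?thesis by (simp add: \<Delta>_def power_mult_distrib)
  qed
  \<comment> \<open>One majorant for the increments of both coefficients since time
    \<open>u\<close>; \<open>\<rho>\<close> bounds the Wasserstein part, and \<open>XV\<close> makes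
    it continuous in time for every path.\<close>
  define f where "f t \<omega> = L * (\<bar>XV t \<omega> - XV u \<omega>\<bar> + \<rho>)" for t \<omega>
  have f0: "0 \<le> f t \<omega>" for t \<omega> using L_pos \<rho> by (simp add: f_def)
  have fm: "(\<lambda>(\<omega>, t). f t \<omega>) \<in> borel_measurable (P \<Otimes>\<^sub>M lborel)"
  proof -
    note [measurable] = XV_props(1) XV_props(4)[of u]
    show ?thesis unfolding f_def by measurable
  qed
  have fc: "continuous_on S (\<lambda>t. f t \<omega>)" for S \<omega>
    unfolding f_def by (intro continuous_intros continuous_on_subset[OF XV_props(2)]) auto
  have fQ: "square_integrable P (f t) \<and> (\<integral>\<omega>. (f t \<omega>)\<^sup>2 \<partial>P) \<le> (2 * L * \<rho>)\<^sup>2" if t: "t \<in> {u..v}" for t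
  proof
    have t0: "0 \<le> t" using t uv by simp
    have sd: "square_integrable P (\<lambda>\<omega>. XV t \<omega> - XV u \<omega>)" by (intro square_integrable_diff XV_square_integrable t0 uv)
    show sf: "square_integrable P (f t)"
      unfolding f_def[abs_def]
      by (intro square_integrable_cmult square_integrable_add square_integrable_abs sd square_integrable_const)
    have "(\<integral>\<omega>. (f t \<omega>)\<^sup>2 \<partial>P) \<le> (\<integral>\<omega>. L\<^sup>2 * (2 * (XV t \<omega> - XV u \<omega>)\<^sup>2 + 2 * \<rho>\<^sup>2) \<partial>P)"
    proof (rule integral_mono[OF square_integrableD(2)[OF sf]])
      show "(f t \<omega>)\<^sup>2 \<le> L\<^sup>2 * (2 * (XV t \<omega> - XV u \<omega>)\<^sup>2 + 2 * \<rho>\<^sup>2)" for \<omega>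
        unfolding f_def power_mult_distrib[of L]
        using add2_square_le[of "\<bar>XV t \<omega> - XV u \<omega>\<bar>" \<rho>] by (intro mult_left_mono) auto
    qed (use square_integrableD(2)[OF sd] in simp)
    also have "\<dots> = L\<^sup>2 * (2 * increment_sq u t + 2 * \<rho>\<^sup>2)"
    proof -
      have "(\<integral>\<omega>. (XV t \<omega> - XV u \<omega>)\<^sup>2 \<partial>P) = increment_sq u t"
        unfolding increment_sq_def by (rule XV_integral_cong[OF t0 uv(1), of "\<lambda>x y. (x - y)\<^sup>2"]) measurable
      then show ?thesis using square_integrableD(2)[OF sd] by (simp add: prob_space)
    qed
    also have "\<dots> \<le> L\<^sup>2 * (2 * \<rho>\<^sup>2 + 2 * \<rho>\<^sup>2)" using inc[OF t] by (intro mult_left_mono add_right_mono) auto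
    finally show "(\<integral>\<omega>. (f t \<omega>)\<^sup>2 \<partial>P) \<le> (2 * L * \<rho>)\<^sup>2" by (simp add: power_mult_distrib)
  qed
  note tf = time_integral_square[OF uv(2) fm fc fQ]
  have coeff_f: "\<bar>b (X t \<omega>) (\<mu> t) - bu \<omega>\<bar> \<le> f t \<omega>" "\<bar>H t \<omega> - Hu \<omega>\<bar> \<le> f t \<omega>"
    if "\<forall>t\<ge>0. XV t \<omega> = X t \<omega>" and t: "t \<in> {u..v}" for t \<omega>
  proof -
    have t0: "0 \<le> t" using t uv by simp
    have "sqrt (increment_sq u t) \<le> \<rho>" using inc[OF t] \<rho>(1) by (rule real_le_lsqrt[rotated])
    then have "L * (\<bar>X t \<omega> - X u \<omega>\<bar> + sqrt (increment_sq u t)) \<le> f t \<omega>"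
      unfolding f_def using that(1) t0 uv L_pos by (intro mult_left_mono add_mono) auto
    then show "\<bar>b (X t \<omega>) (\<mu> t) - bu \<omega>\<bar> \<le> f t \<omega>" "\<bar>H t \<omega> - Hu \<omega>\<bar> \<le> f t \<omega>"
      using coeff_increment_le[OF uv(1) t0, of \<omega>] unfolding bu_def Hu_def by linarith+
  qed
  have \<alpha>2: "(\<integral>\<omega>. (\<alpha> \<omega>)\<^sup>2 \<partial>P) \<le> (\<Delta> * (2 * L * \<rho>))\<^sup>2"
  proof -
    have "(\<integral>\<omega>. (\<alpha> \<omega>)\<^sup>2 \<partial>P) \<le> (\<integral>\<omega>. (LINT t:{u..v}|lborel. \<bar>f t \<omega>\<bar>)\<^sup>2 \<partial>P)"
    proof (rule integral_mono_AE[OF square_integrableD(2)[OF s\<alpha>] square_integrableD(2)[OF tf(3)]])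
      show "AE \<omega> in P. (\<alpha> \<omega>)\<^sup>2 \<le> (LINT t:{u..v}|lborel. \<bar>f t \<omega>\<bar>)\<^sup>2"
        using path_increment[OF uv(1,2)] XV_props(3)
      proof eventually_elim
        case (elim \<omega>)
        have bi: "set_integrable lborel {u..v} (\<lambda>t. b (X t \<omega>) (\<mu> t))" using elim by blast
        have ci: "set_integrable lborel {u..v} (\<lambda>t. bu \<omega>)" by (intro borel_integrable_atLeastAtMost' continuous_on_const)
        have fi: "set_integrable lborel {u..v} (\<lambda>t. f t \<omega>)" by (intro borel_integrable_atLeastAtMost' fc)
        have "(LINT t:{u..v}|lborel. bu \<omega>) = bu \<omega> * \<Delta>"
          using uv by (subst set_integral_continuous_eq) (auto simp: \<Delta>_def)
        then have "\<alpha> \<omega> = (LINT t:{u..v}|lborel. b (X t \<omega>) (\<mu> t) - bu \<omega>)"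
          using elim by (simp add: set_integral_diff(2)[OF bi ci] \<alpha>_def I_def DX_def DJ_def \<kappa>_def)
        also have "\<bar>\<dots>\<bar> \<le> (LINT t:{u..v}|lborel. \<bar>b (X t \<omega>) (\<mu> t) - bu \<omega>\<bar>)"
          using set_integral_norm_bound[OF set_integral_diff(1)[OF bi ci]] by simp
        also have "\<dots> \<le> (LINT t:{u..v}|lborel. \<bar>f t \<omega>\<bar>)"
          by (intro set_integral_mono set_integrable_abs set_integral_diff(1) bi ci fi)
             (use coeff_f(1)[OF elim(2)] f0 in auto)
        finally show ?case by (intro abs_le_square_iff[THEN iffD1]) linarith
      qed
    qed auto
    also have "\<dots> \<le> \<Delta>\<^sup>2 * (2 * L * \<rho>)\<^sup>2" using tf(4) by (simp add: \<Delta>_def)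
    finally show ?thesis by (simp add: power_mult_distrib)
  qed
  have e2: "(\<integral>\<omega>. (e \<omega>)\<^sup>2 \<partial>P) \<le> (2 * L * \<rho> * sqrt \<Delta>)\<^sup>2"
  proof -
    \<comment> \<open>A family with a single piece, the integrand frozen at time
      \<open>u\<close>.\<close>
    have pI: "pieces_integral B {0::nat} (\<lambda>_. Hu) (\<lambda>_. u) (\<lambda>_. v) = W"
      by (simp add: pieces_integral_def W_def fun_eq_iff)
    have "(\<integral>\<omega>. (e \<omega>)\<^sup>2 \<partial>P) \<le> (\<integral>\<omega>. residual u v {0::nat} (\<lambda>_. Hu) (\<lambda>_. u) (\<lambda>_. v) \<omega> \<partial>P)"
      using Ito_inequality(2)[OF uv(1,2) order_refl energy_integrable[OF v0], of "{0::nat}" "\<lambda>_. Hu" "\<lambda>_. u" "\<lambda>_. v"] piece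
      unfolding pI e_def DJ_def by simp
    also have "\<dots> \<le> (\<integral>\<omega>. (\<integral>t. (indicator {u..v} t * f t \<omega>)\<^sup>2 \<partial>lborel) \<partial>P)"
    proof (rule integral_mono_AE'[OF tf(1)])
      show "AE \<omega> in P. residual u v {0::nat} (\<lambda>_. Hu) (\<lambda>_. u) (\<lambda>_. v) \<omega> \<le> (\<integral>t. (indicator {u..v} t * f t \<omega>)\<^sup>2 \<partial>lborel)"
        using XV_props(3)
      proof eventually_elim
        case (elim \<omega>)
        have fsq: "integrable lborel (\<lambda>t. (indicator {u..v} t * f t \<omega>)\<^sup>2)"
          by (rule square_integrableD(2)[OF square_integrable_continuous_Icc[OF fc]])
        show ?case
          unfolding residual_def pieces_value_def
        proof (rule integral_mono_AE'[OF fsq], intro AE_I2)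
          fix t :: real
          show "(indicator {u<..v} t * H t \<omega> - (\<Sum>i\<in>{0::nat}. Hu \<omega> * indicator {u<..v} t))\<^sup>2 \<le> (indicator {u..v} t * f t \<omega>)\<^sup>2"
          proof (cases "t \<in> {u<..v}")
            case True
            then have "\<bar>H t \<omega> - Hu \<omega>\<bar> \<le> \<bar>f t \<omega>\<bar>" using coeff_f(2)[OF elim, of t] f0[of t \<omega>] by auto
            then show ?thesis using True by (simp add: abs_le_square_iff)
          qed simp
        qed simp
      qed
    qed (auto intro!: Bochner_Integration.integral_nonneg)
    also have "\<dots> \<le> \<Delta> * (2 * L * \<rho>)\<^sup>2" using tf(2) by (simp add: \<Delta>_def)
    finally show ?thesis using \<Delta> by (simp add: power_mult_distrib mult_ac)
  qed
  have W2: "(\<integral>\<omega>. (W \<omega>)\<^sup>2 \<partial>P) \<le> (G * sqrt \<Delta>)\<^sup>2"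
  proof -
    have "(\<integral>\<omega>. (W \<omega>)\<^sup>2 \<partial>P) = (\<integral>\<omega>. (Hu \<omega>)\<^sup>2 * (B v \<omega> - B u \<omega>)\<^sup>2 \<partial>P)"
      by (simp add: W_def power_mult_distrib)
    also have "\<dots> = (\<integral>\<omega>. (Hu \<omega>)\<^sup>2 \<partial>P) * \<Delta>"
      unfolding \<Delta>_def using H_measurable_F[OF uv(1)]
      by (intro B_increment_mult2 uv square_integrableD(2)[OF sHu]) (auto simp: Hu_def)
    also have "\<dots> \<le> G\<^sup>2 * \<Delta>" using Hu2 \<Delta> by (intro mult_right_mono)
    finally show ?thesis using \<Delta> by (simp add: power_mult_distrib)
  qed
  \<comment> \<open>The fourth moment of the increment is used here: the term "remainder times
    \<open>W\<close> squared" is split as \<open>(r * Hu)\<close> times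
    \<open>(Hu * (B v - B u)\<^sup>2)\<close>, so Cauchy-Schwarz asks only for a second moment of
    \<open>Hu\<close>.\<close>
  have sHB: "square_integrable P (\<lambda>\<omega>. Hu \<omega> * (B v \<omega> - B u \<omega>)\<^sup>2)"
    and HB: "(\<integral>\<omega>. (Hu \<omega> * (B v \<omega> - B u \<omega>)\<^sup>2)\<^sup>2 \<partial>P) \<le> (2 * G * \<Delta>)\<^sup>2"
  proof -
    have eq: "(Hu \<omega> * (B v \<omega> - B u \<omega>)\<^sup>2)\<^sup>2 = (Hu \<omega>)\<^sup>2 * (B v \<omega> - B u \<omega>) ^ 4" for \<omega>
      by (simp add: power_mult_distrib)
    have i4: "integrable P (\<lambda>\<omega>. (Hu \<omega>)\<^sup>2 * (B v \<omega> - B u \<omega>) ^ 4)"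
      "(\<integral>\<omega>. (Hu \<omega>)\<^sup>2 * (B v \<omega> - B u \<omega>) ^ 4 \<partial>P) = 3 * (\<integral>\<omega>. (Hu \<omega>)\<^sup>2 \<partial>P) * (v - u)\<^sup>2"
      using H_measurable_F[OF uv(1)]
      by (intro B_increment_mult4 uv square_integrableD(2)[OF sHu]; simp add: Hu_def)+
    note [measurable] = square_integrableD(1)[OF sHu] B_measurable[OF uv(1)] B_measurable[OF v0]
    have "(\<lambda>\<omega>. Hu \<omega> * (B v \<omega> - B u \<omega>)\<^sup>2) \<in> borel_measurable P" by measurable
    then show "square_integrable P (\<lambda>\<omega>. Hu \<omega> * (B v \<omega> - B u \<omega>)\<^sup>2)"
      using i4(1) by (auto simp: square_integrable_def eq)
    have "(\<integral>\<omega>. (Hu \<omega> * (B v \<omega> - B u \<omega>)\<^sup>2)\<^sup>2 \<partial>P) = 3 * (\<integral>\<omega>. (Hu \<omega>)\<^sup>2 \<partial>P) * \<Delta>\<^sup>2"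
      unfolding eq \<Delta>_def by (rule i4(2))
    \<comment> \<open>The Gaussian constant 3 is raised to 4 to make the bound a perfect
      square.\<close>
    also have "\<dots> \<le> 4 * G\<^sup>2 * \<Delta>\<^sup>2" using Hu2 by (intro mult_right_mono mult_mono) auto
    finally show "(\<integral>\<omega>. (Hu \<omega> * (B v \<omega> - B u \<omega>)\<^sup>2)\<^sup>2 \<partial>P) \<le> (2 * G * \<Delta>)\<^sup>2" by (simp add: power_mult_distrib)
  qed
  have srH: "square_integrable P (\<lambda>\<omega>. r \<omega> * Hu \<omega>)"
  proof (rule square_integrable_bounded_mult[OF sHu])
    show "r \<in> borel_measurable P"
      using measurable_compose[OF measurable_Pair[OF Xu Xv] remainder_measurable] by (simp add: r_def[abs_def])
    show "\<bar>r \<omega>\<bar> \<le> D" for \<omega> unfolding r_def by (rule remainder_bound[OF D(3)])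
  qed
  define S where "S \<omega> = D * \<bar>\<alpha> \<omega>\<bar> + 2 * D * (3 * ((I \<omega>)\<^sup>2 + \<kappa>\<^sup>2 + (e \<omega>)\<^sup>2) + 2 * \<bar>I \<omega> * W \<omega>\<bar> + 2 * \<kappa> * \<bar>W \<omega>\<bar> + 2 * \<bar>e \<omega> * W \<omega>\<bar>)
    + \<bar>(r \<omega> * Hu \<omega>) * (Hu \<omega> * (B v \<omega> - B u \<omega>)\<^sup>2)\<bar>" for \<omega>
  \<comment> \<open>The terms with \<open>DJ\<close> and with the square of \<open>W\<close> are
    subtracted path by path although they are not small: only their expectations are explicit,
    namely 0 and the second order part of the generator.\<close>
  define R where "R \<omega> = h (X v \<omega>) - h (X u \<omega>) - \<Delta> * (Z \<omega> * bu \<omega>) - \<kappa> * Z \<omega> - Z \<omega> * DJ \<omega> - 1 / 2 * (Z2 \<omega> * (W \<omega>)\<^sup>2)" for \<omega>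
  have Z: "\<bar>Z \<omega>\<bar> \<le> D" "\<bar>Z2 \<omega>\<bar> \<le> D" for \<omega> using D(2,3) by (auto simp: Z_def Z2_def)
  have RS: "\<bar>R \<omega>\<bar> \<le> S \<omega>" for \<omega>
  proof -
    \<comment> \<open>The part of the squared increment beyond \<open>W\<close> squared. Each
      product in its expansion contains a factor \<open>I\<close>, \<open>\<kappa>\<close> or
      \<open>e\<close>, which is of higher order or proportional to the reflection.\<close>
    define Q where "Q = (DX \<omega>)\<^sup>2 - (W \<omega>)\<^sup>2"
    define Y where "Y = I \<omega> + \<kappa> + e \<omega>"
    have DXY: "DX \<omega> = W \<omega> + Y" by (simp add: Y_def I_def e_def)
    have "Q = Y\<^sup>2 + 2 * (Y * W \<omega>)" unfolding Q_def DXY by (simp add: power2_eq_square algebra_simps)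
    moreover have "Y * W \<omega> = I \<omega> * W \<omega> + \<kappa> * W \<omega> + e \<omega> * W \<omega>" by (simp add: Y_def algebra_simps)
    moreover have "Y\<^sup>2 \<le> 3 * ((I \<omega>)\<^sup>2 + \<kappa>\<^sup>2 + (e \<omega>)\<^sup>2)" unfolding Y_def by (rule add3_square_le)
    moreover have "\<bar>\<kappa> * W \<omega>\<bar> = \<kappa> * \<bar>W \<omega>\<bar>" using \<kappa> by (simp add: abs_mult)
    moreover have "0 \<le> Y\<^sup>2" by simp
    ultimately have Q: "\<bar>Q\<bar> \<le> 3 * ((I \<omega>)\<^sup>2 + \<kappa>\<^sup>2 + (e \<omega>)\<^sup>2) + 2 * \<bar>I \<omega> * W \<omega>\<bar> + 2 * \<kappa> * \<bar>W \<omega>\<bar> + 2 * \<bar>e \<omega> * W \<omega>\<bar>"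
      by linarith
    have "h (X v \<omega>) - h (X u \<omega>) = Z \<omega> * DX \<omega> + 1 / 2 * Z2 \<omega> * (DX \<omega>)\<^sup>2 + r \<omega> * (DX \<omega>)\<^sup>2"
      unfolding Z_def Z2_def r_def DX_def by (rule remainder_eq)
    moreover have "DX \<omega> = bu \<omega> * \<Delta> + \<alpha> \<omega> + \<kappa> + DJ \<omega>" by (simp add: \<alpha>_def I_def)
    then have "Z \<omega> * DX \<omega> = \<Delta> * (Z \<omega> * bu \<omega>) + Z \<omega> * \<alpha> \<omega> + \<kappa> * Z \<omega> + Z \<omega> * DJ \<omega>" by (simp add: algebra_simps)
    moreover have "(DX \<omega>)\<^sup>2 = (W \<omega>)\<^sup>2 + Q" by (simp add: Q_def)
    ultimately have R_eq: "R \<omega> = Z \<omega> * \<alpha> \<omega> + 1 / 2 * (Z2 \<omega> * Q) + (r \<omega> * (W \<omega>)\<^sup>2 + r \<omega> * Q)"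
      unfolding R_def by (simp add: algebra_simps)
    have b: "\<bar>Z \<omega> * \<alpha> \<omega>\<bar> \<le> D * \<bar>\<alpha> \<omega>\<bar>" "\<bar>Z2 \<omega> * Q\<bar> \<le> D * \<bar>Q\<bar>" "\<bar>r \<omega> * Q\<bar> \<le> D * \<bar>Q\<bar>" "0 \<le> D * \<bar>Q\<bar>"
      unfolding abs_mult using Z remainder_bound[OF D(3)] D(1) by (auto simp: r_def intro!: mult_right_mono)
    have rW: "r \<omega> * (W \<omega>)\<^sup>2 = (r \<omega> * Hu \<omega>) * (Hu \<omega> * (B v \<omega> - B u \<omega>)\<^sup>2)"
      by (simp add: W_def power2_eq_square)
    have "\<bar>R \<omega>\<bar> \<le> \<bar>Z \<omega> * \<alpha> \<omega>\<bar> + 1 / 2 * \<bar>Z2 \<omega> * Q\<bar> + (\<bar>r \<omega> * (W \<omega>)\<^sup>2\<bar> + \<bar>r \<omega> * Q\<bar>)"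
      unfolding R_eq by linarith
    also have "\<dots> \<le> D * \<bar>\<alpha> \<omega>\<bar> + 2 * (D * \<bar>Q\<bar>) + \<bar>(r \<omega> * Hu \<omega>) * (Hu \<omega> * (B v \<omega> - B u \<omega>)\<^sup>2)\<bar>"
      unfolding rW using b by linarith
    finally have "\<bar>R \<omega>\<bar> \<le> D * \<bar>\<alpha> \<omega>\<bar> + 2 * (D * \<bar>Q\<bar>) + \<bar>(r \<omega> * Hu \<omega>) * (Hu \<omega> * (B v \<omega> - B u \<omega>)\<^sup>2)\<bar>" .
    moreover have "D * \<bar>Q\<bar> \<le> D * (3 * ((I \<omega>)\<^sup>2 + \<kappa>\<^sup>2 + (e \<omega>)\<^sup>2) + 2 * \<bar>I \<omega> * W \<omega>\<bar> + 2 * \<kappa> * \<bar>W \<omega>\<bar> + 2 * \<bar>e \<omega> * W \<omega>\<bar>)"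
      using D(1) Q by (intro mult_left_mono)
    ultimately show ?thesis unfolding S_def by linarith
  qed
  have iZb: "integrable P (\<lambda>\<omega>. Z \<omega> * bu \<omega>)"
    unfolding Z_def by (rule bounded_mult_integrable[OF uv(1) h_measurable(2) D(2) square_integrable_imp_integrable[OF sbu]])
  have iZ: "integrable P Z"
    using bounded_mult_integrable[OF uv(1) h_measurable(2) D(2), of "\<lambda>_. 1"] by (simp add: Z_def[abs_def])
  have iZJ: "integrable P (\<lambda>\<omega>. Z \<omega> * DJ \<omega>)"
    unfolding Z_def by (rule bounded_mult_integrable[OF uv(1) h_measurable(2) D(2) square_integrable_imp_integrable[OF sDJ]])
  have iZW: "integrable P (\<lambda>\<omega>. Z2 \<omega> * (W \<omega>)\<^sup>2)"
    unfolding Z2_def by (rule bounded_mult_integrable[OF uv(1) h_measurable(3) D(3) square_integrableD(2)[OF sW]])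
  \<comment> \<open>The martingale property removes the term of order square root of
    \<open>\<Delta>\<close>; the weight \<open>Z\<close> is bounded and known at time
    \<open>u\<close>.\<close>
  have ZJ0: "(\<integral>\<omega>. Z \<omega> * DJ \<omega> \<partial>P) = 0"
    unfolding DJ_def
  proof (rule Ito_mean_zero[OF uv(1,2) energy_integrable[OF v0] _ Z(1)])
    show "Z \<in> borel_measurable (F u)"
      unfolding Z_def by (rule measurable_compose[OF X_measurable_F[OF uv(1)] h_measurable(2)])
  qed
  have ZW: "(\<integral>\<omega>. Z2 \<omega> * (W \<omega>)\<^sup>2 \<partial>P) = (\<integral>\<omega>. Z2 \<omega> * (Hu \<omega>)\<^sup>2 \<partial>P) * \<Delta>"
  proof -
    have "(\<integral>\<omega>. Z2 \<omega> * (W \<omega>)\<^sup>2 \<partial>P) = (\<integral>\<omega>. (Z2 \<omega> * (Hu \<omega>)\<^sup>2) * (B v \<omega> - B u \<omega>)\<^sup>2 \<partial>P)"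
      by (simp add: W_def power_mult_distrib mult.assoc)
    also have "\<dots> = (\<integral>\<omega>. Z2 \<omega> * (Hu \<omega>)\<^sup>2 \<partial>P) * (v - u)"
    proof (rule B_increment_mult2(2)[OF uv(1,2)])
      show "integrable P (\<lambda>\<omega>. Z2 \<omega> * (Hu \<omega>)\<^sup>2)"
        unfolding Z2_def by (rule bounded_mult_integrable[OF uv(1) h_measurable(3) D(3) square_integrableD(2)[OF sHu]])
      show "(\<lambda>\<omega>. Z2 \<omega> * (Hu \<omega>)\<^sup>2) \<in> borel_measurable (F u)"
        unfolding Z2_def Hu_def
        by (intro borel_measurable_times borel_measurable_power H_measurable_F uv
            measurable_compose[OF X_measurable_F[OF uv(1)] h_measurable(3)])
    qed
    finally show ?thesis by (simp add: \<Delta>_def)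
  qed
  have iR: "integrable P R" unfolding R_def[abs_def]
    by (intro Bochner_Integration.integrable_diff h_X_integrable uv v0 integrable_mult_right iZb iZ iZJ iZW)
  have "(\<integral>\<omega>. R \<omega> \<partial>P) = mean_h v - mean_h u - \<Delta> * (\<integral>\<omega>. Z \<omega> * bu \<omega> \<partial>P) - \<kappa> * (\<integral>\<omega>. Z \<omega> \<partial>P)
      - (\<integral>\<omega>. Z \<omega> * DJ \<omega> \<partial>P) - 1 / 2 * (\<integral>\<omega>. Z2 \<omega> * (W \<omega>)\<^sup>2 \<partial>P)"
    unfolding R_def mean_h_def using iZb iZ iZJ iZW h_X_integrable[OF uv(1)] h_X_integrable[OF v0] by simp
  also have "\<dots> = mean_h v - mean_h u - mean_generator u * \<Delta> - mean_deriv u * \<kappa>"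
    unfolding ZJ0 ZW unfolding mean_generator_eq[OF uv(1)] mean_deriv_def Z_def bu_def Z2_def Hu_def by (simp add: algebra_simps)
  finally have ER: "mean_h v - mean_h u - mean_generator u * \<Delta> - mean_deriv u * \<kappa> = (\<integral>\<omega>. R \<omega> \<partial>P)" ..
  note i\<alpha> = square_integrable_imp_integrable[OF s\<alpha>]
  note i1 = integrable_abs[OF i\<alpha>] square_integrableD(2)[OF sI] square_integrableD(2)[OF se]
    integrable_abs[OF square_integrable_mult[OF sI sW]] integrable_abs[OF square_integrable_imp_integrable[OF sW]]
    integrable_abs[OF square_integrable_mult[OF se sW]] integrable_abs[OF square_integrable_mult[OF srH sHB]]
  have iS: "integrable P S" unfolding S_def[abs_def]
    by (intro Bochner_Integration.integrable_add integrable_mult_right i1 integrable_const)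
  have "\<bar>\<integral>\<omega>. R \<omega> \<partial>P\<bar> \<le> (\<integral>\<omega>. \<bar>R \<omega>\<bar> \<partial>P)" by (rule integral_abs_bound)
  also have "\<dots> \<le> (\<integral>\<omega>. S \<omega> \<partial>P)" by (rule integral_mono[OF integrable_abs[OF iR] iS RS])
  also have "\<dots> = D * (\<integral>\<omega>. \<bar>\<alpha> \<omega>\<bar> \<partial>P) + 2 * D * (3 * ((\<integral>\<omega>. (I \<omega>)\<^sup>2 \<partial>P) + \<kappa>\<^sup>2 + (\<integral>\<omega>. (e \<omega>)\<^sup>2 \<partial>P))
      + 2 * (\<integral>\<omega>. \<bar>I \<omega> * W \<omega>\<bar> \<partial>P) + 2 * \<kappa> * (\<integral>\<omega>. \<bar>W \<omega>\<bar> \<partial>P) + 2 * (\<integral>\<omega>. \<bar>e \<omega> * W \<omega>\<bar> \<partial>P))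
      + (\<integral>\<omega>. \<bar>(r \<omega> * Hu \<omega>) * (Hu \<omega> * (B v \<omega> - B u \<omega>)\<^sup>2)\<bar> \<partial>P)"
    unfolding S_def using i1
    by (simp only: Bochner_Integration.integral_add Bochner_Integration.integrable_add integrable_mult_right integrable_const
        integral_mult_right_zero lebesgue_integral_const) (simp add: prob_space)
  also have "\<dots> \<le> D * (\<Delta> * (2 * L * \<rho>)) + 2 * D * (3 * ((\<Delta> * G)\<^sup>2 + \<kappa>\<^sup>2 + (2 * L * \<rho> * sqrt \<Delta>)\<^sup>2)
      + 2 * ((\<Delta> * G) * (G * sqrt \<Delta>)) + 2 * \<kappa> * (G * sqrt \<Delta>) + 2 * ((2 * L * \<rho> * sqrt \<Delta>) * (G * sqrt \<Delta>)))
      + \<rho> * (2 * G * \<Delta>)"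
  proof -
    have nn: "0 \<le> \<Delta> * (2 * L * \<rho>)" "0 \<le> \<Delta> * G" "0 \<le> G * sqrt \<Delta>" "0 \<le> 2 * L * \<rho> * sqrt \<Delta>" "0 \<le> 2 * G * \<Delta>"
      using \<Delta> CG L_pos \<rho> by auto
    show ?thesis
      by (intro add_mono mult_left_mono order_refl integral_abs_le_root[OF s\<alpha> \<alpha>2 nn(1)] I2 e2
          Cauchy_Schwarz_integral_le[OF sI sW I2 W2 nn(2,3)] integral_abs_le_root[OF sW W2 nn(3)]
          Cauchy_Schwarz_integral_le[OF se sW e2 W2 nn(4,3)]
          Cauchy_Schwarz_integral_le[OF srH sHB _ HB \<rho>(1) nn(5)])
        (use D(1) \<kappa>(1) rem in \<open>auto simp: r_def Hu_def\<close>)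
  qed
  also have "\<dots> \<le> \<rho> * (2 * D * L + 2 * D * (5 * G\<^sup>2 + 12 * L\<^sup>2 + 4 * L * G) + 2 * G + 2 * D * (3 + 2 * G)) * (\<Delta> + \<kappa>)"
  proof -
    \<comment> \<open>From here on pure bookkeeping: \<open>q \<le> \<rho>\<close> turns each
      surplus half power of \<open>\<Delta>\<close> into a factor \<open>\<rho>\<close>, and
      \<open>\<kappa> \<le> \<rho>\<close> does the same for the square of the reflection.\<close>
    define q where "q = sqrt \<Delta>"
    have q: "0 \<le> q" "q \<le> \<rho>" "q\<^sup>2 = \<Delta>" using \<Delta> \<rho>(1) by (auto simp: q_def intro: real_le_lsqrt)
    have \<rho>2: "\<rho>\<^sup>2 \<le> \<rho>" using \<rho> by (simp add: power2_eq_square mult_left_le)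
    have d2: "\<Delta>\<^sup>2 \<le> \<rho> * \<Delta>" unfolding power2_eq_square using \<Delta> \<rho>2 by (intro mult_right_mono) auto
    have t1: "(\<Delta> * G)\<^sup>2 \<le> (\<rho> * \<Delta>) * G\<^sup>2" unfolding power_mult_distrib by (intro mult_right_mono d2) auto
    have t2: "\<kappa>\<^sup>2 \<le> \<rho> * \<kappa>" unfolding power2_eq_square using \<kappa> by (intro mult_right_mono) auto
    have t3: "(2 * L * \<rho> * q)\<^sup>2 \<le> (\<rho> * \<Delta>) * (4 * L\<^sup>2)"
    proof -
      have "(2 * L * \<rho> * q)\<^sup>2 = (4 * L\<^sup>2 * \<Delta>) * \<rho>\<^sup>2" by (simp add: power_mult_distrib q(3) mult_ac)
      also have "\<dots> \<le> (4 * L\<^sup>2 * \<Delta>) * \<rho>" using \<rho>2 \<Delta> by (intro mult_left_mono) auto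
      finally show ?thesis by (simp add: mult_ac)
    qed
    have t4: "(\<Delta> * G) * (G * q) \<le> (\<rho> * \<Delta>) * G\<^sup>2"
    proof -
      have "(\<Delta> * G) * (G * q) = (\<Delta> * G\<^sup>2) * q" by (simp add: power2_eq_square mult_ac)
      also have "\<dots> \<le> (\<Delta> * G\<^sup>2) * \<rho>" using \<Delta> q by (intro mult_left_mono) auto
      finally show ?thesis by (simp add: mult_ac)
    qed
    have t5: "\<kappa> * (G * q) \<le> (\<rho> * \<kappa>) * G"
    proof -
      have "\<kappa> * (G * q) = (\<kappa> * G) * q" by simp
      also have "\<dots> \<le> (\<kappa> * G) * \<rho>" using \<kappa> CG q by (intro mult_left_mono) auto
      finally show ?thesis by (simp add: mult_ac)
    qed
    have t6: "(2 * L * \<rho> * q) * (G * q) = (\<rho> * \<Delta>) * (2 * L * G)"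
      unfolding q(3)[symmetric] by (simp add: power2_eq_square)
    have "3 * ((\<Delta> * G)\<^sup>2 + \<kappa>\<^sup>2 + (2 * L * \<rho> * q)\<^sup>2) + 2 * ((\<Delta> * G) * (G * q)) + 2 * \<kappa> * (G * q) + 2 * ((2 * L * \<rho> * q) * (G * q))
      \<le> 3 * ((\<rho> * \<Delta>) * G\<^sup>2 + \<rho> * \<kappa> + (\<rho> * \<Delta>) * (4 * L\<^sup>2)) + 2 * ((\<rho> * \<Delta>) * G\<^sup>2) + 2 * ((\<rho> * \<kappa>) * G) + 2 * ((\<rho> * \<Delta>) * (2 * L * G))"
      unfolding t6 mult.assoc[of 2 \<kappa>]
      by (intro add_mono mult_left_mono t1 t2 t3 t4 t5 order_refl) auto
    also have "\<dots> = (\<rho> * \<Delta>) * (5 * G\<^sup>2 + 12 * L\<^sup>2 + 4 * L * G) + (\<rho> * \<kappa>) * (3 + 2 * G)" by (simp add: algebra_simps)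
    finally have "2 * D * (3 * ((\<Delta> * G)\<^sup>2 + \<kappa>\<^sup>2 + (2 * L * \<rho> * q)\<^sup>2) + 2 * ((\<Delta> * G) * (G * q)) + 2 * \<kappa> * (G * q) + 2 * ((2 * L * \<rho> * q) * (G * q)))
      \<le> 2 * D * ((\<rho> * \<Delta>) * (5 * G\<^sup>2 + 12 * L\<^sup>2 + 4 * L * G) + (\<rho> * \<kappa>) * (3 + 2 * G))"
      using D(1) by (intro mult_left_mono) auto
    then have "D * (\<Delta> * (2 * L * \<rho>)) + 2 * D * (3 * ((\<Delta> * G)\<^sup>2 + \<kappa>\<^sup>2 + (2 * L * \<rho> * q)\<^sup>2) + 2 * ((\<Delta> * G) * (G * q)) + 2 * \<kappa> * (G * q) + 2 * ((2 * L * \<rho> * q) * (G * q))) + \<rho> * (2 * G * \<Delta>)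
      \<le> D * (\<Delta> * (2 * L * \<rho>)) + 2 * D * ((\<rho> * \<Delta>) * (5 * G\<^sup>2 + 12 * L\<^sup>2 + 4 * L * G) + (\<rho> * \<kappa>) * (3 + 2 * G)) + \<rho> * (2 * G * \<Delta>)"
      by simp
    also have "\<dots> = (\<rho> * \<Delta>) * (2 * D * L + 2 * D * (5 * G\<^sup>2 + 12 * L\<^sup>2 + 4 * L * G) + 2 * G) + (\<rho> * \<kappa>) * (2 * D * (3 + 2 * G))"
      by (simp add: algebra_simps)
    also have "\<dots> \<le> (\<rho> * \<Delta>) * (2 * D * L + 2 * D * (5 * G\<^sup>2 + 12 * L\<^sup>2 + 4 * L * G) + 2 * G + 2 * D * (3 + 2 * G))
        + (\<rho> * \<kappa>) * (2 * D * L + 2 * D * (5 * G\<^sup>2 + 12 * L\<^sup>2 + 4 * L * G) + 2 * G + 2 * D * (3 + 2 * G))"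
    proof -
      have "0 \<le> 2 * D * L + 2 * D * (5 * G\<^sup>2 + 12 * L\<^sup>2 + 4 * L * G) + 2 * G" "0 \<le> 2 * D * (3 + 2 * G)"
        using D(1) CG L_pos by (auto intro!: add_nonneg_nonneg mult_nonneg_nonneg)
      moreover have "0 \<le> \<rho> * \<Delta>" "0 \<le> \<rho> * \<kappa>" using \<rho>(1) \<Delta>(1) \<kappa>(1) by auto
      ultimately show ?thesis by (intro add_mono[OF mult_left_mono mult_left_mono]) linarith+
    qed
    also have "\<dots> = \<rho> * (2 * D * L + 2 * D * (5 * G\<^sup>2 + 12 * L\<^sup>2 + 4 * L * G) + 2 * G + 2 * D * (3 + 2 * G)) * (\<Delta> + \<kappa>)"
    proof -
      have "(a * x) * c + (a * y) * c = a * c * (x + y)" for a x y c :: real by (simp add: algebra_simps)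
      then show ?thesis .
    qed
    finally show ?thesis unfolding q_def .
  qed
  finally show ?thesis unfolding ER[symmetric] by (simp add: \<Delta>_def \<kappa>_def)
qed

end

section \<open>Continuity in time of the three mean functions, and the local expansion\<close>

context constrained_mean_reflected begin

lemma XV_AE_sequence:
  assumes "\<And>n::nat. 0 \<le> s n"
  shows "AE \<omega> in P. \<forall>n. XV (s n) \<omega> = X (s n) \<omega>"
  using XV_props(3) by (rule eventually_mono) (use assms in auto)

lemma XV_tendsto: "s \<longlonglongrightarrow> x \<Longrightarrow> (\<lambda>n. XV (s n) \<omega>) \<longlonglongrightarrow> XV x \<omega>"
  using XV_props(2)[of \<omega>] by (auto simp: continuous_on_eq_continuous_at intro: isCont_tendsto_compose)

lemma X_AE_tendsto:
  assumes "0 \<le> x" "\<And>n::nat. 0 \<le> s n" "s \<longlonglongrightarrow> x"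
  shows "AE \<omega> in P. (\<lambda>n. X (s n) \<omega>) \<longlonglongrightarrow> X x \<omega>"
  using XV_AE_sequence[of s, OF assms(2)] XV_AE[OF assms(1)]
proof eventually_elim
  case (elim \<omega>)
  then show ?case using XV_tendsto[OF assms(3), of \<omega>] by simp
qed

text \<open>Convergence of \<open>Y n\<close> in mean handles the difference
  \<open>Y n - Y0\<close>, as the weights are bounded; with \<open>Y0\<close> fixed, the continuous
  weights pass to the limit by dominated convergence along almost surely continuous paths.\<close>

lemma weighted_mean_tendsto:
  fixes Y :: "nat \<Rightarrow> 'a \<Rightarrow> real" and g :: "real \<Rightarrow> real"
  assumes s: "0 \<le> x" "\<And>n::nat. 0 \<le> s n" "s \<longlonglongrightarrow> x"
    and g: "continuous_on UNIV g" "\<And>x. \<bar>g x\<bar> \<le> D"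
    and Y: "\<And>n. integrable P (Y n)" "integrable P Y0"
    and lim: "(\<lambda>n. \<integral>\<omega>. \<bar>Y n \<omega> - Y0 \<omega>\<bar> \<partial>P) \<longlonglongrightarrow> 0"
  shows "(\<lambda>n. \<integral>\<omega>. g (X (s n) \<omega>) * Y n \<omega> \<partial>P) \<longlonglongrightarrow> (\<integral>\<omega>. g (X x \<omega>) * Y0 \<omega> \<partial>P)"
proof -
  have gm: "g \<in> borel_measurable borel" by (rule borel_measurable_continuous_onI[OF g(1)])
  note bi = bounded_mult_integrable[OF _ gm g(2)]
  have "(\<lambda>n. \<integral>\<omega>. g (X (s n) \<omega>) * (Y n \<omega> - Y0 \<omega>) \<partial>P) \<longlonglongrightarrow> 0"
  proof (rule Lim_null_comparison[OF always_eventually], rule allI)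
    show "(\<lambda>n. D * (\<integral>\<omega>. \<bar>Y n \<omega> - Y0 \<omega>\<bar> \<partial>P)) \<longlonglongrightarrow> 0" using tendsto_mult_right_zero[OF lim] .
    fix n
    have d: "integrable P (\<lambda>\<omega>. Y n \<omega> - Y0 \<omega>)" using Y by simp
    have "\<bar>\<integral>\<omega>. g (X (s n) \<omega>) * (Y n \<omega> - Y0 \<omega>) \<partial>P\<bar> \<le> (\<integral>\<omega>. \<bar>g (X (s n) \<omega>) * (Y n \<omega> - Y0 \<omega>)\<bar> \<partial>P)"
      by (rule integral_abs_bound)
    also have "\<dots> \<le> (\<integral>\<omega>. D * \<bar>Y n \<omega> - Y0 \<omega>\<bar> \<partial>P)"
      by (rule integral_mono[OF integrable_abs[OF bi[OF s(2) d]]])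
        (use d g(2) in \<open>auto simp: abs_mult intro!: mult_right_mono\<close>)
    finally show "norm (\<integral>\<omega>. g (X (s n) \<omega>) * (Y n \<omega> - Y0 \<omega>) \<partial>P) \<le> D * (\<integral>\<omega>. \<bar>Y n \<omega> - Y0 \<omega>\<bar> \<partial>P)" by simp
  qed
  moreover have "(\<lambda>n. \<integral>\<omega>. g (X (s n) \<omega>) * Y0 \<omega> \<partial>P) \<longlonglongrightarrow> (\<integral>\<omega>. g (X x \<omega>) * Y0 \<omega> \<partial>P)"
  proof (rule integral_dominated_convergence[where w = "\<lambda>\<omega>. D * \<bar>Y0 \<omega>\<bar>"])
    show "(\<lambda>\<omega>. g (X x \<omega>) * Y0 \<omega>) \<in> borel_measurable P" "(\<lambda>\<omega>. g (X (s n) \<omega>) * Y0 \<omega>) \<in> borel_measurable P" for n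
      by (rule borel_measurable_integrable[OF bi[OF _ Y(2)]]; use s in simp)+
    have gc: "isCont g y" for y using g(1) by (simp add: continuous_on_eq_continuous_at)
    show "AE \<omega> in P. (\<lambda>n. g (X (s n) \<omega>) * Y0 \<omega>) \<longlonglongrightarrow> g (X x \<omega>) * Y0 \<omega>"
      using X_AE_tendsto[OF s] by eventually_elim (intro tendsto_mult isCont_tendsto_compose[OF gc] tendsto_const)
    show "AE \<omega> in P. norm (g (X (s n) \<omega>) * Y0 \<omega>) \<le> D * \<bar>Y0 \<omega>\<bar>" for n
      using g(2) by (auto simp: abs_mult intro!: mult_right_mono)
  qed (use Y in simp)
  ultimately have "(\<lambda>n. (\<integral>\<omega>. g (X (s n) \<omega>) * (Y n \<omega> - Y0 \<omega>) \<partial>P) + (\<integral>\<omega>. g (X (s n) \<omega>) * Y0 \<omega> \<partial>P)) \<longlonglongrightarrow> 0 + (\<integral>\<omega>. g (X x \<omega>) * Y0 \<omega> \<partial>P)"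
    by (rule tendsto_add)
  moreover have "(\<integral>\<omega>. g (X (s n) \<omega>) * (Y n \<omega> - Y0 \<omega>) \<partial>P) + (\<integral>\<omega>. g (X (s n) \<omega>) * Y0 \<omega> \<partial>P) = (\<integral>\<omega>. g (X (s n) \<omega>) * Y n \<omega> \<partial>P)" for n
  proof -
    have d: "integrable P (\<lambda>\<omega>. Y n \<omega> - Y0 \<omega>)" using Y by simp
    show ?thesis
      by (subst Bochner_Integration.integral_add[OF bi[OF s(2) d] bi[OF s(2) Y(2)], symmetric]) (simp add: algebra_simps)
  qed
  ultimately show ?thesis by simp
qed

text \<open>The spatial increment and the Wasserstein part each contribute
  \<open>2 * L\<^sup>2\<close> times the mean square increment, which gives the square of
  \<open>2 * L * sqrt\<close> of it.\<close>

lemma coeff_increment_square: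
  assumes st: "0 \<le> s" "0 \<le> t"
  shows "(\<integral>\<omega>. (b (X t \<omega>) (\<mu> t) - b (X s \<omega>) (\<mu> s))\<^sup>2 \<partial>P) \<le> (2 * L * sqrt (increment_sq s t))\<^sup>2"
    and "(\<integral>\<omega>. (H t \<omega> - H s \<omega>)\<^sup>2 \<partial>P) \<le> (2 * L * sqrt (increment_sq s t))\<^sup>2"
proof -
  let ?i = "increment_sq s t"
  note dX = X_diff_square_integrable[OF st]
  have "integrable P (\<lambda>\<omega>. L\<^sup>2 * (2 * (X t \<omega> - X s \<omega>)\<^sup>2 + 2 * ?i))"
    using square_integrableD(2)[OF dX] by simp
  moreover have "(\<integral>\<omega>. L\<^sup>2 * (2 * (X t \<omega> - X s \<omega>)\<^sup>2 + 2 * ?i) \<partial>P) = (2 * L * sqrt ?i)\<^sup>2"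
    using square_integrableD(2)[OF dX] increment_sq_nonneg[of s t]
    by (simp add: prob_space power_mult_distrib increment_sq_def[symmetric])
  moreover have bound: "y\<^sup>2 \<le> L\<^sup>2 * (2 * (X t \<omega> - X s \<omega>)\<^sup>2 + 2 * ?i)" if "\<bar>y\<bar> \<le> L * (\<bar>X t \<omega> - X s \<omega>\<bar> + sqrt ?i)" for y \<omega>
  proof -
    have "y\<^sup>2 \<le> (L * (\<bar>X t \<omega> - X s \<omega>\<bar> + sqrt ?i))\<^sup>2"
      using that by (intro abs_le_square_iff[THEN iffD1]) linarith
    also have "\<dots> \<le> L\<^sup>2 * (2 * (X t \<omega> - X s \<omega>)\<^sup>2 + 2 * ?i)"
      unfolding power_mult_distrib
      using add2_square_le[of "\<bar>X t \<omega> - X s \<omega>\<bar>" "sqrt ?i"] increment_sq_nonneg[of s t] by (intro mult_left_mono) auto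
    finally show ?thesis .
  qed
  ultimately show "(\<integral>\<omega>. (b (X t \<omega>) (\<mu> t) - b (X s \<omega>) (\<mu> s))\<^sup>2 \<partial>P) \<le> (2 * L * sqrt ?i)\<^sup>2"
    and "(\<integral>\<omega>. (H t \<omega> - H s \<omega>)\<^sup>2 \<partial>P) \<le> (2 * L * sqrt ?i)\<^sup>2"
    using integral_mono[OF square_integrableD(2)[OF square_integrable_diff[OF coeff_square_integrable(1)[OF st(2)] coeff_square_integrable(1)[OF st(1)]]] _ bound[OF coeff_increment_le(1)[OF st]]]
      integral_mono[OF square_integrableD(2)[OF square_integrable_diff[OF coeff_square_integrable(2)[OF st(2)] coeff_square_integrable(2)[OF st(1)]]] _ bound[OF coeff_increment_le(2)[OF st]]]
    by auto
qed

lemma sqrt_increment_tendsto: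
  assumes "0 \<le> x" "\<And>n::nat. 0 \<le> s n" "s \<longlonglongrightarrow> x"
  shows "(\<lambda>n. sqrt (increment_sq x (s n))) \<longlonglongrightarrow> 0"
  using tendsto_real_sqrt[OF increment_sq_tendsto[OF assms]] by simp

lemma mean_h_continuous: "continuous_on {0..} mean_h"
  unfolding continuous_on_sequentially comp_def
proof (intro allI ballI impI)
  fix s :: "nat \<Rightarrow> real" and x :: real assume *: "x \<in> {0..}" "(\<forall>n. s n \<in> {0..}) \<and> s \<longlonglongrightarrow> x"
  then have s: "0 \<le> x" "\<And>n. 0 \<le> s n" "s \<longlonglongrightarrow> x" by auto
  have M: "0 \<le> M" using h_bilipschitz[of 1 0] m_pos by auto
  have "\<bar>mean_h (s n) - mean_h x\<bar> \<le> M * sqrt (increment_sq x (s n))" for n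
  proof -
    note d = X_diff_square_integrable[OF s(1,2)]
    have "mean_h (s n) - mean_h x = (\<integral>\<omega>. h (X (s n) \<omega>) - h (X x \<omega>) \<partial>P)"
      unfolding mean_h_def by (simp add: h_X_integrable s)
    also have "\<bar>\<dots>\<bar> \<le> (\<integral>\<omega>. \<bar>h (X (s n) \<omega>) - h (X x \<omega>)\<bar> \<partial>P)" by (rule integral_abs_bound)
    also have "\<dots> \<le> (\<integral>\<omega>. M * \<bar>X (s n) \<omega> - X x \<omega>\<bar> \<partial>P)"
    proof (rule integral_mono)
      show "integrable P (\<lambda>\<omega>. \<bar>h (X (s n) \<omega>) - h (X x \<omega>)\<bar>)"
        by (intro integrable_abs Bochner_Integration.integrable_diff h_X_integrable s)
      show "integrable P (\<lambda>\<omega>. M * \<bar>X (s n) \<omega> - X x \<omega>\<bar>)"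
        by (intro integrable_mult_right integrable_abs square_integrable_imp_integrable d)
    qed (use h_bilipschitz in blast)
    also have "\<dots> = M * (\<integral>\<omega>. \<bar>X (s n) \<omega> - X x \<omega>\<bar> \<partial>P)" by simp
    also have "\<dots> \<le> M * sqrt (increment_sq x (s n))"
      using increment_sq_nonneg[of x "s n"]
      by (intro mult_left_mono integral_abs_le_root[OF d] M) (auto simp: increment_sq_def)
    finally show ?thesis .
  qed
  then have "(\<lambda>n. mean_h (s n) - mean_h x) \<longlonglongrightarrow> 0"
    by (intro Lim_null_comparison[OF always_eventually tendsto_mult_right_zero[OF sqrt_increment_tendsto[OF s]]] allI) simp
  then show "(\<lambda>n. mean_h (s n)) \<longlonglongrightarrow> mean_h x" by (rule LIM_zero_cancel)
qed

lemma mean_deriv_continuous: "continuous_on {0..} mean_deriv"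
  unfolding continuous_on_sequentially comp_def
proof (intro allI ballI impI)
  fix s :: "nat \<Rightarrow> real" and x :: real assume *: "x \<in> {0..}" "(\<forall>n. s n \<in> {0..}) \<and> s \<longlonglongrightarrow> x"
  then have s: "0 \<le> x" "\<And>n. 0 \<le> s n" "s \<longlonglongrightarrow> x" by auto
  obtain D where "\<And>x. \<bar>deriv h x\<bar> \<le> D" using derivative_bound by metis
  from weighted_mean_tendsto[OF s deriv_h_continuous this, of "\<lambda>_ _. 1" "\<lambda>_. 1"]
  show "(\<lambda>n. mean_deriv (s n)) \<longlonglongrightarrow> mean_deriv x" by (simp add: mean_deriv_def)
qed

text \<open>The drift converges in mean by its mean square continuity. For the squared diffusion
  coefficient the difference of squares is split as squared increment plus twice increment times the
  value at the limit time, and Cauchy-Schwarz is applied to both.\<close>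

lemma mean_generator_continuous: "continuous_on {0..} mean_generator"
  unfolding continuous_on_sequentially comp_def
proof (intro allI ballI impI)
  fix s :: "nat \<Rightarrow> real" and x :: real assume *: "x \<in> {0..}" "(\<forall>n. s n \<in> {0..}) \<and> s \<longlonglongrightarrow> x"
  then have s: "0 \<le> x" "\<And>n. 0 \<le> s n" "s \<longlonglongrightarrow> x" by auto
  obtain D where D: "\<And>x. \<bar>deriv h x\<bar> \<le> D" "\<And>x. \<bar>deriv (deriv h) x\<bar> \<le> D" using derivative_bound by metis
  define q where "q n = 2 * L * sqrt (increment_sq x (s n))" for n
  have q0: "0 \<le> q n" for n using L_pos increment_sq_nonneg by (simp add: q_def)
  have q: "q \<longlonglongrightarrow> 0"
    unfolding q_def[abs_def] by (rule tendsto_mult_right_zero[OF sqrt_increment_tendsto[OF s]])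
  note cs = coeff_square_integrable[OF s(1)] coeff_square_integrable[OF s(2)]
  note ci = coeff_increment_square[OF s(1,2), folded q_def]
  define hx where "hx = sqrt (\<integral>\<omega>. (H x \<omega>)\<^sup>2 \<partial>P)"
  have hx: "0 \<le> hx" "(\<integral>\<omega>. (H x \<omega>)\<^sup>2 \<partial>P) \<le> hx\<^sup>2" by (simp_all add: hx_def)
  have "(\<integral>\<omega>. \<bar>b (X (s n) \<omega>) (\<mu> (s n)) - b (X x \<omega>) (\<mu> x)\<bar> \<partial>P) \<le> q n" for n
    by (rule integral_abs_le_root[OF square_integrable_diff[OF cs(3,1)] ci(1) q0])
  then have "(\<lambda>n. \<integral>\<omega>. \<bar>b (X (s n) \<omega>) (\<mu> (s n)) - b (X x \<omega>) (\<mu> x)\<bar> \<partial>P) \<longlonglongrightarrow> 0"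
    by (intro Lim_null_comparison[OF always_eventually q] allI) simp
  from weighted_mean_tendsto[OF s deriv_h_continuous D(1) square_integrable_imp_integrable[OF cs(3)] square_integrable_imp_integrable[OF cs(1)] this]
  have 1: "(\<lambda>n. \<integral>\<omega>. deriv h (X (s n) \<omega>) * b (X (s n) \<omega>) (\<mu> (s n)) \<partial>P) \<longlonglongrightarrow> (\<integral>\<omega>. deriv h (X x \<omega>) * b (X x \<omega>) (\<mu> x) \<partial>P)" .
  have H_le: "(\<integral>\<omega>. \<bar>(H (s n) \<omega>)\<^sup>2 - (H x \<omega>)\<^sup>2\<bar> \<partial>P) \<le> q n * q n + 2 * (q n * hx)" for n
  proof -
    note d = square_integrable_diff[OF cs(4,2), of n]
    have "(\<integral>\<omega>. \<bar>(H (s n) \<omega>)\<^sup>2 - (H x \<omega>)\<^sup>2\<bar> \<partial>P) \<le> (\<integral>\<omega>. \<bar>(H (s n) \<omega> - H x \<omega>) * (H (s n) \<omega> - H x \<omega>)\<bar> + 2 * \<bar>(H (s n) \<omega> - H x \<omega>) * H x \<omega>\<bar> \<partial>P)"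
    proof (rule integral_mono)
      show "integrable P (\<lambda>\<omega>. \<bar>(H (s n) \<omega>)\<^sup>2 - (H x \<omega>)\<^sup>2\<bar>)"
        using square_integrableD(2)[OF cs(4)] square_integrableD(2)[OF cs(2)] by simp
      show "integrable P (\<lambda>\<omega>. \<bar>(H (s n) \<omega> - H x \<omega>) * (H (s n) \<omega> - H x \<omega>)\<bar> + 2 * \<bar>(H (s n) \<omega> - H x \<omega>) * H x \<omega>\<bar>)"
        by (intro Bochner_Integration.integrable_add integrable_mult_right integrable_abs square_integrable_mult d cs)
      show "\<bar>(H (s n) \<omega>)\<^sup>2 - (H x \<omega>)\<^sup>2\<bar> \<le> \<bar>(H (s n) \<omega> - H x \<omega>) * (H (s n) \<omega> - H x \<omega>)\<bar> + 2 * \<bar>(H (s n) \<omega> - H x \<omega>) * H x \<omega>\<bar>" for \<omega>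
      proof -
        have "(H (s n) \<omega>)\<^sup>2 - (H x \<omega>)\<^sup>2 = (H (s n) \<omega> - H x \<omega>) * (H (s n) \<omega> - H x \<omega>) + 2 * ((H (s n) \<omega> - H x \<omega>) * H x \<omega>)"
          by (simp add: power2_eq_square algebra_simps)
        then show ?thesis by linarith
      qed
    qed
    also have "\<dots> = (\<integral>\<omega>. \<bar>(H (s n) \<omega> - H x \<omega>) * (H (s n) \<omega> - H x \<omega>)\<bar> \<partial>P) + 2 * (\<integral>\<omega>. \<bar>(H (s n) \<omega> - H x \<omega>) * H x \<omega>\<bar> \<partial>P)"
      using integrable_abs[OF square_integrable_mult[OF d d]] integrable_abs[OF square_integrable_mult[OF d cs(2)]]
      by (simp only: Bochner_Integration.integral_add integrable_mult_right integral_mult_right_zero)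
    also have "\<dots> \<le> q n * q n + 2 * (q n * hx)"
      by (intro add_mono mult_left_mono Cauchy_Schwarz_integral_le[OF d d ci(2) ci(2) q0 q0]
          Cauchy_Schwarz_integral_le[OF d cs(2) ci(2) hx(2) q0 hx(1)]) auto
    finally show ?thesis .
  qed
  have "(\<lambda>n. q n * q n + 2 * (q n * hx)) \<longlonglongrightarrow> 0 * 0 + 2 * (0 * hx)" by (intro tendsto_intros q)
  then have q2: "(\<lambda>n. q n * q n + 2 * (q n * hx)) \<longlonglongrightarrow> 0" by simp
  have "(\<lambda>n. \<integral>\<omega>. \<bar>(H (s n) \<omega>)\<^sup>2 - (H x \<omega>)\<^sup>2\<bar> \<partial>P) \<longlonglongrightarrow> 0"
    by (rule Lim_null_comparison[OF always_eventually q2], rule allI) (simp add: H_le)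
  from weighted_mean_tendsto[OF s h_C2(3) D(2) square_integrableD(2)[OF cs(4)] square_integrableD(2)[OF cs(2)] this]
  have 2: "(\<lambda>n. \<integral>\<omega>. deriv (deriv h) (X (s n) \<omega>) * (H (s n) \<omega>)\<^sup>2 \<partial>P) \<longlonglongrightarrow> (\<integral>\<omega>. deriv (deriv h) (X x \<omega>) * (H x \<omega>)\<^sup>2 \<partial>P)" .
  show "(\<lambda>n. mean_generator (s n)) \<longlonglongrightarrow> mean_generator x"
    unfolding mean_generator_eq[OF s(1)] mean_generator_eq[OF s(2)] by (intro tendsto_intros 1 2)
qed

text \<open>The moving \<open>H (u n)\<close> is first replaced by \<open>H x\<close>, at a cost
  controlled by mean square continuity. With \<open>H x\<close> fixed the bounded remainder tends to
  0 almost surely, and dominated convergence applies.\<close>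

lemma mean_remainder_tendsto:
  assumes x: "0 \<le> x" and u: "\<And>n::nat. 0 \<le> u n" "u \<longlonglongrightarrow> x" and v: "\<And>n. 0 \<le> v n" "v \<longlonglongrightarrow> x"
  shows "(\<lambda>n. \<integral>\<omega>. (remainder (X (u n) \<omega>) (X (v n) \<omega>) * H (u n) \<omega>)\<^sup>2 \<partial>P) \<longlonglongrightarrow> 0"
proof -
  obtain D where D: "0 \<le> D" "\<And>x. \<bar>deriv (deriv h) x\<bar> \<le> D" using derivative_bound by metis
  define r where "r n \<omega> = remainder (X (u n) \<omega>) (X (v n) \<omega>)" for n \<omega>
  have rD: "\<bar>r n \<omega>\<bar> \<le> D" for n \<omega> unfolding r_def by (rule remainder_bound[OF D(2)])
  have rm: "r n \<in> borel_measurable P" for n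
    using measurable_compose[OF measurable_Pair[OF X_measurable[OF u(1)] X_measurable[OF v(1)]] remainder_measurable]
    by (simp add: r_def[abs_def])
  note cs = coeff_square_integrable(2)[OF x] coeff_square_integrable(2)[OF u(1)]
  have s1: "square_integrable P (\<lambda>\<omega>. r n \<omega> * H (u n) \<omega>)" "square_integrable P (\<lambda>\<omega>. r n \<omega> * H x \<omega>)"
    "square_integrable P (\<lambda>\<omega>. H (u n) \<omega> - H x \<omega>)" for n
    by (intro square_integrable_bounded_mult[OF _ rm rD] square_integrable_diff cs)+
  have A: "(\<lambda>n. \<integral>\<omega>. (r n \<omega> * H x \<omega>)\<^sup>2 \<partial>P) \<longlonglongrightarrow> (\<integral>\<omega>. 0 \<partial>P)"
  proof (rule integral_dominated_convergence[where w = "\<lambda>\<omega>. D\<^sup>2 * (H x \<omega>)\<^sup>2"])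
    show "(\<lambda>\<omega>. (r n \<omega> * H x \<omega>)\<^sup>2) \<in> borel_measurable P" for n
      by (rule borel_measurable_integrable[OF square_integrableD(2)[OF s1(2)]])
    show "AE \<omega> in P. (\<lambda>n. (r n \<omega> * H x \<omega>)\<^sup>2) \<longlonglongrightarrow> 0"
      using X_AE_tendsto[OF x u] X_AE_tendsto[OF x v]
    proof eventually_elim
      case (elim \<omega>)
      then have "(\<lambda>n. r n \<omega>) \<longlonglongrightarrow> 0" unfolding r_def by (rule remainder_tendsto)
      then have "(\<lambda>n. (r n \<omega> * H x \<omega>)\<^sup>2) \<longlonglongrightarrow> (0 * H x \<omega>)\<^sup>2" by (intro tendsto_intros)
      then show ?case by simp
    qed
    show "AE \<omega> in P. norm ((r n \<omega> * H x \<omega>)\<^sup>2) \<le> D\<^sup>2 * (H x \<omega>)\<^sup>2" for n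
    proof (intro AE_I2)
      fix \<omega>
      have "(r n \<omega>)\<^sup>2 \<le> D\<^sup>2" using rD[of n \<omega>] D(1) by (intro abs_le_square_iff[THEN iffD1]) simp
      then show "norm ((r n \<omega> * H x \<omega>)\<^sup>2) \<le> D\<^sup>2 * (H x \<omega>)\<^sup>2" by (simp add: power_mult_distrib mult_right_mono)
    qed
  qed (use square_integrableD(2)[OF cs(1)] in simp_all)
  define q where "q n = 2 * L * sqrt (increment_sq x (u n))" for n
  have q: "q \<longlonglongrightarrow> 0"
    unfolding q_def[abs_def] by (rule tendsto_mult_right_zero[OF sqrt_increment_tendsto[OF x u]])
  have le: "(\<integral>\<omega>. (r n \<omega> * H (u n) \<omega>)\<^sup>2 \<partial>P) \<le> 2 * (\<integral>\<omega>. (r n \<omega> * H x \<omega>)\<^sup>2 \<partial>P) + 2 * D\<^sup>2 * (q n)\<^sup>2" for n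
  proof -
    have "(\<integral>\<omega>. (r n \<omega> * H (u n) \<omega>)\<^sup>2 \<partial>P) \<le> (\<integral>\<omega>. 2 * (r n \<omega> * H x \<omega>)\<^sup>2 + 2 * D\<^sup>2 * (H (u n) \<omega> - H x \<omega>)\<^sup>2 \<partial>P)"
    proof (rule integral_mono[OF square_integrableD(2)[OF s1(1)]])
      show "integrable P (\<lambda>\<omega>. 2 * (r n \<omega> * H x \<omega>)\<^sup>2 + 2 * D\<^sup>2 * (H (u n) \<omega> - H x \<omega>)\<^sup>2)"
        using square_integrableD(2)[OF s1(2)] square_integrableD(2)[OF s1(3)] by simp
      fix \<omega>
      have "(r n \<omega> * H (u n) \<omega>)\<^sup>2 \<le> 2 * (r n \<omega> * H x \<omega>)\<^sup>2 + 2 * (r n \<omega> * (H (u n) \<omega> - H x \<omega>))\<^sup>2"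
        using add2_square_le[of "r n \<omega> * H x \<omega>" "r n \<omega> * (H (u n) \<omega> - H x \<omega>)"] by (simp add: algebra_simps)
      moreover have "(r n \<omega> * (H (u n) \<omega> - H x \<omega>))\<^sup>2 \<le> D\<^sup>2 * (H (u n) \<omega> - H x \<omega>)\<^sup>2"
        unfolding power_mult_distrib using rD[of n \<omega>] D(1)
        by (intro mult_right_mono abs_le_square_iff[THEN iffD1]) auto
      ultimately show "(r n \<omega> * H (u n) \<omega>)\<^sup>2 \<le> 2 * (r n \<omega> * H x \<omega>)\<^sup>2 + 2 * D\<^sup>2 * (H (u n) \<omega> - H x \<omega>)\<^sup>2"
        by linarith
    qed
    also have "\<dots> = 2 * (\<integral>\<omega>. (r n \<omega> * H x \<omega>)\<^sup>2 \<partial>P) + 2 * D\<^sup>2 * (\<integral>\<omega>. (H (u n) \<omega> - H x \<omega>)\<^sup>2 \<partial>P)"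
      using square_integrableD(2)[OF s1(2)] square_integrableD(2)[OF s1(3)] by simp
    also have "\<dots> \<le> 2 * (\<integral>\<omega>. (r n \<omega> * H x \<omega>)\<^sup>2 \<partial>P) + 2 * D\<^sup>2 * (q n)\<^sup>2"
      unfolding q_def by (intro add_left_mono mult_left_mono coeff_increment_square x u) auto
    finally show ?thesis .
  qed
  have "(\<lambda>n. 2 * (\<integral>\<omega>. (r n \<omega> * H x \<omega>)\<^sup>2 \<partial>P) + 2 * D\<^sup>2 * (q n)\<^sup>2) \<longlonglongrightarrow> 2 * (\<integral>\<omega>. 0 \<partial>P) + 2 * D\<^sup>2 * 0\<^sup>2"
    by (intro tendsto_intros A q)
  then have lim: "(\<lambda>n. 2 * (\<integral>\<omega>. (r n \<omega> * H x \<omega>)\<^sup>2 \<partial>P) + 2 * D\<^sup>2 * (q n)\<^sup>2) \<longlonglongrightarrow> 0" by simp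
  show ?thesis
    by (rule tendsto_sandwich[OF _ _ tendsto_const lim]; intro always_eventually allI)
      (use le in \<open>simp_all add: r_def\<close>)
qed

text \<open>The remainder is controlled along sequences only, so a failure is assumed and sequences
  \<open>u n\<close>, \<open>v n\<close> around \<open>x\<close> are extracted that contradict
  \<open>expansion_bound\<close>. Only intervals containing \<open>x\<close> are considered; the
  bisection argument asks for no others.\<close>

lemma local_expansion:
  assumes x: "0 \<le> x" and e: "0 < e"
  shows "\<exists>d>0. \<forall>u v. 0 \<le> u \<and> u \<le> x \<and> x \<le> v \<and> v - u < d \<longrightarrow>
    \<bar>mean_h v - mean_h u - mean_generator u * (v - u) - mean_deriv u * (K v - K u)\<bar> \<le> e * ((v - u) + (K v - K u))"
proof (rule ccontr)
  define E where "E u v = \<bar>mean_h v - mean_h u - mean_generator u * (v - u) - mean_deriv u * (K v - K u)\<bar>" for u v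
  assume "\<not> ?thesis"
  then have neg: "\<And>d. 0 < d \<Longrightarrow> \<exists>u v. 0 \<le> u \<and> u \<le> x \<and> x \<le> v \<and> v - u < d \<and> \<not> E u v \<le> e * ((v - u) + (K v - K u))"
    unfolding E_def by (auto simp only: not_ex not_all not_imp de_Morgan_conj) blast
  have "\<forall>n. \<exists>w. 0 \<le> fst w \<and> fst w \<le> x \<and> x \<le> snd w \<and> snd w - fst w < inverse (real (Suc n)) \<and>
      \<not> E (fst w) (snd w) \<le> e * ((snd w - fst w) + (K (snd w) - K (fst w)))"
  proof
    fix n
    obtain u v where "0 \<le> u \<and> u \<le> x \<and> x \<le> v \<and> v - u < inverse (real (Suc n)) \<and> \<not> E u v \<le> e * ((v - u) + (K v - K u))"
      using neg[of "inverse (real (Suc n))"] by auto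
    then show "\<exists>w. 0 \<le> fst w \<and> fst w \<le> x \<and> x \<le> snd w \<and> snd w - fst w < inverse (real (Suc n)) \<and>
      \<not> E (fst w) (snd w) \<le> e * ((snd w - fst w) + (K (snd w) - K (fst w)))"
      by (intro exI[of _ "(u, v)"]) simp
  qed
  from choice[OF this] obtain w where w: "\<And>n. 0 \<le> fst (w n)" "\<And>n. fst (w n) \<le> x" "\<And>n. x \<le> snd (w n)"
    "\<And>n. snd (w n) - fst (w n) < inverse (real (Suc n))"
    "\<And>n. \<not> E (fst (w n)) (snd (w n)) \<le> e * ((snd (w n) - fst (w n)) + (K (snd (w n)) - K (fst (w n))))"
    by blast
  define u where "u n = fst (w n)" for n
  define v where "v n = snd (w n)" for n
  have uv: "\<And>n. 0 \<le> u n" "\<And>n. u n \<le> x" "\<And>n. x \<le> v n" "\<And>n. v n - u n < inverse (real (Suc n))"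
    "\<And>n. \<not> E (u n) (v n) \<le> e * ((v n - u n) + (K (v n) - K (u n)))"
    using w by (auto simp: u_def v_def)
  have v0: "0 \<le> v n" for n using uv(3)[of n] x by linarith
  have "(\<lambda>n. u n - x) \<longlonglongrightarrow> 0" "(\<lambda>n. v n - x) \<longlonglongrightarrow> 0" "(\<lambda>n. v n - u n) \<longlonglongrightarrow> 0"
  proof -
    have b: "norm (u n - x) \<le> inverse (real (Suc n))" "norm (v n - x) \<le> inverse (real (Suc n))" "norm (v n - u n) \<le> inverse (real (Suc n))" for n
      unfolding real_norm_def using uv(2,3,4)[of n] by linarith+
    show "(\<lambda>n. u n - x) \<longlonglongrightarrow> 0" "(\<lambda>n. v n - x) \<longlonglongrightarrow> 0" "(\<lambda>n. v n - u n) \<longlonglongrightarrow> 0"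
      by (rule Lim_null_comparison[OF always_eventually LIMSEQ_inverse_real_of_nat], rule allI, rule b)+
  qed
  then have ux: "u \<longlonglongrightarrow> x" and vx: "v \<longlonglongrightarrow> x" and vu: "(\<lambda>n. v n - u n) \<longlonglongrightarrow> 0"
    by (auto intro: LIM_zero_cancel)
  define T where "T = x + 1"
  have T: "0 \<le> T" using x by (simp add: T_def)
  obtain C G where CG: "0 \<le> C" "0 \<le> G"
    "\<And>t x. t \<in> {0..T} \<Longrightarrow> \<bar>b x (\<mu> t)\<bar> \<le> C + L * \<bar>x\<bar> \<and> \<bar>\<sigma> x (\<mu> t)\<bar> \<le> C + L * \<bar>x\<bar>"
    "\<And>t. t \<in> {0..T} \<Longrightarrow> (\<integral>\<omega>. (C + L * \<bar>X t \<omega>\<bar>)\<^sup>2 \<partial>P) \<le> G\<^sup>2"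
    using linear_growth[OF T] by metis
  obtain D where D: "0 \<le> D" "\<And>x. \<bar>deriv h x\<bar> \<le> D" "\<And>x. \<bar>deriv (deriv h) x\<bar> \<le> D" using derivative_bound by metis
  define Q where "Q = 2 * D * L + 2 * D * (5 * G\<^sup>2 + 12 * L\<^sup>2 + 4 * L * G) + 2 * G + 2 * D * (3 + 2 * G)"
  have Q: "0 \<le> Q" unfolding Q_def using D(1) CG L_pos by (auto intro!: add_nonneg_nonneg mult_nonneg_nonneg)
  \<comment> \<open>\<open>Q\<close> is the constant of \<open>expansion_bound\<close>, so this
    choice gives \<open>\<rho> * Q \<le> e\<close>; adding 1 avoids division by 0.\<close>
  define \<rho> where "\<rho> = min 1 (e / (Q + 1))"
  have \<rho>: "0 < \<rho>" "\<rho> \<le> 1" using e Q by (auto simp: \<rho>_def)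
  have \<rho>Q: "\<rho> * Q \<le> e"
  proof -
    have "\<rho> * Q \<le> e / (Q + 1) * (Q + 1)" using Q e by (intro mult_mono) (auto simp: \<rho>_def)
    then show ?thesis using Q by simp
  qed
  \<comment> \<open>A quarter of the target, since \<open>increment_sq_triangle\<close> doubles each
    of the two increments measured from \<open>x\<close>.\<close>
  have \<rho>2: "0 < \<rho>\<^sup>2" "0 < \<rho>\<^sup>2 / 4" using \<rho> by simp_all
  obtain d where d: "0 < d" "\<And>s. 0 \<le> s \<Longrightarrow> \<bar>s - x\<bar> < d \<Longrightarrow> increment_sq x s < \<rho>\<^sup>2 / 4"
    using increment_sq_small[OF x \<rho>2(2)] by blast
  have "(\<lambda>n. K (v n)) \<longlonglongrightarrow> K x" "(\<lambda>n. K (u n)) \<longlonglongrightarrow> K x"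
    using K_cont x uv(1) v0 ux vx unfolding continuous_on_sequentially by (auto simp: comp_def)
  then have "(\<lambda>n. K (v n) - K (u n)) \<longlonglongrightarrow> K x - K x" by (intro tendsto_intros)
  then have "\<forall>\<^sub>F n in sequentially. K (v n) - K (u n) < \<rho>" using \<rho> by (intro order_tendstoD(2)) auto
  moreover have "\<forall>\<^sub>F n in sequentially. v n - u n < \<rho>\<^sup>2" "\<forall>\<^sub>F n in sequentially. v n - u n < d" "\<forall>\<^sub>F n in sequentially. v n - u n < 1"
    using vu \<rho>2 d by (auto intro: order_tendstoD(2))
  moreover have "\<forall>\<^sub>F n in sequentially. (\<integral>\<omega>. (remainder (X (u n) \<omega>) (X (v n) \<omega>) * H (u n) \<omega>)\<^sup>2 \<partial>P) < \<rho>\<^sup>2"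
    by (rule order_tendstoD(2)[OF mean_remainder_tendsto[OF x uv(1) ux v0 vx] \<rho>2(1)])
  ultimately have "\<forall>\<^sub>F n in sequentially. False"
  proof eventually_elim
    case (elim n)
    have inc: "increment_sq (u n) r \<le> \<rho>\<^sup>2" if r: "r \<in> {u n..v n}" for r
    proof -
      have r0: "0 \<le> r" using r uv(1)[of n] by auto
      have "\<bar>r - x\<bar> < d" "\<bar>u n - x\<bar> < d" using r uv(2,3)[of n] elim(3) by auto
      then have "increment_sq x r < \<rho>\<^sup>2 / 4" "increment_sq x (u n) < \<rho>\<^sup>2 / 4" using d(2) r0 uv(1) by auto
      then show ?thesis using increment_sq_triangle[OF uv(1)[of n] x r0] by linarith
    qed
    have le: "u n \<le> v n" "v n \<le> T" using uv(2,3)[of n] elim(4) by (auto simp: T_def)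
    have "E (u n) (v n) \<le> \<rho> * Q * ((v n - u n) + (K (v n) - K (u n)))"
      unfolding E_def Q_def
      by (rule expansion_bound[OF uv(1) le CG D _ \<rho>(2) _ _ inc]) (use \<rho> elim in auto)
    also have "\<dots> \<le> e * ((v n - u n) + (K (v n) - K (u n)))"
    proof (rule mult_right_mono[OF \<rho>Q])
      show "0 \<le> (v n - u n) + (K (v n) - K (u n))"
        using le mono_onD[OF K_mono, of "u n" "v n"] uv(1)[of n] v0[of n] by auto
    qed
    finally show False using uv(5)[of n] by simp
  qed
  then show False by simp
qed

end

section \<open>Identification of the density\<close>

lemma Ioc_set_integrable:
  fixes g :: "real \<Rightarrow> real"
  assumes N: "sets N = sets borel" "emeasure N {u<..v} < \<infinity>" and g: "continuous_on UNIV g"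
  shows "set_integrable N {u<..v} g"
proof -
  have "bounded (g ` {u..v})"
    by (intro compact_imp_bounded compact_continuous_image continuous_on_subset[OF g]) auto
  then obtain C where "\<forall>y\<in>g ` {u..v}. norm y \<le> C" unfolding bounded_iff by blast
  then have C: "\<bar>g r\<bar> \<le> C" if "r \<in> {u..v}" for r using that by simp
  have "g \<in> borel_measurable borel" by (rule borel_measurable_continuous_onI[OF g])
  then have [measurable]: "g \<in> borel_measurable N" using measurable_cong_sets[OF N(1) refl] by blast
  have [measurable]: "{u<..v} \<in> sets N" using N(1) by simp
  show ?thesis
    unfolding set_integrable_def
  proof (rule Bochner_Integration.integrable_bound)
    show "integrable N (\<lambda>r. indicator {u<..v} r * C)"
      using N by (intro integrable_mult_left integrable_real_indicator) auto
    show "(\<lambda>r. indicator {u<..v} r *\<^sub>R g r) \<in> borel_measurable N" by measurable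
    have "norm (indicator {u<..v} r *\<^sub>R g r) \<le> norm (indicator {u<..v} r * C)" for r
      using C[of r] by (auto simp: indicator_def)
    then show "AE r in N. norm (indicator {u<..v} r *\<^sub>R g r) \<le> norm (indicator {u<..v} r * C)" by simp
  qed
qed

text \<open>Stated for an arbitrary measure so that it serves Lebesgue measure and the Stieltjes
  measure alike.\<close>

lemma Ioc_integral_approx:
  fixes g :: "real \<Rightarrow> real"
  assumes N: "sets N = sets borel" "emeasure N {u<..v} = ennreal w" "0 \<le> w" and g: "continuous_on UNIV g"
    and e: "\<And>r. r \<in> {u<..v} \<Longrightarrow> \<bar>g r - \<gamma>\<bar> \<le> e"
  shows "\<bar>(LINT r:{u<..v}|N. g r) - \<gamma> * w\<bar> \<le> e * w"
proof -
  have fin: "emeasure N {u<..v} < \<infinity>" using N by simp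
  have const: "(LINT r:{u<..v}|N. k) = k * w" for k
    using N(2,3) sets_eq_imp_space_eq[OF N(1)] by (simp add: set_lebesgue_integral_def measure_def)
  have gi: "set_integrable N {u<..v} g" by (rule Ioc_set_integrable[OF N(1) fin g])
  have ki: "set_integrable N {u<..v} (\<lambda>_. k)" for k :: real by (rule Ioc_set_integrable[OF N(1) fin continuous_on_const])
  have "(LINT r:{u<..v}|N. g r) - \<gamma> * w = (LINT r:{u<..v}|N. g r - \<gamma>)"
    by (simp add: set_integral_diff(2)[OF gi ki] const)
  also have "\<bar>\<dots>\<bar> \<le> (LINT r:{u<..v}|N. \<bar>g r - \<gamma>\<bar>)"
    using set_integral_norm_bound[OF set_integral_diff(1)[OF gi ki]] by simp
  also have "\<dots> \<le> (LINT r:{u<..v}|N. e)"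
    by (intro set_integral_mono set_integrable_abs set_integral_diff(1) gi ki e)
  finally show ?thesis by (simp add: const)
qed

lemma measure_eqI_Ioc:
  fixes M N :: "real measure"
  assumes "sets M = sets borel" "sets N = sets borel"
    and eq: "\<And>a b. a \<le> b \<Longrightarrow> emeasure M {a<..b} = emeasure N {a<..b}"
    and fin: "\<And>a b. a \<le> b \<Longrightarrow> emeasure M {a<..b} < \<infinity>"
  shows "M = N"
proof (rule measure_eqI_generator_eq[where \<Omega> = UNIV and E = "range (\<lambda>(a, b). {a<..b::real})" and A = "\<lambda>i::nat. {- real i<..real i}"])
  show "Int_stable (range (\<lambda>(a, b). {a<..b::real}))"
  proof (rule Int_stableI)
    fix A B :: "real set" assume "A \<in> range (\<lambda>(a, b). {a<..b})" "B \<in> range (\<lambda>(a, b). {a<..b})"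
    then obtain a b c d where "A = {a<..b}" "B = {c<..d}" by auto
    then have "A \<inter> B = (\<lambda>(a, b). {a<..b}) (max a c, min b d)" by auto
    then show "A \<inter> B \<in> range (\<lambda>(a, b). {a<..b})" by blast
  qed
  show "sets M = sigma_sets UNIV (range (\<lambda>(a, b). {a<..b::real}))" "sets N = sigma_sets UNIV (range (\<lambda>(a, b). {a<..b::real}))"
    using assms(1,2) by (simp_all add: borel_sigma_sets_Ioc)
  fix X assume "X \<in> range (\<lambda>(a, b). {a<..b::real})"
  then obtain a b where X: "X = {a<..b}" by auto
  then show "emeasure M X = emeasure N X"
    using eq[of a b] by (cases "a \<le> b") auto
next
  show "range (\<lambda>i::nat. {- real i<..real i}) \<subseteq> range (\<lambda>(a, b). {a<..b})" by auto
  have "\<exists>i::nat. - real i < x \<and> x \<le> real i" for x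
  proof -
    obtain i :: nat where "\<bar>x\<bar> < real i" using reals_Archimedean2 by blast
    then show ?thesis by (intro exI[of _ i]) linarith
  qed
  then show "(\<Union>i::nat. {- real i<..real i}) = UNIV" by auto
  show "emeasure M {- real i<..real i} \<noteq> \<infinity>" for i using fin[of "- real i" "real i"] by simp
qed simp

text \<open>After taking expectations only functions of time remain: \<open>\<phi>\<close>,
  \<open>a\<close> and \<open>c\<close> stand for the means of \<open>h\<close>, of the generator
  and of the derivative of \<open>h\<close>. Everything below is real analysis.\<close>

locale flat_expansion =
  fixes \<phi> a c K :: "real \<Rightarrow> real" and m :: real
  assumes K_cont: "continuous_on {0..} K" and K_mono: "mono_on {0..} K"
    and cont: "continuous_on {0..} \<phi>" "continuous_on {0..} a" "continuous_on {0..} c"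
    and \<phi>_nonneg: "\<And>t. 0 \<le> t \<Longrightarrow> 0 \<le> \<phi> t"
    and c_ge: "\<And>t. 0 \<le> t \<Longrightarrow> m \<le> c t" and m_pos: "0 < m"
    and expansion: "\<And>x e. 0 \<le> x \<Longrightarrow> 0 < e \<Longrightarrow> \<exists>d>0. \<forall>u v. 0 \<le> u \<and> u \<le> x \<and> x \<le> v \<and> v - u < d \<longrightarrow>
      \<bar>\<phi> v - \<phi> u - a u * (v - u) - c u * (K v - K u)\<bar> \<le> e * ((v - u) + (K v - K u))"
    and flat: "\<And>t. 0 \<le> t \<Longrightarrow> (LINT s:{0..t}|stieltjes_measure K. \<phi> s) = 0"
begin

text \<open>Constant extension to the left, as in \<open>stieltjes_measure\<close>; it turns
  continuity on \<open>{0..}\<close> into continuity on the whole line.\<close>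

definition ext :: "(real \<Rightarrow> real) \<Rightarrow> real \<Rightarrow> real" where "ext f t = f (max 0 t)"

lemma ext_nonneg_eq: "0 \<le> t \<Longrightarrow> ext f t = f t"
  by (simp add: ext_def)

lemma ext_continuous: "continuous_on {0..} f \<Longrightarrow> continuous_on UNIV (ext f)"
  unfolding ext_def
  by (rule continuous_on_compose2[of "{0..}" f UNIV "max 0"]) (auto intro!: continuous_intros)

abbreviation \<nu> :: "real measure" where "\<nu> \<equiv> stieltjes_measure K"

lemma sets_\<nu>: "sets \<nu> = sets borel"
  by (simp add: stieltjes_measure_def)

lemma ext_K_mono: "u \<le> v \<Longrightarrow> ext K u \<le> ext K v"
  unfolding ext_def by (rule mono_onD[OF K_mono]) auto

lemma \<nu>_Ioc: "u \<le> v \<Longrightarrow> emeasure \<nu> {u<..v} = ennreal (ext K v - ext K u)"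
  using ext_K_mono ext_continuous[OF K_cont] unfolding stieltjes_measure_def ext_def
  by (subst emeasure_interval_measure_Ioc)
    (auto simp: continuous_on_eq_continuous_within intro: continuous_within_subset)

lemma integrable_lborel_Ioc: "continuous_on UNIV g \<Longrightarrow> set_integrable lborel {u<..v} (g :: real \<Rightarrow> real)"
  by (rule Ioc_set_integrable) (cases "u \<le> v"; auto)+

lemma integrable_\<nu>_Ioc: "continuous_on UNIV g \<Longrightarrow> set_integrable \<nu> {u<..v} (g :: real \<Rightarrow> real)"
  by (rule Ioc_set_integrable[OF sets_\<nu>]) (cases "u \<le> v"; auto simp: \<nu>_Ioc)

text \<open>The defect \<open>E\<close> between the increment of \<open>f\<close> and the two
  integrals is additive over adjacent intervals. Near each point it is at most
  \<open>e * ((v - u) + (K v - K u))\<close>, hence by bisection on the whole interval as well, and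
  \<open>e\<close> is arbitrary. This is a fundamental theorem of calculus for the pair of time and
  \<open>K\<close>.\<close>

lemma integral_of_expansion:
  fixes f p q :: "real \<Rightarrow> real"
  assumes pq: "continuous_on UNIV p" "continuous_on UNIV q"
    and local: "\<And>x e. 0 \<le> x \<Longrightarrow> 0 < e \<Longrightarrow> \<exists>d>0. \<forall>u v. 0 \<le> u \<and> u \<le> x \<and> x \<le> v \<and> v - u < d \<longrightarrow>
      \<bar>f v - f u - p x * (v - u) - q x * (K v - K u)\<bar> \<le> e * ((v - u) + (K v - K u))"
    and st: "0 \<le> s" "s \<le> t"
  shows "f t - f s = (LINT r:{s<..t}|lborel. p r) + (LINT r:{s<..t}|\<nu>. q r)"
proof -
  define E where "E u v = f v - f u - (LINT r:{u<..v}|lborel. p r) - (LINT r:{u<..v}|\<nu>. q r)" for u v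
  have E_add: "E u w = E u v + E v w" if "u \<le> v" "v \<le> w" for u v w
  proof -
    have U: "{u<..w} = {u<..v} \<union> {v<..w}" using that by auto
    show ?thesis unfolding E_def U
      by (subst set_integral_Un, (auto intro!: integrable_lborel_Ioc integrable_\<nu>_Ioc pq)[3])+ simp
  qed
  have K_diff: "0 \<le> K v - K u" if "0 \<le> u" "u \<le> v" for u v
    using mono_onD[OF K_mono, of u v] that by auto
  have bound: "\<bar>E s t\<bar> \<le> e * ((t - s) + (K t - K s))" if e: "0 < e" for e
  proof -
    \<comment> \<open>The bisection principle ranges over all real intervals, also those reaching
      below 0; the premise \<open>0 \<le> u\<close> makes the property trivial there.\<close>
    define Q where "Q u v \<longleftrightarrow> (0 \<le> u \<longrightarrow> \<bar>E u v\<bar> \<le> e * ((v - u) + (K v - K u)))" for u v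
    have "Q s t"
    proof (rule Bolzano[OF st(2)])
      fix u v w assume "Q u v" "Q v w" "u \<le> v" "v \<le> w"
      show "Q u w" unfolding Q_def
      proof
        assume u: "0 \<le> u"
        then have "\<bar>E u v\<bar> + \<bar>E v w\<bar> \<le> e * ((v - u) + (K v - K u)) + e * ((w - v) + (K w - K v))"
          using \<open>Q u v\<close> \<open>Q v w\<close> \<open>u \<le> v\<close> unfolding Q_def by (intro add_mono) auto
        also have "\<dots> = e * ((w - u) + (K w - K u))" by (simp add: algebra_simps)
        finally show "\<bar>E u w\<bar> \<le> e * ((w - u) + (K w - K u))"
          using E_add[OF \<open>u \<le> v\<close> \<open>v \<le> w\<close>] by linarith
      qed
    next
      fix x assume "s \<le> x" "x \<le> t"
      then have x: "0 \<le> x" using st by simp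
      \<comment> \<open>One half pays for the assumed expansion, the other for the oscillation of
        \<open>p\<close> and \<open>q\<close> around \<open>x\<close>.\<close>
      have e2: "0 < e / 2" using e by simp
      obtain d1 where d1: "0 < d1" "\<And>u v. 0 \<le> u \<and> u \<le> x \<and> x \<le> v \<and> v - u < d1 \<Longrightarrow>
          \<bar>f v - f u - p x * (v - u) - q x * (K v - K u)\<bar> \<le> e / 2 * ((v - u) + (K v - K u))"
        using local[OF x e2] by blast
      have "isCont p x" "isCont q x" using pq by (auto simp: continuous_on_eq_continuous_at)
      then obtain d2 d3 where d2: "0 < d2" "\<And>r. \<bar>r - x\<bar> < d2 \<Longrightarrow> \<bar>p r - p x\<bar> < e / 2"
        and d3: "0 < d3" "\<And>r. \<bar>r - x\<bar> < d3 \<Longrightarrow> \<bar>q r - q x\<bar> < e / 2"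
        using e2 unfolding continuous_at_eps_delta dist_real_def by metis
      show "\<exists>d>0. \<forall>u v. u \<le> x \<and> x \<le> v \<and> v - u < d \<longrightarrow> Q u v"
      proof (intro exI[of _ "min d1 (min d2 d3)"] conjI allI impI)
        fix u v assume uv: "u \<le> x \<and> x \<le> v \<and> v - u < min d1 (min d2 d3)"
        show "Q u v" unfolding Q_def
        proof
          assume u: "0 \<le> u"
          have uv': "u \<le> v" using uv by simp
          have near: "\<bar>p r - p x\<bar> \<le> e / 2" "\<bar>q r - q x\<bar> \<le> e / 2" if "r \<in> {u<..v}" for r
          proof -
            have "\<bar>r - x\<bar> < d2" "\<bar>r - x\<bar> < d3" using that uv by auto
            from d2(2)[OF this(1)] d3(2)[OF this(2)]
            show "\<bar>p r - p x\<bar> \<le> e / 2" "\<bar>q r - q x\<bar> \<le> e / 2" by simp_all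
          qed
          have 1: "\<bar>(LINT r:{u<..v}|lborel. p r) - p x * (v - u)\<bar> \<le> e / 2 * (v - u)"
            using uv' by (intro Ioc_integral_approx pq near(1)) auto
          have 2: "\<bar>(LINT r:{u<..v}|\<nu>. q r) - q x * (K v - K u)\<bar> \<le> e / 2 * (K v - K u)"
          proof (rule Ioc_integral_approx[OF sets_\<nu> _ K_diff[OF u uv'] pq(2) near(2)])
            show "emeasure \<nu> {u<..v} = ennreal (K v - K u)"
              using \<nu>_Ioc[OF uv'] u uv' by (simp add: ext_nonneg_eq)
          qed
          have 3: "\<bar>f v - f u - p x * (v - u) - q x * (K v - K u)\<bar> \<le> e / 2 * ((v - u) + (K v - K u))"
            using d1(2)[of u v] u uv by auto
          have "\<bar>E u v\<bar> \<le> \<bar>f v - f u - p x * (v - u) - q x * (K v - K u)\<bar> + \<bar>(LINT r:{u<..v}|lborel. p r) - p x * (v - u)\<bar> + \<bar>(LINT r:{u<..v}|\<nu>. q r) - q x * (K v - K u)\<bar>"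
            unfolding E_def by linarith
          also have "\<dots> \<le> e / 2 * ((v - u) + (K v - K u)) + e / 2 * (v - u) + e / 2 * (K v - K u)"
            by (intro add_mono 1 2 3)
          also have "\<dots> = e * ((v - u) + (K v - K u))" by (simp add: field_simps)
          finally show "\<bar>E u v\<bar> \<le> e * ((v - u) + (K v - K u))" .
        qed
      qed (use d1 d2 d3 in auto)
    qed
    then show ?thesis using st by (simp add: Q_def)
  qed
  have "\<bar>E s t\<bar> \<le> 0 + e" if e: "0 < e" for e
  proof -
    have w: "0 \<le> (t - s) + (K t - K s)" using K_diff[OF st] st by simp
    then have "\<bar>E s t\<bar> \<le> e / ((t - s) + (K t - K s) + 1) * ((t - s) + (K t - K s))"
      by (intro bound divide_pos_pos e) simp
    also have "\<dots> \<le> e" using w e by (simp add: field_simps)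
    finally show ?thesis by simp
  qed
  from field_le_epsilon[OF this] have "E s t = 0" by simp
  then show ?thesis by (simp add: E_def)
qed

text \<open>Flatness in the form used later: a non-negative function with integral 0 over every
  \<open>{0..n}\<close> vanishes almost everywhere for the Stieltjes measure.\<close>

lemma \<phi>_AE_zero: "AE s in \<nu>. 0 \<le> s \<longrightarrow> ext \<phi> s = 0"
proof -
  have "AE s in \<nu>. s \<in> {0..real n} \<longrightarrow> ext \<phi> s = 0" for n :: nat
  proof -
    \<comment> \<open>Integrability is available on left-open intervals; starting at -1 captures the
      closed left end 0.\<close>
    have "set_integrable \<nu> {-1<..real n} (ext \<phi>)" by (intro integrable_\<nu>_Ioc ext_continuous cont)
    then have i: "set_integrable \<nu> {0..real n} (ext \<phi>)"
      by (rule set_integrable_subset) (auto simp: sets_\<nu>)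
    have "(LINT s:{0..real n}|\<nu>. ext \<phi> s) = (LINT s:{0..real n}|\<nu>. \<phi> s)"
      unfolding set_lebesgue_integral_def
      by (intro Bochner_Integration.integral_cong) (auto simp: indicator_def ext_def)
    then have "(\<integral>s. indicator {0..real n} s *\<^sub>R ext \<phi> s \<partial>\<nu>) = 0"
      using flat[of "real n"] by (simp add: set_lebesgue_integral_def)
    then have "AE s in \<nu>. indicator {0..real n} s *\<^sub>R ext \<phi> s = 0"
      using i \<phi>_nonneg by (subst (asm) integral_nonneg_eq_0_iff_AE) (auto simp: set_integrable_def indicator_def ext_def)
    then show ?thesis by eventually_elim (auto simp: indicator_def split: if_splits)
  qed
  then have "AE s in \<nu>. \<forall>n::nat. s \<in> {0..real n} \<longrightarrow> ext \<phi> s = 0" unfolding AE_all_countable by blast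
  then show ?thesis
  proof eventually_elim
    case (elim s)
    obtain n :: nat where "s \<le> real n" using real_arch_simple by blast
    then show ?case using elim by auto
  qed
qed

text \<open>The expansion of \<open>\<phi>\<close> is applied to \<open>\<phi> / (1 + n * \<phi>)\<close>, which tends to \<open>0\<close> uniformly while the derivatives
  \<open>1 / (1 + n * \<phi>)\<^sup>2\<close> tend to the indicator of \<open>\<phi> = 0\<close>.\<close>

lemma damped_expansion:
  assumes n: "0 \<le> (n::real)" and x: "0 \<le> x" and e: "0 < e"
  shows "\<exists>d>0. \<forall>u v. 0 \<le> u \<and> u \<le> x \<and> x \<le> v \<and> v - u < d \<longrightarrow>
      \<bar>\<phi> v / (1 + n * \<phi> v) - \<phi> u / (1 + n * \<phi> u) - ext a x / (1 + n * ext \<phi> x)\<^sup>2 * (v - u) - ext c x / (1 + n * ext \<phi> x)\<^sup>2 * (K v - K u)\<bar>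
        \<le> e * ((v - u) + (K v - K u))"
proof -
  define y where "y t = 1 / (1 + n * ext \<phi> t)" for t
  \<comment> \<open>Non-negativity of \<open>\<phi>\<close>, that is the mean constraint, keeps the
    damping denominators positive.\<close>
  have pos: "0 < 1 + n * ext \<phi> t" for t
    using \<phi>_nonneg[of "max 0 t"] n by (auto simp: ext_def intro!: add_pos_nonneg mult_nonneg_nonneg)
  have y01: "0 < y t" "y t \<le> 1" for t
    using pos[of t] \<phi>_nonneg[of "max 0 t"] n by (auto simp: y_def ext_def)
  have yc: "continuous_on UNIV y"
    unfolding y_def by (intro continuous_intros ext_continuous cont) (use pos in \<open>auto simp: less_le\<close>)
  define A where "A t s = y s * y t * ext a t" for s t
  have lim: "((\<lambda>w. y (fst w) * y (snd w) * ext a (fst w)) \<longlongrightarrow> y x * y x * ext a x) (at (x, x))"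
    "((\<lambda>w. y (fst w) * y (snd w) * ext c (fst w)) \<longlongrightarrow> y x * y x * ext c x) (at (x, x))"
  proof -
    have c: "isCont y x" "isCont (ext a) x" "isCont (ext c) x"
      using yc ext_continuous[OF cont(2)] ext_continuous[OF cont(3)] by (auto simp: continuous_on_eq_continuous_at)
    have f: "(fst \<longlongrightarrow> x) (at (x, x))" "(snd \<longlongrightarrow> x) (at (x, x))"
      using tendsto_fst[OF tendsto_ident_at, of "(x, x)" UNIV] tendsto_snd[OF tendsto_ident_at, of "(x, x)" UNIV] by auto
    show "((\<lambda>w. y (fst w) * y (snd w) * ext a (fst w)) \<longlongrightarrow> y x * y x * ext a x) (at (x, x))"
      "((\<lambda>w. y (fst w) * y (snd w) * ext c (fst w)) \<longlongrightarrow> y x * y x * ext c x) (at (x, x))"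
      by (intro tendsto_mult isCont_tendsto_compose[OF c(1)] isCont_tendsto_compose[OF c(2)] isCont_tendsto_compose[OF c(3)] f)+
  qed
  have e3: "0 < e / 3" using e by simp
  have near: "\<exists>d>0. \<forall>u v. \<bar>u - x\<bar> < d \<and> \<bar>v - x\<bar> < d \<longrightarrow> \<bar>g u v - g x x\<bar> \<le> e / 3"
    if gl: "((\<lambda>w. g (fst w) (snd w)) \<longlongrightarrow> g x x) (at (x, x))" for g :: "real \<Rightarrow> real \<Rightarrow> real"
  proof -
    obtain d where d: "0 < d" "\<And>w. w \<noteq> (x, x) \<Longrightarrow> dist w (x, x) < d \<Longrightarrow> dist (g (fst w) (snd w)) (g x x) < e / 3"
      using tendstoD[OF gl e3] unfolding eventually_at by auto
    show ?thesis
    proof (intro exI[of _ "d / 2"] conjI allI impI)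
      fix u v assume uv: "\<bar>u - x\<bar> < d / 2 \<and> \<bar>v - x\<bar> < d / 2"
      have "dist (u, v) (x, x) \<le> \<bar>u - x\<bar> + \<bar>v - x\<bar>"
        unfolding dist_prod_def dist_real_def using sqrt_sum_squares_le_sum_abs[of "\<bar>u - x\<bar>" "\<bar>v - x\<bar>"] by simp
      also have "\<dots> < d" using uv by linarith
      finally show "\<bar>g u v - g x x\<bar> \<le> e / 3"
        using d(2)[of "(u, v)"] e3 by (cases "(u, v) = (x, x)") (auto simp: dist_real_def)
    qed (use d in simp)
  qed
  obtain d1 where d1: "0 < d1" "\<And>u v. \<bar>u - x\<bar> < d1 \<and> \<bar>v - x\<bar> < d1 \<Longrightarrow> \<bar>y u * y v * ext a u - y x * y x * ext a x\<bar> \<le> e / 3"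
    using near[of "\<lambda>u v. y u * y v * ext a u", OF lim(1)] by blast
  obtain d2 where d2: "0 < d2" "\<And>u v. \<bar>u - x\<bar> < d2 \<and> \<bar>v - x\<bar> < d2 \<Longrightarrow> \<bar>y u * y v * ext c u - y x * y x * ext c x\<bar> \<le> e / 3"
    using near[of "\<lambda>u v. y u * y v * ext c u", OF lim(2)] by blast
  obtain d3 where d3: "0 < d3" "\<And>u v. 0 \<le> u \<and> u \<le> x \<and> x \<le> v \<and> v - u < d3 \<Longrightarrow>
      \<bar>\<phi> v - \<phi> u - a u * (v - u) - c u * (K v - K u)\<bar> \<le> e / 3 * ((v - u) + (K v - K u))"
    using expansion[OF x e3] by blast
  show ?thesis
  proof (intro exI[of _ "min d1 (min d2 d3)"] conjI allI impI)
    fix u v assume uv: "0 \<le> u \<and> u \<le> x \<and> x \<le> v \<and> v - u < min d1 (min d2 d3)"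
    then have v0: "0 \<le> v" by simp
    have \<Delta>: "0 \<le> v - u" and \<kappa>: "0 \<le> K v - K u" using uv mono_onD[OF K_mono, of u v] by auto
    have ex: "ext \<phi> u = \<phi> u" "ext \<phi> v = \<phi> v" "ext a u = a u" "ext c u = c u" using uv v0 by (auto simp: ext_nonneg_eq)
    define R where "R = \<phi> v - \<phi> u - a u * (v - u) - c u * (K v - K u)"
    \<comment> \<open>An exact identity for the damping map: the difference quotient is the product
      of the two damping factors, so no derivative or second expansion is needed, only continuity of
      \<open>y\<close>.\<close>
    have "\<phi> v / (1 + n * \<phi> v) - \<phi> u / (1 + n * \<phi> u) = y u * y v * (\<phi> v - \<phi> u)"
      using pos[of u] pos[of v] by (simp add: y_def ex field_simps)
    also have "\<dots> = y u * y v * R + (y u * y v * ext a u) * (v - u) + (y u * y v * ext c u) * (K v - K u)"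
      by (simp add: R_def ex algebra_simps)
    finally have "\<phi> v / (1 + n * \<phi> v) - \<phi> u / (1 + n * \<phi> u) - ext a x / (1 + n * ext \<phi> x)\<^sup>2 * (v - u) - ext c x / (1 + n * ext \<phi> x)\<^sup>2 * (K v - K u)
      = y u * y v * R + (y u * y v * ext a u - y x * y x * ext a x) * (v - u) + (y u * y v * ext c u - y x * y x * ext c x) * (K v - K u)"
      by (simp add: y_def power2_eq_square algebra_simps)
    also have "\<bar>\<dots>\<bar> \<le> \<bar>y u * y v * R\<bar> + \<bar>(y u * y v * ext a u - y x * y x * ext a x) * (v - u)\<bar> + \<bar>(y u * y v * ext c u - y x * y x * ext c x) * (K v - K u)\<bar>"
      by linarith
    also have "\<dots> \<le> e / 3 * ((v - u) + (K v - K u)) + e / 3 * (v - u) + e / 3 * (K v - K u)"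
    proof (intro add_mono)
      have "\<bar>y u * y v * R\<bar> \<le> 1 * \<bar>R\<bar>"
        unfolding abs_mult[of "y u * y v"]
        using y01[of u] y01[of v] by (intro mult_right_mono) (auto simp: abs_mult intro!: mult_le_one)
      also have "\<dots> \<le> e / 3 * ((v - u) + (K v - K u))" using d3(2)[of u v] uv by (auto simp: R_def)
      finally show "\<bar>y u * y v * R\<bar> \<le> e / 3 * ((v - u) + (K v - K u))" .
      have near': "\<bar>u - x\<bar> < d1" "\<bar>v - x\<bar> < d1" "\<bar>u - x\<bar> < d2" "\<bar>v - x\<bar> < d2" using uv by auto
      show "\<bar>(y u * y v * ext a u - y x * y x * ext a x) * (v - u)\<bar> \<le> e / 3 * (v - u)"
        unfolding abs_mult abs_of_nonneg[OF \<Delta>] by (intro mult_right_mono d1(2) \<Delta>) (use near' in simp)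
      show "\<bar>(y u * y v * ext c u - y x * y x * ext c x) * (K v - K u)\<bar> \<le> e / 3 * (K v - K u)"
        unfolding abs_mult abs_of_nonneg[OF \<kappa>] by (intro mult_right_mono d2(2) \<kappa>) (use near' in simp)
    qed
    also have "\<dots> \<le> e * ((v - u) + (K v - K u))"
    proof -
      have "0 \<le> e * ((v - u) + (K v - K u))" using e \<Delta> \<kappa> by (intro mult_nonneg_nonneg) auto
      moreover have "e / 3 * ((v - u) + (K v - K u)) + e / 3 * (v - u) + e / 3 * (K v - K u) = 2 / 3 * (e * ((v - u) + (K v - K u)))"
        by (simp add: field_simps)
      ultimately show ?thesis by linarith
    qed
    finally show "\<bar>\<phi> v / (1 + n * \<phi> v) - \<phi> u / (1 + n * \<phi> u) - ext a x / (1 + n * ext \<phi> x)\<^sup>2 * (v - u) - ext c x / (1 + n * ext \<phi> x)\<^sup>2 * (K v - K u)\<bar>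
        \<le> e * ((v - u) + (K v - K u))" .
  qed (use d1 d2 d3 in auto)
qed

definition Z :: "real set" where "Z = {t. ext \<phi> t = 0}"

lemma Z_measurable [measurable]: "Z \<in> sets borel"
  unfolding Z_def by (intro borel_closed closed_Collect_eq ext_continuous cont continuous_on_const)

text \<open>In the damped identity the increments on the left tend to 0. The Stieltjes integral does
  not feel the damping, since \<open>\<phi> = 0\<close> almost everywhere for it, while in the
  Lebesgue integral the squared damping factors converge to the indicator of \<open>Z\<close>,
  dominated by 1.\<close>

lemma integral_balance:
  assumes st: "0 \<le> s" "s \<le> t"
  shows "(LINT r:{s<..t}|\<nu>. ext c r) = - (LINT r:{s<..t}|lborel. ext a r * indicator Z r)"
proof -
  have \<phi>0: "0 \<le> ext \<phi> r" for r using \<phi>_nonneg[of "max 0 r"] by (simp add: ext_def)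
  have pos: "0 < 1 + real (Suc n) * x" if "0 \<le> x" for x and n :: nat
    using that by (intro add_pos_nonneg mult_nonneg_nonneg) auto
  define p where "p n r = ext a r / (1 + real (Suc n) * ext \<phi> r)\<^sup>2" for n :: nat and r
  define q where "q n r = ext c r / (1 + real (Suc n) * ext \<phi> r)\<^sup>2" for n :: nat and r
  have nz: "(1 + real (Suc n) * ext \<phi> r)\<^sup>2 \<noteq> 0" for n r using pos[OF \<phi>0[of r], of n] by simp
  have pc: "continuous_on UNIV (p n)" "continuous_on UNIV (q n)" for n
    unfolding p_def q_def
    by (intro continuous_intros ext_continuous cont ballI nz)+
  have eq: "\<phi> t / (1 + real (Suc n) * \<phi> t) - \<phi> s / (1 + real (Suc n) * \<phi> s) = (LINT r:{s<..t}|lborel. p n r) + (LINT r:{s<..t}|\<nu>. ext c r)" for n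
  proof -
    have "\<phi> t / (1 + real (Suc n) * \<phi> t) - \<phi> s / (1 + real (Suc n) * \<phi> s) = (LINT r:{s<..t}|lborel. p n r) + (LINT r:{s<..t}|\<nu>. q n r)"
      unfolding p_def q_def
      by (rule integral_of_expansion[where f = "\<lambda>t. \<phi> t / (1 + real (Suc n) * \<phi> t)", OF pc[unfolded p_def q_def] damped_expansion[OF of_nat_0_le_iff] st])
    \<comment> \<open>On \<open>Z\<close> the damping factor equals 1 for every n, so this term is
      already at its limit.\<close>
    also have "(LINT r:{s<..t}|\<nu>. q n r) = (LINT r:{s<..t}|\<nu>. ext c r)"
      unfolding set_lebesgue_integral_def
    proof (rule integral_cong_AE)
      show "AE r in \<nu>. indicator {s<..t} r *\<^sub>R q n r = indicator {s<..t} r *\<^sub>R ext c r"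
        using \<phi>_AE_zero by eventually_elim (use st in \<open>auto simp: q_def indicator_def\<close>)
      show "(\<lambda>r. indicator {s<..t} r *\<^sub>R q n r) \<in> borel_measurable \<nu>" "(\<lambda>r. indicator {s<..t} r *\<^sub>R ext c r) \<in> borel_measurable \<nu>"
        using integrable_\<nu>_Ioc[OF pc(2), of s t n] integrable_\<nu>_Ioc[OF ext_continuous[OF cont(3)], of s t]
        unfolding set_integrable_def by (auto dest: borel_measurable_integrable)
    qed
    finally show ?thesis .
  qed
  have damp: "(\<lambda>n. x / (1 + real (Suc n) * x)) \<longlonglongrightarrow> 0" if x: "0 \<le> x" for x :: real
  proof (rule tendsto_sandwich[OF _ _ tendsto_const LIMSEQ_inverse_real_of_nat]; rule always_eventually, rule allI)
    fix n
    show "0 \<le> x / (1 + real (Suc n) * x)" using pos[OF x, of n] x by simp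
    show "x / (1 + real (Suc n) * x) \<le> inverse (real (Suc n))"
      using pos[OF x, of n] by (simp add: field_simps del: of_nat_Suc)
  qed
  have "(\<lambda>n. \<phi> t / (1 + real (Suc n) * \<phi> t) - \<phi> s / (1 + real (Suc n) * \<phi> s)) \<longlonglongrightarrow> 0 - 0"
    using st by (intro tendsto_diff damp \<phi>_nonneg) auto
  moreover have "(\<lambda>n. LINT r:{s<..t}|lborel. p n r) \<longlonglongrightarrow> (LINT r:{s<..t}|lborel. ext a r * indicator Z r)"
    unfolding set_lebesgue_integral_def
  proof (rule integral_dominated_convergence[where w = "\<lambda>r. \<bar>indicator {s<..t} r *\<^sub>R ext a r\<bar>"])
    have [measurable]: "ext a \<in> borel_measurable borel" "p n \<in> borel_measurable borel" for n
      by (rule borel_measurable_continuous_onI, rule ext_continuous cont pc, (rule cont)?)+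
    show "(\<lambda>r. indicator {s<..t} r *\<^sub>R (ext a r * indicator Z r)) \<in> borel_measurable lborel"
      "(\<lambda>r. indicator {s<..t} r *\<^sub>R p n r) \<in> borel_measurable lborel" for n by measurable
    show "integrable lborel (\<lambda>r. \<bar>indicator {s<..t} r *\<^sub>R ext a r\<bar>)"
      using integrable_lborel_Ioc[OF ext_continuous[OF cont(2)], of s t] by (intro integrable_abs) (simp add: set_integrable_def)
    show "AE r in lborel. (\<lambda>n. indicator {s<..t} r *\<^sub>R p n r) \<longlonglongrightarrow> indicator {s<..t} r *\<^sub>R (ext a r * indicator Z r)"
    proof (intro AE_I2 tendsto_scaleR tendsto_const)
      fix r
      show "(\<lambda>n. p n r) \<longlonglongrightarrow> ext a r * indicator Z r"
      proof (cases "ext \<phi> r = 0")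
        case True
        then show ?thesis by (simp add: p_def Z_def)
      next
        case False
        have "(\<lambda>n. ext a r * (1 / ext \<phi> r * (ext \<phi> r / (1 + real (Suc n) * ext \<phi> r)))\<^sup>2) \<longlonglongrightarrow> ext a r * (1 / ext \<phi> r * 0)\<^sup>2"
          by (intro tendsto_mult tendsto_power tendsto_const damp \<phi>0)
        then show ?thesis using False by (simp add: p_def Z_def power_divide del: of_nat_Suc)
      qed
    qed
    show "AE r in lborel. norm (indicator {s<..t} r *\<^sub>R p n r) \<le> \<bar>indicator {s<..t} r *\<^sub>R ext a r\<bar>" for n
    proof (intro AE_I2)
      fix r
      have "1 \<le> (1 + real (Suc n) * ext \<phi> r)\<^sup>2" using \<phi>0[of r] by (intro one_le_power) simp
      then have "\<bar>p n r\<bar> \<le> \<bar>ext a r\<bar> / 1"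
        unfolding p_def abs_divide by (intro divide_left_mono) auto
      then show "norm (indicator {s<..t} r *\<^sub>R p n r) \<le> \<bar>indicator {s<..t} r *\<^sub>R ext a r\<bar>" by (simp add: indicator_def)
    qed
  qed
  then have "(\<lambda>n. (LINT r:{s<..t}|lborel. p n r) + (LINT r:{s<..t}|\<nu>. ext c r)) \<longlonglongrightarrow> (LINT r:{s<..t}|lborel. ext a r * indicator Z r) + (LINT r:{s<..t}|\<nu>. ext c r)"
    by (intro tendsto_add tendsto_const)
  ultimately have "(LINT r:{s<..t}|lborel. ext a r * indicator Z r) + (LINT r:{s<..t}|\<nu>. ext c r) = 0 - 0"
    unfolding eq by (metis LIMSEQ_unique)
  then show ?thesis by simp
qed

lemma a_measurable [measurable]: "ext a \<in> borel_measurable borel"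
  by (intro borel_measurable_continuous_onI ext_continuous cont)

lemma c_measurable [measurable]: "ext c \<in> borel_measurable borel"
  by (intro borel_measurable_continuous_onI ext_continuous cont)

lemma ext_c_ge: "m \<le> ext c r"
  using c_ge[of "max 0 r"] by (simp add: ext_def)

lemma aZ_integrable: "set_integrable lborel {u<..v} (\<lambda>r. ext a r * indicator Z r)"
proof -
  have "integrable lborel (\<lambda>r. indicator {u<..v} r *\<^sub>R ext a r)"
    using integrable_lborel_Ioc[OF ext_continuous[OF cont(2)], of u v] by (simp add: set_integrable_def)
  then show ?thesis unfolding set_integrable_def
    by (rule Bochner_Integration.integrable_bound) (auto simp: indicator_def)
qed

text \<open>On an interval where \<open>a\<close> is positive the balance equates a non-negative
  integral with a non-positive one, so \<open>Z\<close> has Lebesgue measure 0 there. By continuity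
  the set where \<open>a > 0\<close> at positive times is covered by countably many such intervals
  with rational end points.\<close>

lemma a_nonpos_on_Z: "AE r in lborel. 0 < r \<longrightarrow> r \<in> Z \<longrightarrow> ext a r \<le> 0"
proof -
  define S where "S = {(p, q). p \<in> \<rat> \<and> q \<in> \<rat> \<and> 0 \<le> p \<and> p \<le> q \<and> (\<forall>r\<in>{p<..q}. 0 < ext a r)}"
  have "S \<subseteq> \<rat> \<times> \<rat>" by (auto simp: S_def)
  then have S: "countable S" by (rule countable_subset) (intro countable_SIGMA countable_rat)
  have off_Z: "AE r in lborel. r \<in> {fst w<..snd w} \<longrightarrow> r \<notin> Z" if "w \<in> S" for w
  proof -
    define p and q where "p = fst w" and "q = snd w"
    have w: "w = (p, q)" "0 \<le> p" "p \<le> q" "\<And>r. r \<in> {p<..q} \<Longrightarrow> 0 < ext a r"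
      using that by (auto simp: S_def p_def q_def)
    have "0 \<le> (LINT r:{p<..q}|\<nu>. ext c r)"
      unfolding set_lebesgue_integral_def using order_trans[OF less_imp_le[OF m_pos] ext_c_ge]
      by (intro Bochner_Integration.integral_nonneg) auto
    then have "(\<integral>r. indicator {p<..q} r *\<^sub>R (ext a r * indicator Z r) \<partial>lborel) \<le> 0"
      using integral_balance[OF w(2,3)] by (simp add: set_lebesgue_integral_def)
    moreover have nn: "0 \<le> indicator {p<..q} r *\<^sub>R (ext a r * indicator Z r)" for r
      using w(4)[of r] by (auto simp: indicator_def)
    then have "0 \<le> (\<integral>r. indicator {p<..q} r *\<^sub>R (ext a r * indicator Z r) \<partial>lborel)"
      by (intro Bochner_Integration.integral_nonneg)
    ultimately have "(\<integral>r. indicator {p<..q} r *\<^sub>R (ext a r * indicator Z r) \<partial>lborel) = 0" by simp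
    then have "AE r in lborel. indicator {p<..q} r *\<^sub>R (ext a r * indicator Z r) = 0"
      using nn aZ_integrable[of p q] unfolding set_integrable_def
      by (subst (asm) integral_nonneg_eq_0_iff_AE) auto
    then show ?thesis
    proof eventually_elim
      case (elim r)
      then show ?case using w(4)[of r] by (auto simp: w(1) indicator_def split: if_splits)
    qed
  qed
  have "AE r in lborel. \<forall>w\<in>S. r \<in> {fst w<..snd w} \<longrightarrow> r \<notin> Z"
    by (rule AE_ball_countable'[OF off_Z S])
  then show ?thesis
  proof eventually_elim
    case (elim r)
    show ?case
    proof (intro impI leI notI)
      assume r: "0 < r" "r \<in> Z" and a: "0 < ext a r"
      have "isCont (ext a) r" using ext_continuous[OF cont(2)] by (simp add: continuous_on_eq_continuous_at)
      then obtain d where d: "0 < d" "\<And>y. \<bar>y - r\<bar> < d \<Longrightarrow> \<bar>ext a y - ext a r\<bar> < ext a r"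
        using a unfolding continuous_at_eps_delta dist_real_def by metis
      obtain p where p: "p \<in> \<rat>" "max 0 (r - d) < p" "p < r"
        using Rats_dense_in_real[of "max 0 (r - d)" r] r d by auto
      obtain q where q: "q \<in> \<rat>" "r < q" "q < r + d"
        using Rats_dense_in_real[of r "r + d"] d by auto
      have "0 < ext a y" if "y \<in> {p<..q}" for y
      proof -
        have "\<bar>y - r\<bar> < d" using that p q by auto
        from d(2)[OF this] show ?thesis by linarith
      qed
      then have "(p, q) \<in> S" using p q by (auto simp: S_def)
      then show False using elim r p q by force
    qed
  qed
qed

text \<open>The extended \<open>K\<close> has no increment over \<open>{- n<..0}\<close>, and these
  intervals exhaust the non-positive numbers, including the point 0.\<close>

lemma \<nu>_positive: "AE r in \<nu>. 0 < r"
proof -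
  have "AE r in \<nu>. r \<notin> {- real n<..0}" for n :: nat
  proof (rule AE_not_in)
    show "{- real n<..0} \<in> null_sets \<nu>"
      using \<nu>_Ioc[of "- real n" 0] by (simp add: null_sets_def sets_\<nu> ext_def)
  qed
  then have "AE r in \<nu>. \<forall>n::nat. r \<notin> {- real n<..0}" unfolding AE_all_countable by blast
  then show ?thesis
  proof eventually_elim
    case (elim r)
    obtain n :: nat where "- r < real n" using reals_Archimedean2 by blast
    then show ?case using elim[rule_format, of n] by auto
  qed
qed

definition k :: "real \<Rightarrow> real" where
  "k t = indicator {0..} t * (neg_part (a t) / c t * indicator {t. \<phi> t = 0} t)"

lemma k_ext: "k t = indicator {0..} t * (neg_part (ext a t) / ext c t * indicator Z t)"
  by (auto simp: k_def ext_def Z_def indicator_def)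

lemma neg_part_measurable [measurable]: "neg_part \<in> borel_measurable borel"
  unfolding neg_part_def[abs_def] by measurable

lemma k_measurable: "k \<in> borel_measurable borel"
  unfolding k_ext[abs_def] by measurable

text \<open>The balance identifies the measure \<open>c dK\<close> on left-open intervals, and these
  determine it. Division by \<open>c\<close> is possible only afterwards, at the level of densities,
  because \<open>c\<close> varies under the integral.\<close>

lemma weighted_density:
  "density \<nu> (\<lambda>r. ennreal (ext c r)) = density lborel (\<lambda>r. ennreal (indicator {0<..} r * (neg_part (ext a r) * indicator Z r)))"
proof (rule measure_eqI_Ioc)
  define g where "g r = neg_part (ext a r) * indicator Z r" for r
  have g0: "0 \<le> g r" for r by (auto simp: g_def neg_part_def)
  have c0: "0 \<le> ext c r" for r using m_pos ext_c_ge[of r] by linarith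
  have [measurable]: "ext c \<in> borel_measurable \<nu>" using c_measurable measurable_cong_sets[OF sets_\<nu> refl] by blast
  have [measurable]: "{u<..v} \<in> sets \<nu>" for u v by (simp add: sets_\<nu>)
  show "sets (density \<nu> (\<lambda>r. ennreal (ext c r))) = sets borel" by (simp add: sets_\<nu>)
  have main: "emeasure (density \<nu> (\<lambda>r. ennreal (ext c r))) {u<..v} = ennreal (LINT r:{max 0 u<..max 0 v}|\<nu>. ext c r)"
    if "u \<le> v" for u v
  proof -
    have "emeasure (density \<nu> (\<lambda>r. ennreal (ext c r))) {u<..v} = (\<integral>\<^sup>+r. ennreal (ext c r) * indicator {u<..v} r \<partial>\<nu>)"
      by (rule emeasure_density) measurable
    also have "\<dots> = (\<integral>\<^sup>+r. ennreal (indicator {max 0 u<..max 0 v} r *\<^sub>R ext c r) \<partial>\<nu>)"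
      using \<nu>_positive by (intro nn_integral_cong_AE) (auto simp: indicator_def elim!: eventually_mono)
    also have "\<dots> = ennreal (LINT r:{max 0 u<..max 0 v}|\<nu>. ext c r)"
      unfolding set_lebesgue_integral_def
      using integrable_\<nu>_Ioc[OF ext_continuous[OF cont(3)], of "max 0 u" "max 0 v"] c0
      by (intro nn_integral_eq_integral) (auto simp: set_integrable_def)
    finally show ?thesis .
  qed
  fix u v :: real assume uv: "u \<le> v"
  let ?s = "max 0 u" and ?t = "max 0 v"
  have gi: "integrable lborel (\<lambda>r. indicator {?s<..?t} r *\<^sub>R g r)"
    by (rule Bochner_Integration.integrable_bound[OF aZ_integrable[unfolded set_integrable_def, of ?s ?t]])
      (auto simp: g_def neg_part_def indicator_def)
  have "emeasure (density lborel (\<lambda>r. ennreal (indicator {0<..} r * g r))) {u<..v} = (\<integral>\<^sup>+r. ennreal (indicator {0<..} r * g r) * indicator {u<..v} r \<partial>lborel)"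
    by (rule emeasure_density) (auto simp: g_def)
  also have "\<dots> = (\<integral>\<^sup>+r. ennreal (indicator {?s<..?t} r *\<^sub>R g r) \<partial>lborel)"
    by (intro nn_integral_cong) (auto simp: indicator_def)
  also have "\<dots> = ennreal (\<integral>r. indicator {?s<..?t} r *\<^sub>R g r \<partial>lborel)"
    by (intro nn_integral_eq_integral gi) (auto simp: g0)
  \<comment> \<open>The sign found in \<open>a_nonpos_on_Z\<close> turns the negative part of
    \<open>a\<close> into \<open>- a\<close> almost everywhere on \<open>Z\<close>.\<close>
  also have "(\<integral>r. indicator {?s<..?t} r *\<^sub>R g r \<partial>lborel) = (\<integral>r. - (indicator {?s<..?t} r *\<^sub>R (ext a r * indicator Z r)) \<partial>lborel)"
  proof (rule integral_cong_AE)
    show "AE r in lborel. indicator {?s<..?t} r *\<^sub>R g r = - (indicator {?s<..?t} r *\<^sub>R (ext a r * indicator Z r))"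
      using a_nonpos_on_Z by eventually_elim (auto simp: g_def neg_part_def indicator_def)
  qed (auto simp: g_def)
  also have "\<dots> = (LINT r:{?s<..?t}|\<nu>. ext c r)"
    using uv integral_balance[of ?s ?t] by (simp add: set_lebesgue_integral_def)
  finally show "emeasure (density \<nu> (\<lambda>r. ennreal (ext c r))) {u<..v} = emeasure (density lborel (\<lambda>r. ennreal (indicator {0<..} r * (neg_part (ext a r) * indicator Z r)))) {u<..v}"
    using main[OF uv] by (simp add: g_def)
  show "emeasure (density \<nu> (\<lambda>r. ennreal (ext c r))) {u<..v} < \<infinity>" using main[OF uv] by simp
qed simp

lemma stieltjes_density: "\<nu> = density lborel (\<lambda>t. ennreal (k t))"
proof -
  have c_pos: "0 < ext c r" for r using m_pos ext_c_ge[of r] by linarith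
  have cm [measurable]: "ext c \<in> borel_measurable \<nu>" using c_measurable measurable_cong_sets[OF sets_\<nu> refl] by blast
  have "\<nu> = density \<nu> (\<lambda>r. ennreal (ext c r) * ennreal (1 / ext c r))"
    using c_pos by (simp add: ennreal_mult'[symmetric] less_imp_le density_1) (simp add: less_imp_neq[THEN not_sym] density_1)
  also have "\<dots> = density (density \<nu> (\<lambda>r. ennreal (ext c r))) (\<lambda>r. ennreal (1 / ext c r))"
    by (rule density_density_eq[symmetric]; measurable)
  also have "\<dots> = density lborel (\<lambda>r. ennreal (indicator {0<..} r * (neg_part (ext a r) * indicator Z r)) * ennreal (1 / ext c r))"
    unfolding weighted_density by (intro density_density_eq) measurable
  also have "\<dots> = density lborel (\<lambda>t. ennreal (k t))"
  proof (rule density_cong)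
    \<comment> \<open>The indicators of \<open>{0<..}\<close> and \<open>{0..}\<close> differ at the
      single point 0, a Lebesgue null set.\<close>
    show "AE r in lborel. ennreal (indicator {0<..} r * (neg_part (ext a r) * indicator Z r)) * ennreal (1 / ext c r) = ennreal (k r)"
      using AE_lborel_singleton[of 0]
    proof eventually_elim
      case (elim r)
      then show ?case
        using c_pos[of r] by (auto simp: k_ext indicator_def neg_part_def ennreal_mult'[symmetric])
    qed
  qed (use k_measurable in measurable)
  finally show ?thesis .
qed

text \<open>The density is at most the maximum of the modulus of \<open>a\<close> on
  \<open>{0..T}\<close> divided by the lower bound \<open>m\<close> of \<open>c\<close>; this
  quotient is the Lipschitz constant.\<close>

lemma K_lipschitz:
  assumes T: "0 \<le> T"
  shows "\<exists>C. C-lipschitz_on {0..T} K"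
proof -
  have "bounded (a ` {0..T})"
    by (intro compact_imp_bounded compact_continuous_image continuous_on_subset[OF cont(2)]) auto
  then obtain A where A: "\<forall>y\<in>a ` {0..T}. norm y \<le> A" unfolding bounded_iff by blast
  then have A0: "0 \<le> A" using T order_trans[OF norm_ge_zero, of "a 0" A] by auto
  have k_le: "k r \<le> A / m" if r: "r \<in> {0..T}" for r
  proof -
    have "\<bar>a r\<bar> \<le> A" using A r by auto
    then have "neg_part (a r) \<le> A" using A0 by (auto simp: neg_part_def)
    then have "neg_part (a r) / c r \<le> A / m"
      using c_ge[of r] r m_pos A0 by (intro frac_le) auto
    then show ?thesis using A0 m_pos by (auto simp: k_def indicator_def)
  qed
  have "(A / m)-lipschitz_on {0..T} K"
  proof (rule lipschitz_on_leI)
    fix u v assume uv: "u \<in> {0..T}" "v \<in> {0..T}" "u \<le> v"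
    have "ennreal (K v - K u) = emeasure \<nu> {u<..v}" using \<nu>_Ioc[OF uv(3)] uv by (simp add: ext_nonneg_eq)
    also have "\<dots> = (\<integral>\<^sup>+r. ennreal (k r) * indicator {u<..v} r \<partial>lborel)"
      unfolding stieltjes_density using k_measurable by (intro emeasure_density) auto
    also have "\<dots> \<le> (\<integral>\<^sup>+r. ennreal (A / m) * indicator {u<..v} r \<partial>lborel)"
      using k_le uv by (intro nn_integral_mono) (auto simp: indicator_def intro!: ennreal_leI)
    also have "\<dots> = ennreal (A / m * (v - u))"
      using uv A0 m_pos by (simp add: nn_integral_cmult ennreal_mult[symmetric])
    finally have "K v - K u \<le> A / m * (v - u)"
      using uv A0 m_pos by (subst (asm) ennreal_le_iff) auto
    then show "dist (K u) (K v) \<le> A / m * dist u v"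
      using uv mono_onD[OF K_mono, of u v] by (simp add: dist_real_def)
  qed (use A0 m_pos in auto)
  then show ?thesis by blast
qed

end

theorem proposition3p6:
  fixes P :: "'a measure" and F :: "real \<Rightarrow> 'a measure" and B :: "real \<Rightarrow> 'a \<Rightarrow> real"
    and b \<sigma> :: "real \<Rightarrow> real measure \<Rightarrow> real" and h :: "real \<Rightarrow> real" and \<xi> :: "'a \<Rightarrow> real"
    and X :: "real \<Rightarrow> 'a \<Rightarrow> real" and K :: "real \<Rightarrow> real" and L m M :: real
  assumes space: "complete_filtered_prob_space P F"
    and B: "brownian_motion P F B"
    and L: "0 < L"
    and coeff_lipschitz: "\<And>x y \<mu> \<nu>. \<mu> \<in> P2 \<Longrightarrow> \<nu> \<in> P2 \<Longrightarrow>
          \<bar>b x \<mu> - b y \<nu>\<bar> + \<bar>\<sigma> x \<mu> - \<sigma> y \<nu>\<bar> \<le> L * (\<bar>x - y\<bar> + W2 \<mu> \<nu>)"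
    and h_mono: "mono h"
    and mM: "0 < m" "m \<le> M"
    and h_bilipschitz:
          "\<And>x y. m * \<bar>x - y\<bar> \<le> \<bar>h x - h y\<bar> \<and> \<bar>h x - h y\<bar> \<le> M * \<bar>x - y\<bar>"
    and h_C2: "h differentiable_on UNIV" "deriv h differentiable_on UNIV"
          "continuous_on UNIV (deriv (deriv h))"
    and h_bounded: "bounded (range (deriv h))" "bounded (range (deriv (deriv h)))"
    and \<xi>_measurable: "\<xi> \<in> borel_measurable (F 0)"
    and \<xi>_square: "integrable P (\<lambda>\<omega>. (\<xi> \<omega>)\<^sup>2)"
    and \<xi>_constraint: "0 \<le> (LINT \<omega>|P. h (\<xi> \<omega>))"
    and solution: "deterministic_flat_solution P F B \<xi> b \<sigma> h X K"
  shows "(\<forall>T\<ge>0. \<exists>C. C-lipschitz_on {0..T} K) \<and>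
    (\<lambda>t. indicator {0..} t * reflection_density P b \<sigma> h X t) \<in> borel_measurable borel \<and>
    stieltjes_measure K =
      density lborel (\<lambda>t. ennreal (indicator {0..} t * reflection_density P b \<sigma> h X t))"
proof -
  interpret complete_filtered_prob_space P F by (rule space)
  note sol = solution[unfolded deterministic_flat_solution_def]
  obtain J where J: "ito_integral P F B (\<lambda>s \<omega>. \<sigma> (X s \<omega>) (law P (X s))) J"
    and eq: "AE \<omega> in P. \<forall>t\<ge>0.
           X t \<omega> = \<xi> \<omega> + (LINT s:{0..t}|lborel. b (X s \<omega>) (law P (X s))) + J t \<omega> + K t"
    using sol by blast
  interpret brownian_space P F B by unfold_locales (rule B)
  have \<xi>: "square_integrable P \<xi>"
    by (rule square_integrableI[OF measurable_F_P[OF order_refl \<xi>_measurable] \<xi>_square])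
  interpret constrained_mean_reflected P F B \<sigma> X J b \<xi> K L h m M
    by unfold_locales
      (use J L coeff_lipschitz \<xi> sol eq h_mono mM(1) h_bilipschitz h_C2 h_bounded in \<open>simp_all\<close>)
  interpret flat_expansion mean_h mean_generator mean_deriv K m
  proof unfold_locales
    show "0 \<le> mean_h t" if "0 \<le> t" for t using sol that by (simp add: mean_h_def)
    show "(LINT s:{0..t}|stieltjes_measure K. mean_h s) = 0" if "0 \<le> t" for t
      using sol that by (simp add: mean_h_def)
  qed (use K_cont K_mono mean_h_continuous mean_generator_continuous mean_deriv_continuous
      mean_deriv_ge mM(1) local_expansion in \<open>auto\<close>)
  have "indicator {0..} t * reflection_density P b \<sigma> h X t = k t" for t
    by (simp add: reflection_density_def k_def mean_h_def mean_generator_def mean_deriv_def)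
  then show ?thesis
    using K_lipschitz k_measurable stieltjes_density by simp
qed

end
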